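(* Let $G,G'$ be definably compact definable groups in a sufficiently saturated o-minimal expansion of a real closed field, and let $f\colon G\to G'$ be a definable group homomorphism, with induced Lie homomorphism $F(f)\colon\lambda(G)\to\lambda(G')$, $gG^{00}\mapsto f(g)G'^{00}$. Then $\tau^{G'}_*\circ\pi^{\mathrm{def}}(f)=\pi(F(f))\circ\tau^G_*$ as groupoid morphisms $\Pi^{\mathrm{def}}(G,G)\to\Pi(\lambda(G'),\lambda(G'))$, where $\pi^{\mathrm{def}}(f)\colon\Pi^{\mathrm{def}}(G,G)\to\Pi^{\mathrm{def}}(G',G')$ and $\pi(F(f))\colon\Pi(\lambda(G),\lambda(G))\to\Pi(\lambda(G'),\lambda(G'))$ are induced by composing paths with $f$ and $F(f)$. In other words, $(\tau^G_* )_G$ is a natural transformation from $G\mapsto\Pi^{\mathrm{def}}(G,G)$ to $G\mapsto\Pi(\lambda(G),\lambda(G))$.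
   Context: $G^{00}$ is the smallest type-definable subgroup of bounded index of a definably compact group $G$, and $\lambda(G)=G/G^{00}$ with the logic topology is a compact Lie group, with projection $\tau^G$. $\Pi^{\mathrm{def}}(G,G)$ is the groupoid of definable paths in $G$ (for its definable group topology) modulo definable homotopy rel endpoints; $\Pi(\cdot,\cdot)$ is the classical fundamental groupoid. $\tau^G_*\colon\Pi^{\mathrm{def}}(G,G)\to\Pi(\lambda(G),\lambda(G))$ is the unique groupoid morphism equal to $\tau^G$ on objects such that for every open $O\subseteq\lambda(G)$ and every definable path $a$ with image in $(\tau^G)^{-1}(O)$ there is a path $b$ with image in $O$ and $\tau^G_*([a])=[b]$. *)

theory Defs
  imports
    "HOL-Analysis.Homotopy"
    "HOL-Analysis.Function_Topology"
    "HOL-Computational_Algebra.Polynomial"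
    "HOL-Algebra.Coset"
begin

unbundle cardinal_syntax

section \<open>Expansions of an ordered field as first-order structures\<close>

text \<open>
  The language consists of the language of ordered rings together with arbitrary additional function
  symbols \<open>'f\<close> and relation symbols \<open>'r\<close>. Arities are not recorded: a symbol is interpreted on
  argument lists of every length. Variables are de Bruijn indices into a list of values.
\<close>

datatype 'f tm =
  Var nat | Zero | One | Minus "'f tm" | Plus "'f tm" "'f tm" | Times "'f tm" "'f tm"
  | Fn 'f "'f tm list"

datatype ('f, 'r) fm =
  Eq "'f tm" "'f tm" | Less "'f tm" "'f tm" | Rel 'r "'f tm list"
  | Neg "('f, 'r) fm" | Conj "('f, 'r) fm" "('f, 'r) fm" | Exists "('f, 'r) fm"

record ('a, 'f, 'r) expansion =
  fn_interp :: "'f \<Rightarrow> 'a list \<Rightarrow> 'a"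
  rel_interp :: "'r \<Rightarrow> 'a list \<Rightarrow> bool"

primrec tm_val :: "('a::linordered_field, 'f, 'r) expansion \<Rightarrow> 'a list \<Rightarrow> 'f tm \<Rightarrow> 'a" where
  "tm_val M e (Var i) = (if i < length e then e ! i else 0)"
| "tm_val M e Zero = 0"
| "tm_val M e One = 1"
| "tm_val M e (Minus s) = - tm_val M e s"
| "tm_val M e (Plus s t) = tm_val M e s + tm_val M e t"
| "tm_val M e (Times s t) = tm_val M e s * tm_val M e t"
| "tm_val M e (Fn f ts) = fn_interp M f (map (tm_val M e) ts)"

primrec sat :: "('a::linordered_field, 'f, 'r) expansion \<Rightarrow> 'a list \<Rightarrow> ('f, 'r) fm \<Rightarrow> bool" where
  "sat M e (Eq s t) \<longleftrightarrow> tm_val M e s = tm_val M e t"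
| "sat M e (Less s t) \<longleftrightarrow> tm_val M e s < tm_val M e t"
| "sat M e (Rel r ts) \<longleftrightarrow> rel_interp M r (map (tm_val M e) ts)"
| "sat M e (Neg \<phi>) \<longleftrightarrow> \<not> sat M e \<phi>"
| "sat M e (Conj \<phi> \<psi>) \<longleftrightarrow> sat M e \<phi> \<and> sat M e \<psi>"
| "sat M e (Exists \<phi>) \<longleftrightarrow> (\<exists>x. sat M (x # e) \<phi>)"

text \<open>Points of the \<open>n\<close>-th Cartesian power are lists of length \<open>n\<close>. Definable means definable with
  parameters.\<close>

definition definable :: "('a::linordered_field, 'f, 'r) expansion \<Rightarrow> nat \<Rightarrow> 'a list set \<Rightarrow> bool" where
  "definable M n X \<longleftrightarrow> (\<exists>(\<phi> :: ('f, 'r) fm) ps. X = {xs. length xs = n \<and> sat M (xs @ ps) \<phi>})"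

definition definable_set :: "('a::linordered_field, 'f, 'r) expansion \<Rightarrow> 'a list set \<Rightarrow> bool" where
  "definable_set M X \<longleftrightarrow> (\<exists>n. definable M n X)"

definition definable_map ::
  "('a::linordered_field, 'f, 'r) expansion \<Rightarrow> 'a list set \<Rightarrow> 'a list set \<Rightarrow> ('a list \<Rightarrow> 'a list) \<Rightarrow> bool" where
  "definable_map M X Y f \<longleftrightarrow> definable_set M X \<and> definable_set M Y \<and> f \<in> X \<rightarrow> Y \<and>
     definable_set M {x @ f x | x. x \<in> X}"

definition real_closed_field :: "'a::linordered_field itself \<Rightarrow> bool" where
  "real_closed_field _ \<longleftrightarrow>
     (\<forall>a::'a. 0 \<le> a \<longrightarrow> (\<exists>b. b ^ 2 = a)) \<and>
     (\<forall>p :: 'a poly. odd (degree p) \<longrightarrow> (\<exists>x. poly p x = 0))"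

definition o_minimal :: "('a::linordered_field, 'f, 'r) expansion \<Rightarrow> bool" where
  "o_minimal M \<longleftrightarrow> (\<forall>X. definable M 1 X \<longrightarrow>
     (\<exists>\<I>. finite \<I> \<and> {x. [x] \<in> X} = \<Union>\<I> \<and>
        (\<forall>I\<in>\<I>. (\<exists>a. I = {a}) \<or> (\<exists>a b. I = {a<..<b}) \<or> (\<exists>a. I = {a<..}) \<or> (\<exists>b. I = {..<b}) \<or> I = UNIV)))"

definition saturated :: "('a::linordered_field, 'f, 'r) expansion \<Rightarrow> 'k rel \<Rightarrow> bool" where
  "saturated M \<kappa> \<longleftrightarrow>
     (\<forall>n A (\<Gamma> :: (('f, 'r) fm \<times> 'a list) set).
        |A| <o \<kappa> \<and> (\<forall>(\<phi>, ps)\<in>\<Gamma>. set ps \<subseteq> A) \<and>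
        (\<forall>\<Delta>. finite \<Delta> \<and> \<Delta> \<subseteq> \<Gamma> \<longrightarrow> (\<exists>xs. length xs = n \<and> (\<forall>(\<phi>, ps)\<in>\<Delta>. sat M (xs @ ps) \<phi>))) \<longrightarrow>
        (\<exists>xs. length xs = n \<and> (\<forall>(\<phi>, ps)\<in>\<Gamma>. sat M (xs @ ps) \<phi>)))"

text \<open>There are \<open>|L| + \<aleph>\<^sub>0\<close> formulas, so the cardinality condition says that \<open>\<kappa>\<close> exceeds
  \<open>2\<close> to the power \<open>|L| + \<aleph>\<^sub>0\<close>. ``Small'' and ``bounded'' mean of cardinality less
  than \<open>\<kappa>\<close>; regularity makes small unions of small sets small.\<close>

definition sufficiently_saturated :: "('a::linordered_field, 'f, 'r) expansion \<Rightarrow> 'k rel \<Rightarrow> bool" where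
  "sufficiently_saturated M \<kappa> \<longleftrightarrow>
     Card_order \<kappa> \<and> regularCard \<kappa> \<and> |UNIV :: ('f, 'r) fm set set| <o \<kappa> \<and> saturated M \<kappa>"

definition type_definable :: "('a::linordered_field, 'f, 'r) expansion \<Rightarrow> 'k rel \<Rightarrow> 'a list set \<Rightarrow> bool" where
  "type_definable M \<kappa> X \<longleftrightarrow> (\<exists>n \<X>. |\<X>| <o \<kappa> \<and> (\<forall>Y\<in>\<X>. definable M n Y) \<and>
     X = {xs. length xs = n \<and> (\<forall>Y\<in>\<X>. xs \<in> Y)})"


section \<open>Definable groups\<close>

definition box_topology :: "nat \<Rightarrow> 'a::linordered_field list topology" where
  "box_topology n =
     topology_generated_by (range (\<lambda>(a, b). {xs. length xs = n \<and> (\<forall>i<n. a i < xs ! i \<and> xs ! i < b i)}))"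

text \<open>A definable group carries its definable group topology as an additional component. The conditions
  imposed below (topological group, definable manifold) determine it uniquely.\<close>

record 'a dgroup = "'a list monoid" +
  gtop :: "'a list topology"

definition topological_group_on :: "'a dgroup \<Rightarrow> bool" where
  "topological_group_on G \<longleftrightarrow> topspace (gtop G) = carrier G \<and>
     continuous_map (prod_topology (gtop G) (gtop G)) (gtop G) (\<lambda>(x, y). x \<otimes>\<^bsub>G\<^esub> y) \<and>
     continuous_map (gtop G) (gtop G) (\<lambda>x. inv\<^bsub>G\<^esub> x)"

text \<open>A finite atlas of definable charts onto open subsets of the \<open>n\<close>-th Cartesian power.\<close>

definition definable_manifold :: "('a::linordered_field, 'f, 'r) expansion \<Rightarrow> 'a list topology \<Rightarrow> bool" where
  "definable_manifold M X \<longleftrightarrow>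
     (\<exists>n (\<A> :: ('a list set \<times> ('a list \<Rightarrow> 'a list)) set).
        finite \<A> \<and> topspace X = \<Union>(fst ` \<A>) \<and>
        (\<forall>(U, \<phi>)\<in>\<A>. openin X U \<and> openin (box_topology n) (\<phi> ` U) \<and>
            definable_map M U (\<phi> ` U) \<phi> \<and>
            homeomorphic_map (subtopology X U) (subtopology (box_topology n) (\<phi> ` U)) \<phi>))"

definition definable_group :: "('a::linordered_field, 'f, 'r) expansion \<Rightarrow> 'a dgroup \<Rightarrow> bool" where
  "definable_group M G \<longleftrightarrow> group G \<and> definable_set M (carrier G) \<and>
     definable_set M {x @ y @ (x \<otimes>\<^bsub>G\<^esub> y) | x y. x \<in> carrier G \<and> y \<in> carrier G} \<and>
     topological_group_on G \<and> definable_manifold M (gtop G)"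

text \<open>Every definable continuous curve has limits at both ends of its interval. Unbounded intervals
  need not be mentioned: they are definably homeomorphic to bounded ones by field operations.\<close>

definition definably_compact :: "('a::linordered_field, 'f, 'r) expansion \<Rightarrow> 'a list topology \<Rightarrow> bool" where
  "definably_compact M X \<longleftrightarrow>
     (\<forall>a b \<sigma>. a < b \<and> definable_map M {[s] | s. a < s \<and> s < b} (topspace X) \<sigma> \<and>
        continuous_map (subtopology (box_topology 1) {[s] | s. a < s \<and> s < b}) X \<sigma> \<longrightarrow>
        (\<exists>x\<in>topspace X. \<forall>U. openin X U \<and> x \<in> U \<longrightarrow>
           (\<exists>c. a < c \<and> c < b \<and> (\<forall>s. a < s \<and> s < c \<longrightarrow> \<sigma> [s] \<in> U))) \<and>
        (\<exists>x\<in>topspace X. \<forall>U. openin X U \<and> x \<in> U \<longrightarrow>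
           (\<exists>c. a < c \<and> c < b \<and> (\<forall>s. c < s \<and> s < b \<longrightarrow> \<sigma> [s] \<in> U))))"

definition definably_compact_group :: "('a::linordered_field, 'f, 'r) expansion \<Rightarrow> 'a dgroup \<Rightarrow> bool" where
  "definably_compact_group M G \<longleftrightarrow> definable_group M G \<and> definably_compact M (gtop G)"

definition definable_hom ::
  "('a::linordered_field, 'f, 'r) expansion \<Rightarrow> 'a dgroup \<Rightarrow> 'a dgroup \<Rightarrow> ('a list \<Rightarrow> 'a list) \<Rightarrow> bool" where
  "definable_hom M G G' f \<longleftrightarrow> f \<in> hom G G' \<and> definable_map M (carrier G) (carrier G') f"


section \<open>The quotient by the infinitesimal subgroup\<close>

definition bounded_index_subgroup ::
  "('a::linordered_field, 'f, 'r) expansion \<Rightarrow> 'k rel \<Rightarrow> 'a dgroup \<Rightarrow> 'a list set \<Rightarrow> bool" where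
  "bounded_index_subgroup M \<kappa> G N \<longleftrightarrow>
     subgroup N G \<and> type_definable M \<kappa> N \<and> |rcosets\<^bsub>G\<^esub> N| <o \<kappa>"

definition is_G00 ::
  "('a::linordered_field, 'f, 'r) expansion \<Rightarrow> 'k rel \<Rightarrow> 'a dgroup \<Rightarrow> 'a list set \<Rightarrow> bool" where
  "is_G00 M \<kappa> G N \<longleftrightarrow> bounded_index_subgroup M \<kappa> G N \<and>
     (\<forall>N'. bounded_index_subgroup M \<kappa> G N' \<longrightarrow> N \<subseteq> N')"

text \<open>The smallest type-definable subgroup of bounded index is normal, so left and right cosets agree;
  the library's quotient group \<open>G Mod N\<close> consists of right cosets.\<close>

definition \<tau>_map :: "'a dgroup \<Rightarrow> 'a list set \<Rightarrow> 'a list \<Rightarrow> 'a list set" where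
  "\<tau>_map G N g = N #>\<^bsub>G\<^esub> g"

text \<open>A set of cosets is closed iff its preimage in \<open>G\<close> is type-definable.\<close>

definition logic_topology ::
  "('a::linordered_field, 'f, 'r) expansion \<Rightarrow> 'k rel \<Rightarrow> 'a dgroup \<Rightarrow> 'a list set \<Rightarrow> 'a list set topology" where
  "logic_topology M \<kappa> G N = topology (\<lambda>U. U \<subseteq> carrier (G Mod N) \<and>
     type_definable M \<kappa> {g \<in> carrier G. \<tau>_map G N g \<notin> U})"

text \<open>The map sending the coset of \<open>g\<close> to the coset of \<open>f g\<close>.\<close>

definition induced_map ::
  "'a dgroup \<Rightarrow> 'a list set \<Rightarrow> ('a list \<Rightarrow> 'a list) \<Rightarrow> 'a list set \<Rightarrow> 'a list set" where
  "induced_map G' N' f C = the_elem ((\<lambda>g. \<tau>_map G' N' (f g)) ` C)"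


section \<open>Groupoids and their morphisms\<close>

text \<open>\<open>Comp m k\<close> is the composite of an arrow \<open>m\<close> from \<open>x\<close> to \<open>y\<close> with an arrow \<open>k\<close> from \<open>y\<close> to \<open>z\<close>.
  A morphism is a pair of maps, on objects and on arrows.\<close>

record ('o, 'm) gpd =
  Obj :: "'o set"
  Hom :: "'o \<Rightarrow> 'o \<Rightarrow> 'm set"
  Idt :: "'o \<Rightarrow> 'm"
  Comp :: "'m \<Rightarrow> 'm \<Rightarrow> 'm"

type_synonym ('o, 'm, 'p, 'q) gpd_map = "('o \<Rightarrow> 'p) \<times> ('m \<Rightarrow> 'q)"

definition gpd_morphism :: "('o, 'm) gpd \<Rightarrow> ('p, 'q) gpd \<Rightarrow> ('o, 'm, 'p, 'q) gpd_map \<Rightarrow> bool" where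
  "gpd_morphism A B S \<longleftrightarrow>
     (\<forall>x\<in>Obj A. fst S x \<in> Obj B \<and> snd S (Idt A x) = Idt B (fst S x)) \<and>
     (\<forall>x\<in>Obj A. \<forall>y\<in>Obj A. \<forall>m\<in>Hom A x y. snd S m \<in> Hom B (fst S x) (fst S y)) \<and>
     (\<forall>x\<in>Obj A. \<forall>y\<in>Obj A. \<forall>z\<in>Obj A. \<forall>m\<in>Hom A x y. \<forall>k\<in>Hom A y z.
        snd S (Comp A m k) = Comp B (snd S m) (snd S k))"

definition gpd_morphism_eq ::
  "('o, 'm) gpd \<Rightarrow> ('p, 'q) gpd \<Rightarrow> ('o, 'm, 'p, 'q) gpd_map \<Rightarrow> ('o, 'm, 'p, 'q) gpd_map \<Rightarrow> bool" where
  "gpd_morphism_eq A B S T \<longleftrightarrow> gpd_morphism A B S \<and> gpd_morphism A B T \<and>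
     (\<forall>x\<in>Obj A. fst S x = fst T x) \<and>
     (\<forall>x\<in>Obj A. \<forall>y\<in>Obj A. \<forall>m\<in>Hom A x y. snd S m = snd T m)"

definition gpd_comp :: "('p, 'q, 's, 't) gpd_map \<Rightarrow> ('o, 'm, 'p, 'q) gpd_map \<Rightarrow> ('o, 'm, 's, 't) gpd_map"
    (infixl \<open>\<circ>\<^sub>g\<close> 55) where
  "T \<circ>\<^sub>g S = (fst T \<circ> fst S, snd T \<circ> snd S)"


subsection \<open>The fundamental groupoid of a topological space\<close>

definition path_class :: "'b topology \<Rightarrow> (real \<Rightarrow> 'b) \<Rightarrow> (real \<Rightarrow> 'b) set" where
  "path_class X p =
     {q. homotopic_with (\<lambda>r. r 0 = p 0 \<and> r 1 = p 1) (top_of_set {0..1}) X p q}"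

definition path_concat :: "(real \<Rightarrow> 'b) \<Rightarrow> (real \<Rightarrow> 'b) \<Rightarrow> real \<Rightarrow> 'b" where
  "path_concat p q = (\<lambda>t. if t \<le> 1/2 then p (2 * t) else q (2 * t - 1))"

definition fund_gpd :: "'b topology \<Rightarrow> ('b, (real \<Rightarrow> 'b) set) gpd" where
  "fund_gpd X = \<lparr>
     Obj = topspace X,
     Hom = (\<lambda>x y. {path_class X p | p. pathin X p \<and> p 0 = x \<and> p 1 = y}),
     Idt = (\<lambda>x. path_class X (\<lambda>_. x)),
     Comp = (\<lambda>P Q. \<Union>p\<in>P. \<Union>q\<in>Q. path_class X (path_concat p q))\<rparr>"

text \<open>The morphism into the fundamental groupoid of \<open>Y\<close> induced by a continuous map \<open>h\<close> into \<open>Y\<close>. All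
  representatives give the same class, so the union over them is that class (likewise in \<open>Comp\<close>).\<close>

definition fund_map ::
  "'c topology \<Rightarrow> ('b \<Rightarrow> 'c) \<Rightarrow> ('b, (real \<Rightarrow> 'b) set, 'c, (real \<Rightarrow> 'c) set) gpd_map" where
  "fund_map Y h = (h, \<lambda>P. \<Union>p\<in>P. path_class Y (h \<circ> p))"


subsection \<open>The definable fundamental groupoid of a definable group\<close>

text \<open>Definable paths and homotopies are defined on the unit interval and square of the real closed
  field, whose points are lists of length 1 and 2. In a homotopy the first coordinate is the
  deformation parameter.\<close>

definition unit_cube :: "nat \<Rightarrow> 'a::linordered_field list set" where
  "unit_cube n = {xs. length xs = n \<and> (\<forall>x\<in>set xs. 0 \<le> x \<and> x \<le> 1)}"

definition def_continuous_on_cube ::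
  "('a::linordered_field, 'f, 'r) expansion \<Rightarrow> 'a dgroup \<Rightarrow> nat \<Rightarrow> ('a list \<Rightarrow> 'a list) \<Rightarrow> bool" where
  "def_continuous_on_cube M G n h \<longleftrightarrow> definable_map M (unit_cube n) (carrier G) h \<and>
     continuous_map (subtopology (box_topology n) (unit_cube n)) (gtop G) h"

definition def_path :: "('a::linordered_field, 'f, 'r) expansion \<Rightarrow> 'a dgroup \<Rightarrow> ('a list \<Rightarrow> 'a list) \<Rightarrow> bool" where
  "def_path M G p \<longleftrightarrow> def_continuous_on_cube M G 1 p"

definition def_homotopic ::
  "('a::linordered_field, 'f, 'r) expansion \<Rightarrow> 'a dgroup \<Rightarrow> ('a list \<Rightarrow> 'a list) \<Rightarrow> ('a list \<Rightarrow> 'a list) \<Rightarrow> bool" where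
  "def_homotopic M G p q \<longleftrightarrow> def_path M G p \<and> def_path M G q \<and>
     (\<exists>h. def_continuous_on_cube M G 2 h \<and>
        (\<forall>s. 0 \<le> s \<and> s \<le> 1 \<longrightarrow>
           h [0, s] = p [s] \<and> h [1, s] = q [s] \<and> h [s, 0] = p [0] \<and> h [s, 1] = p [1]))"

definition def_path_class ::
  "('a::linordered_field, 'f, 'r) expansion \<Rightarrow> 'a dgroup \<Rightarrow> ('a list \<Rightarrow> 'a list) \<Rightarrow> ('a list \<Rightarrow> 'a list) set" where
  "def_path_class M G p = {q. def_homotopic M G p q}"

definition def_path_concat ::
  "('a::linordered_field list \<Rightarrow> 'a list) \<Rightarrow> ('a list \<Rightarrow> 'a list) \<Rightarrow> 'a list \<Rightarrow> 'a list" where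
  "def_path_concat p q = (\<lambda>xs. if hd xs \<le> 1/2 then p [2 * hd xs] else q [2 * hd xs - 1])"

definition def_fund_gpd ::
  "('a::linordered_field, 'f, 'r) expansion \<Rightarrow> 'a dgroup \<Rightarrow> ('a list, ('a list \<Rightarrow> 'a list) set) gpd" where
  "def_fund_gpd M G = \<lparr>
     Obj = carrier G,
     Hom = (\<lambda>x y. {def_path_class M G p | p. def_path M G p \<and> p [0] = x \<and> p [1] = y}),
     Idt = (\<lambda>x. def_path_class M G (\<lambda>_. x)),
     Comp = (\<lambda>P Q. \<Union>p\<in>P. \<Union>q\<in>Q. def_path_class M G (def_path_concat p q))\<rparr>"

definition def_fund_map ::
  "('a::linordered_field, 'f, 'r) expansion \<Rightarrow> 'a dgroup \<Rightarrow> ('a list \<Rightarrow> 'a list) \<Rightarrow>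
     ('a list, ('a list \<Rightarrow> 'a list) set, 'a list, ('a list \<Rightarrow> 'a list) set) gpd_map" where
  "def_fund_map M G' f = (f, \<lambda>P. \<Union>p\<in>P. def_path_class M G' (f \<circ> p))"


section \<open>The comparison morphism\<close>

type_synonym 'a comparison =
  "('a list, ('a list \<Rightarrow> 'a list) set, 'a list set, (real \<Rightarrow> 'a list set) set) gpd_map"

definition is_comparison ::
  "('a::linordered_field, 'f, 'r) expansion \<Rightarrow> 'k rel \<Rightarrow> 'a dgroup \<Rightarrow> 'a list set \<Rightarrow> 'a comparison \<Rightarrow> bool" where
  "is_comparison M \<kappa> G N T \<longleftrightarrow>
     (let \<Lambda> = logic_topology M \<kappa> G N; \<tau> = \<tau>_map G N in
        gpd_morphism (def_fund_gpd M G) (fund_gpd \<Lambda>) T \<and>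
        (\<forall>g\<in>carrier G. fst T g = \<tau> g) \<and>
        (\<forall>U a. openin \<Lambda> U \<and> def_path M G a \<and> (\<forall>s\<in>unit_cube 1. \<tau> (a s) \<in> U) \<longrightarrow>
           (\<exists>b. pathin \<Lambda> b \<and> b ` {0..1} \<subseteq> U \<and> snd T (def_path_class M G a) = path_class \<Lambda> b)))"

definition is_tau_star ::
  "('a::linordered_field, 'f, 'r) expansion \<Rightarrow> 'k rel \<Rightarrow> 'a dgroup \<Rightarrow> 'a list set \<Rightarrow> 'a comparison \<Rightarrow> bool" where
  "is_tau_star M \<kappa> G N T \<longleftrightarrow> is_comparison M \<kappa> G N T \<and>
     (\<forall>S. is_comparison M \<kappa> G N S \<longrightarrow>
        gpd_morphism_eq (def_fund_gpd M G) (fund_gpd (logic_topology M \<kappa> G N)) S T)"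

end

theory Submission
  imports Defs
begin

text \<open>
  Let \<open>H = G \<times> G'\<close>. Then \<open>H\<^sup>0\<^sup>0 = G\<^sup>0\<^sup>0 \<times> G'\<^sup>0\<^sup>0\<close>, and the paths \<open>a\<close>, \<open>f \<circ> a\<close> are recovered from \<open>(a, f \<circ> a)\<close> in \<open>H\<close>.
  The comparison morphism of \<open>H\<close> is unique, which is used twice. First, pairing the comparison
  morphisms of the factors yields a comparison for \<open>H\<close>, so the two coincide. Second, the shear
  \<open>(x, y) \<mapsto> (x, f x \<otimes> y)\<close> is a definable homeomorphism of \<open>H\<close> compatible with the cosets of \<open>H\<^sup>0\<^sup>0\<close>, since
  definable homomorphisms are continuous and map \<open>G\<^sup>0\<^sup>0\<close> into \<open>G'\<^sup>0\<^sup>0\<close>; conjugating by it therefore leaves the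
  comparison morphism unchanged. The shear takes \<open>(a, \<one>)\<close> to \<open>(a, f \<circ> a)\<close>, and projecting to the second
  factor gives naturality.
\<close>

section \<open>Definable sets\<close>

text \<open>The comparison morphisms are given by a characterisation, not by a construction, and
  uniqueness only compares two morphisms out of the same groupoid. It yields naturality for
  retractions, but says nothing directly about a map between different groups. The graph map x |->
  (x, f x) is split by the first projection, which recovers a and loses the composite of f with a; a
  self-bijection of H that carries (a, 1) to the graph path keeps both coordinates, and this is what
  the shear is for. Since it is not a homomorphism, paths and cosets are studied for all definable
  continuous maps that respect cosets. The pairing of the factor comparisons is delicate over open
  sets that are not boxes: representatives of the two factor classes can each be controlled, but
  their pair may leave the set. O-minimality enters through the continuity of definable
  homomorphisms. Continuity at a single point is enough there, because a homomorphism can be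
  translated, and that point comes from a weak substitute for cell decomposition. Saturation is used
  as compactness, both there and for the logic topology.\<close>

primrec tm_ren :: "(nat \<Rightarrow> nat) \<Rightarrow> 'f tm \<Rightarrow> 'f tm" where
  "tm_ren r (Var i) = Var (r i)"
| "tm_ren r Zero = Zero"
| "tm_ren r One = One"
| "tm_ren r (Minus s) = Minus (tm_ren r s)"
| "tm_ren r (Plus s t) = Plus (tm_ren r s) (tm_ren r t)"
| "tm_ren r (Times s t) = Times (tm_ren r s) (tm_ren r t)"
| "tm_ren r (Fn f ts) = Fn f (map (tm_ren r) ts)"

primrec fm_ren :: "(nat \<Rightarrow> nat) \<Rightarrow> ('f, 'r) fm \<Rightarrow> ('f, 'r) fm" where
  "fm_ren r (Eq s t) = Eq (tm_ren r s) (tm_ren r t)"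
| "fm_ren r (Less s t) = Less (tm_ren r s) (tm_ren r t)"
| "fm_ren r (Rel R ts) = Rel R (map (tm_ren r) ts)"
| "fm_ren r (Neg \<phi>) = Neg (fm_ren r \<phi>)"
| "fm_ren r (Conj \<phi> \<psi>) = Conj (fm_ren r \<phi>) (fm_ren r \<psi>)"
| "fm_ren r (Exists \<phi>) = Exists (fm_ren (case_nat 0 (\<lambda>i. Suc (r i))) \<phi>)"

text \<open>\<open>tm_val\<close> sends an out-of-range variable to 0. A renaming must respect this
  default too, so agreement is required at every index and not only at those inside the
  lists.\<close>

definition var_val :: "'a::zero list \<Rightarrow> nat \<Rightarrow> 'a" where
  "var_val e i = (if i < length e then e ! i else 0)"

lemma tm_val_ren:
  assumes "\<And>i. var_val e' (r i) = var_val e i"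
  shows "tm_val M e' (tm_ren r t) = tm_val M e t"
proof (induction t)
  case (Fn f ts)
  then have "map (tm_val M e') (map (tm_ren r) ts) = map (tm_val M e) ts" by simp
  then show ?case by (metis tm_val.simps(7) tm_ren.simps(7))
qed (use assms in \<open>auto simp: var_val_def\<close>)

lemma sat_ren:
  assumes "\<And>i. var_val e' (r i) = var_val e i"
  shows "sat M e' (fm_ren r \<phi>) = sat M e \<phi>"
  using assms
proof (induction \<phi> arbitrary: e e' r)
  case (Rel R ts)
  have "map (tm_val M e') (map (tm_ren r) ts) = map (tm_val M e) ts"
    by (auto intro!: tm_val_ren simp: Rel)
  then show ?case by (metis fm_ren.simps(3) sat.simps(3))
next
  case (Exists \<phi>)
  have "sat M (x # e') (fm_ren (case_nat 0 (\<lambda>i. Suc (r i))) \<phi>) = sat M (x # e) \<phi>" for x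
  proof (rule Exists.IH)
    fix i
    show "var_val (x # e') (case_nat 0 (\<lambda>i. Suc (r i)) i) = var_val (x # e) i"
      using Exists.prems[of "i - 1"] by (cases i) (auto simp: var_val_def split: if_splits)
  qed
  then show ?case by simp
qed (simp_all add: tm_val_ren)

text \<open>Phrased for predicates on lists of length n, so that closure properties act as
  introduction rules following the syntax of a first-order condition. Values on lists of other
  lengths do not count, which \<open>dfn_cong\<close> exploits.\<close>

definition dfn :: "('a::linordered_field, 'f, 'r) expansion \<Rightarrow> nat \<Rightarrow> ('a list \<Rightarrow> bool) \<Rightarrow> bool" where
  "dfn M n P \<longleftrightarrow> definable M n {xs. length xs = n \<and> P xs}"

lemma dfn_iff: "dfn M n P \<longleftrightarrow>
    (\<exists>(\<phi> :: ('f, 'r) fm) ps. \<forall>xs. length xs = n \<longrightarrow> P xs = sat (M :: ('a::linordered_field, 'f, 'r) expansion) (xs @ ps) \<phi>)"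
  unfolding dfn_def definable_def by (auto simp: set_eq_iff)

lemma dfnI:
  fixes M :: "('a::linordered_field, 'f, 'r) expansion"
  assumes "\<And>xs. length xs = n \<Longrightarrow> P xs = sat M (xs @ ps) \<phi>"
  shows "dfn M n P"
  using assms unfolding dfn_iff by blast

lemma definable_length: "definable M n X \<Longrightarrow> x \<in> X \<Longrightarrow> length x = n"
  by (auto simp: definable_def)

lemma definable_iff_dfn: "definable M n X \<longleftrightarrow> (\<forall>x\<in>X. length x = n) \<and> dfn M n (\<lambda>x. x \<in> X)"
proof -
  have "definable M n X \<longleftrightarrow> (\<forall>x\<in>X. length x = n) \<and> definable M n X"
    by (auto simp: definable_length)
  moreover have "(\<forall>x\<in>X. length x = n) \<Longrightarrow> {xs. length xs = n \<and> xs \<in> X} = X" by auto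
  ultimately show ?thesis unfolding dfn_def by auto
qed

lemma dfn_cong:
  "(\<And>xs. length xs = n \<Longrightarrow> P xs = Q xs) \<Longrightarrow> dfn M n P = dfn M n Q"
  unfolding dfn_iff by simp

lemma dfn_not: "dfn M n P \<Longrightarrow> dfn M n (\<lambda>xs. \<not> P xs)"
  unfolding dfn_iff by (metis sat.simps(4))

lemma dfn_not_iff [simp]: "dfn M n (\<lambda>xs. \<not> P xs) = dfn M n P"
  using dfn_not[of M n P] dfn_not[of M n "\<lambda>xs. \<not> P xs"] by auto

lemma dfn_conj:
  fixes M :: "('a::linordered_field, 'f, 'r) expansion"
  assumes "dfn M n P" "dfn M n Q"
  shows "dfn M n (\<lambda>xs. P xs \<and> Q xs)"
proof -
  obtain \<phi> :: "('f, 'r) fm" and ps where 1: "\<And>xs. length xs = n \<Longrightarrow> P xs = sat M (xs @ ps) \<phi>"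
    using assms(1) unfolding dfn_iff by blast
  obtain \<psi> :: "('f, 'r) fm" and qs where 2: "\<And>xs. length xs = n \<Longrightarrow> Q xs = sat M (xs @ qs) \<psi>"
    using assms(2) unfolding dfn_iff by blast
  \<comment> \<open>Both formulas get the parameter list ps @ qs. The first keeps its variables and
    moves its out-of-range indices past qs, where they still evaluate to 0; the second jumps over
    ps.\<close>
  define r where "r = (\<lambda>i. if i < n + length ps then i else i + length qs)"
  define s where "s = (\<lambda>i. if i < n then i else i + length ps)"
  show ?thesis
  proof (rule dfnI)
    fix xs :: "'a list" assume n: "length xs = n"
    have "sat M (xs @ ps @ qs) (fm_ren r \<phi>) = sat M (xs @ ps) \<phi>"
      by (rule sat_ren) (auto simp: r_def var_val_def nth_append n)
    moreover have "sat M (xs @ ps @ qs) (fm_ren s \<psi>) = sat M (xs @ qs) \<psi>"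
      by (rule sat_ren) (auto simp: s_def var_val_def nth_append n)
    ultimately show "(P xs \<and> Q xs) = sat M (xs @ (ps @ qs)) (Conj (fm_ren r \<phi>) (fm_ren s \<psi>))"
      using 1 2 n by simp
  qed
qed

lemma dfn_disj: "dfn M n P \<Longrightarrow> dfn M n Q \<Longrightarrow> dfn M n (\<lambda>xs. P xs \<or> Q xs)"
  using dfn_not[OF dfn_conj[OF dfn_not dfn_not], of M n P Q] by simp

lemma dfn_imp: "dfn M n P \<Longrightarrow> dfn M n Q \<Longrightarrow> dfn M n (\<lambda>xs. P xs \<longrightarrow> Q xs)"
  unfolding imp_conv_disj by (intro dfn_disj dfn_not)

lemma dfn_iffI: "dfn M n P \<Longrightarrow> dfn M n Q \<Longrightarrow> dfn M n (\<lambda>xs. P xs \<longleftrightarrow> Q xs)"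
  unfolding iff_conv_conj_imp by (intro dfn_conj dfn_imp)

lemma dfn_const: "dfn M n (\<lambda>xs. P)"
proof (cases P)
  case True then show ?thesis by (intro dfnI[of _ _ _ "[]" "Eq Zero Zero"]) simp
next
  case False then show ?thesis by (intro dfnI[of _ _ _ "[]" "Eq Zero One"]) simp
qed

lemma dfn_bounded_all:
  fixes k :: nat
  assumes "\<And>i. i < k \<Longrightarrow> dfn M n (P i)"
  shows "dfn M n (\<lambda>xs. \<forall>i<k. P i xs)"
  using assms
proof (induction k)
  case 0 then show ?case by (simp add: dfn_const)
next
  case (Suc k)
  then show ?case using dfn_conj[of M n "\<lambda>xs. \<forall>i<k. P i xs" "P k"]
    by (auto simp: less_Suc_eq all_conj_distrib imp_conjR conj_commute cong: dfn_cong)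
qed

lemma dfn_reindex:
  fixes M :: "('a::linordered_field, 'f, 'r) expansion"
  assumes "dfn M m P" "\<And>i. i < m \<Longrightarrow> r i < n"
  shows "dfn M n (\<lambda>xs. P (map (\<lambda>i. xs ! r i) [0..<m]))"
proof -
  obtain \<phi> :: "('f, 'r) fm" and ps where 1: "\<And>xs. length xs = m \<Longrightarrow> P xs = sat M (xs @ ps) \<phi>"
    using assms(1) unfolding dfn_iff by blast
  \<comment> \<open>Indices from m on belong to the parameters, which now start at position
    n.\<close>
  define s where "s = (\<lambda>i. if i < m then r i else i - m + n)"
  show ?thesis
  proof (rule dfnI)
    fix xs :: "'a list" assume n: "length xs = n"
    let ?ys = "map (\<lambda>i. xs ! r i) [0..<m]"
    have "sat M (xs @ ps) (fm_ren s \<phi>) = sat M (?ys @ ps) \<phi>"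
    proof (rule sat_ren)
      fix i show "var_val (xs @ ps) (s i) = var_val (?ys @ ps) i"
        using assms(2)[of i] n by (auto simp: s_def var_val_def nth_append)
    qed
    then show "P ?ys = sat M (xs @ ps) (fm_ren s \<phi>)"
      using 1[of ?ys] by simp
  qed
qed

lemma dfn_take: "dfn M m P \<Longrightarrow> m \<le> n \<Longrightarrow> dfn M n (\<lambda>xs. P (take m xs))"
proof -
  assume "dfn M m P" "m \<le> n"
  then have "dfn M n (\<lambda>xs. P (map (\<lambda>i. xs ! i) [0..<m]))" by (intro dfn_reindex) auto
  moreover have "map (\<lambda>i. xs ! i) [0..<m] = take m xs" if "length xs = n" for xs :: "'a list"
    using that \<open>m \<le> n\<close> by (auto intro!: nth_equalityI)
  ultimately show ?thesis by (simp cong: dfn_cong)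
qed

lemma dfn_drop: "dfn M k P \<Longrightarrow> n = m + k \<Longrightarrow> dfn M n (\<lambda>xs. P (drop m xs))"
proof -
  assume "dfn M k P" and n: "n = m + k"
  then have "dfn M n (\<lambda>xs. P (map (\<lambda>i. xs ! (m + i)) [0..<k]))" by (intro dfn_reindex) auto
  moreover have "map (\<lambda>i. xs ! (m + i)) [0..<k] = drop m xs" if "length xs = n" for xs :: "'a list"
    using that n by (auto intro!: nth_equalityI)
  ultimately show ?thesis by (simp cong: dfn_cong)
qed

lemma dfn_ex:
  fixes M :: "('a::linordered_field, 'f, 'r) expansion"
  assumes "dfn M (Suc n) (\<lambda>zs. Q (take n zs) (zs ! n))"
  shows "dfn M n (\<lambda>xs. \<exists>y. Q xs y)"
proof -
  obtain \<phi> :: "('f, 'r) fm" and ps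
    where 1: "\<And>xs. length xs = Suc n \<Longrightarrow> Q (take n xs) (xs ! n) = sat M (xs @ ps) \<phi>"
    using assms(1) unfolding dfn_iff by blast
  \<comment> \<open>The quantifier binds index 0, whereas the bound value is kept here in the last
    position n; r rotates the first n + 1 variables and fixes the parameters.\<close>
  define r where "r = (\<lambda>i. if i < n then Suc i else if i = n then 0 else i)"
  show ?thesis
  proof (rule dfnI)
    fix xs :: "'a list" assume n: "length xs = n"
    have "sat M (y # (xs @ ps)) (fm_ren r \<phi>) = Q xs y" for y
    proof -
      have "sat M (y # (xs @ ps)) (fm_ren r \<phi>) = sat M ((xs @ [y]) @ ps) \<phi>"
        by (rule sat_ren) (auto simp: r_def var_val_def nth_append nth_Cons' n)
      then show ?thesis using 1[of "xs @ [y]"] n by (simp add: nth_append)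
    qed
    then show "(\<exists>y. Q xs y) = sat M (xs @ ps) (Exists (fm_ren r \<phi>))" by simp
  qed
qed

lemma dfn_all:
  "dfn M (Suc n) (\<lambda>zs. Q (take n zs) (zs ! n)) \<Longrightarrow> dfn M n (\<lambda>xs. \<forall>y. Q xs y)"
  using dfn_not[OF dfn_ex, of M n "\<lambda>xs y. \<not> Q xs y"] by simp

text \<open>The last coordinate of ys is quantified away first, which changes the predicate; the
  induction therefore generalises over Q.\<close>

lemma dfn_exs:
  fixes M :: "('a::linordered_field, 'f, 'r) expansion"
  assumes "dfn M (n + k) (\<lambda>zs. Q (take n zs) (drop n zs))"
  shows "dfn M n (\<lambda>xs. \<exists>ys. length ys = k \<and> Q xs ys)"
  using assms
proof (induction k arbitrary: Q)
  case 0
  then have "dfn M n (\<lambda>zs. Q (take n zs) (drop n zs))" by simp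
  then show ?case by (rule iffD1[OF dfn_cong, rotated]) simp
next
  case (Suc k)
  have "dfn M (n + k) (\<lambda>xs. \<exists>y. Q (take n xs) (drop n xs @ [y]))"
  proof (rule dfn_ex)
    have eq: "Q (take n xs) (drop n xs) = Q (take n (take (n + k) xs)) (drop n (take (n + k) xs) @ [xs ! (n + k)])"
      if "length xs = Suc (n + k)" for xs :: "'a list"
    proof -
      have "drop n xs = drop n (take (n + k) xs @ [xs ! (n + k)])"
        using that take_Suc_conv_app_nth[of "n + k" xs] by simp
      then show ?thesis using that by simp
    qed
    from Suc.prems show "dfn M (Suc (n + k)) (\<lambda>zs. Q (take n (take (n + k) zs)) (drop n (take (n + k) zs) @ [zs ! (n + k)]))"
      by (intro iffD1[OF dfn_cong, OF eq]) simp_all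
  qed
  from Suc.IH[of "\<lambda>x ys. \<exists>y. Q x (ys @ [y])", OF this]
  have "dfn M n (\<lambda>xs. \<exists>ys. length ys = k \<and> (\<exists>y. Q xs (ys @ [y])))" .
  moreover have "(\<exists>ys. length ys = k \<and> (\<exists>y. Q xs (ys @ [y]))) = (\<exists>ys. length ys = Suc k \<and> Q xs ys)" for xs
    by (auto simp: length_Suc_conv_rev)
  ultimately show ?case by simp
qed

lemma dfn_alls:
  "dfn M (n + k) (\<lambda>zs. Q (take n zs) (drop n zs)) \<Longrightarrow> dfn M n (\<lambda>xs. \<forall>ys. length ys = k \<longrightarrow> Q xs ys)"
  using dfn_not[OF dfn_exs, of M n k "\<lambda>xs y. \<not> Q xs y"] by simp

text \<open>\<open>vt\<close> and \<open>st\<close> express that a list-valued, respectively scalar-valued, map on the \<open>n\<close>-th Cartesian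
  power is definable.\<close>

definition vt :: "('a::linordered_field, 'f, 'r) expansion \<Rightarrow> nat \<Rightarrow> nat \<Rightarrow> ('a list \<Rightarrow> 'a list) \<Rightarrow> bool" where
  "vt M n k t \<longleftrightarrow> (\<forall>xs. length xs = n \<longrightarrow> length (t xs) = k) \<and> dfn M (n + k) (\<lambda>zs. drop n zs = t (take n zs))"

definition st :: "('a::linordered_field, 'f, 'r) expansion \<Rightarrow> nat \<Rightarrow> ('a list \<Rightarrow> 'a) \<Rightarrow> bool" where
  "st M n t \<longleftrightarrow> dfn M (Suc n) (\<lambda>zs. zs ! n = t (take n zs))"

lemma vt_length: "vt M n k t \<Longrightarrow> length xs = n \<Longrightarrow> length (t xs) = k"
  by (simp add: vt_def)

text \<open>Definable maps are not terms of the language, so substitution is expressed by an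
  existential quantifier over the value \<open>t xs\<close>.\<close>

lemma dfn_subst:
  assumes "vt M n k t" "dfn M k P"
  shows "dfn M n (\<lambda>xs. P (t xs))"
proof -
  have "dfn M n (\<lambda>xs. \<exists>ys. length ys = k \<and> ys = t xs \<and> P ys)"
    by (rule dfn_exs) (use assms in \<open>auto simp: vt_def intro!: dfn_conj dfn_drop\<close>)
  then show ?thesis using vt_length[OF assms(1)] by (simp cong: dfn_cong)
qed

lemma vt_cong: "(\<And>xs. length xs = n \<Longrightarrow> t xs = s xs) \<Longrightarrow> vt M n k t = vt M n k s"
  unfolding vt_def by (auto cong: dfn_cong)

lemma st_cong: "(\<And>xs. length xs = n \<Longrightarrow> t xs = s xs) \<Longrightarrow> st M n t = st M n s"
  unfolding st_def by (auto cong: dfn_cong)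

lemma vt_reindex:
  fixes M :: "('a::linordered_field, 'f, 'r) expansion"
  assumes "\<And>i. i < k \<Longrightarrow> r i < n"
  shows "vt M n k (\<lambda>xs. map (\<lambda>i. xs ! r i) [0..<k])"
  unfolding vt_def
proof (intro conjI allI impI)
  have "dfn M (n + k) (\<lambda>zs. \<forall>i<k. zs ! (n + i) = zs ! r i)"
  proof (rule dfn_bounded_all)
    fix i assume "i < k"
    then show "dfn M (n + k) (\<lambda>zs. zs ! (n + i) = zs ! r i)"
      using assms[of i] by (intro dfnI[of _ _ _ "[]" "Eq (Var (n + i)) (Var (r i))"]) auto
  qed
  moreover have "(\<forall>i<k. zs ! (n + i) = zs ! r i) = (drop n zs = map (\<lambda>i. take n zs ! r i) [0..<k])"
    if "length zs = n + k" for zs :: "'a list"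
    using that assms by (auto simp: list_eq_iff_nth_eq)
  ultimately show "dfn M (n + k) (\<lambda>zs. drop n zs = map (\<lambda>i. take n zs ! r i) [0..<k])"
    by (simp cong: dfn_cong)
qed simp

lemma vt_id: "vt M n n (\<lambda>xs. xs)"
proof -
  have "vt M n n (\<lambda>xs. map (\<lambda>i. xs ! i) [0..<n])" by (rule vt_reindex)
  then show ?thesis by (subst vt_cong[where s = "\<lambda>xs. map (\<lambda>i. xs ! i) [0..<n]"]) (auto intro!: nth_equalityI)
qed

lemma vt_comp:
  assumes "vt M n k t" "vt M k l s"
  shows "vt M n l (\<lambda>xs. s (t xs))"
  unfolding vt_def
proof (intro conjI allI impI)
  fix xs :: "'a list" assume "length xs = n" then show "length (s (t xs)) = l"
    using assms vt_length by metis
next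
  have "dfn M (n + l) (\<lambda>zs. \<exists>ys. length ys = k \<and> ys = t (take n zs) \<and> drop n zs = s ys)"
  proof (rule dfn_exs, rule dfn_conj)
    \<comment> \<open>The variables are ordered as input, output, intermediate value. This
      reindexing extracts the pair (input, intermediate value) for t.\<close>
    have r: "vt M (n + l + k) (n + k) (\<lambda>zs. map (\<lambda>i. zs ! (if i < n then i else l + i)) [0..<n + k])"
      by (rule vt_reindex) auto
    have "dfn M (n + l + k) (\<lambda>zs. drop n (map (\<lambda>i. zs ! (if i < n then i else l + i)) [0..<n + k]) =
        t (take n (map (\<lambda>i. zs ! (if i < n then i else l + i)) [0..<n + k])))"
      by (rule dfn_subst[OF r]) (use assms(1) in \<open>simp add: vt_def\<close>)
    moreover have "drop n (map (\<lambda>i. zs ! (if i < n then i else l + i)) [0..<n + k]) = drop (n + l) zs"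
      "take n (map (\<lambda>i. zs ! (if i < n then i else l + i)) [0..<n + k]) = take n (take (n + l) zs)"
      if "length zs = n + l + k" for zs :: "'a list"
      using that by (auto intro!: nth_equalityI simp: add.commute add.left_commute)
    ultimately show "dfn M (n + l + k) (\<lambda>zs. drop (n + l) zs = t (take n (take (n + l) zs)))"
      by (simp cong: dfn_cong)
    \<comment> \<open>The same for s: the pair (intermediate value, output).\<close>
    have r: "vt M (n + l + k) (k + l) (\<lambda>zs. map (\<lambda>i. zs ! (if i < k then n + l + i else i - k + n)) [0..<k + l])"
      by (rule vt_reindex) auto
    have "dfn M (n + l + k) (\<lambda>zs. drop k (map (\<lambda>i. zs ! (if i < k then n + l + i else i - k + n)) [0..<k + l]) =
        s (take k (map (\<lambda>i. zs ! (if i < k then n + l + i else i - k + n)) [0..<k + l])))"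
      by (rule dfn_subst[OF r]) (use assms(2) in \<open>simp add: vt_def\<close>)
    moreover have "take k (map (\<lambda>i. zs ! (if i < k then n + l + i else i - k + n)) [0..<k + l]) = drop (n + l) zs"
      "drop k (map (\<lambda>i. zs ! (if i < k then n + l + i else i - k + n)) [0..<k + l]) = drop n (take (n + l) zs)"
      if "length zs = n + l + k" for zs :: "'a list"
      using that by (auto intro!: nth_equalityI simp: add.commute add.left_commute)
    ultimately show "dfn M (n + l + k) (\<lambda>zs. drop n (take (n + l) zs) = s (drop (n + l) zs))"
      by (simp cong: dfn_cong)
  qed
  then show "dfn M (n + l) (\<lambda>zs. drop n zs = s (t (take n zs)))"
    using assms(1) by (simp add: vt_length cong: dfn_cong)
qed

lemma vt_takeI: "k = min j m \<Longrightarrow> vt M m k (take j)"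
proof -
  assume k: "k = min j m"
  have "vt M m k (\<lambda>xs. map (\<lambda>i. xs ! i) [0..<k])" by (rule vt_reindex) (auto simp: k)
  then show ?thesis by (subst vt_cong[where s = "\<lambda>xs. map (\<lambda>i. xs ! i) [0..<k]"]) (auto simp: k intro!: nth_equalityI)
qed

lemma vt_dropI: "k = m - j \<Longrightarrow> vt M m k (drop j)"
proof -
  assume k: "k = m - j"
  have "vt M m k (\<lambda>xs. map (\<lambda>i. xs ! (j + i)) [0..<k])" by (rule vt_reindex) (auto simp: k)
  then show ?thesis by (subst vt_cong[where s = "\<lambda>xs. map (\<lambda>i. xs ! (j + i)) [0..<k]"]) (auto simp: k intro!: nth_equalityI)
qed

lemma vt_take: "vt M n m t \<Longrightarrow> k = min j m \<Longrightarrow> vt M n k (\<lambda>xs. take j (t xs))"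
  by (rule vt_comp[OF _ vt_takeI])

lemma vt_drop: "vt M n m t \<Longrightarrow> k = m - j \<Longrightarrow> vt M n k (\<lambda>xs. drop j (t xs))"
  by (rule vt_comp[OF _ vt_dropI])

lemma dfn_list_eq:
  assumes "vt M n k s" "vt M n k t"
  shows "dfn M n (\<lambda>xs. s xs = t xs)"
proof -
  have "dfn M n (\<lambda>xs. \<exists>ys. length ys = k \<and> ys = s xs \<and> ys = t xs)"
    by (rule dfn_exs) (use assms in \<open>auto simp: vt_def intro!: dfn_conj\<close>)
  then show ?thesis using vt_length[OF assms(1)] by (auto cong: dfn_cong)
qed

lemma vt_append:
  assumes "vt M n k s" "vt M n l t" "K = k + l"
  shows "vt M n K (\<lambda>xs. s xs @ t xs)"
  unfolding vt_def
proof (intro conjI allI impI)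
  fix xs :: "'a list" assume "length xs = n" then show "length (s xs @ t xs) = K"
    using assms vt_length by (metis length_append)
next
  have "dfn M (n + K) (\<lambda>zs. take k (drop n zs) = s (take n zs) \<and> drop k (drop n zs) = t (take n zs))"
    by (rule dfn_conj dfn_list_eq[where k = k] dfn_list_eq[where k = l] vt_comp[OF _ assms(1)]
        vt_comp[OF _ assms(2)] vt_id vt_take vt_drop | simp add: assms(3))+
  then show "dfn M (n + K) (\<lambda>zs. drop n zs = s (take n zs) @ t (take n zs))"
  proof (rule iffD1[OF dfn_cong, rotated])
    fix zs :: "'a list" assume "length zs = n + K"
    then have "length (s (take n zs)) = k" using vt_length[OF assms(1)] by simp
    then show "(take k (drop n zs) = s (take n zs) \<and> drop k (drop n zs) = t (take n zs)) =
        (drop n zs = s (take n zs) @ t (take n zs))"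
      using append_eq_conv_conj[of "s (take n zs)" "t (take n zs)" "drop n zs"] by metis
  qed
qed

text \<open>The entries of c become parameters, one for each coordinate.\<close>

lemma vt_const: "length c = k \<Longrightarrow> vt M n k (\<lambda>xs. c)"
  unfolding vt_def
proof (intro conjI)
  assume k: "length c = k"
  have "dfn M k (\<lambda>xs. xs = c)"
  proof -
    have "dfn M k (\<lambda>xs. \<forall>i<k. xs ! i = c ! i)"
    proof (rule dfn_bounded_all)
      fix i assume "i < k"
      then show "dfn M k (\<lambda>xs. xs ! i = c ! i)"
        by (intro dfnI[of _ _ _ "[c ! i]" "Eq (Var i) (Var k)"]) (auto simp: nth_append)
    qed
    then show ?thesis by (subst dfn_cong[where Q = "\<lambda>xs. \<forall>i<k. xs ! i = c ! i"]) (auto simp: k list_eq_iff_nth_eq)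
  qed
  then show "dfn M (n + k) (\<lambda>zs. drop n zs = c)" by (rule dfn_drop) simp
qed auto

lemma vt_single: "vt M n 1 (\<lambda>xs. [t xs]) \<longleftrightarrow> st M n t"
proof -
  have "drop n zs = [t (take n zs)] \<longleftrightarrow> zs ! n = t (take n zs)" if "length zs = Suc n" for zs
    using that by (subst Cons_nth_drop_Suc[symmetric]) auto
  from dfn_cong[OF this] show ?thesis unfolding vt_def st_def by simp
qed

lemma vt_singleI: "st M n t \<Longrightarrow> k = 1 \<Longrightarrow> vt M n k (\<lambda>xs. [t xs])"
  using vt_single by auto

lemma st_nth: "vt M n k t \<Longrightarrow> i < k \<Longrightarrow> st M n (\<lambda>xs. t xs ! i)"
proof -
  assume t: "vt M n k t" and "i < k"
  then have "vt M k 1 (\<lambda>xs. map (\<lambda>j. xs ! i) [0..<1])" by (intro vt_reindex) auto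
  then have "vt M k 1 (\<lambda>xs. [xs ! i])" by simp
  from vt_comp[OF t this] show ?thesis by (simp only: vt_single)
qed

lemma st_comp: "vt M n k t \<Longrightarrow> st M k s \<Longrightarrow> st M n (\<lambda>xs. s (t xs))"
  using vt_comp[of M n k t 1 "\<lambda>xs. [s xs]"] by (simp only: vt_single)

lemma st_const: "st M n (\<lambda>xs. c)"
proof -
  have "vt M n 1 (\<lambda>xs. [c])" by (rule vt_const) simp
  then show ?thesis by (simp only: vt_single)
qed

section \<open>Definable scalars, field operations and atomic relations\<close>

lemma st_unary:
  assumes "st M n s" "st M 1 (\<lambda>ys. f (ys ! 0))"
  shows "st M n (\<lambda>xs. f (s xs))"
  using st_comp[OF vt_singleI[OF assms(1) refl] assms(2)] by simp

lemma st_binary: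
  assumes "st M n s" "st M n t" "st M 2 (\<lambda>ys. f (ys ! 0) (ys ! 1))"
  shows "st M n (\<lambda>xs. f (s xs) (t xs))"
proof -
  have "vt M n 2 (\<lambda>xs. [s xs] @ [t xs])" by (rule vt_append vt_singleI assms refl)+ simp
  from st_comp[OF this assms(3)] show ?thesis by simp
qed

lemma st_plus: "st M n s \<Longrightarrow> st M n t \<Longrightarrow> st M n (\<lambda>xs. s xs + t xs)"
proof (erule st_binary, assumption)
  show "st M 2 (\<lambda>ys. ys ! 0 + ys ! 1)" unfolding st_def
    by (intro dfnI[of _ _ _ "[]" "Eq (Var 2) (Plus (Var 0) (Var 1))"]) auto
qed

lemma st_times: "st M n s \<Longrightarrow> st M n t \<Longrightarrow> st M n (\<lambda>xs. s xs * t xs)"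
proof (erule st_binary, assumption)
  show "st M 2 (\<lambda>ys. ys ! 0 * ys ! 1)" unfolding st_def
    by (intro dfnI[of _ _ _ "[]" "Eq (Var 2) (Times (Var 0) (Var 1))"]) auto
qed

lemma st_uminus: "st M n s \<Longrightarrow> st M n (\<lambda>xs. - s xs)"
proof (erule st_unary)
  show "st M 1 (\<lambda>ys. - (ys ! 0))" unfolding st_def
    by (intro dfnI[of _ _ _ "[]" "Eq (Var 1) (Minus (Var 0))"]) auto
qed

lemma st_minus: "st M n s \<Longrightarrow> st M n t \<Longrightarrow> st M n (\<lambda>xs. s xs - t xs)"
  using st_plus[OF _ st_uminus] by simp

lemma st_if:
  assumes "dfn M n P" "st M n s" "st M n t"
  shows "st M n (\<lambda>xs. if P xs then s xs else t xs)"
proof -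
  have "dfn M (Suc n) (\<lambda>zs. (P (take n zs) \<longrightarrow> zs ! n = s (take n zs)) \<and> (\<not> P (take n zs) \<longrightarrow> zs ! n = t (take n zs)))"
    using assms unfolding st_def by (intro dfn_conj dfn_imp dfn_not dfn_take) auto
  then show ?thesis unfolding st_def by (rule iffD1[OF dfn_cong, rotated]) auto
qed

text \<open>Reduces an atomic relation between definable scalars to a relation between two
  variables, for which a formula can be written down.\<close>

lemma dfn_binary:
  assumes "st M n s" "st M n t" "dfn M 2 (\<lambda>ys. R (ys ! 0) (ys ! 1))"
  shows "dfn M n (\<lambda>xs. R (s xs) (t xs))"
proof -
  have "vt M n 2 (\<lambda>xs. [s xs] @ [t xs])" by (rule vt_append vt_singleI assms refl)+ simp
  from dfn_subst[OF this assms(3)] show ?thesis by simp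
qed

lemma dfn_eq: "st M n s \<Longrightarrow> st M n t \<Longrightarrow> dfn M n (\<lambda>xs. s xs = t xs)"
proof (erule dfn_binary, assumption)
  show "dfn M 2 (\<lambda>ys. ys ! 0 = ys ! 1)" by (intro dfnI[of _ _ _ "[]" "Eq (Var 0) (Var 1)"]) auto
qed

lemma dfn_less: "st M n s \<Longrightarrow> st M n t \<Longrightarrow> dfn M n (\<lambda>xs. s xs < t xs)"
proof (erule dfn_binary, assumption)
  show "dfn M 2 (\<lambda>ys. ys ! 0 < ys ! 1)" by (intro dfnI[of _ _ _ "[]" "Less (Var 0) (Var 1)"]) auto
qed

lemma dfn_le: "st M n s \<Longrightarrow> st M n t \<Longrightarrow> dfn M n (\<lambda>xs. s xs \<le> t xs)"
  using dfn_not[OF dfn_less, of M n t s] by (simp add: not_less)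

lemma st_abs: "st M n s \<Longrightarrow> st M n (\<lambda>xs. \<bar>s xs\<bar>)"
  unfolding abs_if by (intro st_if dfn_less st_const st_uminus)

lemma st_min: "st M n s \<Longrightarrow> st M n t \<Longrightarrow> st M n (\<lambda>xs. min (s xs) (t xs))"
  unfolding min_def by (intro st_if dfn_le)

lemma st_max: "st M n s \<Longrightarrow> st M n t \<Longrightarrow> st M n (\<lambda>xs. max (s xs) (t xs))"
  unfolding max_def by (intro st_if dfn_le)

lemma dfn_mem: "vt M n k t \<Longrightarrow> definable M k X \<Longrightarrow> dfn M n (\<lambda>xs. t xs \<in> X)"
  by (erule dfn_subst) (simp add: definable_iff_dfn)

lemmas dfn_intros = dfn_const dfn_not dfn_conj dfn_disj dfn_imp dfn_iffI dfn_eq dfn_less dfn_le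
  dfn_ex dfn_all dfn_bounded_all st_if st_plus st_minus st_times st_uminus st_abs st_const
lemmas vt_intros = vt_id vt_take vt_drop vt_append vt_singleI

section \<open>Tame structures: compactness and one-variable sets\<close>

lemma dfn_subst2:
  assumes "dfn M (Suc n) (\<lambda>zs. R (take n zs) (zs ! n))" "vt M m n t" "st M m s"
  shows "dfn M m (\<lambda>xs. R (t xs) (s xs))"
proof -
  have "vt M m (Suc n) (\<lambda>xs. t xs @ [s xs])"
    by (rule vt_append assms vt_singleI refl | simp)+
  from dfn_subst[OF this assms(1)]
  show ?thesis by (rule iffD1[OF dfn_cong, rotated]) (auto simp: nth_append vt_length[OF assms(2)])
qed

lemma dfn_subst3:
  assumes "dfn M (Suc (Suc n)) (\<lambda>zs. R (take n zs) (zs ! n) (zs ! Suc n))" "vt M m n t" "st M m s" "st M m r"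
  shows "dfn M m (\<lambda>xs. R (t xs) (s xs) (r xs))"
proof -
  have "vt M m (Suc (Suc n)) (\<lambda>xs. t xs @ [s xs] @ [r xs])"
    by (rule vt_append assms vt_singleI refl | simp)+
  from dfn_subst[OF this assms(1)]
  show ?thesis by (rule iffD1[OF dfn_cong, rotated]) (auto simp: nth_append vt_length[OF assms(2)])
qed

locale tame_structure =
  fixes M :: "('a::linordered_field, 'f, 'r) expansion" and \<kappa> :: "'k rel"
  assumes o_minimal: "o_minimal M" and sufficiently_saturated: "sufficiently_saturated M \<kappa>"
begin

section \<open>Small cardinals and the compactness principle\<close>

lemma infinite_fm: "infinite (UNIV :: ('f, 'r) fm set)"
proof -
  have "inj (\<lambda>n. Eq (Var n) Zero :: ('f, 'r) fm)" by (simp add: inj_def)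
  then show ?thesis using infinite_UNIV_nat finite_imageD finite_subset subset_UNIV by metis
qed

lemma Card_order: "Card_order \<kappa>" and regularCard: "regularCard \<kappa>" and saturated: "saturated M \<kappa>"
  using sufficiently_saturated by (auto simp: sufficiently_saturated_def)

text \<open>\<kappa> exceeds the number of sets of formulas, and there are infinitely many formulas
  because there are infinitely many variables.\<close>

lemma nat_small: "|UNIV :: nat set| <o \<kappa>"
proof -
  have "infinite (UNIV :: ('f, 'r) fm set set)"
    using infinite_fm by (simp add: Finite_Set.finite_set)
  then have "|UNIV :: nat set| \<le>o |UNIV :: ('f, 'r) fm set set|"
    using infinite_iff_card_of_nat by blast
  then show ?thesis
    using sufficiently_saturated ordLeq_ordLess_trans by (auto simp: sufficiently_saturated_def)
qed

lemma Cinfinite: "Cinfinite \<kappa>"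
proof -
  have "infinite (Field |UNIV :: nat set| )" unfolding Field_card_of by simp
  then have "cinfinite \<kappa>"
    using nat_small cinfinite_mono ordLess_imp_ordLeq unfolding cinfinite_def by blast
  then show ?thesis using Card_order by simp
qed

lemma finite_small: "finite A \<Longrightarrow> |A| <o \<kappa>"
  using Cinfinite card_of_Well_order finite_ordLess_infinite
  by (metis Field_card_of card_order_on_well_order_on cinfinite_def)

lemma countable_small: "countable A \<Longrightarrow> |A| <o \<kappa>"
  using nat_small by (meson card_of_ordLeq countable_def ordLeq_ordLess_trans subset_UNIV)

lemma UN_small: "|I| <o \<kappa> \<Longrightarrow> (\<And>i. i \<in> I \<Longrightarrow> |A i| <o \<kappa>) \<Longrightarrow> |\<Union>i\<in>I. A i| <o \<kappa>"
  using card_of_UNION_ordLess_infinite_Field_regularCard[OF regularCard Cinfinite] by blast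

lemma image_small: "|I| <o \<kappa> \<Longrightarrow> |f ` I| <o \<kappa>"
  using card_of_image ordLeq_ordLess_trans by blast

lemma subset_small: "A \<subseteq> B \<Longrightarrow> |B| <o \<kappa> \<Longrightarrow> |A| <o \<kappa>"
  using card_of_mono1 ordLeq_ordLess_trans by blast

lemma Un_small: "|A| <o \<kappa> \<Longrightarrow> |B| <o \<kappa> \<Longrightarrow> |A \<union> B| <o \<kappa>"
  using UN_small[of "{A, B}" "\<lambda>x. x"] by (auto simp: finite_small)

lemma Times_small: "|A| <o \<kappa> \<Longrightarrow> |B| <o \<kappa> \<Longrightarrow> |A \<times> B| <o \<kappa>"
proof -
  assume A: "|A| <o \<kappa>" and B: "|B| <o \<kappa>"
  have "A \<times> B = (\<Union>a\<in>A. Pair a ` B)" by auto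
  then show ?thesis using UN_small[OF A image_small[OF B]] by metis
qed

text \<open>Saturation speaks of formulas with parameters. Choosing one formula and one parameter
  list for each set keeps the set of parameters small, because each list is finite and the family is
  small.\<close>

lemma compactness:
  assumes small: "|\<Y>| <o \<kappa>" and def: "\<And>Y. Y \<in> \<Y> \<Longrightarrow> definable M n Y"
    and fip: "\<And>\<D>. finite \<D> \<Longrightarrow> \<D> \<subseteq> \<Y> \<Longrightarrow> \<exists>xs. length xs = n \<and> (\<forall>Y\<in>\<D>. xs \<in> Y)"
  shows "\<exists>xs. length xs = n \<and> (\<forall>Y\<in>\<Y>. xs \<in> Y)"
proof -
  have "\<forall>Y\<in>\<Y>. \<exists>q :: ('f, 'r) fm \<times> 'a list. Y = {xs. length xs = n \<and> sat M (xs @ snd q) (fst q)}"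
  proof
    fix Y assume "Y \<in> \<Y>"
    then obtain \<phi> :: "('f, 'r) fm" and ps where "Y = {xs. length xs = n \<and> sat M (xs @ ps) \<phi>}"
      using def unfolding definable_def by blast
    then show "\<exists>q :: ('f, 'r) fm \<times> 'a list. Y = {xs. length xs = n \<and> sat M (xs @ snd q) (fst q)}"
      by (intro exI[of _ "(\<phi>, ps)"]) simp
  qed
  then obtain q :: "'a list set \<Rightarrow> ('f, 'r) fm \<times> 'a list"
    where "\<And>Y. Y \<in> \<Y> \<Longrightarrow> Y = {xs. length xs = n \<and> sat M (xs @ snd (q Y)) (fst (q Y))}"
    by metis
  then have q: "xs \<in> Y \<longleftrightarrow> length xs = n \<and> sat M (xs @ snd (q Y)) (fst (q Y))" if "Y \<in> \<Y>" for Y xs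
    using that by blast
  define A where "A = (\<Union>Y\<in>\<Y>. set (snd (q Y)))"
  have A: "|A| <o \<kappa>" unfolding A_def by (rule UN_small[OF small], rule finite_small, rule finite_set)
  have fs: "\<exists>xs. length xs = n \<and> (\<forall>(\<phi>, ps)\<in>\<Delta>. sat M (xs @ ps) \<phi>)" if fin: "finite \<Delta>" "\<Delta> \<subseteq> q ` \<Y>" for \<Delta>
  proof -
    obtain \<D> where D: "\<D> \<subseteq> \<Y>" "finite \<D>" "\<Delta> = q ` \<D>" using finite_subset_image[OF fin] by auto
    from fip[OF D(2,1)] obtain xs where "length xs = n" "\<forall>Y\<in>\<D>. xs \<in> Y" by blast
    then show ?thesis using D q by (intro exI[of _ xs]) (auto simp: case_prod_beta)
  qed
  have "\<forall>(\<phi>, ps)\<in>q ` \<Y>. set ps \<subseteq> A"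
    unfolding A_def case_prod_beta by blast
  then have "\<exists>xs. length xs = n \<and> (\<forall>(\<phi>, ps)\<in>q ` \<Y>. sat M (xs @ ps) \<phi>)"
    by (intro saturated[unfolded saturated_def, THEN spec[of _ n], THEN spec[of _ A],
          THEN spec[of _ "q ` \<Y>"], THEN mp] conjI A allI impI fs) auto
  then obtain xs where xs: "length xs = n" "\<forall>r\<in>q ` \<Y>. sat M (xs @ snd r) (fst r)"
    by (auto simp: case_prod_beta)
  then have "xs \<in> Y" if "Y \<in> \<Y>" for Y
    unfolding q[OF that] using that by blast
  then show ?thesis using xs(1) by blast
qed

section \<open>Definable subsets of the line\<close>

definition basic_interval :: "'a set \<Rightarrow> bool" where
  "basic_interval I \<longleftrightarrow> (\<exists>a. I = {a}) \<or> (\<exists>a b. I = {a<..<b}) \<or> (\<exists>a. I = {a<..}) \<or> (\<exists>b. I = {..<b}) \<or> I = UNIV"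

abbreviation def1 :: "('a \<Rightarrow> bool) \<Rightarrow> bool" where
  "def1 P \<equiv> dfn M 1 (\<lambda>xs. P (xs ! 0))"

lemma def1_intervals:
  assumes "def1 P"
  shows "\<exists>\<I>. finite \<I> \<and> Collect P = \<Union>\<I> \<and> (\<forall>I\<in>\<I>. basic_interval I)"
proof -
  have 1: "definable M 1 {xs. length xs = 1 \<and> P (xs ! 0)}" using assms by (simp add: dfn_def)
  have 2: "{x. [x] \<in> {xs. length xs = 1 \<and> P (xs ! 0)}} = Collect P" by auto
  show ?thesis
    using o_minimal[unfolded o_minimal_def, THEN spec, THEN mp, OF 1] unfolding 2 basic_interval_def .
qed

text \<open>Some piece of the finite decomposition is infinite; it is not a point, so it contains a
  nonempty open interval.\<close>

lemma def1_infinite: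
  assumes "def1 P" "infinite (Collect P)"
  shows "\<exists>a b. a < b \<and> (\<forall>x. a < x \<longrightarrow> x < b \<longrightarrow> P x)"
proof -
  obtain \<I> where I: "finite \<I>" "Collect P = \<Union>\<I>" "\<And>I. I \<in> \<I> \<Longrightarrow> basic_interval I"
    using def1_intervals[OF assms(1)] by blast
  then obtain I where i: "I \<in> \<I>" "infinite I" using assms(2) by (metis finite_Union)
  then have sub: "I \<subseteq> Collect P" using I by auto
  from I(3)[OF i(1)] consider a b where "I = {a<..<b}" | a where "I = {a<..}" | b where "I = {..<b}" | "I = UNIV"
    using i(2) unfolding basic_interval_def by auto
  then show ?thesis
  proof cases
    case (1 a b)
    then have "a < b" using i(2) by (metis finite.emptyI greaterThanLessThan_empty not_le_imp_less)
    then show ?thesis using sub 1 by (intro exI[of _ a] exI[of _ b]) auto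
  next
    case (2 a) then show ?thesis using sub by (intro exI[of _ a] exI[of _ "a + 1"]) auto
  next
    case (3 b) then show ?thesis using sub by (intro exI[of _ "b - 1"] exI[of _ b]) auto
  next
    case 4 then show ?thesis using sub by (intro exI[of _ 0] exI[of _ 1]) auto
  qed
qed

text \<open>Each basic interval contains or misses a whole right neighbourhood of s, and finitely
  many such neighbourhoods have a common one.\<close>

lemma def1_right_germ:
  assumes "def1 P"
  shows "\<exists>t>s. (\<forall>x. s < x \<and> x < t \<longrightarrow> P x) \<or> (\<forall>x. s < x \<and> x < t \<longrightarrow> \<not> P x)"
proof -
  obtain \<I> where I: "finite \<I>" "Collect P = \<Union>\<I>" "\<And>I. I \<in> \<I> \<Longrightarrow> basic_interval I"
    using def1_intervals[OF assms(1)] by blast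
  from I(1,3) have "\<exists>t>s. {s<..<t} \<subseteq> \<Union>\<I> \<or> {s<..<t} \<inter> \<Union>\<I> = {}"
  proof (induction \<I>)
    case empty then show ?case by (auto intro: exI[of _ "s + 1"])
  next
    case (insert I \<I>)
    have "\<exists>t>s. {s<..<t} \<subseteq> I \<or> {s<..<t} \<inter> I = {}"
    proof -
      have "basic_interval I" using insert.prems by simp
      then consider a where "I = {a}" | a b where "I = {a<..<b}" | a where "I = {a<..}"
        | b where "I = {..<b}" | "I = UNIV" unfolding basic_interval_def by auto
      then show ?thesis
      proof cases
        case (1 a) then show ?thesis
          by (cases "s < a") (auto intro: exI[of _ a] exI[of _ "s + 1"])
      next
        case (2 a b)
        consider "s < a" | "a \<le> s" "s < b" | "b \<le> s" by linarith
        then show ?thesis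
          by cases (use 2 in \<open>auto intro: exI[of _ a] exI[of _ b] exI[of _ "s + 1"]\<close>)
      next
        case (3 a) then show ?thesis
          by (cases "s < a") (auto intro: exI[of _ a] exI[of _ "s + 1"])
      next
        case (4 b) then show ?thesis
          by (cases "s < b") (auto intro: exI[of _ b] exI[of _ "s + 1"])
      next
        case 5 then show ?thesis by (auto intro: exI[of _ "s + 1"])
      qed
    qed
    then obtain t where t: "s < t" "{s<..<t} \<subseteq> I \<or> {s<..<t} \<inter> I = {}" by blast
    obtain u where u: "s < u" "{s<..<u} \<subseteq> \<Union>\<I> \<or> {s<..<u} \<inter> \<Union>\<I> = {}"
      using insert.IH insert.prems by auto
    have "{s<..<min t u} \<subseteq> {s<..<t}" "{s<..<min t u} \<subseteq> {s<..<u}" by auto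
    then have "{s<..<min t u} \<subseteq> \<Union>(insert I \<I>) \<or> {s<..<min t u} \<inter> \<Union>(insert I \<I>) = {}"
      using t(2) u(2) by (simp only: Union_insert) blast
    then show ?case using t(1) u(1) by (intro exI[of _ "min t u"]) simp
  qed
  moreover have "x \<in> \<Union>\<I> \<longleftrightarrow> P x" for x using I(2) by blast
  ultimately show ?thesis unfolding disjoint_iff subset_iff by (simp only: greaterThanLessThan_iff)
qed

text \<open>A relation instead of an operator: the field need not be complete, and in this form the
  notion can occur inside definable conditions, as it does in
  \<open>definable_choice\<close>.\<close>

definition is_glb :: "('a \<Rightarrow> bool) \<Rightarrow> 'a \<Rightarrow> bool" where
  "is_glb P s \<longleftrightarrow> (\<forall>x. P x \<longrightarrow> s \<le> x) \<and> (\<forall>t. (\<forall>x. P x \<longrightarrow> t \<le> x) \<longrightarrow> t \<le> s)"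

lemma is_glb_unique: "is_glb P s \<Longrightarrow> is_glb P t \<Longrightarrow> s = t"
  unfolding is_glb_def by (meson antisym)

text \<open>The infimum of a nonempty basic interval bounded below is its left end, and the infimum
  of a finite union is the least of the infima of its nonempty pieces.\<close>

lemma def1_glb:
  assumes "def1 P" "P x0" "\<And>x. P x \<Longrightarrow> c \<le> x"
  shows "\<exists>s. is_glb P s"
proof -
  obtain \<I> where I: "finite \<I>" "Collect P = \<Union>\<I>" "\<And>I. I \<in> \<I> \<Longrightarrow> basic_interval I"
    using def1_intervals[OF assms(1)] by blast
  have "\<forall>x\<in>\<Union>\<I>. c \<le> x" using I(2) assms(3) by blast
  with I(1,3) have "\<Union>\<I> = {} \<or> (\<exists>s. is_glb (\<lambda>x. x \<in> \<Union>\<I>) s)"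
  proof (induction \<I>)
    case empty then show ?case by simp
  next
    case (insert I \<I>)
    have 1: "\<exists>s. is_glb (\<lambda>x. x \<in> I) s" if ne: "I \<noteq> {}"
    proof -
      have no: False if "\<And>x. x < b \<Longrightarrow> x \<in> I" for b
      proof -
        \<comment> \<open>A point below both b and the lower bound c; it rules out pieces that are
          unbounded below.\<close>
        have "min b c - 1 < b" by (simp add: min_def)
        then have "c \<le> min b c - 1" using that insert.prems by blast
        then show False by (simp add: min_def split: if_splits)
      qed
      have "basic_interval I" using insert.prems by simp
      then consider a where "I = {a}" | a b where "I = {a<..<b}" | a where "I = {a<..}"
        | b where "I = {..<b}" | "I = UNIV" unfolding basic_interval_def by auto
      then show ?thesis
      proof cases
        case (1 a) then show ?thesis by (auto simp: is_glb_def)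
      next
        case (2 a b)
        have "t \<le> a" if "\<forall>x. x \<in> I \<longrightarrow> t \<le> x" for t
        proof (rule ccontr)
          assume "\<not> t \<le> a"
          then have "a < min t b" using ne 2 by auto
          then obtain z where "a < z" "z < min t b" using dense by blast
          then show False using that 2 by (meson greaterThanLessThan_iff leD min_less_iff_conj)
        qed
        then show ?thesis using 2 by (intro exI[of _ a]) (auto simp: is_glb_def)
      next
        case (3 a)
        have "t \<le> a" if "\<forall>x. x \<in> I \<longrightarrow> t \<le> x" for t
        proof (rule ccontr)
          assume "\<not> t \<le> a"
          then obtain z where "a < z" "z < t" using dense[of a t] by auto
          then show False using that 3 by (meson greaterThan_iff leD)
        qed
        then show ?thesis using 3 by (intro exI[of _ a]) (auto simp: is_glb_def)
      next
        case (4 b) then show ?thesis using no[of b] by auto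
      next
        case 5 then show ?thesis using no[of 0] by auto
      qed
    qed
    have 2: "\<Union>\<I> = {} \<or> (\<exists>s. is_glb (\<lambda>x. x \<in> \<Union>\<I>) s)"
      by (rule insert.IH) (use insert.prems in auto)
    show ?case
    proof (cases "I = {} \<or> \<Union>\<I> = {}")
      case True then show ?thesis using 1 2 by (metis Un_empty Un_empty_left Un_empty_right Union_insert)
    next
      case False
      then obtain s t where "is_glb (\<lambda>x. x \<in> I) s" "is_glb (\<lambda>x. x \<in> \<Union>\<I>) t" using 1 2 by blast
      then have "is_glb (\<lambda>x. x \<in> \<Union>(insert I \<I>)) (min s t)"
        unfolding is_glb_def by (auto simp: min_le_iff_disj)
      then show ?thesis by blast
    qed
  qed
  moreover have mem: "x \<in> \<Union>\<I> \<longleftrightarrow> P x" for x using I(2) by blast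
  moreover have "\<Union>\<I> \<noteq> {}" using assms(2) I(2) by blast
  ultimately show ?thesis unfolding mem by blast
qed

text \<open>This is where saturation replaces the Baire category theorem: realising the type saying that
  \<open>R x \<delta>\<close> holds for a fixed infinite sequence of points \<open>x\<close> gives one \<open>\<delta>\<close> that works for infinitely
  many points, hence on an interval.\<close>

lemma uniform_on_subinterval:
  assumes R: "dfn M (Suc 1) (\<lambda>zs. R (zs ! 0) (zs ! 1))" and ab: "a < b"
    and ex: "\<forall>x. a < x \<longrightarrow> x < b \<longrightarrow> (\<exists>\<delta>>0. R x \<delta>)"
    and mono: "\<forall>x \<delta> \<delta>'. R x \<delta> \<longrightarrow> 0 < \<delta>' \<longrightarrow> \<delta>' \<le> \<delta> \<longrightarrow> R x \<delta>'"
  shows "\<exists>c d \<delta>. a \<le> c \<and> c < d \<and> d \<le> b \<and> 0 < \<delta> \<and> (\<forall>x. c < x \<longrightarrow> x < d \<longrightarrow> R x \<delta>)"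
proof -
  have R': "dfn M m (\<lambda>xs. R (s xs) (t xs))" if "st M m s" "st M m t" for m s t
    by (rule dfn_subst2[where R = "\<lambda>x. R (x ! 0)" and n = 1 and t = "\<lambda>xs. [s xs]", simplified])
      (use R that in \<open>auto intro: vt_singleI simp: numeral_2_eq_2\<close>)
  obtain x :: "nat \<Rightarrow> 'a" where x: "inj x" "range x \<subseteq> {a<..<b}"
    using infinite_Ioo[OF ab] infinite_countable_subset by blast
  define D where "D = (\<lambda>i. {xs. length xs = 1 \<and> 0 < xs ! 0 \<and> R (x i) (xs ! 0)})"
  have "\<exists>xs. length xs = 1 \<and> (\<forall>Y\<in>range D. xs \<in> Y)"
  proof (rule compactness)
    show "|range D| <o \<kappa>" by (rule countable_small) simp
    show "definable M 1 Y" if "Y \<in> range D" for Y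
    proof -
      have "dfn M 1 (\<lambda>xs. 0 < xs ! 0 \<and> R (x i) (xs ! 0))" for i
        by (rule dfn_conj dfn_less R' st_const st_nth vt_id | simp)+
      then show ?thesis using that by (auto simp: dfn_def D_def)
    qed
    fix \<D> assume "finite \<D>" "\<D> \<subseteq> range D"
    then obtain F where F: "finite F" "\<D> = D ` F" by (meson finite_subset_image)
    \<comment> \<open>Monotonicity of R in \<delta> allows finitely many radii to be replaced by
      their minimum, which gives finite satisfiability.\<close>
    have "\<exists>\<delta>>0. \<forall>i\<in>F. R (x i) \<delta>" using F(1)
    proof (induction F)
      case empty then show ?case by (auto intro: exI[of _ 1])
    next
      case (insert i F)
      then obtain \<delta> where d: "\<delta> > 0" "\<forall>i\<in>F. R (x i) \<delta>" by blast
      have "a < x i" "x i < b" using subsetD[OF x(2) rangeI, of i] by auto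
      then obtain \<epsilon> where "\<epsilon> > 0" "R (x i) \<epsilon>" using ex by blast
      then have "0 < min \<delta> \<epsilon> \<and> (\<forall>j\<in>insert i F. R (x j) (min \<delta> \<epsilon>))"
        using d mono[rule_format, of _ \<delta> "min \<delta> \<epsilon>"] mono[rule_format, of _ \<epsilon> "min \<delta> \<epsilon>"] by auto
      then show ?case by blast
    qed
    then obtain \<delta> where "\<delta> > 0" "\<forall>i\<in>F. R (x i) \<delta>" by blast
    then show "\<exists>xs. length xs = 1 \<and> (\<forall>Y\<in>\<D>. xs \<in> Y)"
      by (intro exI[of _ "[\<delta>]"]) (auto simp: D_def F(2))
  qed
  then obtain \<delta> where \<delta>: "0 < \<delta>" "\<And>i. R (x i) \<delta>" unfolding D_def by auto
  have 1: "def1 (\<lambda>y. a < y \<and> y < b \<and> R y \<delta>)"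
    by (rule dfn_conj dfn_less R' st_const st_nth vt_id | simp)+
  have 2: "infinite {y. a < y \<and> y < b \<and> R y \<delta>}"
  proof
    assume "finite {y. a < y \<and> y < b \<and> R y \<delta>}"
    moreover have "range x \<subseteq> {y. a < y \<and> y < b \<and> R y \<delta>}" using x(2) \<delta>(2) by auto
    ultimately show False using x(1) by (meson finite_subset range_inj_infinite)
  qed
  obtain c d where cd: "c < d" "\<And>y. c < y \<Longrightarrow> y < d \<Longrightarrow> a < y \<and> y < b \<and> R y \<delta>"
    using def1_infinite[of "\<lambda>y. a < y \<and> y < b \<and> R y \<delta>", OF 1 2] by blast
  have "a \<le> c"
  proof (rule ccontr)
    assume "\<not> a \<le> c"
    then obtain z where "c < z" "z < min a d" using dense[of c "min a d"] cd(1) by auto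
    then show False using cd(2)[of z] by auto
  qed
  moreover have "d \<le> b"
  proof (rule ccontr)
    assume "\<not> d \<le> b"
    then obtain z where "max c b < z" "z < d" using dense[of "max c b" d] cd(1) by auto
    then show False using cd(2)[of z] by auto
  qed
  ultimately show ?thesis using cd \<delta>(1) by blast
qed

section \<open>The monotonicity theorem for definable functions of one variable\<close>

definition cont1 :: "('a \<Rightarrow> 'a) \<Rightarrow> 'a \<Rightarrow> bool" where
  "cont1 f x \<longleftrightarrow> (\<forall>\<epsilon>>0. \<exists>\<delta>>0. \<forall>y. \<bar>y - x\<bar> < \<delta> \<longrightarrow> \<bar>f y - f x\<bar> < \<epsilon>)"

text \<open>Weak monotonicity also covers constant functions, and both clauses pass to subintervals,
  as \<open>uniform_interval\<close> will require.\<close>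

definition monoc :: "('a \<Rightarrow> 'a) \<Rightarrow> 'a \<Rightarrow> 'a \<Rightarrow> bool" where
  "monoc f c d \<longleftrightarrow> ((\<forall>x y. c < x \<and> x \<le> y \<and> y < d \<longrightarrow> f x \<le> f y) \<or> (\<forall>x y. c < x \<and> x \<le> y \<and> y < d \<longrightarrow> f y \<le> f x)) \<and>
     (\<forall>x. c < x \<and> x < d \<longrightarrow> cont1 f x)"

lemma cont1_uminus: "cont1 (\<lambda>x. - f x) = cont1 f"
  unfolding cont1_def by (auto simp: abs_minus_commute fun_eq_iff)

lemma monoc_uminus: "monoc (\<lambda>x. - f x) c d = monoc f c d"
  unfolding monoc_def by (auto simp: cont1_uminus)

text \<open>A common radius of increase on a subinterval, from
  \<open>uniform_on_subinterval\<close>, makes f strictly increasing on a short enough interval. The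
  image there is infinite and definable, so it contains an interval, and an increasing map is
  continuous where it attains all values of an interval.\<close>

lemma monoc_locally_increasing:
  assumes f: "st M 1 (\<lambda>xs. f (xs ! 0))" and ab: "a < b"
    and loc: "\<forall>x. a < x \<longrightarrow> x < b \<longrightarrow> (\<exists>t>x. \<forall>y. x < y \<and> y < t \<longrightarrow> f x < f y)"
  shows "\<exists>c d. a \<le> c \<and> c < d \<and> d \<le> b \<and> monoc f c d"
proof -
  have f': "st M m (\<lambda>xs. f (s xs))" if "st M m s" for m s
    by (rule st_unary[OF that f])
  define R where "R = (\<lambda>x \<delta>. \<forall>y. x < y \<and> y < x + \<delta> \<longrightarrow> f x < f y)"
  have R1: "dfn M (Suc 1) (\<lambda>zs. R (zs ! 0) (zs ! 1))"
    unfolding R_def by (rule dfn_intros f' st_nth vt_intros | simp)+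
  have R2: "\<forall>x. a < x \<longrightarrow> x < b \<longrightarrow> (\<exists>\<delta>>0. R x \<delta>)"
  proof (intro allI impI)
    fix x assume x: "a < x" "x < b"
    obtain t where "t > x" "\<forall>y. x < y \<and> y < t \<longrightarrow> f x < f y" using loc x by blast
    then show "\<exists>\<delta>>0. R x \<delta>" unfolding R_def by (intro exI[of _ "t - x"]) auto
  qed
  have R3: "\<forall>x \<delta> \<delta>'. R x \<delta> \<longrightarrow> 0 < \<delta>' \<longrightarrow> \<delta>' \<le> \<delta> \<longrightarrow> R x \<delta>'"
    unfolding R_def by auto
  obtain c d \<delta> where 1: "a \<le> c" "c < d" "d \<le> b" "0 < \<delta>"
    and R: "\<And>x. c < x \<Longrightarrow> x < d \<Longrightarrow> R x \<delta>"
    using uniform_on_subinterval[of R, OF R1 ab R2 R3] by blast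
  have u: "\<And>x. c < x \<Longrightarrow> x < d \<Longrightarrow> \<forall>y. x < y \<and> y < x + \<delta> \<longrightarrow> f x < f y"
    using R unfolding R_def by blast
  \<comment> \<open>Any two points between c and e differ by less than \<delta>, so the common
    radius applies to them.\<close>
  define e where "e = min d (c + \<delta>)"
  have e: "c < e" "e \<le> d" "e \<le> c + \<delta>" using 1 by (auto simp: e_def)
  have inc: "f x < f y" if "c < x" "x < y" "y < e" for x y
    using u[of x] that e by auto
  have inc': "f x \<le> f y" if "c < x" "x \<le> y" "y < e" for x y
    using inc[of x y] that by (cases "x = y") auto
  have lt: "x < y" if "f x < f y" "c < x" "x < e" "c < y" "y < e" for x y
    using inc[of y x] that by (metis less_asym less_irrefl linorder_cases)
  have 3: "def1 (\<lambda>y. \<exists>x. c < x \<and> x < e \<and> f x = y)"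
    by (rule dfn_intros f' st_nth vt_intros | simp)+
  have 4: "infinite {y. \<exists>x. c < x \<and> x < e \<and> f x = y}"
  proof -
    have "inj_on f {c<..<e}" by (rule linorder_inj_onI') (use inc in force)
    then have "infinite (f ` {c<..<e})" using infinite_Ioo[OF e(1)] by (simp add: finite_image_iff)
    moreover have "f ` {c<..<e} = {y. \<exists>x. c < x \<and> x < e \<and> f x = y}" by auto
    ultimately show ?thesis by simp
  qed
  obtain r s where rs: "r < s" "\<And>y. r < y \<Longrightarrow> y < s \<Longrightarrow> \<exists>x. c < x \<and> x < e \<and> f x = y"
    using def1_infinite[of "\<lambda>y. \<exists>x. c < x \<and> x < e \<and> f x = y", OF 3 4] by blast
  \<comment> \<open>Shrinking (r, s) to (r', s') makes the end values attained, which provides the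
    endpoints c' and d' of the final interval.\<close>
  obtain s' where s': "r < s'" "s' < s" using dense[OF rs(1)] by blast
  obtain r' where r': "r < r'" "r' < s'" using dense[OF s'(1)] by blast
  obtain c' where c': "c < c'" "c' < e" "f c' = r'" using rs(2)[of r'] r' s' by auto
  obtain d' where d': "c < d'" "d' < e" "f d' = s'" using rs(2)[of s'] r' s' by auto
  have "c' < d'" using lt[of c' d'] c' d' r' by auto
  moreover have "monoc f c' d'"
    unfolding monoc_def
  proof (intro conjI disjI1 allI impI)
    fix x assume x: "c' < x \<and> x < d'"
    then have fx: "r' < f x" "f x < s'" using inc[of c' x] inc[of x d'] c' d' by auto
    show "cont1 f x" unfolding cont1_def
    proof (intro allI impI)
      fix \<epsilon> :: 'a assume "\<epsilon> > 0"
      \<comment> \<open>The \<epsilon>-window around f x, cut down to [r', s'] so that u and v are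
        still values of f.\<close>
      define u v where "u = max r' (f x - \<epsilon>)" and "v = min s' (f x + \<epsilon>)"
      have uv: "r' \<le> u" "u < f x" "f x < v" "v \<le> s'" "f x - \<epsilon> \<le> u" "v \<le> f x + \<epsilon>"
        using \<open>\<epsilon> > 0\<close> fx by (auto simp: u_def v_def)
      obtain p where p: "c < p" "p < e" "f p = u" using rs(2)[of u] uv fx s' r' by auto
      obtain q where q: "c < q" "q < e" "f q = v" using rs(2)[of v] uv fx s' r' by auto
      have px: "p < x" "x < q" using lt[of p x] lt[of x q] p q uv x c' d' by auto
      show "\<exists>\<delta>>0. \<forall>y. \<bar>y - x\<bar> < \<delta> \<longrightarrow> \<bar>f y - f x\<bar> < \<epsilon>"
      proof (intro exI conjI allI impI)
        show "0 < min (x - p) (q - x)" using px by simp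
        fix y assume "\<bar>y - x\<bar> < min (x - p) (q - x)"
        then have "p < y" "y < q" by (auto simp: abs_less_iff)
        then have "u < f y" "f y < v" using inc[of p y] inc[of y q] p q by auto
        then show "\<bar>f y - f x\<bar> < \<epsilon>" using uv by (auto simp: abs_less_iff)
      qed
    qed
  qed (use inc' c' d' in auto)
  ultimately show ?thesis using c' d' 1 e by (intro exI[of _ c'] exI[of _ d']) auto
qed

text \<open>An infinite fibre gives an interval on which f is constant. Otherwise the fibres in (a,
  b) are finite, and their least points form an infinite definable set on which f is injective; on
  an interval inside that set, germs decide between local increase and local decrease.\<close>

lemma monoc_subinterval:
  assumes f: "st M 1 (\<lambda>xs. f (xs ! 0))" and ab: "a < b"
  shows "\<exists>c d. a \<le> c \<and> c < d \<and> d \<le> b \<and> monoc f c d"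
proof -
  have f': "st M m (\<lambda>xs. f (s xs))" if "st M m s" for m s
    by (rule st_unary[OF that f])
  have sub: "a \<le> c \<and> d \<le> b" if "c < d" "\<And>y. c < y \<Longrightarrow> y < d \<Longrightarrow> a \<le> y \<and> y \<le> b" for a b c d :: 'a
  proof
    show "a \<le> c" using dense_ge_bounded[OF that(1)] that(2) by blast
    show "d \<le> b" using dense_le_bounded[OF that(1)] that(2) by blast
  qed
  show ?thesis
  proof (cases "\<exists>y. infinite {x. a < x \<and> x < b \<and> f x = y}")
    case True
    then obtain y where y: "infinite {x. a < x \<and> x < b \<and> f x = y}" by blast
    have 1: "def1 (\<lambda>x. a < x \<and> x < b \<and> f x = y)"
      by (rule dfn_intros f' st_nth vt_intros | simp)+
    obtain c d where cd: "c < d" "\<And>x. c < x \<Longrightarrow> x < d \<Longrightarrow> a < x \<and> x < b \<and> f x = y"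
      using def1_infinite[of "\<lambda>x. a < x \<and> x < b \<and> f x = y", OF 1 y] by blast
    have "cont1 f x" if "c < x" "x < d" for x unfolding cont1_def
    proof (intro allI impI)
      fix \<epsilon> :: 'a assume "\<epsilon> > 0"
      then show "\<exists>\<delta>>0. \<forall>y. \<bar>y - x\<bar> < \<delta> \<longrightarrow> \<bar>f y - f x\<bar> < \<epsilon>"
        using that cd by (intro exI[of _ "min (x - c) (d - x)"]) (auto simp: abs_less_iff)
    qed
    then have "monoc f c d" unfolding monoc_def using cd by auto
    moreover have "a \<le> c \<and> d \<le> b" using sub[of c d a b] cd by (metis less_imp_le)
    ultimately show ?thesis using cd(1) by blast
  next
    case False
    \<comment> \<open>Points that come first in their fibre. A finite fibre has a least element, so
      W meets every fibre and is infinite because the image is.\<close>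
    define W where "W = (\<lambda>x. a < x \<and> x < b \<and> (\<forall>x'. a < x' \<and> x' < x \<longrightarrow> f x' \<noteq> f x))"
    have img: "f ` {a<..<b} \<subseteq> f ` Collect W"
    proof
      fix y assume "y \<in> f ` {a<..<b}"
      define S where "S = {x. a < x \<and> x < b \<and> f x = y}"
      have S: "finite S" "S \<noteq> {}" using False \<open>y \<in> _\<close> by (auto simp: S_def)
      obtain m where m: "m \<in> S" "\<forall>x\<in>S. m \<le> x" using S Min_in Min_le by metis
      have "W m" unfolding W_def
      proof (intro conjI allI impI notI)
        fix x assume "a < x \<and> x < m" "f x = f m"
        then have "x \<in> S" using m(1) by (auto simp: S_def)
        then show False using m(2) \<open>a < x \<and> x < m\<close> by auto
      qed (use m(1) in \<open>auto simp: S_def\<close>)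
      then show "y \<in> f ` Collect W" using m(1) by (auto simp: S_def)
    qed
    have "infinite (f ` {a<..<b})"
    proof
      assume "finite (f ` {a<..<b})"
      then have "finite (\<Union>y\<in>f ` {a<..<b}. {x. a < x \<and> x < b \<and> f x = y})" using False by blast
      moreover have "{a<..<b} \<subseteq> (\<Union>y\<in>f ` {a<..<b}. {x. a < x \<and> x < b \<and> f x = y})" by auto
      ultimately show False using infinite_Ioo[OF ab] finite_subset by blast
    qed
    then have W1: "infinite (Collect W)" using img finite_subset by blast
    have W2: "def1 W"
      unfolding W_def by (rule dfn_intros f' st_nth vt_intros | simp)+
    obtain c d where cd: "c < d" "\<And>x. c < x \<Longrightarrow> x < d \<Longrightarrow> W x"
      using def1_infinite[of W, OF W2 W1] by blast
    have ac: "a \<le> c" "d \<le> b" using sub[of c d a b] cd unfolding W_def by (metis less_imp_le)+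
    have inj: "f x \<noteq> f y" if "c < x" "x < y" "y < d" for x y
      using cd(2)[of y] that ac unfolding W_def by auto
    define U where "U = (\<lambda>x. \<exists>t>x. \<forall>y. x < y \<and> y < t \<longrightarrow> f x < f y)"
    have U: "def1 U" "def1 (\<lambda>x. c < x \<and> x < d \<and> U x)" "def1 (\<lambda>x. c < x \<and> x < d \<and> \<not> U x)"
      unfolding U_def by (rule dfn_intros f' st_nth vt_intros | simp)+
    show ?thesis
    proof (cases "finite {x. c < x \<and> x < d \<and> \<not> U x}")
      case True
      have "{c<..<d} \<subseteq> {x. c < x \<and> x < d \<and> U x} \<union> {x. c < x \<and> x < d \<and> \<not> U x}" by auto
      then have U1: "infinite {x. c < x \<and> x < d \<and> U x}"
        using True infinite_Ioo[OF cd(1)] by (meson finite_Un finite_subset)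
      obtain p q where pq: "p < q" "\<And>x. p < x \<Longrightarrow> x < q \<Longrightarrow> c < x \<and> x < d \<and> U x"
        using def1_infinite[of "\<lambda>x. c < x \<and> x < d \<and> U x", OF U(2) U1] by blast
      have loc: "\<forall>x. p < x \<longrightarrow> x < q \<longrightarrow> (\<exists>t>x. \<forall>y. x < y \<and> y < t \<longrightarrow> f x < f y)"
        using pq(2) unfolding U_def by blast
      obtain p' q' where "p \<le> p'" "p' < q'" "q' \<le> q" "monoc f p' q'"
        using monoc_locally_increasing[of f, OF f pq(1) loc] by blast
      moreover have "c \<le> p \<and> q \<le> d" using sub[of p q c d] pq by (metis less_imp_le)
      ultimately show ?thesis using ac by (meson order_trans)
    next
      \<comment> \<open>Here infinitely many points fail to be locally increasing. By
        \<open>def1_right_germ\<close> and injectivity, f decreases to the right of each point of an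
        interval of such points, so \<open>monoc_locally_increasing\<close> applies to -f.\<close>
      case False
      then obtain p q where pq: "p < q" "\<And>x. p < x \<Longrightarrow> x < q \<Longrightarrow> c < x \<and> x < d \<and> \<not> U x"
        using def1_infinite[of "\<lambda>x. c < x \<and> x < d \<and> \<not> U x", OF U(3) False] by blast
      have cpq: "c \<le> p \<and> q \<le> d" using sub[of p q c d] pq by (metis less_imp_le)
      have loc: "\<forall>x. p < x \<longrightarrow> x < q \<longrightarrow> (\<exists>t>x. \<forall>y. x < y \<and> y < t \<longrightarrow> - f x < - f y)"
      proof (intro allI impI)
        fix x assume x: "p < x" "x < q"
        have 1: "def1 (\<lambda>y. f x < f y)" by (rule dfn_intros f' st_nth vt_intros | simp)+
        obtain t where t: "x < t"
          "(\<forall>y. x < y \<and> y < t \<longrightarrow> f x < f y) \<or> (\<forall>y. x < y \<and> y < t \<longrightarrow> \<not> f x < f y)"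
          using def1_right_germ[of "\<lambda>y. f x < f y", OF 1, of x] by blast
        then have "\<forall>y. x < y \<and> y < t \<longrightarrow> \<not> f x < f y" using pq(2)[OF x] unfolding U_def by blast
        then have "\<forall>y. x < y \<and> y < min t q \<longrightarrow> f y < f x"
          using inj[of x] x cpq by (metis dual_order.strict_trans1 min_less_iff_conj not_less_iff_gr_or_eq order_less_le_trans)
        then show "\<exists>t>x. \<forall>y. x < y \<and> y < t \<longrightarrow> - f x < - f y"
          using t(1) x by (intro exI[of _ "min t q"]) auto
      qed
      have 1: "st M 1 (\<lambda>xs. - f (xs ! 0))" by (intro st_uminus f)
      obtain p' q' where "p \<le> p'" "p' < q'" "q' \<le> q" "monoc f p' q'"
        using monoc_locally_increasing[of "\<lambda>x. - f x", OF 1 pq(1) loc] unfolding monoc_uminus by blast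
      then show ?thesis using ac cpq by (meson order_trans)
    qed
  qed
qed

end

section \<open>Generic continuity of definable functions\<close>

definition cube :: "nat \<Rightarrow> 'a::linordered_field list \<Rightarrow> 'a \<Rightarrow> 'a list set" where
  "cube n x d = {y. length y = n \<and> (\<forall>i<n. \<bar>y ! i - x ! i\<bar> < d)}"

text \<open>The length condition gives the quantifier over y the shape handled by
  \<open>dfn_alls\<close>.\<close>

definition cont_at :: "nat \<Rightarrow> ('a::linordered_field list \<Rightarrow> 'a) \<Rightarrow> 'a list \<Rightarrow> bool" where
  "cont_at n f x \<longleftrightarrow> (\<forall>\<epsilon>. 0 < \<epsilon> \<longrightarrow> (\<exists>\<delta>. 0 < \<delta> \<and> (\<forall>y. length y = n \<longrightarrow> y \<in> cube n x \<delta> \<longrightarrow> \<bar>f y - f x\<bar> < \<epsilon>)))"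

lemma cube_length: "y \<in> cube n x d \<Longrightarrow> length y = n"
  by (simp add: cube_def)

lemma cube_center: "length x = n \<Longrightarrow> 0 < d \<Longrightarrow> x \<in> cube n x d"
  by (simp add: cube_def)

lemma cube_mono: "d \<le> e \<Longrightarrow> cube n x d \<subseteq> cube n x e"
  by (auto simp: cube_def)

lemma cube_append:
  assumes "length u = n" "length y = n"
  shows "y @ [z] \<in> cube (Suc n) (u @ [v]) d \<longleftrightarrow> y \<in> cube n u d \<and> \<bar>z - v\<bar> < d"
  using assms by (auto simp: cube_def nth_append less_Suc_eq)

lemma cube_Suc_cases:
  assumes "w \<in> cube (Suc n) x d"
  obtains y z where "w = y @ [z]" "length y = n"
  using cube_length[OF assms] by (metis length_Suc_conv_rev)

text \<open>Finitely many gaps d - |y ! i - x ! i| are positive, so a positive margin e lies below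
  all of them; it is built by induction over the coordinates.\<close>

lemma cube_subcube:
  assumes "y \<in> cube n x d" "0 < d"
  shows "\<exists>e>0. cube n y e \<subseteq> cube n x d"
proof -
  have "\<exists>e>0. \<forall>i<k. \<bar>y ! i - x ! i\<bar> + e \<le> d" if "\<forall>i<k. \<bar>y ! i - x ! i\<bar> < d" for k
    using that
  proof (induction k)
    case 0 then show ?case by (auto intro: exI[of _ 1])
  next
    case (Suc k)
    then obtain e where e: "e > 0" "\<forall>i<k. \<bar>y ! i - x ! i\<bar> + e \<le> d" by auto
    define e' where "e' = min e (d - \<bar>y ! k - x ! k\<bar>)"
    have "e' > 0" "e' \<le> e" "\<bar>y ! k - x ! k\<bar> + e' \<le> d" using e Suc.prems by (auto simp: e'_def min_def)
    then have "\<forall>i<Suc k. \<bar>y ! i - x ! i\<bar> + e' \<le> d"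
      using e(2) by (metis add_left_mono less_Suc_eq order_trans)
    then show ?case using \<open>e' > 0\<close> by blast
  qed
  then obtain e where e: "e > 0" "\<forall>i<n. \<bar>y ! i - x ! i\<bar> + e \<le> d"
    using assms(1) unfolding cube_def by blast
  have "cube n y e \<subseteq> cube n x d"
  proof
    fix w assume w: "w \<in> cube n y e"
    have "\<bar>w ! i - x ! i\<bar> < d" if i: "i < n" for i
    proof -
      have "\<bar>w ! i - x ! i\<bar> \<le> \<bar>w ! i - y ! i\<bar> + \<bar>y ! i - x ! i\<bar>"
        using abs_triangle_ineq[of "w ! i - y ! i" "y ! i - x ! i"] by simp
      moreover have "\<bar>w ! i - y ! i\<bar> < e" using w i by (simp add: cube_def)
      moreover have "\<bar>y ! i - x ! i\<bar> + e \<le> d" using e(2) i by blast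
      ultimately show ?thesis by linarith
    qed
    then show "w \<in> cube n x d" using w by (auto simp: cube_def)
  qed
  then show ?thesis using e(1) by blast
qed

lemma dfn_cube:
  assumes "vt M m n s" "vt M m n t" "st M m e"
  shows "dfn M m (\<lambda>xs. s xs \<in> cube n (t xs) (e xs))"
proof -
  have "dfn M m (\<lambda>xs. \<forall>i<n. \<bar>s xs ! i - t xs ! i\<bar> < e xs)"
    by (rule dfn_bounded_all dfn_less st_abs st_minus assms st_nth[OF assms(1)] st_nth[OF assms(2)] | assumption)+
  then show ?thesis
    by (rule iffD1[OF dfn_cong, rotated]) (simp add: cube_def vt_length[OF assms(1)])
qed

lemma st_subst2:
  assumes "st M (m + n) (\<lambda>zs. g (take m zs) (drop m zs))" "vt M k m s" "vt M k n t"
  shows "st M k (\<lambda>xs. g (s xs) (t xs))"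
proof -
  have "vt M k (m + n) (\<lambda>xs. s xs @ t xs)" by (rule vt_append assms refl)+
  from st_comp[OF this assms(1)]
  have "st M k (\<lambda>xs. g (take m (s xs @ t xs)) (drop m (s xs @ t xs)))" .
  then show ?thesis by (rule iffD1[OF st_cong, rotated]) (simp add: vt_length[OF assms(2)])
qed

text \<open>Continuity at a point is a first-order condition, so \<open>thickD\<close> can be
  applied to the set of continuity points.\<close>

lemma dfn_cont_at:
  assumes g: "st M (m + n) (\<lambda>zs. g (take m zs) (drop m zs))" and t: "vt M m n t"
  shows "dfn M m (\<lambda>xs. cont_at n (g xs) (t xs))"
  unfolding cont_at_def
  by (rule dfn_imp dfn_conj dfn_all dfn_ex dfn_alls dfn_cube dfn_less st_abs st_minus st_const st_subst2[OF g]
      vt_comp[OF _ t] st_nth vt_id vt_take vt_drop refl | simp)+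

context tame_structure
begin

text \<open>If the fibre has a least element, take it. Otherwise its infimum s lies outside, and by
  the germ lemma the fibre contains an interval starting at s; take the midpoint between s and the
  infimum m of the points beyond s that lie outside the fibre.\<close>

lemma definable_choice:
  assumes P: "dfn M (Suc n) (\<lambda>zs. P (take n zs) (zs ! n))" and bdd: "\<And>x y. P x y \<Longrightarrow> a < y \<and> y < b"
  shows "\<exists>f. st M n f \<and> (\<forall>x y. length x = n \<longrightarrow> P x y \<longrightarrow> P x (f x))"
proof -
  define mn where "mn = (\<lambda>x y. P x y \<and> (\<forall>z. P x z \<longrightarrow> y \<le> z))"
  \<comment> \<open>The equation y + y = s + m describes the midpoint without division, which is not
    an operation of the language.\<close>
  define mid where "mid = (\<lambda>x y. \<exists>s m. is_glb (P x) s \<and> is_glb (\<lambda>z. s < z \<and> \<not> P x z) m \<and> y + y = s + m)"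
  \<comment> \<open>The value 0 on empty fibres makes the selected function total, as
    \<open>st\<close> requires.\<close>
  define Sel where "Sel = (\<lambda>x y. if \<exists>z. P x z then (if \<exists>m. mn x m then mn x y else mid x y) else y = 0)"
  have ex1: "\<exists>!y. Sel x y \<and> ((\<exists>z. P x z) \<longrightarrow> P x y)" "\<exists>!y. Sel x y" if x: "length x = n" for x
  proof -
    have "\<exists>y. Sel x y \<and> ((\<exists>z. P x z) \<longrightarrow> P x y) \<and> (\<forall>y'. Sel x y' \<longrightarrow> y' = y)"
    proof (cases "\<exists>z. P x z")
      case False then show ?thesis by (auto simp: Sel_def)
    next
      case True
      then obtain z0 where z0: "P x z0" by blast
      show ?thesis
      proof (cases "\<exists>m. mn x m")
        case mn: True
        then show ?thesis using True unfolding Sel_def mn_def by (auto intro: antisym)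
      next
        case False
        have d1: "def1 (P x)"
          by (rule dfn_subst2[OF P, of 1 "\<lambda>_. x"]) (rule vt_const x st_nth vt_id | simp)+
        have bdd': "\<forall>y. P x y \<longrightarrow> a \<le> y" using bdd by (meson less_imp_le)
        then obtain s where s: "is_glb (P x) s" using def1_glb[of "P x" z0 a] d1 z0 by blast
        have nPs: "\<not> P x s" using False s unfolding mn_def is_glb_def by blast
        have "s < b" using bdd[OF z0] s z0 unfolding is_glb_def by (meson order_le_less_trans)
        obtain t where t: "s < t" "(\<forall>y. s < y \<and> y < t \<longrightarrow> P x y) \<or> (\<forall>y. s < y \<and> y < t \<longrightarrow> \<not> P x y)"
          using def1_right_germ[of "P x", OF d1] by blast
        have germ: "\<forall>y. s < y \<and> y < t \<longrightarrow> P x y"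
        proof (rule ccontr)
          assume "\<not> ?thesis"
          then have no: "\<forall>y. s < y \<and> y < t \<longrightarrow> \<not> P x y" using t(2) by blast
          have "t \<le> y" if "P x y" for y
          proof -
            have "s \<le> y" "s \<noteq> y" using s nPs that unfolding is_glb_def by auto
            then show ?thesis using no that by (metis le_neq_trans not_le)
          qed
          then have "t \<le> s" using s unfolding is_glb_def by blast
          then show False using t(1) by simp
        qed
        have d2: "def1 (\<lambda>z. s < z \<and> \<not> P x z)"
          by (rule dfn_conj dfn_not dfn_less st_const d1 st_nth vt_id | simp)+
        \<comment> \<open>The upper bound b is a point beyond s outside the fibre, so the second
          infimum exists.\<close>
        have "s < b \<and> \<not> P x b" using \<open>s < b\<close> bdd by blast
        then obtain m where m: "is_glb (\<lambda>z. s < z \<and> \<not> P x z) m"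
          using def1_glb[of "\<lambda>z. s < z \<and> \<not> P x z" b s, OF d2] by auto
        have "t \<le> m" using m germ unfolding is_glb_def by (meson not_le)
        have sub: "P x z" if "s < z" "z < m" for z
          using m that unfolding is_glb_def by (meson not_le)
        define y where "y = (s + m) / 2"
        have y: "y + y = s + m" by (simp add: y_def)
        then have "s < y" "y < m" using t(1) \<open>t \<le> m\<close> by linarith+
        then have Pxy: "P x y" using sub by blast
        have "mid x y" unfolding mid_def using s m y by blast
        moreover have "y' = y" if mid': "mid x y'" for y'
        proof -
          obtain s' m' where "is_glb (P x) s'" "is_glb (\<lambda>z. s' < z \<and> \<not> P x z) m'" "y' + y' = s' + m'"
            using mid' unfolding mid_def by blast
          then have "y' + y' = y + y" using is_glb_unique[OF s] is_glb_unique[OF m] y by metis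
          then show ?thesis by simp
        qed
        moreover have "Sel x z \<longleftrightarrow> mid x z" for z
          unfolding Sel_def if_P[OF True] if_not_P[OF False] ..
        ultimately show ?thesis using Pxy by blast
      qed
    qed
    then show "\<exists>!y. Sel x y \<and> ((\<exists>z. P x z) \<longrightarrow> P x y)" "\<exists>!y. Sel x y" by blast+
  qed
  define f where "f = (\<lambda>x. THE y. Sel x y)"
  have f: "y = f x \<longleftrightarrow> Sel x y" if "length x = n" for x y
    using ex1(2)[OF that] unfolding f_def by (metis the_equality)
  have "dfn M (Suc n) (\<lambda>zs. Sel (take n zs) (zs ! n))"
    unfolding Sel_def mn_def mid_def is_glb_def if_bool_eq_conj
    by (rule dfn_imp dfn_conj dfn_all dfn_ex dfn_not dfn_less dfn_le dfn_eq st_plus st_const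
        dfn_subst2[OF P] st_nth vt_id vt_take refl | simp)+
  then have "st M n f" unfolding st_def
    by (rule iffD1[OF dfn_cong, rotated]) (simp add: f)
  moreover have "P x (f x)" if "length x = n" "P x y" for x y
    using ex1[OF that(1)] f[OF that(1)] that(2) by metis
  ultimately show ?thesis by blast
qed

section \<open>Generic constancy and generic continuity in several variables\<close>

definition thick :: "nat \<Rightarrow> bool" where
  "thick n \<longleftrightarrow> (\<forall>P x d. dfn M n P \<longrightarrow> length x = n \<longrightarrow> 0 < d \<longrightarrow>
     (\<exists>x' d'. length x' = n \<and> 0 < d' \<and> cube n x' d' \<subseteq> cube n x d \<and>
        ((\<forall>y\<in>cube n x' d'. P y) \<or> (\<forall>y\<in>cube n x' d'. \<not> P y))))"

text \<open>Paired with \<open>thick\<close>, this is a weak substitute for cell decomposition: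
  definable predicates become constant, and definable functions continuous, somewhere in every cube.
  The inductive step of each uses both in the dimension below.\<close>

definition gencont :: "nat \<Rightarrow> bool" where
  "gencont n \<longleftrightarrow> (\<forall>f x d. st M n f \<longrightarrow> length x = n \<longrightarrow> 0 < d \<longrightarrow> (\<exists>y\<in>cube n x d. cont_at n f y))"

lemma thickD:
  assumes "thick n" "dfn M n P" "length x = n" "0 < d"
  shows "\<exists>x' d'. length x' = n \<and> 0 < d' \<and> cube n x' d' \<subseteq> cube n x d \<and>
        ((\<forall>y\<in>cube n x' d'. P y) \<or> (\<forall>y\<in>cube n x' d'. \<not> P y))"
  using assms unfolding thick_def by blast

lemma gencontD:
  assumes "gencont n" "st M n f" "length x = n" "0 < d"
  shows "\<exists>y\<in>cube n x d. cont_at n f y"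
  using assms unfolding gencont_def by blast

text \<open>By \<open>thick\<close>, the continuity points fill a subcube or are absent from one;
  \<open>gencont\<close> excludes the second case.\<close>

lemma gencont_cube:
  assumes "thick n" "gencont n" and f: "st M n f" and x: "length x = n" "0 < d"
  shows "\<exists>x' d'. length x' = n \<and> 0 < d' \<and> cube n x' d' \<subseteq> cube n x d \<and> (\<forall>y\<in>cube n x' d'. cont_at n f y)"
proof -
  have "dfn M n (\<lambda>xs. cont_at n f xs)"
    by (rule dfn_cont_at[where g = "\<lambda>_. f"]) (rule st_comp[OF _ f] vt_drop vt_id refl | simp)+
  from thickD[OF assms(1) this x] obtain x' d' where 1: "length x' = n" "0 < d'" "cube n x' d' \<subseteq> cube n x d"
    "(\<forall>y\<in>cube n x' d'. cont_at n f y) \<or> (\<forall>y\<in>cube n x' d'. \<not> cont_at n f y)" by blast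
  moreover have "\<exists>y\<in>cube n x' d'. cont_at n f y" by (rule gencontD[OF assms(2) f 1(1,2)])
  ultimately show ?thesis by blast
qed

text \<open>Definable choice turns the endpoints l and r into functions of the base point. Near a
  common point of continuity they move little, so one slightly shorter interval lies inside all of
  the moving ones.\<close>

lemma uniform_interval:
  assumes ind: "thick n" "gencont n"
    and R: "dfn M (Suc (Suc n)) (\<lambda>zs. R (take n zs) (zs ! n) (zs ! Suc n))"
    and u: "length u = n" "0 < d"
    and ex: "\<And>x. x \<in> cube n u d \<Longrightarrow> \<exists>l r. a < l \<and> l < r \<and> r < b \<and> R x l r"
    and sub: "\<And>x l r l' r'. R x l r \<Longrightarrow> l \<le> l' \<Longrightarrow> l' < r' \<Longrightarrow> r' \<le> r \<Longrightarrow> R x l' r'"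
  shows "\<exists>u' d' c e. length u' = n \<and> 0 < d' \<and> cube n u' d' \<subseteq> cube n u d \<and> a < c \<and> c < e \<and> e < b \<and>
    (\<forall>x\<in>cube n u' d'. R x c e)"
proof -
  \<comment> \<open>Choice selects one scalar at a time: first a left end that admits a right end,
    then a right end for the chosen left end.\<close>
  define P1 where "P1 = (\<lambda>x l. a < l \<and> l < b \<and> (\<exists>r. l < r \<and> r < b \<and> R x l r))"
  have "dfn M (Suc n) (\<lambda>zs. P1 (take n zs) (zs ! n))" unfolding P1_def
    by (rule dfn_conj dfn_ex dfn_less st_const dfn_subst3[OF R] st_nth vt_id vt_take refl | simp)+
  moreover have "\<And>x y. P1 x y \<Longrightarrow> a < y \<and> y < b" by (simp add: P1_def)
  ultimately obtain f where f: "st M n f" "\<forall>x y. length x = n \<longrightarrow> P1 x y \<longrightarrow> P1 x (f x)"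
    using definable_choice[of n P1 a b] by blast
  define P2 where "P2 = (\<lambda>x r. a < r \<and> r < b \<and> f x < r \<and> R x (f x) r)"
  have "dfn M (Suc n) (\<lambda>zs. P2 (take n zs) (zs ! n))" unfolding P2_def
    by (rule dfn_conj dfn_ex dfn_less st_const dfn_subst3[OF R] st_comp[OF _ f(1)] st_nth vt_id vt_take refl | simp)+
  moreover have "\<And>x y. P2 x y \<Longrightarrow> a < y \<and> y < b" by (simp add: P2_def)
  ultimately obtain g where g: "st M n g" "\<forall>x y. length x = n \<longrightarrow> P2 x y \<longrightarrow> P2 x (g x)"
    using definable_choice[of n P2 a b] by blast
  have fg: "a < f x \<and> f x < g x \<and> g x < b \<and> R x (f x) (g x)" if x: "x \<in> cube n u d" for x
  proof -
    obtain l r where lr: "a < l" "l < r" "r < b" "R x l r" using ex[OF x] by blast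
    have "P1 x l" unfolding P1_def using lr by auto
    then have 1: "P1 x (f x)" using f(2) cube_length[OF x] by blast
    then obtain r' where "P2 x r'" unfolding P1_def P2_def by (meson less_trans)
    then have "P2 x (g x)" using g(2) cube_length[OF x] by blast
    then show ?thesis using 1 unfolding P1_def P2_def by blast
  qed
  obtain u1 d1 where 1: "length u1 = n" "0 < d1" "cube n u1 d1 \<subseteq> cube n u d" "\<forall>y\<in>cube n u1 d1. cont_at n f y"
    using gencont_cube[OF ind f(1) u] by blast
  obtain y where y: "y \<in> cube n u1 d1" "cont_at n g y" using gencontD[OF ind(2) g(1) 1(1,2)] by blast
  have fy: "a < f y" "f y < g y" "g y < b" using fg y(1) 1(3) by auto
  \<comment> \<open>With a quarter of the length as tolerance, the interval from f y + h to g y - h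
    keeps half the length and stays between f x and g x whenever both functions vary by less than
    h.\<close>
  define h where "h = (g y - f y) / 4"
  have h: "0 < h" "f y + h < g y - h" using fy by (auto simp: h_def field_simps)
  have "cont_at n f y" using 1(4) y(1) by blast
  then obtain \<delta>1 where \<delta>1: "\<delta>1 > 0" "\<forall>x. length x = n \<longrightarrow> x \<in> cube n y \<delta>1 \<longrightarrow> \<bar>f x - f y\<bar> < h"
    using h(1) unfolding cont_at_def by blast
  obtain \<delta>2 where \<delta>2: "\<delta>2 > 0" "\<forall>x. length x = n \<longrightarrow> x \<in> cube n y \<delta>2 \<longrightarrow> \<bar>g x - g y\<bar> < h"
    using h(1) y(2) unfolding cont_at_def by blast
  obtain e where e: "e > 0" "cube n y e \<subseteq> cube n u1 d1" using cube_subcube[OF y(1) 1(2)] by blast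
  define d' where "d' = min e (min \<delta>1 \<delta>2)"
  have d': "0 < d'" "cube n y d' \<subseteq> cube n y e" "cube n y d' \<subseteq> cube n y \<delta>1" "cube n y d' \<subseteq> cube n y \<delta>2"
    using e(1) \<delta>1(1) \<delta>2(1) by (auto simp: d'_def intro!: cube_mono subsetD[OF cube_mono, rotated])
  have "R x (f y + h) (g y - h)" if x: "x \<in> cube n y d'" for x
  proof (rule sub)
    have "x \<in> cube n u d" using x d'(2) e(2) 1(3) by blast
    then show "R x (f x) (g x)" using fg by blast
    have "\<bar>f x - f y\<bar> < h" "\<bar>g x - g y\<bar> < h" using \<delta>1(2) \<delta>2(2) x d' cube_length[OF x] by auto
    then show "f x \<le> f y + h" "g y - h \<le> g x" by (auto simp: abs_less_iff)
  qed (use h in auto)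
  moreover have "a < f y + h" "g y - h < b" using fy h by auto
  moreover have "cube n y d' \<subseteq> cube n u d" using d'(2) e(2) 1(3) by blast
  ultimately show ?thesis
    using d'(1) h(2) cube_length[OF y(1)] by (intro exI[of _ y] exI[of _ d'] exI[of _ "f y + h"] exI[of _ "g y - h"]) auto
qed

text \<open>\<open>uniform_interval\<close> produces a box over a base cube on which T holds; the
  rest inscribes a cube in that box, centred at half height.\<close>

lemma thick_column:
  assumes ind: "thick n" "gencont n" and T: "dfn M (Suc n) T" and u: "length u = n" "0 < d"
    and ex: "\<And>x. x \<in> cube n u d \<Longrightarrow> \<exists>l r. a < l \<and> l < r \<and> r < b \<and> (\<forall>z. l < z \<and> z < r \<longrightarrow> T (x @ [z]))"
  shows "\<exists>u' d' v'. length u' = n \<and> 0 < d' \<and> cube n u' d' \<subseteq> cube n u d \<and> a < v' - d' \<and> v' + d' < b \<and>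
    (\<forall>y\<in>cube (Suc n) (u' @ [v']) d'. T y)"
proof -
  define R where "R = (\<lambda>x l r. \<forall>z. l < z \<and> z < r \<longrightarrow> T (x @ [z]))"
  have "dfn M (Suc (Suc n)) (\<lambda>zs. R (take n zs) (zs ! n) (zs ! Suc n))" unfolding R_def
    by (rule dfn_imp dfn_conj dfn_all dfn_less dfn_subst[OF _ T] vt_append vt_singleI st_nth vt_id vt_take refl | simp)+
  moreover have "\<And>x l r l' r'. R x l r \<Longrightarrow> l \<le> l' \<Longrightarrow> l' < r' \<Longrightarrow> r' \<le> r \<Longrightarrow> R x l' r'"
    unfolding R_def by auto
  ultimately obtain u' d' c e where 1: "length u' = n" "0 < d'" "cube n u' d' \<subseteq> cube n u d" "a < c" "c < e" "e < b"
    "\<forall>x\<in>cube n u' d'. R x c e"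
    using uniform_interval[of n R u d a b] ind u ex unfolding R_def by blast
  define v r where "v = (c + e) / 2" and "r = min d' ((e - c) / 2)"
  have "2 * v = c + e" by (simp add: v_def)
  moreover have "0 < r" "r \<le> d'" "2 * r \<le> e - c" using 1 by (auto simp: r_def min_def)
  ultimately have r: "0 < r" "r \<le> d'" "c \<le> v - r" "v + r \<le> e" by linarith+
  have "T w" if w: "w \<in> cube (Suc n) (u' @ [v]) r" for w
  proof -
    obtain y z where yz: "w = y @ [z]" "length y = n" by (rule cube_Suc_cases[OF w])
    then have "y \<in> cube n u' r" "\<bar>z - v\<bar> < r" using w cube_append[OF 1(1) yz(2)] by auto
    then have "y \<in> cube n u' d'" "c < z" "z < e" using r cube_mono[OF r(2)] by (auto simp: abs_less_iff)
    then show ?thesis using 1(7) unfolding R_def yz(1) by blast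
  qed
  moreover have "cube n u' r \<subseteq> cube n u d" using cube_mono[OF r(2)] 1(3) by blast
  ultimately show ?thesis using r 1 by (intro exI[of _ u'] exI[of _ r] exI[of _ v]) auto
qed

text \<open>Over each base point, P or its negation holds at infinitely many heights and hence on an
  interval of heights. \<open>thick n\<close> makes one of the two alternatives hold over a whole
  base cube, where \<open>thick_column\<close> applies.\<close>

lemma thick_Suc:
  assumes ind: "thick n" "gencont n"
  shows "thick (Suc n)"
  unfolding thick_def
proof (intro allI impI)
  fix P :: "'a list \<Rightarrow> bool" and x :: "'a list" and d :: 'a
  assume P: "dfn M (Suc n) P" and x: "length x = Suc n" and d: "0 < d"
  obtain u v where uv: "x = u @ [v]" "length u = n" using x by (metis length_Suc_conv_rev)
  define C where "C = (\<lambda>T x. \<exists>l r. v - d < l \<and> l < r \<and> r < v + d \<and> (\<forall>z. l < z \<and> z < r \<longrightarrow> T (x @ [z])))"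
  have Cd: "dfn M n (\<lambda>x. C P x)" unfolding C_def
    by (rule dfn_imp dfn_conj dfn_all dfn_ex dfn_less dfn_subst[OF _ P] vt_append vt_singleI st_const st_nth vt_id vt_take refl | simp)+
  have PQ: "C P y \<or> C (\<lambda>w. \<not> P w) y" if y: "length y = n" for y
  proof -
    define S where "S = (\<lambda>T z. v - d < z \<and> z < v + d \<and> T (y @ [z]))"
    have C: "C T y" if T: "dfn M (Suc n) T" and inf: "infinite {z. S T z}" for T
    proof -
      have 1: "def1 (S T)" unfolding S_def
        by (rule dfn_conj dfn_less dfn_subst[OF _ T] vt_append vt_singleI vt_const y st_const st_nth vt_id refl | simp)+
      obtain l r where lr: "l < r" "\<forall>z. l < z \<longrightarrow> z < r \<longrightarrow> S T z"
        using def1_infinite[of "S T", OF 1 inf] by blast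
      \<comment> \<open>Moving both ends inwards puts them into the set itself, which gives the
        strict bounds v - d < l' and r' < v + d.\<close>
      obtain l' where l': "l < l'" "l' < r" using dense[OF lr(1)] by blast
      obtain r' where r': "l' < r'" "r' < r" using dense[OF l'(2)] by blast
      have "S T l'" "S T r'" using lr(2) l' r' by auto
      moreover have "\<forall>z. l' < z \<and> z < r' \<longrightarrow> T (y @ [z])" using lr(2) l' r' unfolding S_def by (meson less_trans)
      ultimately show ?thesis unfolding C_def S_def using r'(1) by blast
    qed
    have "v - d < v + d" using d by simp
    then have "infinite {v - d<..<v + d}" by (rule infinite_Ioo)
    moreover have "{v - d<..<v + d} \<subseteq> {z. S P z} \<union> {z. S (\<lambda>w. \<not> P w) z}" unfolding S_def by auto
    ultimately have "infinite {z. S P z} \<or> infinite {z. S (\<lambda>w. \<not> P w) z}" by (meson finite_Un finite_subset)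
    then show ?thesis using C[OF P] C[OF dfn_not[OF P]] by blast
  qed
  have step: "\<exists>x' d'. length x' = Suc n \<and> 0 < d' \<and> cube (Suc n) x' d' \<subseteq> cube (Suc n) x d \<and> (\<forall>y\<in>cube (Suc n) x' d'. T y)"
    if T: "dfn M (Suc n) T" and u': "length u' = n" "0 < d'" "cube n u' d' \<subseteq> cube n u d"
      and all: "\<forall>y\<in>cube n u' d'. C T y" for T u' d'
  proof -
    obtain u'' d'' v'' where 1: "length u'' = n" "0 < d''" "cube n u'' d'' \<subseteq> cube n u' d'" "v - d < v'' - d''"
      "v'' + d'' < v + d" "\<forall>y\<in>cube (Suc n) (u'' @ [v'']) d''. T y"
      using thick_column[OF ind T u'(1,2), of "v - d" "v + d"] all unfolding C_def by blast
    have "cube (Suc n) (u'' @ [v'']) d'' \<subseteq> cube (Suc n) x d"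
    proof
      fix w assume w: "w \<in> cube (Suc n) (u'' @ [v'']) d''"
      obtain y z where yz: "w = y @ [z]" "length y = n" by (rule cube_Suc_cases[OF w])
      then have "y \<in> cube n u'' d''" "\<bar>z - v''\<bar> < d''" using w cube_append[OF 1(1) yz(2)] by auto
      then have "y \<in> cube n u d" "\<bar>z - v\<bar> < d" using 1 u'(3) by (auto simp: abs_less_iff)
      then show "w \<in> cube (Suc n) x d" unfolding uv(1) yz(1) using cube_append[OF uv(2) yz(2)] by blast
    qed
    then show ?thesis using 1 by (intro exI[of _ "u'' @ [v'']"] exI[of _ d'']) auto
  qed
  obtain u' d' where u': "length u' = n" "0 < d'" "cube n u' d' \<subseteq> cube n u d"
    "(\<forall>y\<in>cube n u' d'. C P y) \<or> (\<forall>y\<in>cube n u' d'. \<not> C P y)"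
    using thickD[OF ind(1) Cd uv(2) d] by blast
  from u'(4) show "\<exists>x' d'. length x' = Suc n \<and> 0 < d' \<and> cube (Suc n) x' d' \<subseteq> cube (Suc n) x d \<and>
        ((\<forall>y\<in>cube (Suc n) x' d'. P y) \<or> (\<forall>y\<in>cube (Suc n) x' d'. \<not> P y))"
  proof
    assume "\<forall>y\<in>cube n u' d'. C P y"
    from step[OF P u'(1-3) this] show ?thesis by blast
  next
    assume "\<forall>y\<in>cube n u' d'. \<not> C P y"
    then have "\<forall>y\<in>cube n u' d'. C (\<lambda>w. \<not> P w) y" using PQ cube_length by blast
    from step[OF dfn_not[OF P] u'(1-3) this] show ?thesis by blast
  qed
qed

text \<open>On a suitable box f is monotone and continuous in the last variable over every base
  point, and continuous in the base variables at every height. Monotonicity then encloses f (y @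
  [z]) between its values at two fixed heights around the centre, where continuity in the base
  variables is enough.\<close>

lemma gencont_Suc:
  assumes ind: "thick n" "gencont n"
  shows "gencont (Suc n)"
  unfolding gencont_def
proof (intro allI impI)
  fix f :: "'a list \<Rightarrow> 'a" and x :: "'a list" and d :: 'a
  assume f: "st M (Suc n) f" and x: "length x = Suc n" and d: "0 < d"
  obtain u v where uv: "x = u @ [v]" "length u = n" using x by (metis length_Suc_conv_rev)
  define R where "R = (\<lambda>y l r. monoc (\<lambda>z. f (y @ [z])) l r)"
  have "dfn M (Suc (Suc n)) (\<lambda>zs. R (take n zs) (zs ! n) (zs ! Suc n))"
    unfolding R_def monoc_def cont1_def
    by (rule dfn_intros st_comp[OF _ f] vt_append vt_singleI st_nth vt_id vt_take refl | simp)+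
  moreover have "\<exists>l r. v - d < l \<and> l < r \<and> r < v + d \<and> R y l r" if y: "y \<in> cube n u d" for y
  proof -
    have "st M 1 (\<lambda>xs. f (y @ [xs ! 0]))"
      by (rule st_comp[OF _ f] vt_append vt_singleI vt_const cube_length[OF y] st_nth vt_id refl | simp)+
    moreover have "v - d / 2 < v + d / 2" using d by simp
    ultimately obtain l r where "v - d / 2 \<le> l" "l < r" "r \<le> v + d / 2" "R y l r"
      using monoc_subinterval[of "\<lambda>z. f (y @ [z])" "v - d / 2" "v + d / 2"] unfolding R_def by blast
    moreover have "v - d < v - d / 2" "v + d / 2 < v + d" using d by auto
    ultimately show ?thesis by (meson order_less_le_trans order_le_less_trans)
  qed
  moreover have "\<And>x l r l' r'. R x l r \<Longrightarrow> l \<le> l' \<Longrightarrow> l' < r' \<Longrightarrow> r' \<le> r \<Longrightarrow> R x l' r'"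
    unfolding R_def monoc_def by (meson order_le_less_trans order_less_le_trans)
  ultimately obtain u1 d1 c e where 1: "length u1 = n" "0 < d1" "cube n u1 d1 \<subseteq> cube n u d" "v - d < c" "c < e"
      "e < v + d" and Rce: "\<And>y. y \<in> cube n u1 d1 \<Longrightarrow> R y c e"
    using uniform_interval[of n R u d "v - d" "v + d"] ind uv(2) d by blast
  define v1 r where "v1 = (c + e) / 2" and "r = min d1 ((e - c) / 2)"
  have "2 * v1 = c + e" by (simp add: v1_def)
  moreover have "0 < r" "r \<le> d1" "2 * r \<le> e - c" using 1 by (auto simp: r_def min_def)
  ultimately have r: "0 < r" "r \<le> d1" "c \<le> v1 - r" "v1 + r \<le> e" by linarith+
  \<comment> \<open>Continuity in the first n variables with the last one held fixed.\<close>
  define Q where "Q = (\<lambda>w. cont_at n (\<lambda>y. f (y @ [w ! n])) (take n w))"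
  have "dfn M (Suc n) Q" unfolding Q_def
    by (rule dfn_cont_at[where g = "\<lambda>w y. f (y @ [w ! n])"])
      (rule st_comp[OF _ f] vt_append vt_singleI st_nth vt_id vt_take vt_drop refl | simp)+
  moreover have "length (u1 @ [v1]) = Suc n" using 1(1) by simp
  ultimately obtain x2 d2 where 2: "length x2 = Suc n" "0 < d2" "cube (Suc n) x2 d2 \<subseteq> cube (Suc n) (u1 @ [v1]) r"
    "(\<forall>w\<in>cube (Suc n) x2 d2. Q w) \<or> (\<forall>w\<in>cube (Suc n) x2 d2. \<not> Q w)"
    using thickD[OF thick_Suc[OF ind]] r(1) by blast
  obtain p q where pq: "x2 = p @ [q]" "length p = n" using 2(1) by (metis length_Suc_conv_rev)
  have mem: "y @ [z] \<in> cube (Suc n) x2 d2 \<longleftrightarrow> \<bar>z - q\<bar> < d2" if "y \<in> cube n p d2" for y z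
    using cube_append[OF pq(2) cube_length[OF that]] that unfolding pq(1) by blast
  have loc: "y \<in> cube n u1 d1 \<and> c < z \<and> z < e" if "y \<in> cube n p d2" "\<bar>z - q\<bar> < d2" for y z
  proof -
    have "y @ [z] \<in> cube (Suc n) (u1 @ [v1]) r" using mem[OF that(1)] that(2) 2(3) by blast
    then have "y \<in> cube n u1 r" "\<bar>z - v1\<bar> < r" using cube_append[OF 1(1) cube_length[OF that(1)]] by auto
    then show ?thesis using cube_mono[OF r(2)] r by (auto simp: abs_less_iff)
  qed
  have p: "p \<in> cube n p d2" using cube_center[OF pq(2) 2(2)] .
  \<comment> \<open>The alternative that Q fails on the whole subcube is refuted on the slice at
    height q, where \<open>gencont n\<close> gives a continuity point.\<close>
  have Q: "\<forall>w\<in>cube (Suc n) x2 d2. Q w"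
  proof -
    have g: "st M n (\<lambda>y. f (y @ [q]))"
      by (rule st_comp[OF _ f] vt_append vt_singleI st_const vt_id refl | simp)+
    obtain y where y: "y \<in> cube n p d2" "cont_at n (\<lambda>y. f (y @ [q])) y"
      using gencontD[OF ind(2) g pq(2) 2(2)] by blast
    have "Q (y @ [q])" using y(2) cube_length[OF y(1)] by (simp add: Q_def nth_append)
    moreover have "y @ [q] \<in> cube (Suc n) x2 d2" using mem[OF y(1)] 2(2) by simp
    ultimately show ?thesis using 2(4) by blast
  qed
  have Qp: "cont_at n (\<lambda>y. f (y @ [z])) p" if "\<bar>z - q\<bar> < d2" for z
    using Q mem[OF p, of z] that pq(2) by (auto simp: Q_def nth_append)
  have "cont_at (Suc n) f x2" unfolding cont_at_def
  proof (intro allI impI)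
    fix \<epsilon> :: 'a assume \<epsilon>: "0 < \<epsilon>"
    then have \<epsilon>2: "0 < \<epsilon> / 2" by simp
    have "R p c e" and q: "c < q" "q < e" using loc[OF p, of q] 2(2) Rce by auto
    then have "cont1 (\<lambda>z. f (p @ [z])) q" unfolding R_def monoc_def by blast
    then obtain \<delta> where \<delta>: "0 < \<delta>" "\<forall>z. \<bar>z - q\<bar> < \<delta> \<longrightarrow> \<bar>f (p @ [z]) - f (p @ [q])\<bar> < \<epsilon> / 2"
      using \<epsilon>2 unfolding cont1_def by blast
    \<comment> \<open>Half of the minimum, so that h is strictly below both radii.\<close>
    define h where "h = min \<delta> d2 / 2"
    have h: "0 < h" "h < \<delta>" "h < d2" using \<delta>(1) 2(2) by (auto simp: h_def min_def)
    define y1 y2 where "y1 = q - h" and "y2 = q + h"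
    have y12: "\<bar>y1 - q\<bar> < d2" "\<bar>y2 - q\<bar> < d2" "\<bar>y1 - q\<bar> < \<delta>" "\<bar>y2 - q\<bar> < \<delta>" using h by (auto simp: y1_def y2_def)
    obtain \<delta>1 where \<delta>1: "0 < \<delta>1" "\<forall>y. length y = n \<longrightarrow> y \<in> cube n p \<delta>1 \<longrightarrow> \<bar>f (y @ [y1]) - f (p @ [y1])\<bar> < \<epsilon> / 2"
      using Qp[OF y12(1)] \<epsilon>2 unfolding cont_at_def by blast
    obtain \<delta>2 where \<delta>2: "0 < \<delta>2" "\<forall>y. length y = n \<longrightarrow> y \<in> cube n p \<delta>2 \<longrightarrow> \<bar>f (y @ [y2]) - f (p @ [y2])\<bar> < \<epsilon> / 2"
      using Qp[OF y12(2)] \<epsilon>2 unfolding cont_at_def by blast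
    define \<eta> where "\<eta> = min h (min \<delta>1 \<delta>2)"
    have \<eta>: "0 < \<eta>" "\<eta> \<le> h" "\<eta> \<le> \<delta>1" "\<eta> \<le> \<delta>2" "\<eta> \<le> d2" using h \<delta>1(1) \<delta>2(1) by (auto simp: \<eta>_def)
    have "\<bar>f w - f x2\<bar> < \<epsilon>" if w: "w \<in> cube (Suc n) x2 \<eta>" for w
    proof -
      obtain y z where yz: "w = y @ [z]" "length y = n" by (rule cube_Suc_cases[OF w])
      then have y: "y \<in> cube n p \<eta>" and z: "\<bar>z - q\<bar> < \<eta>" using w cube_append[OF pq(2) yz(2)] pq(1) by auto
      have yd: "y \<in> cube n p d2" "y \<in> cube n p \<delta>1" "y \<in> cube n p \<delta>2"
        using y \<eta> cube_mono by blast+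
      have ord: "c < y1" "y1 \<le> z" "z \<le> y2" "y2 < e"
        using loc[OF p y12(1)] loc[OF p y12(2)] z \<eta>(2) by (auto simp: y1_def y2_def abs_less_iff)
      have "R y c e" using Rce loc[OF yd(1), of q] 2(2) by auto
      \<comment> \<open>The direction of monotonicity may depend on y; in either direction the value
        at z lies between the values at y1 and y2.\<close>
      then have "f (y @ [y1]) \<le> f (y @ [z]) \<and> f (y @ [z]) \<le> f (y @ [y2]) \<or> f (y @ [y2]) \<le> f (y @ [z]) \<and> f (y @ [z]) \<le> f (y @ [y1])"
        using ord unfolding R_def monoc_def by (meson order_le_less_trans order_less_le_trans)
      moreover have "\<bar>f (y @ [y1]) - f (p @ [y1])\<bar> < \<epsilon> / 2" "\<bar>f (y @ [y2]) - f (p @ [y2])\<bar> < \<epsilon> / 2"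
        using \<delta>1(2) \<delta>2(2) yd yz(2) by auto
      moreover have "\<bar>f (p @ [y1]) - f (p @ [q])\<bar> < \<epsilon> / 2" "\<bar>f (p @ [y2]) - f (p @ [q])\<bar> < \<epsilon> / 2"
        using \<delta>(2) y12 by auto
      ultimately show ?thesis unfolding yz(1) pq(1) abs_less_iff by linarith
    qed
    then show "\<exists>\<delta>. 0 < \<delta> \<and> (\<forall>y. length y = Suc n \<longrightarrow> y \<in> cube (Suc n) x2 \<delta> \<longrightarrow> \<bar>f y - f x2\<bar> < \<epsilon>)"
      using \<eta>(1) by blast
  qed
  moreover have "x2 \<in> cube (Suc n) x d"
  proof -
    have "p \<in> cube n u d" "\<bar>q - v\<bar> < d" using loc[OF p, of q] 1 2(2) by (auto simp: abs_less_iff)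
    then show ?thesis unfolding pq(1) uv(1) using cube_append[OF uv(2) pq(2)] by blast
  qed
  ultimately show "\<exists>y\<in>cube (Suc n) x d. cont_at (Suc n) f y" by blast
qed

lemma thick_gencont: "thick n \<and> gencont n"
proof (induction n)
  case 0
  have c: "cube 0 x d = {[]}" for x :: "'a list" and d by (auto simp: cube_def)
  have "thick 0" unfolding thick_def c by (auto intro: exI[of _ "[]"] exI[of _ 1])
  moreover have "gencont 0" unfolding gencont_def c cont_at_def by (auto intro: exI[of _ 1])
  ultimately show ?case ..
qed (simp add: thick_Suc gencont_Suc)

text \<open>Each further function costs one more passage to a subcube, and continuity of the earlier
  ones is inherited.\<close>

lemma continuous_on_subcube:
  fixes k :: nat
  assumes "\<And>i. i < k \<Longrightarrow> st M n (f i)" "length x = n" "0 < d"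
  shows "\<exists>x' d'. length x' = n \<and> 0 < d' \<and> cube n x' d' \<subseteq> cube n x d \<and> (\<forall>y\<in>cube n x' d'. \<forall>i<k. cont_at n (f i) y)"
  using assms(1)
proof (induction k)
  case 0 then show ?case using assms(2,3) by blast
next
  case (Suc k)
  then obtain x' d' where 1: "length x' = n" "0 < d'" "cube n x' d' \<subseteq> cube n x d"
    "\<forall>y\<in>cube n x' d'. \<forall>i<k. cont_at n (f i) y" by auto
  have "st M n (f k)" using Suc.prems by simp
  from gencont_cube[OF conjunct1[OF thick_gencont] conjunct2[OF thick_gencont] this 1(1,2)]
  obtain x2 d2 where 2: "length x2 = n" "0 < d2" "cube n x2 d2 \<subseteq> cube n x' d'" "\<forall>y\<in>cube n x2 d2. cont_at n (f k) y"
    by blast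
  then have "\<forall>y\<in>cube n x2 d2. \<forall>i<Suc k. cont_at n (f i) y" using 1(4) by (auto simp: less_Suc_eq)
  then show ?case using 1(3) 2 by blast
qed

end

section \<open>Definable maps\<close>

lemma definable_Int: "definable M n X \<Longrightarrow> definable M n Y \<Longrightarrow> definable M n (X \<inter> Y)"
  by (auto simp: definable_iff_dfn intro: dfn_conj)

lemma definable_Un: "definable M n X \<Longrightarrow> definable M n Y \<Longrightarrow> definable M n (X \<union> Y)"
  by (auto simp: definable_iff_dfn intro: dfn_disj)

lemma definable_Diff: "definable M n X \<Longrightarrow> definable M n Y \<Longrightarrow> definable M n (X - Y)"
  by (auto simp: definable_iff_dfn intro: dfn_conj dfn_not)

lemma definable_empty: "definable M n {}"
  by (simp add: definable_iff_dfn dfn_const)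

lemma definable_Collect: "dfn M n P \<Longrightarrow> definable M n {xs. length xs = n \<and> P xs}"
  by (simp add: dfn_def)

lemma definable_Times:
  assumes "definable M m X" "definable M n Y"
  shows "definable M (m + n) {x @ y | x y. x \<in> X \<and> y \<in> Y}"
proof -
  have "dfn M (m + n) (\<lambda>zs. take m zs \<in> X \<and> drop m zs \<in> Y)"
    by (rule dfn_conj dfn_mem[OF _ assms(1)] dfn_mem[OF _ assms(2)] vt_take vt_drop vt_id refl | simp)+
  then have "definable M (m + n) {zs. length zs = m + n \<and> take m zs \<in> X \<and> drop m zs \<in> Y}"
    by (rule definable_Collect)
  also have "{zs. length zs = m + n \<and> take m zs \<in> X \<and> drop m zs \<in> Y} = {x @ y | x y. x \<in> X \<and> y \<in> Y}"
  proof (intro equalityI subsetI)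
    fix zs assume "zs \<in> {zs. length zs = m + n \<and> take m zs \<in> X \<and> drop m zs \<in> Y}"
    then show "zs \<in> {x @ y | x y. x \<in> X \<and> y \<in> Y}"
      by (intro CollectI exI[of _ "take m zs"] exI[of _ "drop m zs"]) auto
  next
    fix zs assume "zs \<in> {x @ y | x y. x \<in> X \<and> y \<in> Y}"
    then show "zs \<in> {zs. length zs = m + n \<and> take m zs \<in> X \<and> drop m zs \<in> Y}"
      using definable_length[OF assms(1)] definable_length[OF assms(2)] by auto
  qed
  finally show ?thesis .
qed

text \<open>A partial map counts as definable when a total definable map extends it from its domain.
  This lets the calculus of \<open>vt\<close> be reused without tracking domains.\<close>

definition dmap :: "('a::linordered_field, 'f, 'r) expansion \<Rightarrow> nat \<Rightarrow> nat \<Rightarrow> 'a list set \<Rightarrow> ('a list \<Rightarrow> 'a list) \<Rightarrow> bool" where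
  "dmap M m k X f \<longleftrightarrow> definable M m X \<and> (\<exists>g. vt M m k g \<and> (\<forall>x\<in>X. g x = f x))"

lemma dmap_vt: "vt M m k g \<Longrightarrow> definable M m X \<Longrightarrow> dmap M m k X g"
  unfolding dmap_def by blast

lemma dmap_cong: "(\<And>x. x \<in> X \<Longrightarrow> f x = g x) \<Longrightarrow> dmap M m k X f = dmap M m k X g"
  unfolding dmap_def by auto

lemma dmap_length:
  assumes "dmap M m k X f" "x \<in> X" shows "length (f x) = k"
proof -
  obtain g where "vt M m k g" "\<forall>x\<in>X. g x = f x" "definable M m X" using assms unfolding dmap_def by blast
  then show ?thesis using assms(2) vt_length[of M m k g x] definable_length[of M m X x] by auto
qed

lemma dmap_comp:
  assumes "dmap M m k X f" "dmap M k l Y h" "\<And>x. x \<in> X \<Longrightarrow> f x \<in> Y"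
  shows "dmap M m l X (\<lambda>x. h (f x))"
proof -
  obtain g where g: "vt M m k g" "\<forall>x\<in>X. g x = f x" "definable M m X" using assms(1) unfolding dmap_def by blast
  obtain j where j: "vt M k l j" "\<forall>y\<in>Y. j y = h y" using assms(2) unfolding dmap_def by blast
  show ?thesis unfolding dmap_def
    using vt_comp[OF g(1) j(1)] g(2,3) j(2) assms(3) by (intro conjI exI[of _ "\<lambda>x. j (g x)"]) auto
qed

lemma dmap_append:
  assumes "dmap M m k X f" "dmap M m l X h"
  shows "dmap M m (k + l) X (\<lambda>x. f x @ h x)"
proof -
  obtain g where g: "vt M m k g" "\<forall>x\<in>X. g x = f x" "definable M m X" using assms(1) unfolding dmap_def by blast
  obtain j where j: "vt M m l j" "\<forall>y\<in>X. j y = h y" using assms(2) unfolding dmap_def by blast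
  show ?thesis unfolding dmap_def
    using vt_append[OF g(1) j(1) refl] g(2,3) j(2) by (intro conjI exI[of _ "\<lambda>x. g x @ j x"]) auto
qed

lemma dmap_if:
  assumes "dmap M m k X f" "dmap M m k X h" "dfn M m P"
  shows "dmap M m k X (\<lambda>x. if P x then f x else h x)"
proof -
  obtain g where g: "vt M m k g" "\<forall>x\<in>X. g x = f x" "definable M m X" using assms(1) unfolding dmap_def by blast
  obtain j where j: "vt M m k j" "\<forall>y\<in>X. j y = h y" using assms(2) unfolding dmap_def by blast
  have "vt M m k (\<lambda>x. if P x then g x else j x)" unfolding vt_def
  proof (intro conjI allI impI)
    have "dfn M (m + k) (\<lambda>zs. (P (take m zs) \<longrightarrow> drop m zs = g (take m zs)) \<and> (\<not> P (take m zs) \<longrightarrow> drop m zs = j (take m zs)))"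
      by (rule dfn_conj dfn_imp dfn_not dfn_take assms dfn_list_eq[where k = k] vt_comp[OF _ g(1)] vt_comp[OF _ j(1)]
          vt_id vt_take vt_drop refl | simp)+
    then show "dfn M (m + k) (\<lambda>zs. drop m zs = (if P (take m zs) then g (take m zs) else j (take m zs)))"
      by (rule iffD1[OF dfn_cong, rotated]) simp
  qed (use vt_length[OF g(1)] vt_length[OF j(1)] in simp)
  then show ?thesis unfolding dmap_def using g j by (intro conjI exI[of _ "\<lambda>x. if P x then g x else j x"]) auto
qed

lemma dmap_subset: "dmap M m k X f \<Longrightarrow> Y \<subseteq> X \<Longrightarrow> definable M m Y \<Longrightarrow> dmap M m k Y f"
  unfolding dmap_def by blast

lemma dmap_preimage:
  assumes "dmap M m k X f" "definable M k E"
  shows "definable M m {x \<in> X. f x \<in> E}"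
proof -
  obtain g where g: "vt M m k g" "\<forall>x\<in>X. g x = f x" "definable M m X" using assms(1) unfolding dmap_def by blast
  have "dfn M m (\<lambda>x. x \<in> X \<and> g x \<in> E)"
    by (rule dfn_conj dfn_mem[OF vt_id g(3)] dfn_mem[OF g(1) assms(2)])+
  from definable_Collect[OF this] have "definable M m {x. length x = m \<and> x \<in> X \<and> g x \<in> E}" .
  moreover have "length x = m \<and> x \<in> X \<and> g x \<in> E \<longleftrightarrow> x \<in> X \<and> f x \<in> E" for x
  proof (cases "x \<in> X")
    case True
    then have "g x = f x" "length x = m" using g(2) definable_length[OF g(3)] by blast+
    then show ?thesis by simp
  qed simp
  ultimately show ?thesis by simp
qed

lemma dmap_image:
  assumes "dmap M m k X f" "D \<subseteq> X" "definable M m D"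
  shows "definable M k (f ` D)"
proof -
  obtain g where g: "vt M m k g" "\<forall>x\<in>X. g x = f x" using assms(1) unfolding dmap_def by blast
  have "dfn M k (\<lambda>y. \<exists>x. length x = m \<and> x \<in> D \<and> y = g x)"
    by (rule dfn_conj dfn_exs dfn_mem[OF _ assms(3)] dfn_list_eq[where k = k] vt_comp[OF _ g(1)]
        vt_id vt_take vt_drop refl | simp)+
  from definable_Collect[OF this] have "definable M k {y. length y = k \<and> (\<exists>x. length x = m \<and> x \<in> D \<and> y = g x)}" .
  moreover have "{y. length y = k \<and> (\<exists>x. length x = m \<and> x \<in> D \<and> y = g x)} = f ` D"
  proof -
    have *: "length x = m \<and> f x = g x \<and> length (g x) = k" if "x \<in> D" for x
    proof -
      have "length x = m" using definable_length[OF assms(3) that] .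
      moreover have "f x = g x" using g(2) assms(2) that by auto
      ultimately show ?thesis using vt_length[OF g(1)] by simp
    qed
    show ?thesis
    proof (intro equalityI subsetI)
      fix y assume "y \<in> {y. length y = k \<and> (\<exists>x. length x = m \<and> x \<in> D \<and> y = g x)}"
      then obtain x where "x \<in> D" "y = g x" by blast
      then show "y \<in> f ` D" using * by (metis imageI)
    next
      fix y assume "y \<in> f ` D"
      then obtain x where "x \<in> D" "y = f x" by blast
      then show "y \<in> {y. length y = k \<and> (\<exists>x. length x = m \<and> x \<in> D \<and> y = g x)}" using * by auto
    qed
  qed
  ultimately show ?thesis by simp
qed

lemma dmap_graph: "dmap M m k X f \<Longrightarrow> definable M (m + k) {x @ f x | x. x \<in> X}"
proof -
  assume f: "dmap M m k X f"
  then have X: "definable M m X" by (simp add: dmap_def)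
  have "dmap M m (m + k) X (\<lambda>x. x @ f x)" by (rule dmap_append dmap_vt vt_id f X)+
  from dmap_image[OF this subset_refl X] show ?thesis by (simp add: image_def Setcompr_eq_image)
qed

text \<open>\<open>definable_map\<close> knows the graph only as a definable set of unspecified
  dimension. A point of X fixes that dimension as m + k; without such a point the graph is empty and
  carries no information, hence the case split.\<close>

lemma definable_map_iff:
  assumes X: "definable M m X" and Y: "definable M k Y"
  shows "definable_map M X Y f \<longleftrightarrow> f \<in> X \<rightarrow> Y \<and> dmap M m k X f"
proof (intro iffI conjI)
  assume f: "definable_map M X Y f"
  show XY: "f \<in> X \<rightarrow> Y" using f by (simp add: definable_map_def)
  show "dmap M m k X f"
  proof (cases "X = {}")
    case True
    then show ?thesis unfolding dmap_def using X by (auto intro!: exI[of _ "\<lambda>_. replicate k 0"] vt_const)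
  next
    case False
    then obtain x where x: "x \<in> X" by blast
    obtain N where N: "definable M N {x @ f x | x. x \<in> X}" using f by (auto simp: definable_map_def definable_set_def)
    have len: "length x = m" "length (f x) = k" if "x \<in> X" for x
      using definable_length[OF X] definable_length[OF Y] XY that by auto
    have "N = m + k" using definable_length[OF N, of "x @ f x"] x len by auto
    with N have G: "definable M (m + k) {x @ f x | x. x \<in> X}" by simp
    \<comment> \<open>Extension by zeros off X, to obtain a total map.\<close>
    define g where "g = (\<lambda>x. if x \<in> X then f x else replicate k 0)"
    have "dfn M (m + k) (\<lambda>zs. zs \<in> {x @ f x | x. x \<in> X} \<or> take m zs \<notin> X \<and> drop m zs = replicate k 0)"
      by (rule dfn_conj dfn_disj dfn_not dfn_mem[OF _ G] dfn_mem[OF _ X] dfn_list_eq[where k = k] vt_id vt_const vt_take vt_drop refl | simp)+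
    moreover have "zs \<in> {x @ f x | x. x \<in> X} \<or> take m zs \<notin> X \<and> drop m zs = replicate k 0 \<longleftrightarrow> drop m zs = g (take m zs)"
      if "length zs = m + k" for zs
    proof -
      have "zs \<in> {x @ f x | x. x \<in> X} \<longleftrightarrow> take m zs \<in> X \<and> drop m zs = f (take m zs)"
      proof
        assume "zs \<in> {x @ f x | x. x \<in> X}"
        then show "take m zs \<in> X \<and> drop m zs = f (take m zs)" using len by auto
      next
        assume "take m zs \<in> X \<and> drop m zs = f (take m zs)"
        then show "zs \<in> {x @ f x | x. x \<in> X}"
          by (intro CollectI exI[of _ "take m zs"]) (metis append_take_drop_id)
      qed
      then show ?thesis by (simp add: g_def)
    qed
    ultimately have "dfn M (m + k) (\<lambda>zs. drop m zs = g (take m zs))"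
      by (rule iffD1[OF dfn_cong, rotated])
    then have "vt M m k g" unfolding vt_def using len by (simp add: g_def)
    then show ?thesis unfolding dmap_def using X by (auto simp: g_def)
  qed
next
  assume "f \<in> X \<rightarrow> Y \<and> dmap M m k X f"
  then show "definable_map M X Y f"
    unfolding definable_map_def definable_set_def using X Y dmap_graph by blast
qed

section \<open>The box topology and definable continuous maps on cubes\<close>

text \<open>Inside an open box, a point keeps a positive distance from each of the finitely many
  faces, so the cubes around it form a neighbourhood base.\<close>

lemma openin_box_topology:
  "openin (box_topology n) U \<longleftrightarrow> (\<forall>x\<in>U. length x = n \<and> (\<exists>d>0. cube n x d \<subseteq> U))"
proof
  define B where "B = range (\<lambda>(a, b). {xs :: 'a list. length xs = n \<and> (\<forall>i<n. a i < xs ! i \<and> xs ! i < b i)})"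
  assume "openin (box_topology n) U"
  then have "generate_topology_on B U"
    unfolding box_topology_def B_def openin_topology_generated_by_iff .
  then show "\<forall>x\<in>U. length x = n \<and> (\<exists>d>0. cube n x d \<subseteq> U)"
  proof induction
    case Empty then show ?case by simp
  next
    case (Int a b)
    show ?case
    proof
      fix x assume x: "x \<in> a \<inter> b"
      then obtain d e where "d > 0" "cube n x d \<subseteq> a" "e > 0" "cube n x e \<subseteq> b" using Int by blast
      then have "min d e > 0 \<and> cube n x (min d e) \<subseteq> a \<inter> b"
        using cube_mono[of "min d e" d n x] cube_mono[of "min d e" e n x] by auto
      then show "length x = n \<and> (\<exists>d>0. cube n x d \<subseteq> a \<inter> b)" using Int x by blast
    qed
  next
    case (UN K) then show ?case by (meson Union_iff Union_upper order_trans)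
  next
    case (Basis s)
    then obtain a b where s: "s = {xs. length xs = n \<and> (\<forall>i<n. a i < xs ! i \<and> xs ! i < b i)}"
      by (auto simp: B_def)
    show ?case
    proof
      fix x assume x: "x \<in> s"
      have "\<exists>d>0. \<forall>i<k. a i \<le> x ! i - d \<and> x ! i + d \<le> b i" if "k \<le> n" for k
        using that
      proof (induction k)
        case 0 then show ?case by (auto intro: exI[of _ 1])
      next
        case (Suc k)
        then obtain d where d: "d > 0" "\<forall>i<k. a i \<le> x ! i - d \<and> x ! i + d \<le> b i" by auto
        define e where "e = min d (min (x ! k - a k) (b k - x ! k))"
        have "k < n" using Suc.prems by simp
        then have "e > 0" "e \<le> d" "a k \<le> x ! k - e" "x ! k + e \<le> b k" using d(1) x by (auto simp: e_def s min_def)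
        moreover have "a i \<le> x ! i - e" "x ! i + e \<le> b i" if "i < k" for i
          using d(2)[rule_format, OF that] \<open>e \<le> d\<close> by linarith+
        ultimately show ?case by (intro exI[of _ e]) (auto simp: less_Suc_eq)
      qed
      then obtain d where d: "d > 0" "\<forall>i<n. a i \<le> x ! i - d \<and> x ! i + d \<le> b i" by blast
      have "cube n x d \<subseteq> s"
      proof
        fix y assume y: "y \<in> cube n x d"
        have "a i < y ! i \<and> y ! i < b i" if "i < n" for i
        proof -
          have "\<bar>y ! i - x ! i\<bar> < d" using y that by (simp add: cube_def)
          then show ?thesis using d(2)[rule_format, OF that] by (auto simp: abs_less_iff)
        qed
        then show "y \<in> s" using y by (simp add: s cube_def)
      qed
      then show "length x = n \<and> (\<exists>d>0. cube n x d \<subseteq> s)" using d(1) x s by auto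
    qed
  qed
next
  assume U: "\<forall>x\<in>U. length x = n \<and> (\<exists>d>0. cube n x d \<subseteq> U)"
  have cube: "openin (box_topology n) (cube n x d)" for x :: "'a list" and d
    unfolding box_topology_def
  proof (rule topology_generated_by_Basis)
    have "cube n x d = (\<lambda>(a, b). {xs. length xs = n \<and> (\<forall>i<n. a i < xs ! i \<and> xs ! i < b i)}) (\<lambda>i. x ! i - d, \<lambda>i. x ! i + d)"
      by (auto simp: cube_def abs_less_iff algebra_simps)
    then show "cube n x d \<in> range (\<lambda>(a, b). {xs. length xs = n \<and> (\<forall>i<n. a i < xs ! i \<and> xs ! i < b i)})" by blast
  qed
  have "\<forall>x\<in>U. \<exists>T. openin (box_topology n) T \<and> x \<in> T \<and> T \<subseteq> U"
  proof
    fix x assume "x \<in> U"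
    then obtain d where "length x = n" "d > 0" "cube n x d \<subseteq> U" using U by blast
    then show "\<exists>T. openin (box_topology n) T \<and> x \<in> T \<and> T \<subseteq> U"
      using cube[of x d] cube_center[of x n d] by (intro exI[of _ "cube n x d"] conjI)
  qed
  then show "openin (box_topology n) U" by (subst openin_subopen)
qed

lemma openin_cube: "0 < d \<Longrightarrow> openin (box_topology n) (cube n x d)"
  unfolding openin_box_topology using cube_length cube_subcube by blast

lemma topspace_box_topology [simp]: "topspace (box_topology n) = {xs. length xs = n}"
proof -
  have "openin (box_topology n) {xs :: 'a list. length xs = n}"
    unfolding openin_box_topology by (auto simp: cube_def intro!: exI[of _ 1])
  moreover have "topspace (box_topology n) \<subseteq> {xs :: 'a list. length xs = n}"
    using openin_topspace[of "box_topology n"] unfolding openin_box_topology by blast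
  ultimately show ?thesis by (intro subset_antisym openin_subset)
qed

section \<open>Pointwise continuity and the box topology\<close>

lemma cont_at_const: "cont_at n (\<lambda>x. c) x"
  by (auto simp: cont_at_def intro: exI[of _ 1])

lemma cont_at_nth: "i < n \<Longrightarrow> cont_at n (\<lambda>x. x ! i) x"
  by (auto simp: cont_at_def cube_def)

lemma cont_at_uminus: "cont_at n f x \<Longrightarrow> cont_at n (\<lambda>x. - f x) x"
  by (simp add: cont_at_def abs_minus_commute)

lemma cont_at2:
  assumes "cont_at n f x" "cont_at n g x" "0 < \<epsilon>"
  shows "\<exists>\<delta>>0. \<forall>y. length y = n \<longrightarrow> y \<in> cube n x \<delta> \<longrightarrow> \<bar>f y - f x\<bar> < \<epsilon> \<and> \<bar>g y - g x\<bar> < \<epsilon>"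
proof -
  obtain d e where d: "0 < d" "\<forall>y. length y = n \<longrightarrow> y \<in> cube n x d \<longrightarrow> \<bar>f y - f x\<bar> < \<epsilon>"
    and e: "0 < e" "\<forall>y. length y = n \<longrightarrow> y \<in> cube n x e \<longrightarrow> \<bar>g y - g x\<bar> < \<epsilon>"
    using assms(1)[unfolded cont_at_def, THEN spec, THEN mp, OF assms(3)]
      assms(2)[unfolded cont_at_def, THEN spec, THEN mp, OF assms(3)] by blast
  have "cube n x (min d e) \<subseteq> cube n x d" "cube n x (min d e) \<subseteq> cube n x e" by (rule cube_mono, simp)+
  then show ?thesis using d e by (intro exI[of _ "min d e"]) (simp add: subset_iff)
qed

lemma cont_at_add:
  assumes "cont_at n f x" "cont_at n g x"
  shows "cont_at n (\<lambda>x. f x + g x) x"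
  unfolding cont_at_def
proof (intro allI impI)
  fix \<epsilon> :: 'a assume "0 < \<epsilon>"
  then have "0 < \<epsilon> / 2" by simp
  from cont_at2[OF assms this] obtain \<delta> where \<delta>: "\<delta> > 0"
    "\<forall>y. length y = n \<longrightarrow> y \<in> cube n x \<delta> \<longrightarrow> \<bar>f y - f x\<bar> < \<epsilon> / 2 \<and> \<bar>g y - g x\<bar> < \<epsilon> / 2" by blast
  have "\<bar>f y + g y - (f x + g x)\<bar> < \<epsilon>" if "length y = n" "y \<in> cube n x \<delta>" for y
  proof -
    have "\<bar>f y - f x\<bar> < \<epsilon> / 2" "\<bar>g y - g x\<bar> < \<epsilon> / 2" using \<delta>(2) that by blast+
    then show ?thesis unfolding abs_less_iff by linarith
  qed
  then show "\<exists>\<delta>. 0 < \<delta> \<and> (\<forall>y. length y = n \<longrightarrow> y \<in> cube n x \<delta> \<longrightarrow> \<bar>f y + g y - (f x + g x)\<bar> < \<epsilon>)"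
    using \<delta>(1) by blast
qed

lemma cont_at_diff: "cont_at n f x \<Longrightarrow> cont_at n g x \<Longrightarrow> cont_at n (\<lambda>x. f x - g x) x"
  using cont_at_add[OF _ cont_at_uminus, of n f x g] by simp

lemma cont_at_max:
  assumes "cont_at n f x" "cont_at n g x"
  shows "cont_at n (\<lambda>x. max (f x) (g x)) x"
  unfolding cont_at_def
proof (intro allI impI)
  fix \<epsilon> :: 'a assume "0 < \<epsilon>"
  from cont_at2[OF assms this] obtain \<delta> where \<delta>: "\<delta> > 0"
    "\<forall>y. length y = n \<longrightarrow> y \<in> cube n x \<delta> \<longrightarrow> \<bar>f y - f x\<bar> < \<epsilon> \<and> \<bar>g y - g x\<bar> < \<epsilon>" by blast
  have "\<bar>max (f y) (g y) - max (f x) (g x)\<bar> < \<epsilon>" if "length y = n" "y \<in> cube n x \<delta>" for y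
  proof -
    have "\<bar>f y - f x\<bar> < \<epsilon>" "\<bar>g y - g x\<bar> < \<epsilon>" using \<delta>(2) that by blast+
    then show ?thesis
      by (cases "f x \<le> g x"; cases "f y \<le> g y"; simp add: max_def abs_less_iff; linarith)
  qed
  then show "\<exists>\<delta>. 0 < \<delta> \<and> (\<forall>y. length y = n \<longrightarrow> y \<in> cube n x \<delta> \<longrightarrow> \<bar>max (f y) (g y) - max (f x) (g x)\<bar> < \<epsilon>)"
    using \<delta>(1) by blast
qed

lemma cont_at_min:
  assumes "cont_at n f x" "cont_at n g x"
  shows "cont_at n (\<lambda>x. min (f x) (g x)) x"
  using cont_at_uminus[OF cont_at_max[OF cont_at_uminus[OF assms(1)] cont_at_uminus[OF assms(2)]]]
  by (simp add: minus_max_eq_min)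

lemma cont_at_uniform:
  fixes k :: nat
  assumes "\<And>i. i < k \<Longrightarrow> cont_at n (\<lambda>x. f x ! i) x" "0 < \<epsilon>"
  shows "\<exists>\<delta>>0. \<forall>y\<in>cube n x \<delta>. \<forall>i<k. \<bar>f y ! i - f x ! i\<bar> < \<epsilon>"
  using assms(1)
proof (induction k)
  case 0 then show ?case by (auto intro: exI[of _ 1])
next
  case (Suc k)
  then obtain \<delta> where d: "\<delta> > 0" "\<forall>y\<in>cube n x \<delta>. \<forall>i<k. \<bar>f y ! i - f x ! i\<bar> < \<epsilon>" by auto
  have "cont_at n (\<lambda>x. f x ! k) x" using Suc.prems by simp
  then obtain e where e: "e > 0" "\<forall>y. length y = n \<longrightarrow> y \<in> cube n x e \<longrightarrow> \<bar>f y ! k - f x ! k\<bar> < \<epsilon>"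
    using assms(2) unfolding cont_at_def by blast
  have "cube n x (min \<delta> e) \<subseteq> cube n x \<delta>" "cube n x (min \<delta> e) \<subseteq> cube n x e" by (rule cube_mono, simp)+
  then have "\<forall>y\<in>cube n x (min \<delta> e). length y = n \<and> y \<in> cube n x e \<and> y \<in> cube n x \<delta>"
    using cube_length by blast
  then have "\<forall>y\<in>cube n x (min \<delta> e). \<forall>i<Suc k. \<bar>f y ! i - f x ! i\<bar> < \<epsilon>"
    using d(2) e(2) by (simp add: less_Suc_eq)
  then show ?case using d(1) e(1) by (intro exI[of _ "min \<delta> e"]) auto
qed

lemma continuous_map_box:
  assumes len: "\<And>x. length x = n \<Longrightarrow> length (f x) = k"
    and cont: "\<And>x i. length x = n \<Longrightarrow> i < k \<Longrightarrow> cont_at n (\<lambda>x. f x ! i) x"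
  shows "continuous_map (box_topology n) (box_topology k) f"
  unfolding continuous_map_def
proof (intro conjI allI impI)
  show "f \<in> topspace (box_topology n) \<rightarrow> topspace (box_topology k)" using len by auto
  fix U :: "'a list set" assume U: "openin (box_topology k) U"
  show "openin (box_topology n) {x \<in> topspace (box_topology n). f x \<in> U}"
    unfolding openin_box_topology
  proof (intro ballI conjI)
    fix x assume x: "x \<in> {x \<in> topspace (box_topology n). f x \<in> U}"
    then show lx: "length x = n" by simp
    obtain e where e: "e > 0" "cube k (f x) e \<subseteq> U" using U x unfolding openin_box_topology by blast
    obtain d where d: "d > 0" "\<forall>y\<in>cube n x d. \<forall>i<k. \<bar>f y ! i - f x ! i\<bar> < e"
      using cont_at_uniform[of k n f x e] cont[OF lx] e(1) by blast
    then have "f y \<in> cube k (f x) e" if "y \<in> cube n x d" for y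
      using len[OF cube_length[OF that]] that by (simp add: cube_def)
    then show "\<exists>d>0. cube n x d \<subseteq> {x \<in> topspace (box_topology n). f x \<in> U}"
      using d(1) e(2) cube_length by (intro exI[of _ d]) auto
  qed
qed

text \<open>A nonempty set determines its dimension, and the empty set is definable in every
  dimension.\<close>

lemma definable_set_subset:
  assumes "definable_set M X" "\<And>x. x \<in> X \<Longrightarrow> length x = m"
  shows "definable M m X"
proof (cases "X = {}")
  case True then show ?thesis by (simp add: definable_empty)
next
  case False
  then obtain x where x: "x \<in> X" by blast
  obtain n where n: "definable M n X" using assms(1) by (auto simp: definable_set_def)
  then have "n = m" using definable_length[OF n x] assms(2)[OF x] by simp
  then show ?thesis using n by simp
qed

lemma unit_cube_alt: "unit_cube n = {xs. length xs = n \<and> (\<forall>i<n. 0 \<le> xs ! i \<and> xs ! i \<le> 1)}"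
  by (auto simp: unit_cube_def all_set_conv_all_nth)

lemma definable_unit_cube: "definable M n (unit_cube n)"
  unfolding unit_cube_alt
  by (rule definable_Collect) (rule dfn_bounded_all dfn_conj dfn_le st_const st_nth vt_id | assumption)+

lemma closedin_box_le: "i < n \<Longrightarrow> closedin (box_topology n) {xs :: 'a::linordered_field list. length xs = n \<and> xs ! i \<le> c}"
  and closedin_box_ge: "i < n \<Longrightarrow> closedin (box_topology n) {xs :: 'a::linordered_field list. length xs = n \<and> c \<le> xs ! i}"
proof -
  assume i: "i < n"
  have *: "\<exists>d>0. cube n x d \<subseteq> {xs :: 'a list. length xs = n \<and> c < xs ! i}" if "c < x ! i" for x
    using that i by (intro exI[of _ "x ! i - c"]) (auto simp: cube_def abs_less_iff)
  have **: "\<exists>d>0. cube n x d \<subseteq> {xs :: 'a list. length xs = n \<and> xs ! i < c}" if "x ! i < c" for x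
    using that i by (intro exI[of _ "c - x ! i"]) (auto simp: cube_def abs_less_iff)
  have "openin (box_topology n) {xs :: 'a list. length xs = n \<and> c < xs ! i}"
    unfolding openin_box_topology using * by simp
  moreover have "topspace (box_topology n) - {xs :: 'a list. length xs = n \<and> xs ! i \<le> c} = {xs. length xs = n \<and> c < xs ! i}"
    by auto
  ultimately show "closedin (box_topology n) {xs :: 'a list. length xs = n \<and> xs ! i \<le> c}"
    unfolding closedin_def by auto
  have "openin (box_topology n) {xs :: 'a list. length xs = n \<and> xs ! i < c}"
    unfolding openin_box_topology using ** by simp
  moreover have "topspace (box_topology n) - {xs :: 'a list. length xs = n \<and> c \<le> xs ! i} = {xs. length xs = n \<and> xs ! i < c}"
    by auto
  ultimately show "closedin (box_topology n) {xs :: 'a list. length xs = n \<and> c \<le> xs ! i}"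
    unfolding closedin_def by auto
qed

text \<open>Gluing along the two closed halves on which the coordinate is at most c and at least
  c.\<close>

lemma continuous_map_box_paste:
  fixes f g :: "'a::linordered_field list \<Rightarrow> 'b"
  assumes f: "continuous_map (subtopology (box_topology n) S) Y f"
    and g: "continuous_map (subtopology (box_topology n) S) Y g"
    and i: "i < n" and eq: "\<And>x. x \<in> S \<Longrightarrow> length x = n \<Longrightarrow> x ! i = c \<Longrightarrow> f x = g x"
  shows "continuous_map (subtopology (box_topology n) S) Y (\<lambda>x. if x ! i \<le> c then f x else g x)"
  unfolding continuous_map_closedin
proof (intro conjI allI impI)
  let ?X = "subtopology (box_topology n) S"
  show "(\<lambda>x. if x ! i \<le> c then f x else g x) \<in> topspace ?X \<rightarrow> topspace Y"
    using f g unfolding continuous_map_def by auto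
  fix C assume C: "closedin Y C"
  have 1: "closedin ?X {x \<in> topspace ?X. f x \<in> C}" "closedin ?X {x \<in> topspace ?X. g x \<in> C}"
    using f g C unfolding continuous_map_closedin by auto
  have 2: "closedin ?X (S \<inter> {xs. length xs = n \<and> xs ! i \<le> c})" "closedin ?X (S \<inter> {xs. length xs = n \<and> c \<le> xs ! i})"
    by (rule closedin_subtopology_Int_closed closedin_box_le closedin_box_ge i)+
  have "closedin ?X ({x \<in> topspace ?X. f x \<in> C} \<inter> (S \<inter> {xs. length xs = n \<and> xs ! i \<le> c}) \<union>
      {x \<in> topspace ?X. g x \<in> C} \<inter> (S \<inter> {xs. length xs = n \<and> c \<le> xs ! i}))"
    by (rule closedin_Un[OF closedin_Int[OF 1(1) 2(1)] closedin_Int[OF 1(2) 2(2)]])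
  also have "{x \<in> topspace ?X. f x \<in> C} \<inter> (S \<inter> {xs. length xs = n \<and> xs ! i \<le> c}) \<union>
      {x \<in> topspace ?X. g x \<in> C} \<inter> (S \<inter> {xs. length xs = n \<and> c \<le> xs ! i}) =
      {x \<in> topspace ?X. (if x ! i \<le> c then f x else g x) \<in> C}" (is "?L = ?R")
  proof (rule Set.set_eqI)
    fix x
    consider "x ! i < c" | "x ! i = c" | "c < x ! i" by (rule linorder_cases)
    then show "x \<in> ?L \<longleftrightarrow> x \<in> ?R"
      by cases (use eq[of x] in auto)
  qed
  finally show "closedin ?X {x \<in> topspace ?X. (if x ! i \<le> c then f x else g x) \<in> C}" .
qed

section \<open>Definable continuous maps on cubes\<close>

lemma definable_carrier:
  assumes "definable_group M G"
  obtains m where "definable M m (carrier G)"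
  using assms by (auto simp: definable_group_def definable_set_def)

lemma def_cont_iff:
  assumes "definable M m (carrier G)"
  shows "def_continuous_on_cube M G n h \<longleftrightarrow> h \<in> unit_cube n \<rightarrow> carrier G \<and> dmap M n m (unit_cube n) h \<and>
    continuous_map (subtopology (box_topology n) (unit_cube n)) (gtop G) h"
  unfolding def_continuous_on_cube_def definable_map_iff[OF definable_unit_cube assms] by blast

lemma def_cont_mem: "def_continuous_on_cube M G n h \<Longrightarrow> x \<in> unit_cube n \<Longrightarrow> h x \<in> carrier G"
  by (auto simp: def_continuous_on_cube_def definable_map_def)

text \<open>Paths and homotopies are total functions on lists, but only their values on the cube
  carry meaning.\<close>

lemma def_cont_cong:
  assumes "\<And>x. x \<in> unit_cube n \<Longrightarrow> h x = k x"
  shows "def_continuous_on_cube M G n h \<longleftrightarrow> def_continuous_on_cube M G n k"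
proof -
  have "def_continuous_on_cube M G n k"
    if h: "def_continuous_on_cube M G n h" and eq: "\<And>x. x \<in> unit_cube n \<Longrightarrow> h x = k x" for h k
  proof -
    have "continuous_map (subtopology (box_topology n) (unit_cube n)) (gtop G) k"
      by (rule continuous_map_eq[of _ _ h]) (use h eq in \<open>auto simp: def_continuous_on_cube_def\<close>)
    moreover have "{x @ h x | x. x \<in> unit_cube n} = {x @ k x | x. x \<in> unit_cube n}" using eq by metis
    moreover have "k \<in> unit_cube n \<rightarrow> carrier G" using def_cont_mem[OF h] eq by (metis Pi_I)
    ultimately show ?thesis using h
      unfolding def_continuous_on_cube_def definable_map_def by simp
  qed
  then show ?thesis using assms by metis
qed

text \<open>Asking for continuity of \<alpha> at all lists of length n' keeps \<open>cont_at\<close>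
  free of subspaces; the reparametrisations used below are continuous everywhere.\<close>

lemma def_cont_comp:
  assumes h: "def_continuous_on_cube M G n h" and G: "definable_set M (carrier G)"
    and \<alpha>: "vt M n' n \<alpha>" "\<And>x i. length x = n' \<Longrightarrow> i < n \<Longrightarrow> cont_at n' (\<lambda>x. \<alpha> x ! i) x"
    and cube: "\<And>x. x \<in> unit_cube n' \<Longrightarrow> \<alpha> x \<in> unit_cube n"
  shows "def_continuous_on_cube M G n' (\<lambda>x. h (\<alpha> x))"
proof -
  obtain m where m: "definable M m (carrier G)" using G by (auto simp: definable_set_def)
  note h' = h[unfolded def_cont_iff[OF m]]
  have "dmap M n' m (unit_cube n') (\<lambda>x. h (\<alpha> x))"
    by (rule dmap_comp[OF dmap_vt[OF \<alpha>(1) definable_unit_cube] _ cube]) (use h' in auto)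
  moreover have "continuous_map (box_topology n') (box_topology n) \<alpha>"
    by (rule continuous_map_box[OF vt_length[OF \<alpha>(1)] \<alpha>(2)])
  then have "continuous_map (subtopology (box_topology n') (unit_cube n')) (subtopology (box_topology n) (unit_cube n)) \<alpha>"
    using cube by (intro continuous_map_into_subtopology continuous_map_from_subtopology) auto
  then have "continuous_map (subtopology (box_topology n') (unit_cube n')) (gtop G) (\<lambda>x. h (\<alpha> x))"
    using h' continuous_map_compose[unfolded o_def] by blast
  ultimately show ?thesis unfolding def_cont_iff[OF m] using h' cube by auto
qed

lemma def_cont_compose_map:
  assumes h: "def_continuous_on_cube M G n h" and G: "definable_set M (carrier G)"
    and k: "definable_map M (carrier G) (carrier G') k" "continuous_map (gtop G) (gtop G') k"
  shows "def_continuous_on_cube M G' n (k \<circ> h)"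
proof -
  obtain m where m: "definable M m (carrier G)" using G by (auto simp: definable_set_def)
  obtain m' where m': "definable M m' (carrier G')" using k by (auto simp: definable_set_def definable_map_def)
  note h' = h[unfolded def_cont_iff[OF m]] and k' = k(1)[unfolded definable_map_iff[OF m m']]
  have "dmap M n m' (unit_cube n) (\<lambda>x. k (h x))"
    using h' k' by (intro dmap_comp[of M n m _ h m' "carrier G" k]) auto
  moreover have "continuous_map (subtopology (box_topology n) (unit_cube n)) (gtop G') (k \<circ> h)"
    using h' k(2) continuous_map_compose by blast
  ultimately show ?thesis unfolding def_cont_iff[OF m'] using h' k' by (auto simp: o_def)
qed

lemma def_cont_const:
  assumes "c \<in> carrier G" "definable_set M (carrier G)" "topspace (gtop G) = carrier G"
  shows "def_continuous_on_cube M G n (\<lambda>x. c)"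
proof -
  obtain m where m: "definable M m (carrier G)" using assms by (auto simp: definable_set_def)
  show ?thesis unfolding def_cont_iff[OF m]
    using assms definable_length[OF m] by (auto intro!: dmap_vt vt_const definable_unit_cube)
qed

text \<open>Both branches are taken to be defined and continuous on the whole cube. The
  concatenations and homotopies below arrange this by clipping their arguments with min and
  max.\<close>

lemma def_cont_paste:
  fixes M :: "('a::linordered_field, 'f, 'r) expansion"
  assumes f: "def_continuous_on_cube M G n f" and g: "def_continuous_on_cube M G n g"
    and G: "definable_set M (carrier G)"
    and i: "i < n" and eq: "\<And>x. x \<in> unit_cube n \<Longrightarrow> x ! i = c \<Longrightarrow> f x = g x"
  shows "def_continuous_on_cube M G n (\<lambda>x. if x ! i \<le> c then f x else g x)"
proof -
  obtain m where m: "definable M m (carrier G)" using G by (auto simp: definable_set_def)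
  note f' = f[unfolded def_cont_iff[OF m]] and g' = g[unfolded def_cont_iff[OF m]]
  have "dfn M n (\<lambda>x. x ! i \<le> c)" by (rule dfn_le st_const st_nth vt_id i)+
  then have "dmap M n m (unit_cube n) (\<lambda>x. if x ! i \<le> c then f x else g x)"
    using f' g' by (intro dmap_if) auto
  moreover have "continuous_map (subtopology (box_topology n) (unit_cube n)) (gtop G) (\<lambda>x. if x ! i \<le> c then f x else g x)"
    using f' g' i eq by (intro continuous_map_box_paste) auto
  ultimately show ?thesis unfolding def_cont_iff[OF m] using f' g' by auto
qed

section \<open>Continuity of definable homomorphisms\<close>

text \<open>The graph of the inverse is the image of U under x |-> \<phi> x @ x.\<close>

lemma dmap_inverse:
  assumes "dmap M m k U \<phi>" "inj_on \<phi> U"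
  shows "dmap M k m (\<phi> ` U) (inv_into U \<phi>)"
proof -
  have U: "definable M m U" using assms by (simp add: dmap_def)
  have V: "definable M k (\<phi> ` U)" using dmap_image[OF assms(1) subset_refl U] .
  have "dmap M m (k + m) U (\<lambda>x. \<phi> x @ x)" by (rule dmap_append assms dmap_vt vt_id U)+
  from dmap_image[OF this subset_refl U] have "definable M (k + m) ((\<lambda>x. \<phi> x @ x) ` U)" .
  moreover have "(\<lambda>x. \<phi> x @ x) ` U = {w @ inv_into U \<phi> w | w. w \<in> \<phi> ` U}"
    using inv_into_f_f[OF assms(2)] by force
  moreover have "inv_into U \<phi> \<in> \<phi> ` U \<rightarrow> U" using inv_into_into by (intro Pi_I)
  ultimately have "definable_map M (\<phi> ` U) U (inv_into U \<phi>)"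
    unfolding definable_map_def definable_set_def using U V by metis
  then show ?thesis unfolding definable_map_iff[OF V U] by blast
qed

lemma chart_dmap:
  assumes "openin X U" "topspace X = C" "definable M m C" "openin (box_topology n) (\<phi> ` U)"
    "definable_map M U (\<phi> ` U) \<phi>"
  shows "dmap M m n U \<phi>"
proof -
  have "U \<subseteq> C" using assms(1,2) openin_subset by blast
  then have "definable M m U" using assms(5) definable_length[OF assms(3)]
    by (intro definable_set_subset) (auto simp: definable_map_def)
  moreover have "definable M n (\<phi> ` U)"
    using assms(4,5) by (intro definable_set_subset) (auto simp: definable_map_def openin_box_topology)
  ultimately show ?thesis using definable_map_iff assms(5) by blast
qed

context tame_structure
begin

text \<open>Treat the pieces one after another: either a piece fills a subcube, or it can be
  discarded after passing to a subcube that misses it.\<close>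

lemma thick_cover:
  assumes "finite J" "\<And>j. j \<in> J \<Longrightarrow> dfn M n (P j)" "length x = n" "0 < d"
    "\<And>y. y \<in> cube n x d \<Longrightarrow> \<exists>j\<in>J. P j y"
  shows "\<exists>x' d'. length x' = n \<and> 0 < d' \<and> cube n x' d' \<subseteq> cube n x d \<and> (\<exists>j\<in>J. \<forall>y\<in>cube n x' d'. P j y)"
  using assms
proof (induction J arbitrary: x d)
  case empty
  then show ?case using cube_center by blast
next
  case (insert j J)
  have "dfn M n (P j)" using insert.prems by simp
  from thickD[OF conjunct1[OF thick_gencont] this insert.prems(2,3)]
  obtain x' d' where 1: "length x' = n" "0 < d'" "cube n x' d' \<subseteq> cube n x d"
    "(\<forall>y\<in>cube n x' d'. P j y) \<or> (\<forall>y\<in>cube n x' d'. \<not> P j y)" by blast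
  show ?case
  proof (cases "\<forall>y\<in>cube n x' d'. P j y")
    case True then show ?thesis using 1 by blast
  next
    case False
    then have "\<And>y. y \<in> cube n x' d' \<Longrightarrow> \<exists>j\<in>J. P j y" using 1(3,4) insert.prems(4) by blast
    then obtain x2 d2 where "length x2 = n" "0 < d2" "cube n x2 d2 \<subseteq> cube n x' d'" "\<exists>j\<in>J. \<forall>y\<in>cube n x2 d2. P j y"
      using insert.IH[of x' d'] insert.prems(1) 1(1,2) by blast
    then show ?thesis using 1(3) by blast
  qed
qed

text \<open>Read in a chart of G, the map becomes definable on a cube. Finitely many charts of G'
  cover its values, so on a subcube a single one suffices, and there all coordinate functions are
  continuous at a common point.\<close>

lemma definable_map_continuous_at_point:
  assumes G: "definable_group M G" and G': "definable_group M G'"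
    and f: "definable_map M (carrier G) (carrier G') f"
  shows "\<exists>x0. topcontinuous_at (gtop G) (gtop G') f x0"
proof -
  obtain m where m: "definable M m (carrier G)" using definable_carrier[OF G] .
  obtain m' where m': "definable M m' (carrier G')" using definable_carrier[OF G'] .
  have top: "topspace (gtop G) = carrier G" and top': "topspace (gtop G') = carrier G'"
    using G G' by (auto simp: definable_group_def topological_group_on_def)
  have fd: "f \<in> carrier G \<rightarrow> carrier G'" "dmap M m m' (carrier G) f" using f unfolding definable_map_iff[OF m m'] by auto
  obtain n \<A> where A: "topspace (gtop G) = \<Union>(fst ` \<A>)" "\<forall>(U, \<phi>)\<in>\<A>. openin (gtop G) U \<and>
      openin (box_topology n) (\<phi> ` U) \<and> definable_map M U (\<phi> ` U) \<phi> \<and>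
      homeomorphic_map (subtopology (gtop G) U) (subtopology (box_topology n) (\<phi> ` U)) \<phi>"
    using G unfolding definable_group_def definable_manifold_def by blast
  obtain n' \<A>' where A': "finite \<A>'" "topspace (gtop G') = \<Union>(fst ` \<A>')" "\<forall>(U, \<phi>)\<in>\<A>'. openin (gtop G') U \<and>
      openin (box_topology n') (\<phi> ` U) \<and> definable_map M U (\<phi> ` U) \<phi> \<and>
      homeomorphic_map (subtopology (gtop G') U) (subtopology (box_topology n') (\<phi> ` U)) \<phi>"
    using G' unfolding definable_group_def definable_manifold_def by blast
  have "\<one>\<^bsub>G\<^esub> \<in> carrier G" using G by (simp add: definable_group_def group.is_monoid)
  \<comment> \<open>The identity is used to find a chart with nonempty domain.\<close>
  then obtain U \<phi> where U: "(U, \<phi>) \<in> \<A>" "\<one>\<^bsub>G\<^esub> \<in> U" using A(1) top by fastforce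
  have oU: "openin (gtop G) U" and oV: "openin (box_topology n) (\<phi> ` U)" and d\<phi>: "definable_map M U (\<phi> ` U) \<phi>"
    and h\<phi>: "homeomorphic_map (subtopology (gtop G) U) (subtopology (box_topology n) (\<phi> ` U)) \<phi>"
    using A(2) U(1) by auto
  have UG: "U \<subseteq> carrier G" using oU top openin_subset by blast
  then have tsU: "topspace (subtopology (gtop G) U) = U" using top by auto
  have inj: "inj_on \<phi> U" using homeomorphic_imp_injective_map[OF h\<phi>] tsU by simp
  define \<psi> where "\<psi> = inv_into U \<phi>"
  have \<psi>: "\<psi> w \<in> U" "\<phi> (\<psi> w) = w" if "w \<in> \<phi> ` U" for w
    using that by (auto simp: \<psi>_def inv_into_into f_inv_into_f)
  have \<psi>\<phi>: "\<psi> (\<phi> x) = x" if "x \<in> U" for x using inv_into_f_f[OF inj that] by (simp add: \<psi>_def)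
  have "dmap M n m (\<phi> ` U) \<psi>" unfolding \<psi>_def by (rule dmap_inverse[OF chart_dmap[OF oU top m oV d\<phi>] inj])
  then have h: "dmap M n m' (\<phi> ` U) (\<lambda>w. f (\<psi> w))"
    using \<psi> UG by (intro dmap_comp[OF _ fd(2)]) auto
  obtain d where d: "0 < d" "cube n (\<phi> \<one>\<^bsub>G\<^esub>) d \<subseteq> \<phi> ` U" "length (\<phi> \<one>\<^bsub>G\<^esub>) = n"
    using oV U(2) unfolding openin_box_topology by blast
  \<comment> \<open>Definable by \<open>dmap_preimage\<close>, so the finite atlas of G' becomes a
    definable cover to which \<open>thick_cover\<close> applies.\<close>
  define P where "P = (\<lambda>(j :: 'a list set \<times> ('a list \<Rightarrow> 'a list)) w. w \<in> {w \<in> \<phi> ` U. f (\<psi> w) \<in> fst j})"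
  have ch: "openin (gtop G') (fst j)" "openin (box_topology n') (snd j ` fst j)" "dmap M m' n' (fst j) (snd j)"
    "homeomorphic_map (subtopology (gtop G') (fst j)) (subtopology (box_topology n') (snd j ` fst j)) (snd j)"
    if "j \<in> \<A>'" for j
  proof -
    show 1: "openin (gtop G') (fst j)" "openin (box_topology n') (snd j ` fst j)"
      "homeomorphic_map (subtopology (gtop G') (fst j)) (subtopology (box_topology n') (snd j ` fst j)) (snd j)"
      using A'(3) that by (auto simp: case_prod_beta)
    have "definable_map M (fst j) (snd j ` fst j) (snd j)" using A'(3) that by (auto simp: case_prod_beta)
    then show "dmap M m' n' (fst j) (snd j)" by (rule chart_dmap[OF 1(1) top' m' 1(2)])
  qed
  have "dfn M n (P j)" if "j \<in> \<A>'" for j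
  proof -
    have "definable M m' (fst j)" using ch(3)[OF that] by (simp add: dmap_def)
    from dmap_preimage[OF h this] show ?thesis unfolding P_def definable_iff_dfn by blast
  qed
  moreover have "\<exists>j\<in>\<A>'. P j w" if "w \<in> cube n (\<phi> \<one>\<^bsub>G\<^esub>) d" for w
  proof -
    have w: "w \<in> \<phi> ` U" using that d by blast
    then have "f (\<psi> w) \<in> \<Union>(fst ` \<A>')" using \<psi>(1)[OF w] UG fd(1) top' A'(2) by auto
    then show ?thesis using w unfolding P_def by auto
  qed
  ultimately obtain x1 d1 j where 1: "length x1 = n" "0 < d1" "cube n x1 d1 \<subseteq> cube n (\<phi> \<one>\<^bsub>G\<^esub>) d"
    "j \<in> \<A>'" "\<And>w. w \<in> cube n x1 d1 \<Longrightarrow> P j w"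
    using thick_cover[OF A'(1) _ d(3,1), of P] by blast
  define C where "C = cube n x1 d1"
  have C: "w \<in> \<phi> ` U" "f (\<psi> w) \<in> fst j" if "w \<in> C" for w using 1(5) that unfolding C_def P_def by auto
  have "dfn M n (\<lambda>w. w \<in> C)" unfolding C_def by (rule dfn_cube vt_id vt_const st_const 1(1))+
  then have dC: "definable M n C" unfolding definable_iff_dfn C_def using cube_length by blast
  have "dmap M n n' C (\<lambda>w. snd j (f (\<psi> w)))"
    using C by (intro dmap_comp[OF dmap_subset[OF h _ dC] ch(3)[OF 1(4)]]) auto
  then obtain g where g: "vt M n n' g" "\<And>w. w \<in> C \<Longrightarrow> g w = snd j (f (\<psi> w))" unfolding dmap_def by blast
  have "st M n (\<lambda>w. g w ! i)" if "i < n'" for i by (rule st_nth[OF g(1) that])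
  from continuous_on_subcube[of n' n "\<lambda>i w. g w ! i", OF this 1(1,2)]
  obtain p d2 where 2: "length p = n" "0 < d2" "cube n p d2 \<subseteq> C" "\<forall>y\<in>cube n p d2. \<forall>i<n'. cont_at n (\<lambda>w. g w ! i) y"
    unfolding C_def by blast
  have p: "p \<in> cube n p d2" using cube_center[OF 2(1,2)] .
  then have pC: "p \<in> C" using 2(3) by blast
  have "topcontinuous_at (gtop G) (gtop G') f (\<psi> p)"
    unfolding topcontinuous_at_def
  proof (intro conjI allI impI)
    show "\<psi> p \<in> topspace (gtop G)" using \<psi>(1)[OF C(1)[OF pC]] UG top by auto
    show "f \<in> topspace (gtop G) \<rightarrow> topspace (gtop G')" using fd top top' by simp
    fix V assume V: "openin (gtop G') V \<and> f (\<psi> p) \<in> V"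
    have sub': "fst j \<subseteq> carrier G'" using ch(1)[OF 1(4)] top' openin_subset by blast
    have inj': "inj_on (snd j) (fst j)"
      using homeomorphic_imp_injective_map[OF ch(4)[OF 1(4)]] sub' top' by (simp add: Int_absorb1)
    have "openin (subtopology (gtop G') (fst j)) (V \<inter> fst j)" using V by (auto simp: openin_subtopology)
    then have "openin (subtopology (box_topology n') (snd j ` fst j)) (snd j ` (V \<inter> fst j))"
      using homeomorphic_imp_open_map[OF ch(4)[OF 1(4)]] unfolding open_map_def by blast
    then have oW: "openin (box_topology n') (snd j ` (V \<inter> fst j))"
      using openin_trans_full ch(2)[OF 1(4)] by blast
    moreover have "g p \<in> snd j ` (V \<inter> fst j)" using g(2)[OF pC] C(2)[OF pC] V by blast
    ultimately obtain e where e: "0 < e" "cube n' (g p) e \<subseteq> snd j ` (V \<inter> fst j)"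
      unfolding openin_box_topology by blast
    obtain \<delta> where \<delta>: "0 < \<delta>" "\<forall>y\<in>cube n p \<delta>. \<forall>i<n'. \<bar>g y ! i - g p ! i\<bar> < e"
      using cont_at_uniform[of n' n g p e] 2(4) p e(1) by blast
    define D where "D = cube n p (min \<delta> d2)"
    have D: "D \<subseteq> cube n p \<delta>" "D \<subseteq> cube n p d2" unfolding D_def by (rule cube_mono, simp)+
    have D': "p \<in> D" "openin (box_topology n) D"
      using \<delta>(1) 2(1,2) by (simp_all add: D_def cube_center openin_cube)
    have DV: "f (\<psi> w) \<in> V" if w: "w \<in> D" for w
    proof -
      have wC: "w \<in> C" using w D(2) 2(3) by blast
      have "length w = n" using w cube_length unfolding D_def by blast
      then have "length (g w) = n'" using vt_length[OF g(1)] by blast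
      then have "g w \<in> cube n' (g p) e" using \<delta>(2) w D(1) unfolding cube_def[of n'] by blast
      then have "snd j (f (\<psi> w)) \<in> snd j ` (V \<inter> fst j)" using e(2) g(2)[OF wC] by auto
      then show ?thesis using inj' C(2)[OF wC] by (auto simp: inj_on_def)
    qed
    define W where "W = {x \<in> topspace (subtopology (gtop G) U). \<phi> x \<in> D}"
    have DU: "D \<subseteq> \<phi> ` U" using D(2) 2(3) C(1) by blast
    have "openin (subtopology (box_topology n) (\<phi> ` U)) D"
      using D'(2) DU openin_open_subtopology[OF oV] by blast
    then have "openin (subtopology (gtop G) U) W"
      unfolding W_def using openin_continuous_map_preimage homeomorphic_imp_continuous_map[OF h\<phi>] by blast
    then have "openin (gtop G) W" using openin_trans_full oU by blast
    moreover have "\<psi> p \<in> W" using \<psi>[OF C(1)[OF pC]] D'(1) unfolding W_def tsU by simp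
    moreover have "f x \<in> V" if "x \<in> W" for x
      using DV[of "\<phi> x"] \<psi>\<phi>[of x] that unfolding W_def tsU by simp
    ultimately show "\<exists>W. openin (gtop G) W \<and> \<psi> p \<in> W \<and> (\<forall>y\<in>W. f y \<in> V)" by blast
  qed
  then show ?thesis by blast
qed

lemma continuous_translation:
  assumes "definable_group M G" "c \<in> carrier G"
  shows "continuous_map (gtop G) (gtop G) (\<lambda>x. c \<otimes>\<^bsub>G\<^esub> x)"
proof -
  have top: "topspace (gtop G) = carrier G"
    and mult: "continuous_map (prod_topology (gtop G) (gtop G)) (gtop G) (\<lambda>(x, y). x \<otimes>\<^bsub>G\<^esub> y)"
    using assms by (auto simp: definable_group_def topological_group_on_def)
  have "continuous_map (gtop G) (prod_topology (gtop G) (gtop G)) (\<lambda>x. (c, x))"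
    using assms(2) top by (intro continuous_map_pairedI) auto
  from continuous_map_compose[OF this mult] show ?thesis by (simp add: o_def)
qed

text \<open>For fixed c, f y is the product of the inverse of f c with f (c y). Choosing c so that c
  x is a known continuity point transports continuity from there to x by translations in both
  groups.\<close>

lemma definable_hom_continuous:
  assumes G: "definable_group M G" and G': "definable_group M G'" and f: "definable_hom M G G' f"
  shows "continuous_map (gtop G) (gtop G') f"
  unfolding continuous_map_eq_topcontinuous_at
proof
  interpret G: group G using G by (simp add: definable_group_def)
  interpret G': group G' using G' by (simp add: definable_group_def)
  have fh: "f \<in> hom G G'" "definable_map M (carrier G) (carrier G') f" using f by (auto simp: definable_hom_def)
  interpret group_hom G G' f using fh by unfold_locales
  have top: "topspace (gtop G) = carrier G" and top': "topspace (gtop G') = carrier G'"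
    using G G' by (auto simp: definable_group_def topological_group_on_def)
  obtain x0 where x0: "topcontinuous_at (gtop G) (gtop G') f x0"
    using definable_map_continuous_at_point[OF G G' fh(2)] by blast
  fix x assume "x \<in> topspace (gtop G)"
  then have xG: "x \<in> carrier G" using top by simp
  have x0G: "x0 \<in> carrier G" using x0 top by (simp add: topcontinuous_at_def)
  define c where "c = x0 \<otimes>\<^bsub>G\<^esub> inv\<^bsub>G\<^esub> x"
  have c: "c \<in> carrier G" "c \<otimes>\<^bsub>G\<^esub> x = x0" using xG x0G by (auto simp: c_def G.m_assoc)
  show "topcontinuous_at (gtop G) (gtop G') f x"
    unfolding topcontinuous_at_def
  proof (intro conjI allI impI)
    show "x \<in> topspace (gtop G)" using xG top by simp
    show "f \<in> topspace (gtop G) \<rightarrow> topspace (gtop G')" using top top' by auto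
    fix V assume V: "openin (gtop G') V \<and> f x \<in> V"
    define V' where "V' = {y \<in> topspace (gtop G'). inv\<^bsub>G'\<^esub> (f c) \<otimes>\<^bsub>G'\<^esub> y \<in> V}"
    have "openin (gtop G') V'" unfolding V'_def
      using V c(1) by (intro openin_continuous_map_preimage[OF continuous_translation[OF G']]) auto
    moreover have eq: "inv\<^bsub>G'\<^esub> (f c) \<otimes>\<^bsub>G'\<^esub> f (c \<otimes>\<^bsub>G\<^esub> y) = f y" if "y \<in> carrier G" for y
      using that c(1) by (simp add: G'.m_assoc[symmetric])
    then have "f x0 \<in> V'" using V c(2) xG x0G top' unfolding V'_def by (metis (mono_tags, lifting) hom_closed mem_Collect_eq)
    ultimately obtain U where U: "openin (gtop G) U" "x0 \<in> U" "\<forall>y\<in>U. f y \<in> V'"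
      using x0 unfolding topcontinuous_at_def by blast
    define W where "W = {y \<in> topspace (gtop G). c \<otimes>\<^bsub>G\<^esub> y \<in> U}"
    have "openin (gtop G) W" unfolding W_def
      by (rule openin_continuous_map_preimage[OF continuous_translation[OF G c(1)] U(1)])
    moreover have "x \<in> W" using xG top c(2) U(2) by (simp add: W_def)
    moreover have "f y \<in> V" if "y \<in> W" for y
    proof -
      have y: "y \<in> carrier G" "c \<otimes>\<^bsub>G\<^esub> y \<in> U" using that top by (auto simp: W_def)
      then have "f (c \<otimes>\<^bsub>G\<^esub> y) \<in> V'" using U(3) by blast
      then show ?thesis using eq[OF y(1)] by (simp add: V'_def)
    qed
    ultimately show "\<exists>W. openin (gtop G) W \<and> x \<in> W \<and> (\<forall>y\<in>W. f y \<in> V)" by blast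
  qed
qed

end

section \<open>The fundamental groupoid of a topological space\<close>

definition path_homotopic :: "'b topology \<Rightarrow> (real \<Rightarrow> 'b) \<Rightarrow> (real \<Rightarrow> 'b) \<Rightarrow> bool" where
  "path_homotopic X p q \<longleftrightarrow> homotopic_with (\<lambda>r. r 0 = p 0 \<and> r 1 = p 1) (top_of_set {0..1}) X p q"

lemma path_class_path_homotopic: "path_class X p = {q. path_homotopic X p q}"
  by (simp add: path_class_def path_homotopic_def)

lemma path_homotopic_imp_pathin: "path_homotopic X p q \<Longrightarrow> pathin X p" "path_homotopic X p q \<Longrightarrow> pathin X q"
  unfolding path_homotopic_def pathin_def using homotopic_with_imp_continuous_maps by blast+

lemma path_homotopic_endpoints: "path_homotopic X p q \<Longrightarrow> q 0 = p 0" "path_homotopic X p q \<Longrightarrow> q 1 = p 1"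
  unfolding path_homotopic_def using homotopic_with_imp_property by blast+

lemma path_homotopic_refl: "pathin X p \<Longrightarrow> path_homotopic X p p"
  by (simp add: path_homotopic_def pathin_def)

lemma path_homotopic_sym: "path_homotopic X p q \<Longrightarrow> path_homotopic X q p"
proof -
  assume pq: "path_homotopic X p q"
  then have "homotopic_with (\<lambda>r. r 0 = p 0 \<and> r 1 = p 1) (top_of_set {0..1}) X q p"
    unfolding path_homotopic_def by (rule homotopic_with_symD)
  then show ?thesis using path_homotopic_endpoints[OF pq] by (simp add: path_homotopic_def)
qed

lemma path_homotopic_trans: "path_homotopic X p q \<Longrightarrow> path_homotopic X q r \<Longrightarrow> path_homotopic X p r"
proof -
  assume pq: "path_homotopic X p q" and qr: "path_homotopic X q r"
  have "homotopic_with (\<lambda>r. r 0 = p 0 \<and> r 1 = p 1) (top_of_set {0..1}) X q r"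
    using qr path_homotopic_endpoints[OF pq] by (simp add: path_homotopic_def)
  then show ?thesis using pq homotopic_with_trans unfolding path_homotopic_def by blast
qed

lemma path_class_eq: "path_homotopic X p q \<Longrightarrow> path_class X p = path_class X q"
  unfolding path_class_path_homotopic using path_homotopic_sym path_homotopic_trans by blast

lemma path_class_eqD: "path_class X p = path_class X q \<Longrightarrow> pathin X q \<Longrightarrow> path_homotopic X p q"
  using path_homotopic_refl unfolding path_class_path_homotopic by blast

lemma path_class_self: "pathin X p \<Longrightarrow> p \<in> path_class X p"
  using path_homotopic_refl unfolding path_class_path_homotopic by blast

lemma path_homotopic_cong:
  assumes "pathin X p" "\<And>t. 0 \<le> t \<Longrightarrow> t \<le> 1 \<Longrightarrow> p t = q t"
  shows "path_homotopic X p q"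
  unfolding path_homotopic_def
  by (rule homotopic_with_equal) (use assms in \<open>auto simp: pathin_def\<close>)

lemma path_homotopic_compose:
  assumes "path_homotopic X p q" "continuous_map X Y h"
  shows "path_homotopic Y (h \<circ> p) (h \<circ> q)"
  using assms unfolding path_homotopic_def by (rule homotopic_with_compose_continuous_map_left) simp

lemma pathin_compose': "pathin X p \<Longrightarrow> continuous_map X Y h \<Longrightarrow> pathin Y (h \<circ> p)"
  unfolding pathin_def by (rule continuous_map_compose)

text \<open>A straight-line homotopy between \<phi> and \<psi> stays in the unit interval by
  convexity; compose it with p. The unit and cancellation laws below are instances.\<close>

lemma path_homotopic_reparam:
  assumes p: "pathin X p" and \<phi>: "continuous_on {0..1} \<phi>" "\<phi> \<in> {0..1} \<rightarrow> {0..1}"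
    and \<psi>: "continuous_on {0..1} \<psi>" "\<psi> \<in> {0..1} \<rightarrow> {0..1}" and eq: "\<phi> 0 = \<psi> 0" "\<phi> 1 = \<psi> 1"
  shows "path_homotopic X (\<lambda>t. p (\<phi> t)) (\<lambda>t. p (\<psi> t))"
proof -
  have "homotopic_with (\<lambda>r. r 0 = \<phi> 0 \<and> r 1 = \<phi> 1) (top_of_set {0..1}) (top_of_set {0..1}) \<phi> \<psi>"
    unfolding homotopic_with_def
  proof (intro exI conjI allI ballI)
    let ?h = "\<lambda>z :: real \<times> real. (1 - fst z) * \<phi> (snd z) + fst z * \<psi> (snd z)"
    have in01: "?h (s, t) \<in> {0..1}" if "s \<in> {0..1}" "t \<in> {0..1}" for s t
    proof -
      have "0 \<le> \<phi> t" "\<phi> t \<le> 1" "0 \<le> \<psi> t" "\<psi> t \<le> 1" using that(2) \<phi>(2) \<psi>(2) by fastforce+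
      then show ?thesis
        using convex_bound_le[of "\<phi> t" 1 "\<psi> t" "1 - s" s] that(1) by simp
    qed
    have c: "continuous_on ({0..1} \<times> {0..1}) (\<lambda>z :: real \<times> real. \<phi> (snd z))" "continuous_on ({0..1} \<times> {0..1}) (\<lambda>z :: real \<times> real. \<psi> (snd z))"
      by (rule continuous_on_compose2[OF \<phi>(1)] continuous_on_compose2[OF \<psi>(1)]; auto intro!: continuous_intros)+
    have "continuous_on ({0..1} \<times> {0..1}) ?h"
      by (intro continuous_intros c)
    then show "continuous_map (prod_topology (top_of_set {0..1}) (top_of_set {0..1})) (top_of_set {0..1}) ?h"
      using in01 by (auto simp: prod_topology_subtopology_eu continuous_map_in_subtopology)
  qed (auto simp: eq algebra_simps)
  then have "homotopic_with (\<lambda>r. r 0 = p (\<phi> 0) \<and> r 1 = p (\<phi> 1)) (top_of_set {0..1}) X (p \<circ> \<phi>) (p \<circ> \<psi>)"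
    by (rule homotopic_with_compose_continuous_map_left) (use p in \<open>auto simp: pathin_def\<close>)
  then show ?thesis by (simp add: path_homotopic_def o_def)
qed

lemma path_homotopic_reparam_id:
  assumes "pathin X p" "continuous_on {0..1} \<phi>" "\<phi> \<in> {0..1} \<rightarrow> {0..1}" "\<phi> 0 = 0" "\<phi> 1 = 1"
  shows "path_homotopic X (\<lambda>t. p (\<phi> t)) p"
  using path_homotopic_reparam[OF assms(1-3), of "\<lambda>t. t"] assms(4,5) by simp

lemma path_homotopic_concat:
  assumes p: "path_homotopic X p p'" and q: "path_homotopic X q q'" and pq: "p 1 = q 0"
  shows "path_homotopic X (path_concat p q) (path_concat p' q')"
proof -
  let ?I = "top_of_set {0..1 :: real}"
  let ?II = "prod_topology ?I ?I"
  obtain h where h: "continuous_map ?II X h" "\<And>t. h (0, t) = p t" "\<And>t. h (1, t) = p' t"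
    "\<And>s. s \<in> {0..1} \<Longrightarrow> h (s, 0) = p 0 \<and> h (s, 1) = p 1"
    using p unfolding path_homotopic_def homotopic_with_def by blast
  obtain k where k: "continuous_map ?II X k" "\<And>t. k (0, t) = q t" "\<And>t. k (1, t) = q' t"
    "\<And>s. s \<in> {0..1} \<Longrightarrow> k (s, 0) = q 0 \<and> k (s, 1) = q 1"
    using q unfolding path_homotopic_def homotopic_with_def by blast
  define H where "H = (\<lambda>z. if snd z \<le> 1/2 then (h \<circ> (\<lambda>z. (fst z, 2 * snd z))) z else (k \<circ> (\<lambda>z. (fst z, 2 * snd z - 1))) z)"
  have "continuous_map ?II X H"
    unfolding H_def
  proof (rule continuous_map_cases_le)
    show "continuous_map ?II euclideanreal snd"
      using continuous_map_snd continuous_map_in_subtopology by blast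
    show "continuous_map ?II euclideanreal (\<lambda>x. 1/2)" by simp
    have c: "continuous_map (subtopology ?II S) ?II (\<lambda>z. (fst z, g (snd z)))"
      if "continuous_on {0..1} g" "\<And>z. z \<in> topspace ?II \<Longrightarrow> z \<in> S \<Longrightarrow> g (snd z) \<in> {0..1}" for g :: "real \<Rightarrow> real" and S
    proof -
      have "continuous_on ({0..1} \<times> {0..1}) (\<lambda>z :: real \<times> real. (fst z, g (snd z)))"
        by (intro continuous_intros continuous_on_compose2[OF that(1)]) auto
      then have "continuous_on (({0..1} \<times> {0..1}) \<inter> S) (\<lambda>z :: real \<times> real. (fst z, g (snd z)))"
        by (rule continuous_on_subset) auto
      moreover have "(\<lambda>z. (fst z, g (snd z))) \<in> ({0..1} \<times> {0..1}) \<inter> S \<rightarrow> {0..1} \<times> {0..1}" using that(2) by auto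
      ultimately show ?thesis
        by (simp add: prod_topology_subtopology_eu subtopology_subtopology continuous_map_in_subtopology)
    qed
    show "continuous_map (subtopology ?II {z \<in> topspace ?II. snd z \<le> 1/2}) X (h \<circ> (\<lambda>z. (fst z, 2 * snd z)))"
      by (rule continuous_map_compose[OF _ h(1)], rule c) (auto intro!: continuous_intros)
    show "continuous_map (subtopology ?II {z \<in> topspace ?II. 1/2 \<le> snd z}) X (k \<circ> (\<lambda>z. (fst z, 2 * snd z - 1)))"
      by (rule continuous_map_compose[OF _ k(1)], rule c) (auto intro!: continuous_intros)
    show "(h \<circ> (\<lambda>z. (fst z, 2 * snd z))) z = (k \<circ> (\<lambda>z. (fst z, 2 * snd z - 1))) z"
      if "z \<in> topspace ?II" "snd z = 1/2" for z
    proof -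
      have "2 * snd z = 1" "fst z \<in> {0..1}" using that by auto
      then show ?thesis using h(4)[of "fst z"] k(4)[of "fst z"] pq unfolding o_def by simp
    qed
  qed
  then show ?thesis
    unfolding path_homotopic_def homotopic_with_def
    by (intro exI[of _ H]) (use h k in \<open>auto simp: H_def path_concat_def\<close>)
qed

lemma pathin_concat: "pathin X p \<Longrightarrow> pathin X q \<Longrightarrow> p 1 = q 0 \<Longrightarrow> pathin X (path_concat p q)"
  using path_homotopic_concat[OF path_homotopic_refl path_homotopic_refl] path_homotopic_imp_pathin by blast

lemma path_concat_ends [simp]: "path_concat p q 0 = p 0" "path_concat p q 1 = q 1"
  by (simp_all add: path_concat_def)

lemma path_concat_in:
  assumes "\<And>t. t \<in> {0..1} \<Longrightarrow> p t \<in> S" "\<And>t. t \<in> {0..1} \<Longrightarrow> q t \<in> S" "t \<in> {0..1}"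
  shows "path_concat p q t \<in> S"
  using assms(1)[of "2 * t"] assms(2)[of "2 * t - 1"] assms(3) by (auto simp: path_concat_def)

lemma comp_path_concat: "h \<circ> path_concat p q = path_concat (h \<circ> p) (h \<circ> q)"
  by (auto simp: path_concat_def)

lemma pathin_const': "x \<in> topspace X \<Longrightarrow> pathin X (\<lambda>_. x)"
  by (simp add: pathin_def)

lemma pathin_reverse:
  assumes "pathin X p"
  shows "pathin X (\<lambda>t. p (1 - t))"
proof -
  have "continuous_on {0..1} (\<lambda>t :: real. 1 - t)" by (intro continuous_intros)
  then show ?thesis
    by (intro path_homotopic_imp_pathin(1)[OF path_homotopic_reparam[OF assms, of "\<lambda>t. 1 - t" "\<lambda>t. 1 - t"]]) auto
qed

lemma path_homotopic_const_left: "pathin X r \<Longrightarrow> path_homotopic X (path_concat (\<lambda>_. r 0) r) r"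
proof -
  assume r: "pathin X r"
  have h: "path_homotopic X (\<lambda>t. r (max 0 (2 * t - 1))) r"
    by (rule path_homotopic_reparam_id[OF r]) (auto intro!: continuous_intros)
  have "path_homotopic X (\<lambda>t. r (max 0 (2 * t - 1))) (path_concat (\<lambda>_. r 0) r)"
  proof (rule path_homotopic_cong[OF path_homotopic_imp_pathin(1)[OF h]])
    fix t :: real
    show "r (max 0 (2 * t - 1)) = path_concat (\<lambda>_. r 0) r t"
      by (cases "t \<le> 1/2") (simp_all add: path_concat_def)
  qed
  then show ?thesis using h path_homotopic_sym path_homotopic_trans by blast
qed

lemma path_homotopic_const_right: "pathin X r \<Longrightarrow> path_homotopic X (path_concat r (\<lambda>_. r 1)) r"
proof -
  assume r: "pathin X r"
  have h: "path_homotopic X (\<lambda>t. r (min 1 (2 * t))) r"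
    by (rule path_homotopic_reparam_id[OF r]) (auto intro!: continuous_intros)
  have "path_homotopic X (\<lambda>t. r (min 1 (2 * t))) (path_concat r (\<lambda>_. r 1))"
  proof (rule path_homotopic_cong[OF path_homotopic_imp_pathin(1)[OF h]])
    fix t :: real
    show "r (min 1 (2 * t)) = path_concat r (\<lambda>_. r 1) t"
      by (cases "t \<le> 1/2") (simp_all add: path_concat_def)
  qed
  then show ?thesis using h path_homotopic_sym path_homotopic_trans by blast
qed

text \<open>Both sides are reparametrisations of the single path ?w: one walks to its end and back
  to the middle, the other walks directly to the middle.\<close>

lemma path_homotopic_cancel_right:
  assumes x: "pathin X x" and y: "pathin X y" and xy: "x 1 = y 0"
  shows "path_homotopic X (path_concat (path_concat x y) (\<lambda>t. y (1 - t))) x"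
proof -
  let ?w = "path_concat x y"
  have w: "pathin X ?w" by (rule pathin_concat[OF assms])
  \<comment> \<open>The first parameter climbs to 1 at t = 1/2 and falls back to 1/2 at t = 1, where
    t / 2 ends as well.\<close>
  have h: "path_homotopic X (\<lambda>t. ?w (min (2 * t) (3/2 - t))) (\<lambda>t. ?w (t / 2))"
    by (rule path_homotopic_reparam[OF w]) (auto intro!: continuous_intros)
  have "path_homotopic X (\<lambda>t. ?w (min (2 * t) (3/2 - t))) (path_concat ?w (\<lambda>t. y (1 - t)))"
  proof (rule path_homotopic_cong[OF path_homotopic_imp_pathin(1)[OF h]])
    fix t :: real assume t: "0 \<le> t" "t \<le> 1"
    consider "t \<le> 1/2" | "1/2 < t" "t < 1" | "t = 1" using t by linarith
    then show "?w (min (2 * t) (3/2 - t)) = path_concat ?w (\<lambda>t. y (1 - t)) t"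
    proof cases
      case 1
      then have "min (2 * t) (3/2 - t) = 2 * t" by simp
      then show ?thesis using 1 by (simp add: path_concat_def[of ?w])
    next
      case 2
      then have "min (2 * t) (3/2 - t) = 3/2 - t" by simp
      then show ?thesis using 2 by (simp add: path_concat_def algebra_simps)
    next
      case 3 then show ?thesis using xy by (simp add: path_concat_def min_def)
    qed
  qed
  moreover have "path_homotopic X (\<lambda>t. ?w (t / 2)) x"
    by (rule path_homotopic_cong[OF path_homotopic_imp_pathin(2)[OF h]]) (auto simp: path_concat_def)
  ultimately show ?thesis using h path_homotopic_sym path_homotopic_trans by blast
qed

text \<open>As before, but starting from the middle of ?w: one side goes back to the start and then
  to the end, the other goes directly to the end.\<close>

lemma path_homotopic_cancel_left:
  assumes x: "pathin X x" and y: "pathin X y" and xy: "x 1 = y 0"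
  shows "path_homotopic X (path_concat (\<lambda>t. x (1 - t)) (path_concat x y)) y"
proof -
  let ?w = "path_concat x y"
  have w: "pathin X ?w" by (rule pathin_concat[OF assms])
  \<comment> \<open>The first parameter falls from 1/2 to 0 at t = 1/2 and then climbs to 1; the
    second runs from 1/2 to 1.\<close>
  have h: "path_homotopic X (\<lambda>t. ?w (max (1/2 - t) (2 * t - 1))) (\<lambda>t. ?w (1/2 + t / 2))"
    by (rule path_homotopic_reparam[OF w]) (auto intro!: continuous_intros)
  have "path_homotopic X (\<lambda>t. ?w (max (1/2 - t) (2 * t - 1))) (path_concat (\<lambda>t. x (1 - t)) ?w)"
  proof (rule path_homotopic_cong[OF path_homotopic_imp_pathin(1)[OF h]])
    fix t :: real assume t: "0 \<le> t" "t \<le> 1"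
    consider "t \<le> 1/2" | "1/2 < t" using t by linarith
    then show "?w (max (1/2 - t) (2 * t - 1)) = path_concat (\<lambda>t. x (1 - t)) ?w t"
    proof cases
      case 1
      then have "max (1/2 - t) (2 * t - 1) = 1/2 - t" by simp
      moreover have "?w (1/2 - t) = x (1 - 2 * t)" using t by (simp add: path_concat_def algebra_simps)
      ultimately show ?thesis using 1 by (simp add: path_concat_def[of "\<lambda>t. x (1 - t)"])
    next
      case 2
      then have "max (1/2 - t) (2 * t - 1) = 2 * t - 1" by simp
      then show ?thesis using 2 by (simp add: path_concat_def[of "\<lambda>t. x (1 - t)"])
    qed
  qed
  moreover have "path_homotopic X (\<lambda>t. ?w (1/2 + t / 2)) y"
  proof (rule path_homotopic_cong[OF path_homotopic_imp_pathin(2)[OF h]])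
    fix t :: real assume "0 \<le> t" "t \<le> 1"
    then show "?w (1/2 + t / 2) = y t" using xy by (cases "t = 0") (auto simp: path_concat_def)
  qed
  ultimately show ?thesis using h path_homotopic_sym path_homotopic_trans by blast
qed

text \<open>Serves to multiply homotopies in the two quotient groups, with c the product of
  cosets.\<close>

lemma path_homotopic_pair:
  assumes p: "path_homotopic X p p'" and q: "path_homotopic Y q q'" and c: "continuous_map (prod_topology X Y) Z c"
  shows "path_homotopic Z (\<lambda>t. c (p t, q t)) (\<lambda>t. c (p' t, q' t))"
proof -
  let ?II = "prod_topology (top_of_set {0..1 :: real}) (top_of_set {0..1 :: real})"
  obtain h where h: "continuous_map ?II X h" "\<And>t. h (0, t) = p t" "\<And>t. h (1, t) = p' t"
    "\<And>s. s \<in> {0..1} \<Longrightarrow> h (s, 0) = p 0 \<and> h (s, 1) = p 1"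
    using p unfolding path_homotopic_def homotopic_with_def by blast
  obtain k where k: "continuous_map ?II Y k" "\<And>t. k (0, t) = q t" "\<And>t. k (1, t) = q' t"
    "\<And>s. s \<in> {0..1} \<Longrightarrow> k (s, 0) = q 0 \<and> k (s, 1) = q 1"
    using q unfolding path_homotopic_def homotopic_with_def by blast
  have "continuous_map ?II (prod_topology X Y) (\<lambda>z. (h z, k z))"
    using h(1) k(1) by (intro continuous_map_pairedI)
  from continuous_map_compose[OF this c] have "continuous_map ?II Z (\<lambda>z. c (h z, k z))" by (simp add: o_def)
  then show ?thesis unfolding path_homotopic_def homotopic_with_def
    by (intro exI[of _ "\<lambda>z. c (h z, k z)"]) (use h k in auto)
qed

lemma pathin_pair:
  "pathin X p \<Longrightarrow> pathin Y q \<Longrightarrow> continuous_map (prod_topology X Y) Z c \<Longrightarrow> pathin Z (\<lambda>t. c (p t, q t))"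
  using path_homotopic_pair[OF path_homotopic_refl path_homotopic_refl] path_homotopic_imp_pathin by blast

text \<open>Different representatives have homotopic concatenations, so the union in
  \<open>Comp\<close> consists of copies of one class; it is nonempty because p and q represent
  their own classes.\<close>

lemma Comp_path_class:
  assumes "pathin X p" "pathin X q" "p 1 = q 0"
  shows "Comp (fund_gpd X) (path_class X p) (path_class X q) = path_class X (path_concat p q)"
proof -
  have "path_class X (path_concat p' q') = path_class X (path_concat p q)"
    if "p' \<in> path_class X p" "q' \<in> path_class X q" for p' q'
    using that path_homotopic_concat[of X p p' q q'] assms(3) path_class_eq unfolding path_class_path_homotopic by blast
  moreover have "p \<in> path_class X p" "q \<in> path_class X q" using assms path_class_self by blast+
  ultimately have "(\<Union>p\<in>path_class X p. \<Union>q\<in>path_class X q. path_class X (path_concat p q)) = path_class X (path_concat p q)"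
    by blast
  then show ?thesis by (simp add: fund_gpd_def)
qed

lemma fund_map_class:
  assumes "continuous_map X Y h" "pathin X p"
  shows "snd (fund_map Y h) (path_class X p) = path_class Y (h \<circ> p)"
proof -
  have "path_class Y (h \<circ> p') = path_class Y (h \<circ> p)" if "p' \<in> path_class X p" for p'
    using that path_homotopic_compose[OF _ assms(1)] path_class_eq unfolding path_class_path_homotopic by blast
  moreover have "p \<in> path_class X p" using assms path_class_self by blast
  ultimately have "(\<Union>p\<in>path_class X p. path_class Y (h \<circ> p)) = path_class Y (h \<circ> p)" by blast
  then show ?thesis by (simp add: fund_map_def)
qed

lemma fund_gpd_simps:
  "Obj (fund_gpd X) = topspace X" "Idt (fund_gpd X) x = path_class X (\<lambda>_. x)"
  "m \<in> Hom (fund_gpd X) x y \<longleftrightarrow> (\<exists>p. m = path_class X p \<and> pathin X p \<and> p 0 = x \<and> p 1 = y)"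
  by (auto simp: fund_gpd_def)

lemma fund_map_morphism:
  assumes h: "continuous_map X Y h"
  shows "gpd_morphism (fund_gpd X) (fund_gpd Y) (fund_map Y h)"
  unfolding gpd_morphism_def fund_gpd_simps(1,2)
proof (intro conjI ballI)
  fix x assume x: "x \<in> topspace X"
  show "fst (fund_map Y h) x \<in> topspace Y"
    using x h by (auto simp: fund_map_def continuous_map_def)
  show "snd (fund_map Y h) (path_class X (\<lambda>_. x)) = path_class Y (\<lambda>_. fst (fund_map Y h) x)"
    using fund_map_class[OF h pathin_const'[OF x]] by (simp add: fund_map_def o_def)
next
  fix x y m assume "m \<in> Hom (fund_gpd X) x y"
  then obtain p where p: "m = path_class X p" "pathin X p" "p 0 = x" "p 1 = y" by (auto simp: fund_gpd_simps)
  show "snd (fund_map Y h) m \<in> Hom (fund_gpd Y) (fst (fund_map Y h) x) (fst (fund_map Y h) y)"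
    unfolding fund_gpd_simps p(1) fund_map_class[OF h p(2)]
    using p pathin_compose'[OF p(2) h] by (intro exI[of _ "h \<circ> p"]) (auto simp: fund_map_def)
next
  fix x y z m k assume "m \<in> Hom (fund_gpd X) x y" "k \<in> Hom (fund_gpd X) y z"
  then obtain p q where p: "m = path_class X p" "pathin X p" "p 0 = x" "p 1 = y"
    and q: "k = path_class X q" "pathin X q" "q 0 = y" "q 1 = z" by (auto simp: fund_gpd_simps)
  have pq: "p 1 = q 0" using p q by simp
  show "snd (fund_map Y h) (Comp (fund_gpd X) m k) = Comp (fund_gpd Y) (snd (fund_map Y h) m) (snd (fund_map Y h) k)"
    unfolding p(1) q(1) Comp_path_class[OF p(2) q(2) pq] fund_map_class[OF h p(2)] fund_map_class[OF h q(2)]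
      fund_map_class[OF h pathin_concat[OF p(2) q(2) pq]] comp_path_concat
    using pq by (subst Comp_path_class[OF pathin_compose'[OF p(2) h] pathin_compose'[OF q(2) h]]) auto
qed

section \<open>Composition of groupoid morphisms\<close>

lemma gpd_morphismD:
  assumes "gpd_morphism A B S"
  shows "x \<in> Obj A \<Longrightarrow> fst S x \<in> Obj B" "x \<in> Obj A \<Longrightarrow> snd S (Idt A x) = Idt B (fst S x)"
    "x \<in> Obj A \<Longrightarrow> y \<in> Obj A \<Longrightarrow> m \<in> Hom A x y \<Longrightarrow> snd S m \<in> Hom B (fst S x) (fst S y)"
    "x \<in> Obj A \<Longrightarrow> y \<in> Obj A \<Longrightarrow> z \<in> Obj A \<Longrightarrow> m \<in> Hom A x y \<Longrightarrow> k \<in> Hom A y z \<Longrightarrow>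
      snd S (Comp A m k) = Comp B (snd S m) (snd S k)"
proof -
  note S = assms[unfolded gpd_morphism_def]
  show "x \<in> Obj A \<Longrightarrow> fst S x \<in> Obj B" "x \<in> Obj A \<Longrightarrow> snd S (Idt A x) = Idt B (fst S x)"
    using S[THEN conjunct1] by blast+
  show "x \<in> Obj A \<Longrightarrow> y \<in> Obj A \<Longrightarrow> m \<in> Hom A x y \<Longrightarrow> snd S m \<in> Hom B (fst S x) (fst S y)"
    using S[THEN conjunct2, THEN conjunct1] by blast
  show "x \<in> Obj A \<Longrightarrow> y \<in> Obj A \<Longrightarrow> z \<in> Obj A \<Longrightarrow> m \<in> Hom A x y \<Longrightarrow> k \<in> Hom A y z \<Longrightarrow>
      snd S (Comp A m k) = Comp B (snd S m) (snd S k)"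
    using S[THEN conjunct2, THEN conjunct2] by blast
qed

lemma gpd_morphism_comp:
  assumes S: "gpd_morphism A B S" and T: "gpd_morphism B C T"
  shows "gpd_morphism A C (T \<circ>\<^sub>g S)"
  unfolding gpd_morphism_def gpd_comp_def fst_conv snd_conv o_apply
proof (intro conjI ballI)
  fix x assume x: "x \<in> Obj A"
  note B = gpd_morphismD(1)[OF S x]
  show "fst T (fst S x) \<in> Obj C" by (rule gpd_morphismD(1)[OF T B])
  show "snd T (snd S (Idt A x)) = Idt C (fst T (fst S x))"
    unfolding gpd_morphismD(2)[OF S x] by (rule gpd_morphismD(2)[OF T B])
next
  fix x y m assume "x \<in> Obj A" "y \<in> Obj A" "m \<in> Hom A x y"
  then show "snd T (snd S m) \<in> Hom C (fst T (fst S x)) (fst T (fst S y))"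
    by (intro gpd_morphismD(3)[OF T] gpd_morphismD(1)[OF S] gpd_morphismD(3)[OF S])
next
  fix x y z m k assume x: "x \<in> Obj A" "y \<in> Obj A" "z \<in> Obj A" "m \<in> Hom A x y" "k \<in> Hom A y z"
  show "snd T (snd S (Comp A m k)) = Comp C (snd T (snd S m)) (snd T (snd S k))"
    unfolding gpd_morphismD(4)[OF S x]
    by (rule gpd_morphismD(4)[OF T gpd_morphismD(1)[OF S x(1)] gpd_morphismD(1)[OF S x(2)] gpd_morphismD(1)[OF S x(3)]
        gpd_morphismD(3)[OF S x(1,2,4)] gpd_morphismD(3)[OF S x(2,3,5)]])
qed

section \<open>The definable fundamental groupoid\<close>

lemma unit_cube_lists [simp]:
  "[a] \<in> unit_cube (Suc 0) \<longleftrightarrow> 0 \<le> a \<and> a \<le> 1"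
  "[a, b] \<in> unit_cube 2 \<longleftrightarrow> 0 \<le> a \<and> a \<le> 1 \<and> 0 \<le> b \<and> b \<le> 1"
  by (auto simp: unit_cube_def)

lemma unit_cube_nth: "x \<in> unit_cube n \<Longrightarrow> i < n \<Longrightarrow> 0 \<le> x ! i" "x \<in> unit_cube n \<Longrightarrow> i < n \<Longrightarrow> x ! i \<le> 1"
  by (simp_all add: unit_cube_alt)

lemma unit_cube_1E:
  assumes "x \<in> unit_cube 1" obtains a where "x = [a]" "0 \<le> a" "a \<le> 1"
proof -
  have "length x = 1" using assms by (simp add: unit_cube_def)
  then obtain a where "x = [a]" by (auto simp: length_Suc_conv)
  then show ?thesis using that assms by simp
qed

lemmas st_intros = st_const st_plus st_minus st_max st_min st_nth
lemmas cont_at_intros = cont_at_const cont_at_add cont_at_diff cont_at_max cont_at_min cont_at_nth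

text \<open>The part of \<open>definable_group\<close> on which the theory of paths and homotopies
  rests.\<close>

definition dspace :: "('a::linordered_field, 'f, 'r) expansion \<Rightarrow> 'a dgroup \<Rightarrow> bool" where
  "dspace M G \<longleftrightarrow> definable_set M (carrier G) \<and> topspace (gtop G) = carrier G"

lemma definable_group_dspace: "definable_group M G \<Longrightarrow> dspace M G"
  by (simp add: definable_group_def topological_group_on_def dspace_def)

section \<open>Definable paths and homotopies\<close>

lemma def_cont_comp1:
  assumes "def_continuous_on_cube M G 1 p" "dspace M G" "st M n a" "\<And>x. length x = n \<Longrightarrow> cont_at n a x"
    "\<And>x. x \<in> unit_cube n \<Longrightarrow> 0 \<le> a x \<and> a x \<le> 1"
  shows "def_continuous_on_cube M G n (\<lambda>x. p [a x])"
proof (rule def_cont_comp[OF assms(1)])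
  show "vt M n 1 (\<lambda>x. [a x])" by (rule vt_singleI[OF assms(3) refl])
qed (use assms in \<open>auto simp: dspace_def\<close>)

lemma def_cont_comp2:
  assumes "def_continuous_on_cube M G 2 p" "dspace M G"
    "st M n a" "\<And>x. length x = n \<Longrightarrow> cont_at n a x" "\<And>x. x \<in> unit_cube n \<Longrightarrow> 0 \<le> a x \<and> a x \<le> 1"
    "st M n b" "\<And>x. length x = n \<Longrightarrow> cont_at n b x" "\<And>x. x \<in> unit_cube n \<Longrightarrow> 0 \<le> b x \<and> b x \<le> 1"
  shows "def_continuous_on_cube M G n (\<lambda>x. p [a x, b x])"
proof (rule def_cont_comp[OF assms(1)])
  have "vt M n 2 (\<lambda>x. [a x] @ [b x])"
    by (rule vt_append[OF vt_singleI[OF assms(3) refl] vt_singleI[OF assms(6) refl]]) simp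
  then show "vt M n 2 (\<lambda>x. [a x, b x])" by simp
  show "cont_at n (\<lambda>x. [a x, b x] ! i) x" if "length x = n" "i < 2" for x i
    using assms(4,7) that by (auto simp: less_2_cases_iff)
qed (use assms in \<open>auto simp: dspace_def\<close>)

lemma def_homotopicI:
  assumes "def_path M G p" "def_path M G q" "def_continuous_on_cube M G 2 h"
    "\<And>s. 0 \<le> s \<Longrightarrow> s \<le> 1 \<Longrightarrow> h [0, s] = p [s]" "\<And>s. 0 \<le> s \<Longrightarrow> s \<le> 1 \<Longrightarrow> h [1, s] = q [s]"
    "\<And>s. 0 \<le> s \<Longrightarrow> s \<le> 1 \<Longrightarrow> h [s, 0] = p [0]" "\<And>s. 0 \<le> s \<Longrightarrow> s \<le> 1 \<Longrightarrow> h [s, 1] = p [1]"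
  shows "def_homotopic M G p q"
  unfolding def_homotopic_def using assms by blast

lemma def_homotopicE:
  assumes "def_homotopic M G p q"
  obtains h where "def_path M G p" "def_path M G q" "def_continuous_on_cube M G 2 h"
    "\<And>s. 0 \<le> s \<Longrightarrow> s \<le> 1 \<Longrightarrow> h [0, s] = p [s]" "\<And>s. 0 \<le> s \<Longrightarrow> s \<le> 1 \<Longrightarrow> h [1, s] = q [s]"
    "\<And>s. 0 \<le> s \<Longrightarrow> s \<le> 1 \<Longrightarrow> h [s, 0] = p [0]" "\<And>s. 0 \<le> s \<Longrightarrow> s \<le> 1 \<Longrightarrow> h [s, 1] = p [1]"
  using assms unfolding def_homotopic_def by blast

lemma def_homotopic_paths: "def_homotopic M G p q \<Longrightarrow> def_path M G p" "def_homotopic M G p q \<Longrightarrow> def_path M G q"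
  by (auto simp: def_homotopic_def)

lemma def_homotopic_endpoints:
  assumes "def_homotopic M G p q" shows "q [0] = p [0]" "q [1] = p [1]"
proof -
  obtain h where h: "\<And>s. 0 \<le> s \<Longrightarrow> s \<le> 1 \<Longrightarrow> h [1, s] = q [s]"
    "\<And>s. 0 \<le> s \<Longrightarrow> s \<le> 1 \<Longrightarrow> h [s, 0] = p [0]" "\<And>s. 0 \<le> s \<Longrightarrow> s \<le> 1 \<Longrightarrow> h [s, 1] = p [1]"
    using assms unfolding def_homotopic_def by blast
  show "q [0] = p [0]" "q [1] = p [1]" using h(1)[of 0] h(1)[of 1] h(2)[of 1] h(3)[of 1] by simp_all
qed

lemma def_path_mem: "def_path M G p \<Longrightarrow> 0 \<le> s \<Longrightarrow> s \<le> 1 \<Longrightarrow> p [s] \<in> carrier G"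
  unfolding def_path_def by (erule def_cont_mem) simp

lemma def_path_cong: "(\<And>s. 0 \<le> s \<Longrightarrow> s \<le> 1 \<Longrightarrow> p [s] = q [s]) \<Longrightarrow> def_path M G p = def_path M G q"
  unfolding def_path_def by (rule def_cont_cong) (metis unit_cube_1E)

lemma def_homotopic_cong:
  assumes p: "def_path M G p" and G: "dspace M G" and eq: "\<And>s. 0 \<le> s \<Longrightarrow> s \<le> 1 \<Longrightarrow> p [s] = q [s]"
  shows "def_homotopic M G p q"
proof (rule def_homotopicI)
  show "def_path M G p" "def_path M G q" using p def_path_cong[of p q M G] eq by blast+
  show "def_continuous_on_cube M G 2 (\<lambda>x. p [x ! 1])"
  proof (rule def_cont_comp1[OF p[unfolded def_path_def] G])
    show "st M 2 (\<lambda>x. x ! 1)" by (rule st_nth[OF vt_id]) simp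
  qed (auto intro: cont_at_nth unit_cube_nth)
qed (use eq in auto)

lemma def_homotopic_refl: "def_path M G p \<Longrightarrow> dspace M G \<Longrightarrow> def_homotopic M G p p"
  by (rule def_homotopic_cong) auto

lemma def_homotopic_sym:
  assumes "def_homotopic M G p q" and G: "dspace M G" shows "def_homotopic M G q p"
proof -
  obtain h where h: "def_path M G p" "def_path M G q" "def_continuous_on_cube M G 2 h"
    "\<And>s. 0 \<le> s \<Longrightarrow> s \<le> 1 \<Longrightarrow> h [0, s] = p [s]" "\<And>s. 0 \<le> s \<Longrightarrow> s \<le> 1 \<Longrightarrow> h [1, s] = q [s]"
    "\<And>s. 0 \<le> s \<Longrightarrow> s \<le> 1 \<Longrightarrow> h [s, 0] = p [0]" "\<And>s. 0 \<le> s \<Longrightarrow> s \<le> 1 \<Longrightarrow> h [s, 1] = p [1]"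
    by (rule def_homotopicE[OF assms(1)]) blast
  show ?thesis
  proof (rule def_homotopicI)
    show "def_continuous_on_cube M G 2 (\<lambda>x. h [1 - x ! 0, x ! 1])"
    proof (rule def_cont_comp2[OF h(3) G])
      show "st M 2 (\<lambda>x. 1 - x ! 0)" by (rule st_intros vt_id | simp)+
      show "st M 2 (\<lambda>x. x ! 1)" by (rule st_intros vt_id | simp)+
      show "cont_at 2 (\<lambda>x. 1 - x ! 0) x" for x :: "'a list" by (rule cont_at_intros | simp)+
      show "cont_at 2 (\<lambda>x. x ! 1) x" for x :: "'a list" by (rule cont_at_intros | simp)+
    qed (auto simp: unit_cube_nth)
  qed (use h def_homotopic_endpoints[OF assms(1)] in auto)
qed

lemma def_homotopic_trans:
  assumes pq: "def_homotopic M G p q" and qr: "def_homotopic M G q r" and G: "dspace M G"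
  shows "def_homotopic M G p r"
proof -
  obtain h where h: "def_path M G p" "def_path M G q" "def_continuous_on_cube M G 2 h"
    "\<And>s. 0 \<le> s \<Longrightarrow> s \<le> 1 \<Longrightarrow> h [0, s] = p [s]" "\<And>s. 0 \<le> s \<Longrightarrow> s \<le> 1 \<Longrightarrow> h [1, s] = q [s]"
    "\<And>s. 0 \<le> s \<Longrightarrow> s \<le> 1 \<Longrightarrow> h [s, 0] = p [0]" "\<And>s. 0 \<le> s \<Longrightarrow> s \<le> 1 \<Longrightarrow> h [s, 1] = p [1]"
    by (rule def_homotopicE[OF pq]) blast
  obtain k where k: "def_path M G q" "def_path M G r" "def_continuous_on_cube M G 2 k"
    "\<And>s. 0 \<le> s \<Longrightarrow> s \<le> 1 \<Longrightarrow> k [0, s] = q [s]" "\<And>s. 0 \<le> s \<Longrightarrow> s \<le> 1 \<Longrightarrow> k [1, s] = r [s]"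
    "\<And>s. 0 \<le> s \<Longrightarrow> s \<le> 1 \<Longrightarrow> k [s, 0] = q [0]" "\<And>s. 0 \<le> s \<Longrightarrow> s \<le> 1 \<Longrightarrow> k [s, 1] = q [1]"
    by (rule def_homotopicE[OF qr]) blast
  define H where "H = (\<lambda>x :: 'a list. if x ! 0 \<le> 1/2 then h [min 1 (x ! 0 + x ! 0), x ! 1] else k [max 0 (x ! 0 + x ! 0 - 1), x ! 1])"
  show ?thesis
  proof (rule def_homotopicI)
    show "def_continuous_on_cube M G 2 H" unfolding H_def
    proof (rule def_cont_paste)
      show "def_continuous_on_cube M G 2 (\<lambda>x. h [min 1 (x ! 0 + x ! 0), x ! 1])"
      proof (rule def_cont_comp2[OF h(3) G])
        show "st M 2 (\<lambda>x. min 1 (x ! 0 + x ! 0))" by (rule st_intros vt_id | simp)+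
        show "st M 2 (\<lambda>x. x ! 1)" by (rule st_intros vt_id | simp)+
        show "cont_at 2 (\<lambda>x. min 1 (x ! 0 + x ! 0)) x" for x :: "'a list" by (rule cont_at_intros | simp)+
        show "cont_at 2 (\<lambda>x. x ! 1) x" for x :: "'a list" by (rule cont_at_intros | simp)+
      qed (auto simp: unit_cube_nth)
      show "def_continuous_on_cube M G 2 (\<lambda>x. k [max 0 (x ! 0 + x ! 0 - 1), x ! 1])"
      proof (rule def_cont_comp2[OF k(3) G])
        show "st M 2 (\<lambda>x. max 0 (x ! 0 + x ! 0 - 1))" by (rule st_intros vt_id | simp)+
        show "st M 2 (\<lambda>x. x ! 1)" by (rule st_intros vt_id | simp)+
        show "cont_at 2 (\<lambda>x. max 0 (x ! 0 + x ! 0 - 1)) x" for x :: "'a list" by (rule cont_at_intros | simp)+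
        show "cont_at 2 (\<lambda>x. x ! 1) x" for x :: "'a list" by (rule cont_at_intros | simp)+
        show "0 \<le> max 0 (x ! 0 + x ! 0 - 1) \<and> max 0 (x ! 0 + x ! 0 - 1) \<le> 1" if "x \<in> unit_cube 2" for x
          using unit_cube_nth(2)[OF that, of 0] by simp
      qed (auto simp: unit_cube_nth)
      show "h [min 1 (x ! 0 + x ! 0), x ! 1] = k [max 0 (x ! 0 + x ! 0 - 1), x ! 1]"
        if "x \<in> unit_cube 2" "x ! 0 = 1/2" for x
        using h(5)[of "x ! 1"] k(4)[of "x ! 1"] unit_cube_nth[OF that(1), of 1] that(2) by simp
      show "definable_set M (carrier G)" using G by (simp add: dspace_def)
    qed simp
    have "1 \<le> (1 :: 'a) + 1" by simp
    then show "H [1, s] = r [s]" if "0 \<le> s" "s \<le> 1" for s using k(5)[OF that] by (simp add: H_def)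
    show "H [0, s] = p [s]" if "0 \<le> s" "s \<le> 1" for s using h(4)[OF that] by (simp add: H_def)
    show "H [s, 0] = p [0]" if s: "0 \<le> s" "s \<le> 1" for s
    proof -
      have "h [min 1 (s + s), 0] = p [0]" by (rule h(6)) (use s in auto)
      moreover have "k [max 0 (s + s - 1), 0] = p [0]"
        unfolding def_homotopic_endpoints(1)[OF pq, symmetric] by (rule k(6)) (use s in auto)
      ultimately show ?thesis 
        unfolding H_def by (simp only: nth_Cons_0 nth_Cons_Suc One_nat_def split: if_split) simp
    qed
    show "H [s, 1] = p [1]" if s: "0 \<le> s" "s \<le> 1" for s
    proof -
      have "h [min 1 (s + s), 1] = p [1]" by (rule h(7)) (use s in auto)
      moreover have "k [max 0 (s + s - 1), 1] = p [1]"
        unfolding def_homotopic_endpoints(2)[OF pq, symmetric] by (rule k(7)) (use s in auto)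
      ultimately show ?thesis 
        unfolding H_def by (simp only: nth_Cons_0 nth_Cons_Suc One_nat_def split: if_split) simp
    qed
  qed (use h k in auto)
qed

lemma def_path_class_eq: "def_homotopic M G p q \<Longrightarrow> dspace M G \<Longrightarrow> def_path_class M G p = def_path_class M G q"
  unfolding def_path_class_def using def_homotopic_sym def_homotopic_trans by blast

lemma def_path_class_self: "def_path M G p \<Longrightarrow> dspace M G \<Longrightarrow> p \<in> def_path_class M G p"
  unfolding def_path_class_def using def_homotopic_refl by blast

lemma def_homotopic_concat:
  assumes pq: "def_homotopic M G p p'" and qr: "def_homotopic M G q q'" and G: "dspace M G" and eq: "p [1] = q [0]"
  shows "def_homotopic M G (def_path_concat p q) (def_path_concat p' q')"
proof -
  have path: "def_path M G (def_path_concat p q)" if p: "def_path M G p" and q: "def_path M G q" and eq: "p [1] = q [0]" for p q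
  proof -
    have "def_continuous_on_cube M G 1 (\<lambda>x. if x ! 0 \<le> 1/2 then p [min 1 (x ! 0 + x ! 0)] else q [max 0 (x ! 0 + x ! 0 - 1)])"
    proof (rule def_cont_paste)
      show "def_continuous_on_cube M G 1 (\<lambda>x. p [min 1 (x ! 0 + x ! 0)])"
      proof (rule def_cont_comp1[OF p[unfolded def_path_def] G])
        show "st M 1 (\<lambda>x. min 1 (x ! 0 + x ! 0))" by (rule st_intros vt_id | simp)+
        show "cont_at 1 (\<lambda>x. min 1 (x ! 0 + x ! 0)) x" for x :: "'a list" by (rule cont_at_intros | simp)+
      qed (auto simp: unit_cube_nth)
      show "def_continuous_on_cube M G 1 (\<lambda>x. q [max 0 (x ! 0 + x ! 0 - 1)])"
      proof (rule def_cont_comp1[OF q[unfolded def_path_def] G])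
        show "st M 1 (\<lambda>x. max 0 (x ! 0 + x ! 0 - 1))" by (rule st_intros vt_id | simp)+
        show "cont_at 1 (\<lambda>x. max 0 (x ! 0 + x ! 0 - 1)) x" for x :: "'a list" by (rule cont_at_intros | simp)+
        show "0 \<le> max 0 (x ! 0 + x ! 0 - 1) \<and> max 0 (x ! 0 + x ! 0 - 1) \<le> 1" if "x \<in> unit_cube 1" for x
          using unit_cube_nth(2)[OF that, of 0] by simp
      qed
      show "definable_set M (carrier G)" using G by (simp add: dspace_def)
    qed (use eq in auto)
    moreover have "def_path_concat p q x = (if x ! 0 \<le> 1/2 then p [min 1 (x ! 0 + x ! 0)] else q [max 0 (x ! 0 + x ! 0 - 1)])"
      if "x \<in> unit_cube 1" for x
      using that by (rule unit_cube_1E) (auto simp: def_path_concat_def)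
    ultimately show ?thesis unfolding def_path_def by (subst def_cont_cong) auto
  qed
  obtain h where h: "def_path M G p" "def_path M G p'" "def_continuous_on_cube M G 2 h"
    "\<And>s. 0 \<le> s \<Longrightarrow> s \<le> 1 \<Longrightarrow> h [0, s] = p [s]" "\<And>s. 0 \<le> s \<Longrightarrow> s \<le> 1 \<Longrightarrow> h [1, s] = p' [s]"
    "\<And>s. 0 \<le> s \<Longrightarrow> s \<le> 1 \<Longrightarrow> h [s, 0] = p [0]" "\<And>s. 0 \<le> s \<Longrightarrow> s \<le> 1 \<Longrightarrow> h [s, 1] = p [1]"
    by (rule def_homotopicE[OF pq]) blast
  obtain k where k: "def_path M G q" "def_path M G q'" "def_continuous_on_cube M G 2 k"
    "\<And>s. 0 \<le> s \<Longrightarrow> s \<le> 1 \<Longrightarrow> k [0, s] = q [s]" "\<And>s. 0 \<le> s \<Longrightarrow> s \<le> 1 \<Longrightarrow> k [1, s] = q' [s]"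
    "\<And>s. 0 \<le> s \<Longrightarrow> s \<le> 1 \<Longrightarrow> k [s, 0] = q [0]" "\<And>s. 0 \<le> s \<Longrightarrow> s \<le> 1 \<Longrightarrow> k [s, 1] = q [1]"
    by (rule def_homotopicE[OF qr]) blast
  define H where "H = (\<lambda>x :: 'a list. if x ! 1 \<le> 1/2 then h [x ! 0, min 1 (x ! 1 + x ! 1)] else k [x ! 0, max 0 (x ! 1 + x ! 1 - 1)])"
  show ?thesis
  proof (rule def_homotopicI)
    show "def_path M G (def_path_concat p q)" by (rule path[OF h(1) k(1) eq])
    show "def_path M G (def_path_concat p' q')"
      by (rule path[OF h(2) k(2)]) (use eq def_homotopic_endpoints[OF pq] def_homotopic_endpoints[OF qr] in simp)
    show "def_continuous_on_cube M G 2 H" unfolding H_def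
    proof (rule def_cont_paste)
      show "def_continuous_on_cube M G 2 (\<lambda>x. h [x ! 0, min 1 (x ! 1 + x ! 1)])"
      proof (rule def_cont_comp2[OF h(3) G])
        show "st M 2 (\<lambda>x. min 1 (x ! 1 + x ! 1))" by (rule st_intros vt_id | simp)+
        show "st M 2 (\<lambda>x. x ! 0)" by (rule st_intros vt_id | simp)+
        show "cont_at 2 (\<lambda>x. min 1 (x ! 1 + x ! 1)) x" for x :: "'a list" by (rule cont_at_intros | simp)+
        show "cont_at 2 (\<lambda>x. x ! 0) x" for x :: "'a list" by (rule cont_at_intros | simp)+
      qed (auto simp: unit_cube_nth)
      show "def_continuous_on_cube M G 2 (\<lambda>x. k [x ! 0, max 0 (x ! 1 + x ! 1 - 1)])"
      proof (rule def_cont_comp2[OF k(3) G])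
        show "st M 2 (\<lambda>x. max 0 (x ! 1 + x ! 1 - 1))" by (rule st_intros vt_id | simp)+
        show "st M 2 (\<lambda>x. x ! 0)" by (rule st_intros vt_id | simp)+
        show "cont_at 2 (\<lambda>x. max 0 (x ! 1 + x ! 1 - 1)) x" for x :: "'a list" by (rule cont_at_intros | simp)+
        show "cont_at 2 (\<lambda>x. x ! 0) x" for x :: "'a list" by (rule cont_at_intros | simp)+
        show "0 \<le> max 0 (x ! 1 + x ! 1 - 1) \<and> max 0 (x ! 1 + x ! 1 - 1) \<le> 1" if "x \<in> unit_cube 2" for x
          using unit_cube_nth(2)[OF that, of 1] by simp
      qed (auto simp: unit_cube_nth)
      show "h [x ! 0, min 1 (x ! 1 + x ! 1)] = k [x ! 0, max 0 (x ! 1 + x ! 1 - 1)]"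
        if "x \<in> unit_cube 2" "x ! 1 = 1/2" for x
        using h(7)[of "x ! 0"] k(6)[of "x ! 0"] unit_cube_nth[OF that(1), of 0] that(2) eq by simp
      show "definable_set M (carrier G)" using G by (simp add: dspace_def)
    qed simp
    show "H [0, s] = def_path_concat p q [s]" if s: "0 \<le> s" "s \<le> 1" for s
      using h(4)[of "min 1 (s + s)"] k(4)[of "max 0 (s + s - 1)"] s by (auto simp: H_def def_path_concat_def)
    show "H [1, s] = def_path_concat p' q' [s]" if s: "0 \<le> s" "s \<le> 1" for s
      using h(5)[of "min 1 (s + s)"] k(5)[of "max 0 (s + s - 1)"] s by (auto simp: H_def def_path_concat_def)
    show "H [s, 0] = def_path_concat p q [0]" if s: "0 \<le> s" "s \<le> 1" for s
      using h(6)[OF s] by (simp add: H_def def_path_concat_def)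
    show "H [s, 1] = def_path_concat p q [1]" if s: "0 \<le> s" "s \<le> 1" for s
      using k(7)[OF s] by (simp add: H_def def_path_concat_def)
  qed
qed

lemma def_path_concat: "def_path M G p \<Longrightarrow> def_path M G q \<Longrightarrow> dspace M G \<Longrightarrow> p [1] = q [0] \<Longrightarrow> def_path M G (def_path_concat p q)"
  using def_homotopic_concat[OF def_homotopic_refl def_homotopic_refl] def_homotopic_paths by blast

lemma def_path_concat_ends [simp]: "def_path_concat p q [0] = p [0]" "def_path_concat p q [1] = q [1]"
  by (simp_all add: def_path_concat_def)

lemma comp_def_path_concat: "h \<circ> def_path_concat p q = def_path_concat (h \<circ> p) (h \<circ> q)"
  by (auto simp: def_path_concat_def)

lemma Comp_def_path_class:
  assumes "def_path M G p" "def_path M G q" "dspace M G" "p [1] = q [0]"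
  shows "Comp (def_fund_gpd M G) (def_path_class M G p) (def_path_class M G q) = def_path_class M G (def_path_concat p q)"
proof -
  have "def_path_class M G (def_path_concat p' q') = def_path_class M G (def_path_concat p q)"
    if "p' \<in> def_path_class M G p" "q' \<in> def_path_class M G q" for p' q'
  proof -
    have "def_homotopic M G p p'" "def_homotopic M G q q'" using that by (auto simp: def_path_class_def)
    then have "def_homotopic M G (def_path_concat p q) (def_path_concat p' q')"
      using def_homotopic_concat assms(3,4) by blast
    then show ?thesis using def_path_class_eq assms(3) by blast
  qed
  moreover have "p \<in> def_path_class M G p" "q \<in> def_path_class M G q"
    using assms def_path_class_self by blast+
  ultimately have "(\<Union>p\<in>def_path_class M G p. \<Union>q\<in>def_path_class M G q. def_path_class M G (def_path_concat p q)) =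
      def_path_class M G (def_path_concat p q)" by blast
  then show ?thesis by (simp add: def_fund_gpd_def)
qed

lemma def_fund_gpd_simps:
  "Obj (def_fund_gpd M G) = carrier G" "Idt (def_fund_gpd M G) x = def_path_class M G (\<lambda>_. x)"
  "m \<in> Hom (def_fund_gpd M G) x y \<longleftrightarrow> (\<exists>p. m = def_path_class M G p \<and> def_path M G p \<and> p [0] = x \<and> p [1] = y)"
  by (auto simp: def_fund_gpd_def)

text \<open>Group structure is left out on purpose: the slices x |-> (x, y) and the shear have to be
  covered.\<close>

definition cdmap :: "('a::linordered_field, 'f, 'r) expansion \<Rightarrow> 'a dgroup \<Rightarrow> 'a dgroup \<Rightarrow> ('a list \<Rightarrow> 'a list) \<Rightarrow> bool" where
  "cdmap M G G' k \<longleftrightarrow> dspace M G \<and> dspace M G' \<and> definable_map M (carrier G) (carrier G') k \<and> continuous_map (gtop G) (gtop G') k"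

lemma cdmap_def_cont:
  "cdmap M G G' k \<Longrightarrow> def_continuous_on_cube M G n h \<Longrightarrow> def_continuous_on_cube M G' n (k \<circ> h)"
  unfolding cdmap_def dspace_def using def_cont_compose_map by blast

lemma cdmap_def_path: "cdmap M G G' k \<Longrightarrow> def_path M G p \<Longrightarrow> def_path M G' (k \<circ> p)"
  unfolding def_path_def by (rule cdmap_def_cont)

lemma cdmap_mem: "cdmap M G G' k \<Longrightarrow> x \<in> carrier G \<Longrightarrow> k x \<in> carrier G'"
  by (auto simp: cdmap_def definable_map_def)

lemma cdmap_def_homotopic:
  assumes k: "cdmap M G G' k" and pq: "def_homotopic M G p q"
  shows "def_homotopic M G' (k \<circ> p) (k \<circ> q)"
proof -
  obtain h where h: "def_path M G p" "def_path M G q" "def_continuous_on_cube M G 2 h"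
    "\<And>s. 0 \<le> s \<Longrightarrow> s \<le> 1 \<Longrightarrow> h [0, s] = p [s]" "\<And>s. 0 \<le> s \<Longrightarrow> s \<le> 1 \<Longrightarrow> h [1, s] = q [s]"
    "\<And>s. 0 \<le> s \<Longrightarrow> s \<le> 1 \<Longrightarrow> h [s, 0] = p [0]" "\<And>s. 0 \<le> s \<Longrightarrow> s \<le> 1 \<Longrightarrow> h [s, 1] = p [1]"
    by (rule def_homotopicE[OF pq]) blast
  show ?thesis
    by (rule def_homotopicI[OF cdmap_def_path[OF k h(1)] cdmap_def_path[OF k h(2)] cdmap_def_cont[OF k h(3)]])
      (use h in auto)
qed

lemma def_fund_map_class:
  assumes k: "cdmap M G G' k" and p: "def_path M G p"
  shows "snd (def_fund_map M G' k) (def_path_class M G p) = def_path_class M G' (k \<circ> p)"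
proof -
  have G: "dspace M G" "dspace M G'" using k by (auto simp: cdmap_def)
  have "def_path_class M G' (k \<circ> q) = def_path_class M G' (k \<circ> p)" if "q \<in> def_path_class M G p" for q
  proof -
    have "def_homotopic M G p q" using that by (simp add: def_path_class_def)
    from def_path_class_eq[OF cdmap_def_homotopic[OF k this] G(2)] show ?thesis by simp
  qed
  moreover have "p \<in> def_path_class M G p" using def_path_class_self[OF p G(1)] .
  ultimately have "(\<Union>p\<in>def_path_class M G p. def_path_class M G' (k \<circ> p)) = def_path_class M G' (k \<circ> p)" by blast
  then show ?thesis by (simp add: def_fund_map_def)
qed

lemma def_fund_map_morphism:
  assumes k: "cdmap M G G' k"
  shows "gpd_morphism (def_fund_gpd M G) (def_fund_gpd M G') (def_fund_map M G' k)"
  unfolding gpd_morphism_def def_fund_gpd_simps(1,2)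
proof (intro conjI ballI)
  have G: "dspace M G" "dspace M G'" using k by (auto simp: cdmap_def)
  have fst: "fst (def_fund_map M G' k) = k" by (simp add: def_fund_map_def)
  {
    fix x assume x: "x \<in> carrier G"
    show "fst (def_fund_map M G' k) x \<in> carrier G'" unfolding fst by (rule cdmap_mem[OF k x])
    have "def_path M G (\<lambda>_. x)" unfolding def_path_def
      using x G(1) unfolding dspace_def by (intro def_cont_const) auto
    from def_fund_map_class[OF k this]
    show "snd (def_fund_map M G' k) (def_path_class M G (\<lambda>_. x)) = def_path_class M G' (\<lambda>_. fst (def_fund_map M G' k) x)"
      unfolding fst by (simp add: o_def)
  next
    fix x y m assume "m \<in> Hom (def_fund_gpd M G) x y"
    then obtain p where p: "m = def_path_class M G p" "def_path M G p" "p [0] = x" "p [1] = y" by (auto simp: def_fund_gpd_simps)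
    show "snd (def_fund_map M G' k) m \<in> Hom (def_fund_gpd M G') (fst (def_fund_map M G' k) x) (fst (def_fund_map M G' k) y)"
      unfolding def_fund_gpd_simps p(1) def_fund_map_class[OF k p(2)] fst
      using p cdmap_def_path[OF k p(2)] by (intro exI[of _ "k \<circ> p"]) auto
  next
    fix x y z m j assume "m \<in> Hom (def_fund_gpd M G) x y" "j \<in> Hom (def_fund_gpd M G) y z"
    then obtain p q where p: "m = def_path_class M G p" "def_path M G p" "p [0] = x" "p [1] = y"
      and q: "j = def_path_class M G q" "def_path M G q" "q [0] = y" "q [1] = z" by (auto simp: def_fund_gpd_simps)
    have pq: "p [1] = q [0]" using p q by simp
    then have kpq: "(k \<circ> p) [1] = (k \<circ> q) [0]" by simp
    show "snd (def_fund_map M G' k) (Comp (def_fund_gpd M G) m j) =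
        Comp (def_fund_gpd M G') (snd (def_fund_map M G' k) m) (snd (def_fund_map M G' k) j)"
      unfolding p(1) q(1) Comp_def_path_class[OF p(2) q(2) G(1) pq] def_fund_map_class[OF k p(2)] def_fund_map_class[OF k q(2)]
        def_fund_map_class[OF k def_path_concat[OF p(2) q(2) G(1) pq]] comp_def_path_concat
        Comp_def_path_class[OF cdmap_def_path[OF k p(2)] cdmap_def_path[OF k q(2)] G(2) kpq] ..
  }
qed

text \<open>The square is filled by F, so its diagonal can be pushed onto two of its sides. In a
  product group this separates the motion in the two factors.\<close>

lemma def_homotopic_diagonal:
  assumes F: "def_continuous_on_cube M G 2 F" and G: "dspace M G"
  shows "def_homotopic M G (\<lambda>x. F [hd x, hd x]) (def_path_concat (\<lambda>x. F [hd x, 0]) (\<lambda>x. F [1, hd x]))"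
proof -
  have hd: "hd x = x ! 0" if "x \<in> unit_cube 1" for x :: "'a list" using that by (rule unit_cube_1E) simp
  have side: "def_path M G (\<lambda>x. F [a (x ! 0), b (x ! 0)])"
    if ab: "st M 1 (\<lambda>x. a (x ! 0))" "st M 1 (\<lambda>x. b (x ! 0))" "\<And>x. length x = 1 \<Longrightarrow> cont_at 1 (\<lambda>x. a (x ! 0)) x"
        "\<And>x. length x = 1 \<Longrightarrow> cont_at 1 (\<lambda>x. b (x ! 0)) x"
      and bd: "\<And>s. 0 \<le> s \<Longrightarrow> s \<le> 1 \<Longrightarrow> 0 \<le> a s \<and> a s \<le> 1 \<and> 0 \<le> b s \<and> b s \<le> 1" for a b
    unfolding def_path_def
  proof (rule def_cont_comp2[OF F G ab(1) ab(3) _ ab(2) ab(4)])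
    fix x :: "'a list" assume "x \<in> unit_cube 1"
    then have "0 \<le> x ! 0" "x ! 0 \<le> 1" using unit_cube_nth[of x 1 0] by auto
    from bd[OF this] show "0 \<le> a (x ! 0) \<and> a (x ! 0) \<le> 1" "0 \<le> b (x ! 0) \<and> b (x ! 0) \<le> 1" by auto
  qed
  have "def_path M G (\<lambda>x. F [x ! 0, x ! 0])" "def_path M G (\<lambda>x. F [x ! 0, 0])" "def_path M G (\<lambda>x. F [1, x ! 0])"
    by (rule side st_intros vt_id cont_at_intros | simp)+
  then have p: "def_path M G (\<lambda>x. F [hd x, hd x])" "def_path M G (\<lambda>x. F [hd x, 0])" "def_path M G (\<lambda>x. F [1, hd x])"
    by (simp_all add: def_path_cong[of "\<lambda>x. F [hd x, hd x]" "\<lambda>x. F [x ! 0, x ! 0]"]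
        def_path_cong[of "\<lambda>x. F [hd x, 0]" "\<lambda>x. F [x ! 0, 0]"] def_path_cong[of "\<lambda>x. F [1, hd x]" "\<lambda>x. F [1, x ! 0]"])
  \<comment> \<open>At deformation parameter 0 both coordinates equal s; at 1 they run along the two
    sides. Shifting one argument of a maximum or minimum makes the deformation piecewise linear, so
    the continuity rules for sums, maxima and minima suffice, whereas a straight-line homotopy would
    multiply coordinates.\<close>
  define u v where "u = (\<lambda>x :: 'a list. max (x ! 1) (min 1 (x ! 1 + x ! 1) - 1 + x ! 0))"
    and "v = (\<lambda>x :: 'a list. min (x ! 1) (max 0 (x ! 1 + x ! 1 - 1) + 1 - x ! 0))"
  show ?thesis
  proof (rule def_homotopicI)
    show "def_path M G (\<lambda>x. F [hd x, hd x])" by (rule p(1))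
    show "def_path M G (def_path_concat (\<lambda>x. F [hd x, 0]) (\<lambda>x. F [1, hd x]))"
      by (rule def_path_concat[OF p(2,3) G]) simp
    show "def_continuous_on_cube M G 2 (\<lambda>x. F [u x, v x])"
    proof (rule def_cont_comp2[OF F G])
      show "st M 2 u" unfolding u_def by (rule st_intros vt_id | simp)+
      show "st M 2 v" unfolding v_def by (rule st_intros vt_id | simp)+
      show "cont_at 2 u x" for x :: "'a list" unfolding u_def by (rule cont_at_intros | simp)+
      show "cont_at 2 v x" for x :: "'a list" unfolding v_def by (rule cont_at_intros | simp)+
      fix x :: "'a list" assume x: "x \<in> unit_cube 2"
      have b: "0 \<le> x ! 0" "x ! 0 \<le> 1" "0 \<le> x ! 1" "x ! 1 \<le> 1" using unit_cube_nth[OF x] by auto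
      have "min 1 (x ! 1 + x ! 1) - 1 + x ! 0 \<le> 1" using b min.cobounded1[of 1 "x ! 1 + x ! 1"] by linarith
      then show "0 \<le> u x \<and> u x \<le> 1" using b by (auto simp: u_def le_max_iff_disj)
      have "0 \<le> max 0 (x ! 1 + x ! 1 - 1) + 1 - x ! 0" using b max.cobounded1[of 0 "x ! 1 + x ! 1 - 1"] by linarith
      then show "0 \<le> v x \<and> v x \<le> 1" using b by (auto simp: v_def min_le_iff_disj)
    qed
    fix s :: 'a assume s: "0 \<le> s" "s \<le> 1"
    have m1: "min 1 (s + s) \<le> 1" "0 \<le> max 0 (s + s - 1)" by simp_all
    have "u [0, s] = s" "v [0, s] = s"
      using s m1 by (auto simp: u_def v_def max_def min_def)
    then show "F [u [0, s], v [0, s]] = F [hd [s], hd [s]]" by simp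
    have "u [s, 0] = 0" "v [s, 0] = 0" using s by (auto simp: u_def v_def max_def min_def)
    then show "F [u [s, 0], v [s, 0]] = F [hd [0], hd [0]]" by simp
    have "u [s, 1] = 1" "v [s, 1] = 1" using s by (auto simp: u_def v_def max_def min_def)
    then show "F [u [s, 1], v [s, 1]] = F [hd [1], hd [1]]" by simp
    show "F [u [1, s], v [1, s]] = def_path_concat (\<lambda>x. F [hd x, 0]) (\<lambda>x. F [1, hd x]) [s]"
    proof (cases "s \<le> 1/2")
      case True
      then have "s + s \<le> 1" by simp
      then have "u [1, s] = s + s" "v [1, s] = 0" using s by (auto simp: u_def v_def max_def min_def)
      then show ?thesis using True by (simp add: def_path_concat_def)
    next
      case False
      then have "1 < s + s" by simp
      then have "u [1, s] = 1" "v [1, s] = s + s - 1" using s by (auto simp: u_def v_def max_def min_def)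
      then show ?thesis using False by (simp add: def_path_concat_def)
    qed
  qed
qed

section \<open>Type-definable sets and the logic topology\<close>

context tame_structure
begin

text \<open>Fixes the dimension that \<open>type_definable\<close> quantifies existentially.\<close>

definition tdef :: "nat \<Rightarrow> 'a list set \<Rightarrow> bool" where
  "tdef n X \<longleftrightarrow> (\<exists>\<X>. |\<X>| <o \<kappa> \<and> (\<forall>Y\<in>\<X>. definable M n Y) \<and> X = {xs. length xs = n \<and> (\<forall>Y\<in>\<X>. xs \<in> Y)})"

lemma type_definable_tdef: "type_definable M \<kappa> X \<longleftrightarrow> (\<exists>n. tdef n X)"
  by (simp add: type_definable_def tdef_def)

lemma tdef_length: "tdef n X \<Longrightarrow> x \<in> X \<Longrightarrow> length x = n"
  by (auto simp: tdef_def)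

lemma tdefI:
  assumes "|\<X>| <o \<kappa>" "\<And>Y. Y \<in> \<X> \<Longrightarrow> definable M n Y"
    "\<And>xs. xs \<in> X \<longleftrightarrow> length xs = n \<and> (\<forall>Y\<in>\<X>. xs \<in> Y)"
  shows "tdef n X"
  unfolding tdef_def using assms by (intro exI[of _ \<X>]) auto

lemma tdefE:
  assumes "tdef n X"
  obtains \<X> where "|\<X>| <o \<kappa>" "\<And>Y. Y \<in> \<X> \<Longrightarrow> definable M n Y" "\<And>xs. xs \<in> X \<longleftrightarrow> length xs = n \<and> (\<forall>Y\<in>\<X>. xs \<in> Y)"
  using assms unfolding tdef_def by blast

lemma tdef_definable: "definable M n X \<Longrightarrow> tdef n X"
  by (rule tdefI[of "{X}"]) (auto simp: finite_small definable_length)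

lemma type_definable_subset:
  assumes X: "type_definable M \<kappa> X" "X \<subseteq> C" and C: "definable M m C"
  shows "tdef m X"
proof (cases "X = {}")
  case True then show ?thesis using tdef_definable[OF definable_empty] by simp
next
  case False
  then obtain x where x: "x \<in> X" by blast
  obtain n where n: "tdef n X" using X unfolding type_definable_tdef by blast
  have "length x = m" using definable_length[OF C] x X(2) by blast
  then have "n = m" using tdef_length[OF n x] by simp
  then show ?thesis using n by simp
qed

lemma tdef_INT:
  assumes I: "|I| <o \<kappa>" and X: "\<And>i. i \<in> I \<Longrightarrow> tdef n (X i)"
  shows "tdef n {xs. length xs = n \<and> (\<forall>i\<in>I. xs \<in> X i)}"
proof -
  have "\<forall>i\<in>I. \<exists>\<X>. |\<X>| <o \<kappa> \<and> (\<forall>Y\<in>\<X>. definable M n Y) \<and> X i = {xs. length xs = n \<and> (\<forall>Y\<in>\<X>. xs \<in> Y)}"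
    using X unfolding tdef_def by blast
  from bchoice[OF this] obtain \<X> where
    "\<forall>i\<in>I. |\<X> i| <o \<kappa> \<and> (\<forall>Y\<in>\<X> i. definable M n Y) \<and> X i = {xs. length xs = n \<and> (\<forall>Y\<in>\<X> i. xs \<in> Y)}" by blast
  then have 1: "\<And>i. i \<in> I \<Longrightarrow> |\<X> i| <o \<kappa>" "\<And>i Y. i \<in> I \<Longrightarrow> Y \<in> \<X> i \<Longrightarrow> definable M n Y"
    and 2: "\<And>i xs. i \<in> I \<Longrightarrow> xs \<in> X i \<longleftrightarrow> length xs = n \<and> (\<forall>Y\<in>\<X> i. xs \<in> Y)" by blast+
  show ?thesis
  proof (rule tdefI)
    show "|\<Union>i\<in>I. \<X> i| <o \<kappa>" by (rule UN_small[OF I 1(1)])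
    show "definable M n Y" if "Y \<in> (\<Union>i\<in>I. \<X> i)" for Y using 1(2) that by blast
    show "xs \<in> {xs. length xs = n \<and> (\<forall>i\<in>I. xs \<in> X i)} \<longleftrightarrow> length xs = n \<and> (\<forall>Y\<in>\<Union>i\<in>I. \<X> i. xs \<in> Y)" for xs
      using 2 by blast
  qed
qed

text \<open>Distributivity turns a union of two intersections into the intersection of all pairwise
  unions.\<close>

lemma tdef_Un:
  assumes "tdef n X" "tdef n Y"
  shows "tdef n (X \<union> Y)"
proof -
  obtain \<X> where X: "|\<X>| <o \<kappa>" "\<And>Y. Y \<in> \<X> \<Longrightarrow> definable M n Y" "\<And>xs. xs \<in> X \<longleftrightarrow> length xs = n \<and> (\<forall>Y\<in>\<X>. xs \<in> Y)"
    using tdefE[OF assms(1)] by blast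
  obtain \<Y> where Y: "|\<Y>| <o \<kappa>" "\<And>Y. Y \<in> \<Y> \<Longrightarrow> definable M n Y" "\<And>xs. xs \<in> Y \<longleftrightarrow> length xs = n \<and> (\<forall>Y\<in>\<Y>. xs \<in> Y)"
    using tdefE[OF assms(2)] by blast
  show ?thesis
  proof (rule tdefI)
    show "|(\<lambda>(A, B). A \<union> B) ` (\<X> \<times> \<Y>)| <o \<kappa>" by (intro image_small Times_small X Y)
    show "definable M n Z" if "Z \<in> (\<lambda>(A, B). A \<union> B) ` (\<X> \<times> \<Y>)" for Z
    proof -
      obtain A B where "A \<in> \<X>" "B \<in> \<Y>" "Z = A \<union> B" using \<open>Z \<in> _\<close> by auto
      then show ?thesis using definable_Un[OF X(2) Y(2)] by simp
    qed
    show "xs \<in> X \<union> Y \<longleftrightarrow> length xs = n \<and> (\<forall>Z\<in>(\<lambda>(A, B). A \<union> B) ` (\<X> \<times> \<Y>). xs \<in> Z)" for xs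
      unfolding Un_iff X(3) Y(3) ball_simps(9) by (simp add: split_beta) blast
  qed
qed

lemma tdef_preimage:
  assumes f: "dmap M m k C f" and Y: "tdef k Y"
  shows "tdef m {x \<in> C. f x \<in> Y}"
proof -
  obtain \<Y> where Y: "|\<Y>| <o \<kappa>" "\<And>Y. Y \<in> \<Y> \<Longrightarrow> definable M k Y" "\<And>xs. xs \<in> Y \<longleftrightarrow> length xs = k \<and> (\<forall>Y\<in>\<Y>. xs \<in> Y)"
    using tdefE[OF Y] by blast
  have C: "definable M m C" using f by (simp add: dmap_def)
  show ?thesis
  proof (rule tdefI)
    show "|{C} \<union> (\<lambda>Z. {x \<in> C. f x \<in> Z}) ` \<Y>| <o \<kappa>" by (intro Un_small image_small Y finite_small) simp
    show "definable M m Z" if "Z \<in> {C} \<union> (\<lambda>Z. {x \<in> C. f x \<in> Z}) ` \<Y>" for Z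
      using that C dmap_preimage[OF f Y(2)] by auto
    show "xs \<in> {x \<in> C. f x \<in> Y} \<longleftrightarrow> length xs = m \<and> (\<forall>Z\<in>{C} \<union> (\<lambda>Z. {x \<in> C. f x \<in> Z}) ` \<Y>. xs \<in> Z)" for xs
      using definable_length[OF C, of xs] dmap_length[OF f, of xs] by (auto simp: Y(3))
  qed
qed

text \<open>Definable approximations of N from outside. Closure under intersection lets a single
  member stand in for any finite subfamily in compactness arguments.\<close>

definition dirfam :: "nat \<Rightarrow> 'a list set \<Rightarrow> 'a list set set \<Rightarrow> bool" where
  "dirfam n N \<D> \<longleftrightarrow> |\<D>| <o \<kappa> \<and> \<D> \<noteq> {} \<and> (\<forall>D\<in>\<D>. definable M n D) \<and> (\<forall>D\<in>\<D>. \<forall>E\<in>\<D>. D \<inter> E \<in> \<D>) \<and> N = \<Inter>\<D>"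

lemma dirfam_finite_Inter:
  assumes "\<forall>D\<in>\<D>. \<forall>E\<in>\<D>. D \<inter> E \<in> \<D>" "finite \<F>" "\<F> \<noteq> {}" "\<F> \<subseteq> \<D>"
  shows "\<Inter>\<F> \<in> \<D>"
  using assms(2,3,4)
proof (induction \<F> rule: finite_ne_induct)
  case (insert F \<F>) then show ?case using assms(1) by simp
qed simp

text \<open>Lists index the finite intersections in \<open>ex_dirfam\<close>. Over a small set there
  are few lists of each length and countably many lengths, and \<kappa> is regular and
  uncountable.\<close>

lemma lists_small: "|A| <o \<kappa> \<Longrightarrow> |{l. set l \<subseteq> A}| <o \<kappa>"
proof -
  assume A: "|A| <o \<kappa>"
  have len: "|{l. set l \<subseteq> A \<and> length l = n}| <o \<kappa>" for n
  proof (induction n)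
    case 0
    have "{l. set l \<subseteq> A \<and> length l = 0} \<subseteq> {[]}" by auto
    then show ?case by (rule subset_small[OF _ finite_small]) simp
  next
    case (Suc n)
    have "{l. set l \<subseteq> A \<and> length l = Suc n} \<subseteq> (\<lambda>(x, l). x # l) ` (A \<times> {l. set l \<subseteq> A \<and> length l = n})"
      by (force simp: length_Suc_conv)
    then show ?case by (rule subset_small[OF _ image_small[OF Times_small[OF A Suc]]])
  qed
  have "{l. set l \<subseteq> A} = (\<Union>n\<in>UNIV. {l. set l \<subseteq> A \<and> length l = n})" by auto
  then show ?thesis using UN_small[OF nat_small len] by simp
qed

lemma ex_dirfam:
  assumes "tdef n N"
  shows "\<exists>\<D>. dirfam n N \<D>"
proof -
  obtain \<X> where X: "|\<X>| <o \<kappa>" "\<And>Y. Y \<in> \<X> \<Longrightarrow> definable M n Y" "\<And>xs. xs \<in> N \<longleftrightarrow> length xs = n \<and> (\<forall>Y\<in>\<X>. xs \<in> Y)"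
    using tdefE[OF assms] by blast
  \<comment> \<open>Concatenating lists intersects the corresponding sets, which gives directedness,
    and the empty list yields the whole power, which makes the family nonempty.\<close>
  define g where "g = (\<lambda>l. {xs :: 'a list. length xs = n \<and> (\<forall>Y\<in>set l. xs \<in> Y)})"
  have "definable M n (g l)" if "set l \<subseteq> \<X>" for l
    using that
  proof (induction l)
    case Nil
    have "g [] = {xs. length xs = n \<and> True}" by (simp add: g_def)
    then show ?case using definable_Collect[of M n "\<lambda>_. True", OF dfn_const] by simp
  next
    case (Cons Y l)
    have "g (Y # l) = Y \<inter> g l" by (auto simp: g_def)
    then show ?case using Cons X(2) by (simp add: definable_Int)
  qed
  moreover have "g l \<inter> g l' \<in> g ` {l. set l \<subseteq> \<X>}" if "set l \<subseteq> \<X>" "set l' \<subseteq> \<X>" for l l'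
  proof -
    have "g l \<inter> g l' = g (l @ l')" by (auto simp: g_def)
    then show ?thesis using that by (intro image_eqI[of _ _ "l @ l'"]) auto
  qed
  moreover have "N = \<Inter>(g ` {l. set l \<subseteq> \<X>})"
  proof (intro equalityI subsetI)
    fix x assume "x \<in> N" then show "x \<in> \<Inter>(g ` {l. set l \<subseteq> \<X>})" unfolding X(3) g_def by auto
  next
    fix x assume x: "x \<in> \<Inter>(g ` {l. set l \<subseteq> \<X>})"
    have "x \<in> g []" using x by auto
    moreover have "x \<in> g [Y]" if "Y \<in> \<X>" for Y using x that by auto
    ultimately show "x \<in> N" unfolding X(3) by (auto simp: g_def)
  qed
  moreover have "|g ` {l. set l \<subseteq> \<X>}| <o \<kappa>" by (intro image_small lists_small X)
  moreover have "g ` {l. set l \<subseteq> \<X>} \<noteq> {}" by (auto intro: exI[of _ "[]"])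
  ultimately show ?thesis unfolding dirfam_def by (intro exI[of _ "g ` {l. set l \<subseteq> \<X>}"]) blast
qed

lemma dirfam_nonempty:
  assumes D: "dirfam n N \<D>" and ne: "\<And>D. D \<in> \<D> \<Longrightarrow> D \<noteq> {}"
  shows "N \<noteq> {}"
proof -
  have D': "|\<D>| <o \<kappa>" "\<D> \<noteq> {}" "\<And>D. D \<in> \<D> \<Longrightarrow> definable M n D" "\<forall>D\<in>\<D>. \<forall>E\<in>\<D>. D \<inter> E \<in> \<D>" "N = \<Inter>\<D>"
    using D unfolding dirfam_def by blast+
  have "\<exists>xs. length xs = n \<and> (\<forall>Y\<in>\<D>. xs \<in> Y)"
  proof (rule compactness[OF D'(1,3)])
    fix \<F> assume F: "finite \<F>" "\<F> \<subseteq> \<D>"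
    obtain D where D: "D \<in> \<D>" "\<forall>Y\<in>\<F>. D \<subseteq> Y"
    proof (cases "\<F> = {}")
      case True then show ?thesis using that D'(2) by blast
    next
      case False
      show ?thesis using that[OF dirfam_finite_Inter[OF D'(4) F(1) False F(2)]] by blast
    qed
    obtain x where x: "x \<in> D" using ne[OF D(1)] by blast
    then have "length x = n" using definable_length[OF D'(3)[OF D(1)]] by blast
    then show "\<exists>xs. length xs = n \<and> (\<forall>Y\<in>\<F>. xs \<in> Y)" using x D(2) by blast
  qed
  then show ?thesis using D'(5) by blast
qed

lemma dirfam_Int:
  assumes "dirfam n N \<D>" "dirfam n X \<E>"
  shows "dirfam n (N \<inter> X) ((\<lambda>(D, E). D \<inter> E) ` (\<D> \<times> \<E>))"
proof -
  have D: "|\<D>| <o \<kappa>" "\<D> \<noteq> {}" "\<And>D. D \<in> \<D> \<Longrightarrow> definable M n D" "\<And>D E. D \<in> \<D> \<Longrightarrow> E \<in> \<D> \<Longrightarrow> D \<inter> E \<in> \<D>" "N = \<Inter>\<D>"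
    using assms(1) unfolding dirfam_def by blast+
  have E: "|\<E>| <o \<kappa>" "\<E> \<noteq> {}" "\<And>D. D \<in> \<E> \<Longrightarrow> definable M n D" "\<And>D E. D \<in> \<E> \<Longrightarrow> E \<in> \<E> \<Longrightarrow> D \<inter> E \<in> \<E>" "X = \<Inter>\<E>"
    using assms(2) unfolding dirfam_def by blast+
  show ?thesis unfolding dirfam_def
  proof (intro conjI ballI)
    show "|(\<lambda>(D, E). D \<inter> E) ` (\<D> \<times> \<E>)| <o \<kappa>" by (intro image_small Times_small D E)
    show "(\<lambda>(D, E). D \<inter> E) ` (\<D> \<times> \<E>) \<noteq> {}" using D(2) E(2) by auto
    show "definable M n Z" if "Z \<in> (\<lambda>(D, E). D \<inter> E) ` (\<D> \<times> \<E>)" for Z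
    proof -
      obtain A B where "A \<in> \<D>" "B \<in> \<E>" "Z = A \<inter> B" using \<open>Z \<in> _\<close> by auto
      then show ?thesis using definable_Int[OF D(3) E(3)] by simp
    qed
    show "Y \<inter> Z \<in> (\<lambda>(D, E). D \<inter> E) ` (\<D> \<times> \<E>)" if YZ: "Y \<in> (\<lambda>(D, E). D \<inter> E) ` (\<D> \<times> \<E>)" "Z \<in> (\<lambda>(D, E). D \<inter> E) ` (\<D> \<times> \<E>)" for Y Z
    proof -
      obtain A B A' B' where "A \<in> \<D>" "B \<in> \<E>" "Y = A \<inter> B" "A' \<in> \<D>" "B' \<in> \<E>" "Z = A' \<inter> B'" using YZ by auto
      then show ?thesis using D(4)[of A A'] E(4)[of B B'] by (intro image_eqI[of _ _ "(A \<inter> A', B \<inter> B')"]) auto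
    qed
    show "N \<inter> X = \<Inter>((\<lambda>(D, E). D \<inter> E) ` (\<D> \<times> \<E>))"
    proof (intro equalityI subsetI)
      fix x assume "x \<in> N \<inter> X" then show "x \<in> \<Inter>((\<lambda>(D, E). D \<inter> E) ` (\<D> \<times> \<E>))" using D(5) E(5) by auto
    next
      fix x assume x: "x \<in> \<Inter>((\<lambda>(D, E). D \<inter> E) ` (\<D> \<times> \<E>))"
      then have "x \<in> A \<inter> B" if "A \<in> \<D>" "B \<in> \<E>" for A B using that by auto
      then show "x \<in> N \<inter> X" using D(2,5) E(2,5) by auto
    qed
  qed
qed

text \<open>Mostly used in contrapositive form: a type-definable X disjoint from N is already
  disjoint from one member of the family.\<close>

lemma dirfam_meet:
  assumes D: "dirfam n N \<D>" and X: "tdef n X" and ne: "\<And>D. D \<in> \<D> \<Longrightarrow> D \<inter> X \<noteq> {}"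
  shows "N \<inter> X \<noteq> {}"
proof -
  obtain \<E> where E: "dirfam n X \<E>" using ex_dirfam[OF X] by blast
  have "X = \<Inter>\<E>" using E by (simp add: dirfam_def)
  then show ?thesis using ne by (intro dirfam_nonempty[OF dirfam_Int[OF D E]]) blast
qed

lemma dirfam_sub: "dirfam n N \<D> \<Longrightarrow> D \<in> \<D> \<Longrightarrow> N \<subseteq> D"
  by (auto simp: dirfam_def)

text \<open>Products of approximations of N and of N' form a directed family whose intersection is
  the product of N and N', so by compactness one of them avoids X. This is the tube lemma behind
  \<open>continuous_lprod\<close>.\<close>

lemma tdef_Times_meet:
  assumes N: "tdef m N" "tdef n N'" and X: "tdef (m + n) X" and disj: "\<And>x y. x \<in> N \<Longrightarrow> y \<in> N' \<Longrightarrow> x @ y \<notin> X"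
  shows "\<exists>D D'. definable M m D \<and> definable M n D' \<and> N \<subseteq> D \<and> N' \<subseteq> D' \<and> (\<forall>x\<in>D. \<forall>y\<in>D'. x @ y \<notin> X)"
proof -
  obtain \<D> \<D>' where DD: "dirfam m N \<D>" "dirfam n N' \<D>'" using ex_dirfam N by blast
  have D: "|\<D>| <o \<kappa>" "\<D> \<noteq> {}" "\<And>D. D \<in> \<D> \<Longrightarrow> definable M m D" "\<And>D E. D \<in> \<D> \<Longrightarrow> E \<in> \<D> \<Longrightarrow> D \<inter> E \<in> \<D>" "N = \<Inter>\<D>"
    using DD(1) unfolding dirfam_def by blast+
  have E: "|\<D>'| <o \<kappa>" "\<D>' \<noteq> {}" "\<And>D. D \<in> \<D>' \<Longrightarrow> definable M n D" "\<And>D E. D \<in> \<D>' \<Longrightarrow> E \<in> \<D>' \<Longrightarrow> D \<inter> E \<in> \<D>'" "N' = \<Inter>\<D>'"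
    using DD(2) unfolding dirfam_def by blast+
  define T where "T = (\<lambda>A B :: 'a list set. {x @ y | x y. x \<in> A \<and> y \<in> B})"
  have T: "w \<in> T A B \<longleftrightarrow> length w = m + n \<and> take m w \<in> A \<and> drop m w \<in> B" if "A \<in> \<D>" "B \<in> \<D>'" for w A B
  proof
    assume "w \<in> T A B"
    then show "length w = m + n \<and> take m w \<in> A \<and> drop m w \<in> B"
      using definable_length[OF D(3)[OF that(1)]] definable_length[OF E(3)[OF that(2)]] by (auto simp: T_def)
  next
    assume "length w = m + n \<and> take m w \<in> A \<and> drop m w \<in> B"
    then show "w \<in> T A B" unfolding T_def by (intro CollectI exI[of _ "take m w"] exI[of _ "drop m w"]) simp
  qed
  let ?P = "(\<lambda>(A, B). T A B) ` (\<D> \<times> \<D>')"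
  have "dirfam (m + n) (\<Inter>?P) ?P" unfolding dirfam_def
  proof (intro conjI ballI)
    show "|?P| <o \<kappa>" by (intro image_small Times_small D E)
    show "?P \<noteq> {}" using D(2) E(2) by auto
    show "definable M (m + n) Z" if "Z \<in> ?P" for Z
    proof -
      obtain A B where "A \<in> \<D>" "B \<in> \<D>'" "Z = T A B" using \<open>Z \<in> ?P\<close> by auto
      then show ?thesis using definable_Times[OF D(3) E(3)] by (simp add: T_def)
    qed
    show "Y \<inter> Z \<in> ?P" if YZ: "Y \<in> ?P" "Z \<in> ?P" for Y Z
    proof -
      obtain A B A' B' where *: "A \<in> \<D>" "B \<in> \<D>'" "Y = T A B" "A' \<in> \<D>" "B' \<in> \<D>'" "Z = T A' B'" using YZ by auto
      have "A \<inter> A' \<in> \<D>" "B \<inter> B' \<in> \<D>'" using * D(4) E(4) by blast+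
      moreover have "w \<in> Y \<inter> Z \<longleftrightarrow> w \<in> T (A \<inter> A') (B \<inter> B')" for w
        unfolding *(3) *(6) Int_iff T[OF *(1,2)] T[OF *(4,5)] T[OF calculation] by blast
      then have "Y \<inter> Z = T (A \<inter> A') (B \<inter> B')" by blast
      ultimately show ?thesis by (intro image_eqI[of _ _ "(A \<inter> A', B \<inter> B')"]) auto
    qed
  qed simp
  moreover have "\<Inter>?P \<inter> X = {}"
  proof -
    have "w \<notin> X" if w: "w \<in> \<Inter>?P" for w
    proof -
      have *: "length w = m + n \<and> take m w \<in> A \<and> drop m w \<in> B" if "A \<in> \<D>" "B \<in> \<D>'" for A B
        using w T[OF that, of w] that by auto
      then have "take m w \<in> N" "drop m w \<in> N'" using D(2,5) E(2,5) by blast+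
      from disj[OF this] show ?thesis by simp
    qed
    then show ?thesis by blast
  qed
  ultimately obtain Z where "Z \<in> ?P" "Z \<inter> X = {}" using dirfam_meet[OF _ X, of "\<Inter>?P" ?P] by blast
  then obtain A B where AB: "A \<in> \<D>" "B \<in> \<D>'" "T A B \<inter> X = {}" by auto
  then have "\<forall>x\<in>A. \<forall>y\<in>B. x @ y \<notin> X" unfolding T_def by blast
  then show ?thesis using AB D(3) E(3) dirfam_sub[OF DD(1)] dirfam_sub[OF DD(2)] by blast
qed

section \<open>Group multiplication on definable and type-definable sets\<close>

lemma mult_dmap:
  assumes "definable_group M G" "definable M m (carrier G)"
  shows "dmap M (m + m) m {x @ y | x y. x \<in> carrier G \<and> y \<in> carrier G} (\<lambda>w. take m w \<otimes>\<^bsub>G\<^esub> drop m w)"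
proof -
  interpret group G using assms by (simp add: definable_group_def)
  let ?C = "{x @ y | x y. x \<in> carrier G \<and> y \<in> carrier G}"
  have C: "definable M (m + m) ?C" by (rule definable_Times[OF assms(2,2)])
  have len: "length x = m" if "x \<in> carrier G" for x using definable_length[OF assms(2) that] .
  have "{w @ (take m w \<otimes>\<^bsub>G\<^esub> drop m w) | w. w \<in> ?C} = {x @ y @ (x \<otimes>\<^bsub>G\<^esub> y) | x y. x \<in> carrier G \<and> y \<in> carrier G}"
  proof (intro equalityI subsetI)
    fix z assume "z \<in> {w @ (take m w \<otimes>\<^bsub>G\<^esub> drop m w) | w. w \<in> ?C}"
    then obtain x y where "x \<in> carrier G" "y \<in> carrier G" "z = (x @ y) @ (take m (x @ y) \<otimes>\<^bsub>G\<^esub> drop m (x @ y))" by blast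
    then show "z \<in> {x @ y @ (x \<otimes>\<^bsub>G\<^esub> y) | x y. x \<in> carrier G \<and> y \<in> carrier G}" using len by auto
  next
    fix z assume "z \<in> {x @ y @ (x \<otimes>\<^bsub>G\<^esub> y) | x y. x \<in> carrier G \<and> y \<in> carrier G}"
    then obtain x y where "x \<in> carrier G" "y \<in> carrier G" "z = x @ y @ (x \<otimes>\<^bsub>G\<^esub> y)" by blast
    then show "z \<in> {w @ (take m w \<otimes>\<^bsub>G\<^esub> drop m w) | w. w \<in> ?C}"
      using len by (intro CollectI exI[of _ "x @ y"]) auto
  qed
  then have "definable_map M ?C (carrier G) (\<lambda>w. take m w \<otimes>\<^bsub>G\<^esub> drop m w)"
    using assms C len unfolding definable_map_def definable_group_def definable_set_def by auto
  then show ?thesis using definable_map_iff[OF C assms(2)] by blast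
qed

lemma dmap_mult:
  assumes G: "definable_group M G" "definable M m (carrier G)"
    and f: "dmap M n m X f" "f \<in> X \<rightarrow> carrier G" and g: "dmap M n m X g" "g \<in> X \<rightarrow> carrier G"
  shows "dmap M n m X (\<lambda>x. f x \<otimes>\<^bsub>G\<^esub> g x)"
proof -
  have "dmap M n m X (\<lambda>x. take m (f x @ g x) \<otimes>\<^bsub>G\<^esub> drop m (f x @ g x))"
    by (rule dmap_comp[OF dmap_append[OF f(1) g(1)] mult_dmap[OF G]]) (use f g in auto)
  then show ?thesis
    using dmap_length[OF f(1)] by (subst dmap_cong[where g = "\<lambda>x. take m (f x @ g x) \<otimes>\<^bsub>G\<^esub> drop m (f x @ g x)"]) auto
qed

lemma dmap_const: "definable M n X \<Longrightarrow> length c = k \<Longrightarrow> dmap M n k X (\<lambda>_. c)"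
  by (rule dmap_vt[OF vt_const])

lemma dmap_id: "definable M n X \<Longrightarrow> dmap M n n X (\<lambda>x. x)"
  by (rule dmap_vt[OF vt_id])

text \<open>The quantifier over N is replaced by one over each definable approximation D of N. If
  every D contains a suitable x, compactness finds one in N, so the resulting definable conditions
  cut out the right set.\<close>

lemma tdef_saturation:
  assumes G: "definable_group M G" "definable M m (carrier G)" and N: "tdef m N" "N \<subseteq> carrier G"
    and E: "definable M m E" "E \<subseteq> carrier G"
  shows "tdef m {h \<in> carrier G. \<exists>x\<in>N. x \<otimes>\<^bsub>G\<^esub> h \<in> E}"
proof -
  let ?C = "carrier G"
  let ?CC = "{x @ y | x y. x \<in> ?C \<and> y \<in> ?C}"
  obtain \<D> where D: "dirfam m N \<D>" using ex_dirfam[OF N(1)] by blast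
  have D': "|\<D>| <o \<kappa>" "\<D> \<noteq> {}" "\<And>D. D \<in> \<D> \<Longrightarrow> definable M m D" using D unfolding dirfam_def by blast+
  have len: "length x = m" if "x \<in> ?C" for x using definable_length[OF G(2) that] .
  define P where "P = (\<lambda>D. {h \<in> ?C. \<exists>x\<in>D \<inter> ?C. x \<otimes>\<^bsub>G\<^esub> h \<in> E})"
  have P: "definable M m (P D)" if "D \<in> \<D>" for D
  proof -
    have CC: "definable M (m + m) ?CC" by (rule definable_Times[OF G(2,2)])
    have "definable M (m + m) {w \<in> ?CC. take m w \<in> D}"
      by (rule dmap_preimage[OF dmap_vt[OF vt_takeI CC] D'(3)[OF that]]) simp
    moreover have "definable M (m + m) {w \<in> ?CC. take m w \<otimes>\<^bsub>G\<^esub> drop m w \<in> E}"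
      by (rule dmap_preimage[OF mult_dmap[OF G] E(1)])
    ultimately have W: "definable M (m + m) ({w \<in> ?CC. take m w \<in> D} \<inter> {w \<in> ?CC. take m w \<otimes>\<^bsub>G\<^esub> drop m w \<in> E})" (is "definable M _ ?W")
      by (rule definable_Int)
    have "definable M m (drop m ` ?W)"
      by (rule dmap_image[OF dmap_vt[OF vt_dropI CC] _ W]) auto
    moreover have "drop m ` ?W = P D"
    proof (intro equalityI subsetI)
      fix h assume "h \<in> drop m ` ?W"
      then obtain x y where "x \<in> ?C" "y \<in> ?C" "take m (x @ y) \<in> D" "take m (x @ y) \<otimes>\<^bsub>G\<^esub> drop m (x @ y) \<in> E" "h = drop m (x @ y)" by blast
      then show "h \<in> P D" using len by (auto simp: P_def)
    next
      fix h assume "h \<in> P D"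
      then obtain x where x: "h \<in> ?C" "x \<in> D" "x \<in> ?C" "x \<otimes>\<^bsub>G\<^esub> h \<in> E" by (auto simp: P_def)
      then have "x @ h \<in> ?W" using len by auto
      moreover have "h = drop m (x @ h)" using len x by simp
      ultimately show "h \<in> drop m ` ?W" by blast
    qed
    ultimately show ?thesis by simp
  qed
  have "tdef m {h. length h = m \<and> (\<forall>D\<in>\<D>. h \<in> P D)}"
    by (rule tdef_INT[OF D'(1)]) (rule tdef_definable[OF P])
  moreover have "{h. length h = m \<and> (\<forall>D\<in>\<D>. h \<in> P D)} = {h \<in> ?C. \<exists>x\<in>N. x \<otimes>\<^bsub>G\<^esub> h \<in> E}"
  proof (intro equalityI subsetI)
    fix h assume h: "h \<in> {h. length h = m \<and> (\<forall>D\<in>\<D>. h \<in> P D)}"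
    then have hC: "h \<in> ?C" using D'(2) by (auto simp: P_def)
    have "dmap M m m ?C (\<lambda>x. x \<otimes>\<^bsub>G\<^esub> h)"
      using hC len by (intro dmap_mult[OF G] dmap_id dmap_const G) auto
    from tdef_definable[OF dmap_preimage[OF this E(1)]]
    have Z: "tdef m {x \<in> ?C. x \<otimes>\<^bsub>G\<^esub> h \<in> E}" .
    have "N \<inter> {x \<in> ?C. x \<otimes>\<^bsub>G\<^esub> h \<in> E} \<noteq> {}"
    proof (rule dirfam_meet[OF D Z])
      fix D assume "D \<in> \<D>"
      then have "h \<in> P D" using h by blast
      then show "D \<inter> {x \<in> ?C. x \<otimes>\<^bsub>G\<^esub> h \<in> E} \<noteq> {}" by (auto simp: P_def)
    qed
    then show "h \<in> {h \<in> ?C. \<exists>x\<in>N. x \<otimes>\<^bsub>G\<^esub> h \<in> E}" using hC by blast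
  next
    fix h assume "h \<in> {h \<in> ?C. \<exists>x\<in>N. x \<otimes>\<^bsub>G\<^esub> h \<in> E}"
    then show "h \<in> {h. length h = m \<and> (\<forall>D\<in>\<D>. h \<in> P D)}"
      using dirfam_sub[OF D] N(2) len by (auto simp: P_def)
  qed
  ultimately show ?thesis by simp
qed


text \<open>Covers every type-definable subgroup of bounded index; the logic topology on right
  cosets already makes sense for these.\<close>

definition lgroup :: "'a dgroup \<Rightarrow> 'a list set \<Rightarrow> bool" where
  "lgroup G N \<longleftrightarrow> definable_group M G \<and> bounded_index_subgroup M \<kappa> G N"

lemma lgroupD:
  assumes "lgroup G N"
  shows "definable_group M G" "group G" "subgroup N G" "|rcosets\<^bsub>G\<^esub> N| <o \<kappa>" "dspace M G" "topspace (gtop G) = carrier G"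
  using assms definable_group_dspace
  by (auto simp: lgroup_def bounded_index_subgroup_def definable_group_def topological_group_on_def)

lemma lgroup_tdef:
  assumes "lgroup G N" "definable M m (carrier G)" shows "tdef m N"
  using assms subgroup.subset[OF lgroupD(3)[OF assms(1)]]
  by (intro type_definable_subset) (auto simp: lgroup_def bounded_index_subgroup_def)

section \<open>Cosets and the logic topology\<close>

lemma tau_mem: "lgroup G N \<Longrightarrow> x \<in> carrier G \<Longrightarrow> y \<in> carrier G \<Longrightarrow> y \<in> \<tau>_map G N x \<longleftrightarrow> y \<otimes>\<^bsub>G\<^esub> inv\<^bsub>G\<^esub> x \<in> N"
  unfolding \<tau>_map_def using subgroup.rcos_module[OF lgroupD(3) lgroupD(2)] by blast

lemma tau_subset: "lgroup G N \<Longrightarrow> x \<in> carrier G \<Longrightarrow> \<tau>_map G N x \<subseteq> carrier G"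
  unfolding \<tau>_map_def
  by (rule monoid.r_coset_subset_G[OF group.is_monoid[OF lgroupD(2)] subgroup.subset[OF lgroupD(3)]])

lemma tau_self: "lgroup G N \<Longrightarrow> x \<in> carrier G \<Longrightarrow> x \<in> \<tau>_map G N x"
  unfolding \<tau>_map_def by (rule group.rcos_self[OF lgroupD(2) _ lgroupD(3)])

lemma tau_eq: "lgroup G N \<Longrightarrow> x \<in> carrier G \<Longrightarrow> y \<in> \<tau>_map G N x \<Longrightarrow> \<tau>_map G N y = \<tau>_map G N x"
  unfolding \<tau>_map_def using group.repr_independence[OF lgroupD(2) _ _ lgroupD(3)] by metis

lemma carrier_Mod: "carrier (G Mod N) = \<tau>_map G N ` carrier G"
  by (auto simp: FactGroup_def RCOSETS_def \<tau>_map_def)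

lemma rcosets_tau: "rcosets\<^bsub>G\<^esub> N = \<tau>_map G N ` carrier G"
  by (auto simp: RCOSETS_def \<tau>_map_def)

lemma tdef_coset:
  assumes L: "lgroup G N" and m: "definable M m (carrier G)" and x: "x \<in> carrier G"
  shows "tdef m (\<tau>_map G N x)"
proof -
  interpret group G by (rule lgroupD(2)[OF L])
  have "dmap M m m (carrier G) (\<lambda>g. g \<otimes>\<^bsub>G\<^esub> inv\<^bsub>G\<^esub> x)"
    using x definable_length[OF m] by (intro dmap_mult[OF lgroupD(1)[OF L] m] dmap_id dmap_const m) auto
  from tdef_preimage[OF this lgroup_tdef[OF L m]]
  have "tdef m {g \<in> carrier G. g \<otimes>\<^bsub>G\<^esub> inv\<^bsub>G\<^esub> x \<in> N}" .
  moreover have "{g \<in> carrier G. g \<otimes>\<^bsub>G\<^esub> inv\<^bsub>G\<^esub> x \<in> N} = \<tau>_map G N x"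
    using tau_mem[OF L x] tau_subset[OF L x] by blast
  ultimately show ?thesis by simp
qed

text \<open>For unions, complements have to be intersected over a family that may fail to be small.
  Bounded index resolves this: there are few cosets, each is the intersection of few definable sets,
  and complements of those already cut out the same set.\<close>

lemma istopology_logic:
  assumes L: "lgroup G N"
  shows "istopology (\<lambda>U. U \<subseteq> carrier (G Mod N) \<and> type_definable M \<kappa> {g \<in> carrier G. \<tau>_map G N g \<notin> U})"
proof -
  let ?C = "carrier G"
  let ?\<tau> = "\<tau>_map G N"
  obtain m where m: "definable M m ?C" using definable_carrier[OF lgroupD(1)[OF L]] .
  have td: "type_definable M \<kappa> {g \<in> ?C. ?\<tau> g \<notin> U} \<longleftrightarrow> tdef m {g \<in> ?C. ?\<tau> g \<notin> U}" for U
    using type_definable_subset[OF _ _ m, of "{g \<in> ?C. ?\<tau> g \<notin> U}"] type_definable_tdef by auto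
  show ?thesis unfolding istopology_def td
  proof (intro conjI allI impI)
    fix U V assume U: "U \<subseteq> carrier (G Mod N) \<and> tdef m {g \<in> ?C. ?\<tau> g \<notin> U}"
      and V: "V \<subseteq> carrier (G Mod N) \<and> tdef m {g \<in> ?C. ?\<tau> g \<notin> V}"
    show "U \<inter> V \<subseteq> carrier (G Mod N)" using U by blast
    have "{g \<in> ?C. ?\<tau> g \<notin> U \<inter> V} = {g \<in> ?C. ?\<tau> g \<notin> U} \<union> {g \<in> ?C. ?\<tau> g \<notin> V}" by blast
    then show "tdef m {g \<in> ?C. ?\<tau> g \<notin> U \<inter> V}" using tdef_Un U V by simp
  next
    fix \<K> assume K: "\<forall>U\<in>\<K>. U \<subseteq> carrier (G Mod N) \<and> tdef m {g \<in> ?C. ?\<tau> g \<notin> U}"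
    show "\<Union>\<K> \<subseteq> carrier (G Mod N)" using K by blast
    let ?X = "{g \<in> ?C. ?\<tau> g \<notin> \<Union>\<K>}"
    have "\<forall>x\<in>?C. \<exists>\<D>. dirfam m (?\<tau> x) \<D>" using ex_dirfam[OF tdef_coset[OF L m]] by blast
    define D where "D = (\<lambda>K. SOME \<D>. dirfam m K \<D>)"
    have D: "dirfam m K (D K)" if "K \<in> ?\<tau> ` ?C" for K
      unfolding D_def using that ex_dirfam[OF tdef_coset[OF L m]] by (intro someI_ex[of "dirfam m K"]) blast
    \<comment> \<open>Complements of the approximations of all cosets, restricted to those that
      still contain ?X; together with ?C they will have ?X as intersection.\<close>
    define \<S> where "\<S> = {C' \<in> (\<lambda>A. ?C - A) ` (\<Union>K\<in>?\<tau> ` ?C. D K). ?X \<subseteq> C'}"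
    have small: "|\<Union>K\<in>?\<tau> ` ?C. D K| <o \<kappa>"
    proof (rule UN_small)
      show "|?\<tau> ` ?C| <o \<kappa>" using lgroupD(4)[OF L] unfolding rcosets_tau .
      show "|D K| <o \<kappa>" if "K \<in> ?\<tau> ` ?C" for K using D[OF that] by (simp add: dirfam_def)
    qed
    have "|\<S>| <o \<kappa>" unfolding \<S>_def
      by (rule subset_small[OF _ image_small[OF small, of "\<lambda>A. ?C - A"]]) (rule Collect_restrict)
    then have S1: "|insert ?C \<S>| <o \<kappa>" using Un_small[OF finite_small[of "{?C}"]] by simp
    have S2: "definable M m Z" if Z: "Z \<in> insert ?C \<S>" for Z
    proof (cases "Z = ?C")
      case False
      then obtain K A where "K \<in> ?\<tau> ` ?C" "A \<in> D K" "Z = ?C - A" using Z unfolding \<S>_def by blast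
      moreover have "definable M m A" using D[OF \<open>K \<in> _\<close>] \<open>A \<in> _\<close> unfolding dirfam_def by blast
      ultimately show ?thesis using definable_Diff[OF m] by simp
    qed (use m in simp)
    have S3: "g \<in> ?X \<longleftrightarrow> length g = m \<and> (\<forall>Z\<in>insert ?C \<S>. g \<in> Z)" for g
    proof
      assume g: "g \<in> ?X"
      have "?X \<subseteq> Z" if "Z \<in> \<S>" for Z using that unfolding \<S>_def mem_Collect_eq by (rule conjunct2)
      then show "length g = m \<and> (\<forall>Z\<in>insert ?C \<S>. g \<in> Z)"
        using definable_length[OF m] g by (metis (no_types, lifting) insert_iff mem_Collect_eq subsetD)
    next
      assume g: "length g = m \<and> (\<forall>Z\<in>insert ?C \<S>. g \<in> Z)"
      then have gC: "g \<in> ?C" by simp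
      have "?\<tau> g \<notin> U" if U: "U \<in> \<K>" for U
      proof
        assume gU: "?\<tau> g \<in> U"
        let ?XU = "{g \<in> ?C. ?\<tau> g \<notin> U}"
        have XU: "tdef m ?XU" using K U by blast
        \<comment> \<open>The coset of g lies in U and so avoids ?XU; by compactness some
          approximation A of the coset avoids it too, and the complement of A then belongs to the
          family and excludes g.\<close>
        have "?\<tau> g \<inter> ?XU = {}" using tau_eq[OF L gC] gU by auto
        then obtain A where A: "A \<in> D (?\<tau> g)" "A \<inter> ?XU = {}"
          using dirfam_meet[OF D[OF imageI[OF gC]] XU] by blast
        have "?X \<subseteq> ?XU" using U by blast
        then have "?X \<subseteq> ?C - A" using A(2) by blast
        moreover have "?C - A \<in> (\<lambda>A. ?C - A) ` (\<Union>K\<in>?\<tau> ` ?C. D K)"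
          by (rule imageI, rule UN_I[of "?\<tau> g"], rule imageI, rule gC, rule A(1))
        ultimately have "?C - A \<in> \<S>" unfolding \<S>_def mem_Collect_eq by (intro conjI)
        then have "g \<in> ?C - A" using g by (metis insertCI)
        then have "g \<notin> A" by simp
        moreover have "g \<in> A" using dirfam_sub[OF D[OF imageI[OF gC]] A(1)] tau_self[OF L gC] by blast
        ultimately show False by simp
      qed
      then show "g \<in> ?X" using gC by blast
    qed
    show "tdef m ?X" by (rule tdefI[OF S1 S2 S3])
  qed
qed

lemma openin_logic:
  assumes L: "lgroup G N" and m: "definable M m (carrier G)"
  shows "openin (logic_topology M \<kappa> G N) U \<longleftrightarrow> U \<subseteq> \<tau>_map G N ` carrier G \<and> tdef m {g \<in> carrier G. \<tau>_map G N g \<notin> U}"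
proof -
  have "type_definable M \<kappa> {g \<in> carrier G. \<tau>_map G N g \<notin> U} \<longleftrightarrow> tdef m {g \<in> carrier G. \<tau>_map G N g \<notin> U}"
    using type_definable_subset[OF _ _ m, of "{g \<in> carrier G. \<tau>_map G N g \<notin> U}"] type_definable_tdef by auto
  moreover have "openin (logic_topology M \<kappa> G N) U \<longleftrightarrow> U \<subseteq> carrier (G Mod N) \<and> type_definable M \<kappa> {g \<in> carrier G. \<tau>_map G N g \<notin> U}"
    unfolding logic_topology_def topology_inverse'[OF istopology_logic[OF L]] ..
  ultimately show ?thesis by (simp only: carrier_Mod)
qed

lemma topspace_logic:
  assumes L: "lgroup G N"
  shows "topspace (logic_topology M \<kappa> G N) = \<tau>_map G N ` carrier G"
proof -
  obtain m where m: "definable M m (carrier G)" using definable_carrier[OF lgroupD(1)[OF L]] .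
  have e: "{g \<in> carrier G. \<tau>_map G N g \<notin> \<tau>_map G N ` carrier G} = {}" by blast
  have "openin (logic_topology M \<kappa> G N) (\<tau>_map G N ` carrier G)"
    unfolding openin_logic[OF L m] e using tdef_definable[OF definable_empty] by blast
  moreover have "topspace (logic_topology M \<kappa> G N) \<subseteq> \<tau>_map G N ` carrier G"
    using openin_topspace[of "logic_topology M \<kappa> G N"] unfolding openin_logic[OF L m] by blast
  ultimately show ?thesis by (intro subset_antisym openin_subset)
qed

text \<open>A coset N h fails to lie in D exactly when it meets the complement, a type-definable
  condition on h by \<open>tdef_saturation\<close>. These sets are the neighbourhoods used in
  \<open>continuous_lprod\<close>.\<close>

lemma openin_logic_inside:
  assumes L: "lgroup G N" and m: "definable M m (carrier G)" and D: "definable M m D"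
  shows "openin (logic_topology M \<kappa> G N) {K \<in> \<tau>_map G N ` carrier G. K \<subseteq> D}"
proof -
  interpret group G by (rule lgroupD(2)[OF L])
  have N: "N \<subseteq> carrier G" by (rule subgroup.subset[OF lgroupD(3)[OF L]])
  have "tdef m {h \<in> carrier G. \<exists>x\<in>N. x \<otimes>\<^bsub>G\<^esub> h \<in> carrier G - D}"
    by (rule tdef_saturation[OF lgroupD(1)[OF L] m lgroup_tdef[OF L m] N definable_Diff[OF m D]]) blast
  moreover have "{h \<in> carrier G. \<exists>x\<in>N. x \<otimes>\<^bsub>G\<^esub> h \<in> carrier G - D} =
      {g \<in> carrier G. \<tau>_map G N g \<notin> {K \<in> \<tau>_map G N ` carrier G. K \<subseteq> D}}"
  proof -
    have "(\<exists>x\<in>N. x \<otimes>\<^bsub>G\<^esub> h \<in> carrier G - D) \<longleftrightarrow> \<not> \<tau>_map G N h \<subseteq> D" if h: "h \<in> carrier G" for h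
      using N h by (auto simp: \<tau>_map_def r_coset_def)
    then show ?thesis by blast
  qed
  ultimately show ?thesis unfolding openin_logic[OF L m] by auto
qed

text \<open>Cosets of the preimage are preimages of cosets of N2, so there are few of them.\<close>

lemma pullback_bounded_index:
  assumes G: "definable_group M G" and G2: "definable_group M G2" and h: "definable_hom M G G2 h"
    and N2: "bounded_index_subgroup M \<kappa> G2 N2"
  shows "bounded_index_subgroup M \<kappa> G {x \<in> carrier G. h x \<in> N2}"
proof -
  interpret G: group G using G by (simp add: definable_group_def)
  interpret G2: group G2 using G2 by (simp add: definable_group_def)
  have hh: "h \<in> hom G G2" "definable_map M (carrier G) (carrier G2) h" using h by (auto simp: definable_hom_def)
  interpret group_hom G G2 h using hh by unfold_locales
  have L2: "lgroup G2 N2" using G2 N2 by (simp add: lgroup_def)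
  interpret S: subgroup N2 G2 by (rule lgroupD(3)[OF L2])
  obtain m where m: "definable M m (carrier G)" using definable_carrier[OF G] .
  obtain m2 where m2: "definable M m2 (carrier G2)" using definable_carrier[OF G2] .
  let ?N = "{x \<in> carrier G. h x \<in> N2}"
  have sub: "subgroup ?N G"
  proof
    show "inv\<^bsub>G\<^esub> x \<in> ?N" if "x \<in> ?N" for x using that S.m_inv_closed by simp
  qed (auto simp: S.m_closed)
  have "tdef m ?N"
    by (rule tdef_preimage[OF _ lgroup_tdef[OF L2 m2]]) (use hh(2) definable_map_iff[OF m m2] in blast)
  then have "type_definable M \<kappa> ?N" unfolding type_definable_tdef by blast
  moreover have "|rcosets\<^bsub>G\<^esub> ?N| <o \<kappa>"
  proof (rule subset_small[OF _ image_small[OF lgroupD(4)[OF L2]]])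
    show "rcosets\<^bsub>G\<^esub> ?N \<subseteq> (\<lambda>K. {x \<in> carrier G. h x \<in> K}) ` (rcosets\<^bsub>G2\<^esub> N2)"
    proof
      fix K assume "K \<in> rcosets\<^bsub>G\<^esub> ?N"
      then obtain x where x: "x \<in> carrier G" "K = ?N #>\<^bsub>G\<^esub> x" by (auto simp: RCOSETS_def)
      have "y \<in> K \<longleftrightarrow> h y \<in> N2 #>\<^bsub>G2\<^esub> h x" if y: "y \<in> carrier G" for y
        unfolding x(2) subgroup.rcos_module[OF sub G.is_group x(1) y] S.rcos_module[OF G2.is_group hom_closed[OF x(1)] hom_closed[OF y]]
        using x y by simp
      moreover have "K \<subseteq> carrier G" unfolding x(2)
        by (rule G.r_coset_subset_G[OF _ x(1)]) blast
      ultimately have "K = {y \<in> carrier G. h y \<in> N2 #>\<^bsub>G2\<^esub> h x}" by blast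
      moreover have "N2 #>\<^bsub>G2\<^esub> h x \<in> rcosets\<^bsub>G2\<^esub> N2" using x by (auto simp: RCOSETS_def)
      ultimately show "K \<in> (\<lambda>K. {x \<in> carrier G. h x \<in> K}) ` (rcosets\<^bsub>G2\<^esub> N2)" by blast
    qed
  qed
  ultimately show ?thesis using sub by (simp add: bounded_index_subgroup_def)
qed

text \<open>N is the smallest type-definable subgroup of bounded index, hence contained in the
  preimage of N2.\<close>

lemma G00_hom:
  assumes "definable_group M G" "definable_group M G2" "definable_hom M G G2 h"
    "is_G00 M \<kappa> G N" "bounded_index_subgroup M \<kappa> G2 N2" "x \<in> N"
  shows "h x \<in> N2"
  using pullback_bounded_index[OF assms(1,2,3,5)] assms(4,6) unfolding is_G00_def by blast

lemma is_G00_lgroup: "definable_group M G \<Longrightarrow> is_G00 M \<kappa> G N \<Longrightarrow> lgroup G N"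
  by (simp add: lgroup_def is_G00_def)

text \<open>Conjugation is a definable endomorphism, so normality is an instance of
  \<open>G00_hom\<close>.\<close>

lemma G00_conjugate:
  assumes G: "definable_group M G" and N: "is_G00 M \<kappa> G N" and x: "x \<in> carrier G" and n: "n \<in> N"
  shows "x \<otimes>\<^bsub>G\<^esub> n \<otimes>\<^bsub>G\<^esub> inv\<^bsub>G\<^esub> x \<in> N"
proof -
  interpret group G using G by (simp add: definable_group_def)
  obtain m where m: "definable M m (carrier G)" using definable_carrier[OF G] .
  have "dmap M m m (carrier G) (\<lambda>g. x \<otimes>\<^bsub>G\<^esub> g \<otimes>\<^bsub>G\<^esub> inv\<^bsub>G\<^esub> x)"
    using x definable_length[OF m] by (intro dmap_mult[OF G m] dmap_id dmap_const m) auto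
  then have "definable_map M (carrier G) (carrier G) (\<lambda>g. x \<otimes>\<^bsub>G\<^esub> g \<otimes>\<^bsub>G\<^esub> inv\<^bsub>G\<^esub> x)"
    unfolding definable_map_iff[OF m m] using x by auto
  moreover have "(\<lambda>g. x \<otimes>\<^bsub>G\<^esub> g \<otimes>\<^bsub>G\<^esub> inv\<^bsub>G\<^esub> x) \<in> hom G G"
  proof (rule homI)
    fix a b assume ab: "a \<in> carrier G" "b \<in> carrier G"
    have "x \<otimes>\<^bsub>G\<^esub> a \<otimes>\<^bsub>G\<^esub> inv\<^bsub>G\<^esub> x \<otimes>\<^bsub>G\<^esub> (x \<otimes>\<^bsub>G\<^esub> b \<otimes>\<^bsub>G\<^esub> inv\<^bsub>G\<^esub> x) =
        x \<otimes>\<^bsub>G\<^esub> a \<otimes>\<^bsub>G\<^esub> (inv\<^bsub>G\<^esub> x \<otimes>\<^bsub>G\<^esub> x) \<otimes>\<^bsub>G\<^esub> b \<otimes>\<^bsub>G\<^esub> inv\<^bsub>G\<^esub> x"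
      using x ab by (simp only: m_assoc m_closed inv_closed)
    then show "x \<otimes>\<^bsub>G\<^esub> (a \<otimes>\<^bsub>G\<^esub> b) \<otimes>\<^bsub>G\<^esub> inv\<^bsub>G\<^esub> x = x \<otimes>\<^bsub>G\<^esub> a \<otimes>\<^bsub>G\<^esub> inv\<^bsub>G\<^esub> x \<otimes>\<^bsub>G\<^esub> (x \<otimes>\<^bsub>G\<^esub> b \<otimes>\<^bsub>G\<^esub> inv\<^bsub>G\<^esub> x)"
      using x ab by (simp add: m_assoc)
  qed (use x in simp)
  ultimately have "definable_hom M G G (\<lambda>g. x \<otimes>\<^bsub>G\<^esub> g \<otimes>\<^bsub>G\<^esub> inv\<^bsub>G\<^esub> x)" by (simp add: definable_hom_def)
  then show ?thesis by (rule G00_hom[OF G G _ N _ n]) (use N in \<open>simp add: is_G00_def\<close>)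
qed

text \<open>Coset maps need not be homomorphisms: the shear \<open>(x, y) \<mapsto> (x, f x \<otimes> y)\<close> used below is not one.\<close>

definition coset_map :: "'a dgroup \<Rightarrow> 'a list set \<Rightarrow> 'a dgroup \<Rightarrow> 'a list set \<Rightarrow> ('a list \<Rightarrow> 'a list) \<Rightarrow> bool" where
  "coset_map G N G2 N2 k \<longleftrightarrow> lgroup G N \<and> lgroup G2 N2 \<and> cdmap M G G2 k \<and>
     (\<forall>x\<in>carrier G. \<forall>y\<in>\<tau>_map G N x. \<tau>_map G2 N2 (k y) = \<tau>_map G2 N2 (k x))"

lemma induced_map_tau:
  assumes "coset_map G N G2 N2 k" "x \<in> carrier G"
  shows "induced_map G2 N2 k (\<tau>_map G N x) = \<tau>_map G2 N2 (k x)"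
proof -
  have "(\<lambda>g. \<tau>_map G2 N2 (k g)) ` \<tau>_map G N x = {\<tau>_map G2 N2 (k x)}"
    using assms tau_self[of G N x] unfolding coset_map_def by blast
  then show ?thesis by (simp add: induced_map_def)
qed

text \<open>Closed sets correspond to type-definable sets upstairs, where the preimage is taken
  under the definable map k.\<close>

lemma coset_map_continuous:
  assumes k: "coset_map G N G2 N2 k"
  shows "continuous_map (logic_topology M \<kappa> G N) (logic_topology M \<kappa> G2 N2) (induced_map G2 N2 k)"
proof -
  have L: "lgroup G N" "lgroup G2 N2" and kd: "cdmap M G G2 k" using k by (auto simp: coset_map_def)
  obtain m where m: "definable M m (carrier G)" using definable_carrier[OF lgroupD(1)[OF L(1)]] .
  obtain m2 where m2: "definable M m2 (carrier G2)" using definable_carrier[OF lgroupD(1)[OF L(2)]] .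
  have kdm: "dmap M m m2 (carrier G) k" using kd definable_map_iff[OF m m2] by (auto simp: cdmap_def)
  show ?thesis unfolding continuous_map_def
  proof (intro conjI allI impI)
    show "induced_map G2 N2 k \<in> topspace (logic_topology M \<kappa> G N) \<rightarrow> topspace (logic_topology M \<kappa> G2 N2)"
      unfolding topspace_logic[OF L(1)] topspace_logic[OF L(2)] using induced_map_tau[OF k] cdmap_mem[OF kd] by auto
    fix U assume U: "openin (logic_topology M \<kappa> G2 N2) U"
    have "tdef m {g \<in> carrier G. k g \<in> {g \<in> carrier G2. \<tau>_map G2 N2 g \<notin> U}}"
      by (rule tdef_preimage[OF kdm]) (use U openin_logic[OF L(2) m2] in blast)
    moreover have "{g \<in> carrier G. k g \<in> {g \<in> carrier G2. \<tau>_map G2 N2 g \<notin> U}} =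
        {g \<in> carrier G. \<tau>_map G N g \<notin> {x \<in> \<tau>_map G N ` carrier G. induced_map G2 N2 k x \<in> U}}"
      using cdmap_mem[OF kd] induced_map_tau[OF k] by auto
    ultimately show "openin (logic_topology M \<kappa> G N) {x \<in> topspace (logic_topology M \<kappa> G N). induced_map G2 N2 k x \<in> U}"
      unfolding openin_logic[OF L(1) m] topspace_logic[OF L(1)] by auto
  qed
qed

section \<open>Comparison morphisms and retractions\<close>

lemma is_comparisonI:
  assumes "gpd_morphism (def_fund_gpd M G) (fund_gpd (logic_topology M \<kappa> G N)) T"
    "\<And>g. g \<in> carrier G \<Longrightarrow> fst T g = \<tau>_map G N g"
    "\<And>U a. openin (logic_topology M \<kappa> G N) U \<Longrightarrow> def_path M G a \<Longrightarrow> (\<And>s. 0 \<le> s \<Longrightarrow> s \<le> 1 \<Longrightarrow> \<tau>_map G N (a [s]) \<in> U) \<Longrightarrow>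
      \<exists>b. pathin (logic_topology M \<kappa> G N) b \<and> b ` {0..1} \<subseteq> U \<and> snd T (def_path_class M G a) = path_class (logic_topology M \<kappa> G N) b"
  shows "is_comparison M \<kappa> G N T"
  unfolding is_comparison_def Let_def
proof (intro conjI allI impI ballI)
  fix U a assume "openin (logic_topology M \<kappa> G N) U \<and> def_path M G a \<and> (\<forall>s\<in>unit_cube 1. \<tau>_map G N (a s) \<in> U)"
  then show "\<exists>b. pathin (logic_topology M \<kappa> G N) b \<and> b ` {0..1} \<subseteq> U \<and> snd T (def_path_class M G a) = path_class (logic_topology M \<kappa> G N) b"
    by (intro assms(3)) auto
qed (use assms in auto)

lemma is_comparisonD:
  assumes "is_comparison M \<kappa> G N T"
  shows "gpd_morphism (def_fund_gpd M G) (fund_gpd (logic_topology M \<kappa> G N)) T"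
    "g \<in> carrier G \<Longrightarrow> fst T g = \<tau>_map G N g"
    "openin (logic_topology M \<kappa> G N) U \<Longrightarrow> def_path M G a \<Longrightarrow> (\<And>s. 0 \<le> s \<Longrightarrow> s \<le> 1 \<Longrightarrow> \<tau>_map G N (a [s]) \<in> U) \<Longrightarrow>
      \<exists>b. pathin (logic_topology M \<kappa> G N) b \<and> b ` {0..1} \<subseteq> U \<and> snd T (def_path_class M G a) = path_class (logic_topology M \<kappa> G N) b"
proof -
  note C = assms[unfolded is_comparison_def Let_def]
  show "gpd_morphism (def_fund_gpd M G) (fund_gpd (logic_topology M \<kappa> G N)) T" using C by blast
  show "g \<in> carrier G \<Longrightarrow> fst T g = \<tau>_map G N g" using C by blast
  show "\<exists>b. pathin (logic_topology M \<kappa> G N) b \<and> b ` {0..1} \<subseteq> U \<and> snd T (def_path_class M G a) = path_class (logic_topology M \<kappa> G N) b"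
    if "openin (logic_topology M \<kappa> G N) U" "def_path M G a" "\<And>s. 0 \<le> s \<Longrightarrow> s \<le> 1 \<Longrightarrow> \<tau>_map G N (a [s]) \<in> U"
  proof -
    have "\<forall>s\<in>unit_cube 1. \<tau>_map G N (a s) \<in> U"
    proof
      fix s :: "'a list" assume "s \<in> unit_cube 1"
      then obtain t where "s = [t]" "0 \<le> t" "t \<le> 1" by (rule unit_cube_1E)
      then show "\<tau>_map G N (a s) \<in> U" using that(3) by blast
    qed
    then show ?thesis using C[THEN conjunct2, THEN conjunct2] that(1,2) by blast
  qed
qed

lemma comparison_path:
  assumes T: "is_comparison M \<kappa> G N T" and G: "definable_group M G" and a: "def_path M G a"
  shows "\<exists>b. pathin (logic_topology M \<kappa> G N) b \<and> b 0 = \<tau>_map G N (a [0]) \<and> b 1 = \<tau>_map G N (a [1]) \<and>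
    snd T (def_path_class M G a) = path_class (logic_topology M \<kappa> G N) b"
proof -
  have a01: "a [0] \<in> carrier G" "a [1] \<in> carrier G" using def_path_mem[OF a] by auto
  have "def_path_class M G a \<in> Hom (def_fund_gpd M G) (a [0]) (a [1])"
    unfolding def_fund_gpd_simps using a by blast
  then have "snd T (def_path_class M G a) \<in> Hom (fund_gpd (logic_topology M \<kappa> G N)) (fst T (a [0])) (fst T (a [1]))"
    using gpd_morphismD(3)[OF is_comparisonD(1)[OF T]] a01 by (simp add: def_fund_gpd_simps)
  then show ?thesis unfolding fund_gpd_simps is_comparisonD(2)[OF T a01(1)] is_comparisonD(2)[OF T a01(2)] by blast
qed

text \<open>Open sets are pulled back along v and paths pushed forward along u; since v undoes u,
  the two fit together. With uniqueness this computes comparison morphisms: for the projections of H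
  with their slices, and for the shear with its inverse.\<close>

lemma comparison_retract:
  assumes T: "is_comparison M \<kappa> H NH T" and u: "coset_map G N H NH u" and v: "coset_map H NH G N v"
    and vu: "\<And>x. x \<in> carrier G \<Longrightarrow> v (u x) = x"
  shows "is_comparison M \<kappa> G N (fund_map (logic_topology M \<kappa> G N) (induced_map G N v) \<circ>\<^sub>g (T \<circ>\<^sub>g def_fund_map M H u))" (is "is_comparison M \<kappa> G N ?S")
proof -
  let ?\<Lambda> = "logic_topology M \<kappa> G N"
  let ?\<Lambda>H = "logic_topology M \<kappa> H NH"
  have uc: "cdmap M G H u" and LH: "lgroup H NH" and LG: "lgroup G N" using u by (auto simp: coset_map_def)
  note vc = coset_map_continuous[OF v]
  have fu: "fst (def_fund_map M H u) = u" by (simp add: def_fund_map_def)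
  have fv: "fst (fund_map ?\<Lambda> (induced_map G N v)) = induced_map G N v" by (simp add: fund_map_def)
  show ?thesis
  proof (rule is_comparisonI)
    show "gpd_morphism (def_fund_gpd M G) (fund_gpd ?\<Lambda>) ?S"
      by (rule gpd_morphism_comp[OF gpd_morphism_comp[OF def_fund_map_morphism[OF uc] is_comparisonD(1)[OF T]]
            fund_map_morphism[OF vc]])
    show "fst ?S g = \<tau>_map G N g" if g: "g \<in> carrier G" for g
      using is_comparisonD(2)[OF T cdmap_mem[OF uc g]] induced_map_tau[OF v cdmap_mem[OF uc g]] vu[OF g]
      by (simp add: gpd_comp_def fu fv)
    fix U a assume U: "openin ?\<Lambda> U" and a: "def_path M G a" and aU: "\<And>s. 0 \<le> s \<Longrightarrow> s \<le> 1 \<Longrightarrow> \<tau>_map G N (a [s]) \<in> U"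
    define V where "V = {K \<in> topspace ?\<Lambda>H. induced_map G N v K \<in> U}"
    have V: "openin ?\<Lambda>H V" unfolding V_def by (rule openin_continuous_map_preimage[OF vc U])
    have "\<tau>_map H NH ((u \<circ> a) [s]) \<in> V" if s: "0 \<le> s" "s \<le> 1" for s
    proof -
      have as: "a [s] \<in> carrier G" using def_path_mem[OF a s] .
      then show ?thesis
        using induced_map_tau[OF v cdmap_mem[OF uc as]] vu[OF as] aU[OF s] cdmap_mem[OF uc as]
        unfolding V_def topspace_logic[OF LH] by auto
    qed
    from is_comparisonD(3)[OF T V cdmap_def_path[OF uc a] this]
    obtain b where b: "pathin ?\<Lambda>H b" "b ` {0..1} \<subseteq> V" "snd T (def_path_class M H (u \<circ> a)) = path_class ?\<Lambda>H b" by blast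
    have "snd ?S (def_path_class M G a) = path_class ?\<Lambda> (induced_map G N v \<circ> b)"
      by (simp add: gpd_comp_def def_fund_map_class[OF uc a] b(3) fund_map_class[OF vc b(1)])
    moreover have "(induced_map G N v \<circ> b) ` {0..1} \<subseteq> U" using b(2) unfolding V_def by auto
    ultimately show "\<exists>b. pathin ?\<Lambda> b \<and> b ` {0..1} \<subseteq> U \<and> snd ?S (def_path_class M G a) = path_class ?\<Lambda> b"
      using pathin_compose'[OF b(1) vc] by blast
  qed
qed

end

section \<open>Products of definable groups\<close>

definition lprod :: "'a list set \<Rightarrow> 'a list set \<Rightarrow> 'a list set" where
  "lprod A B = {x @ y | x y. x \<in> A \<and> y \<in> B}"

lemma lprod_mem:
  assumes "\<And>x. x \<in> A \<Longrightarrow> length x = m"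
  shows "w \<in> lprod A B \<longleftrightarrow> take m w \<in> A \<and> drop m w \<in> B"
proof
  assume "w \<in> lprod A B"
  then show "take m w \<in> A \<and> drop m w \<in> B" using assms by (auto simp: lprod_def)
next
  assume "take m w \<in> A \<and> drop m w \<in> B"
  then show "w \<in> lprod A B" unfolding lprod_def by (intro CollectI exI[of _ "take m w"] exI[of _ "drop m w"]) simp
qed

text \<open>Appending forgets where the first factor ends, so the length m of its points is passed
  explicitly; the topology is that of the product, pulled back along the splitting.\<close>

definition dprod :: "nat \<Rightarrow> 'a dgroup \<Rightarrow> 'a dgroup \<Rightarrow> 'a dgroup" where
  "dprod m G G' = \<lparr>carrier = lprod (carrier G) (carrier G'),
     mult = (\<lambda>u v. (take m u \<otimes>\<^bsub>G\<^esub> take m v) @ (drop m u \<otimes>\<^bsub>G'\<^esub> drop m v)),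
     one = \<one>\<^bsub>G\<^esub> @ \<one>\<^bsub>G'\<^esub>,
     gtop = pullback_topology (lprod (carrier G) (carrier G')) (\<lambda>u. (take m u, drop m u)) (prod_topology (gtop G) (gtop G'))\<rparr>"

lemma dprod_simps [simp]:
  "carrier (dprod m G G') = lprod (carrier G) (carrier G')"
  "u \<otimes>\<^bsub>dprod m G G'\<^esub> v = (take m u \<otimes>\<^bsub>G\<^esub> take m v) @ (drop m u \<otimes>\<^bsub>G'\<^esub> drop m v)"
  "\<one>\<^bsub>dprod m G G'\<^esub> = \<one>\<^bsub>G\<^esub> @ \<one>\<^bsub>G'\<^esub>"
  by (simp_all add: dprod_def)

lemma gtop_dprod:
  "gtop (dprod m G G') = pullback_topology (lprod (carrier G) (carrier G')) (\<lambda>u. (take m u, drop m u)) (prod_topology (gtop G) (gtop G'))"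
  by (simp add: dprod_def)

lemma continuous_map_box_take: "continuous_map (box_topology (n + n')) (box_topology n) (take n :: 'a::linordered_field list \<Rightarrow> 'a list)"
  and continuous_map_box_drop: "continuous_map (box_topology (n + n')) (box_topology n') (drop n :: 'a::linordered_field list \<Rightarrow> 'a list)"
proof -
  show "continuous_map (box_topology (n + n')) (box_topology n) (take n :: 'a list \<Rightarrow> 'a list)"
  proof (rule continuous_map_box)
    show "cont_at (n + n') (\<lambda>x. take n x ! i) x" if "i < n" for x :: "'a list" and i
      using cont_at_nth[of i "n + n'" x] that by simp
  qed simp
  show "continuous_map (box_topology (n + n')) (box_topology n') (drop n :: 'a list \<Rightarrow> 'a list)"
  proof (rule continuous_map_box)
    fix x :: "'a list" and i assume x: "length x = n + n'" and i: "i < n'"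
    have "\<bar>drop n y ! i - drop n x ! i\<bar> < \<epsilon>" if "length y = n + n'" "y \<in> cube (n + n') x \<epsilon>" for y \<epsilon>
      using that x i by (auto simp: cube_def)
    then show "cont_at (n + n') (\<lambda>x. drop n x ! i) x" unfolding cont_at_def by blast
  qed simp
qed

lemma continuous_map_box_append:
  fixes f g :: "'b \<Rightarrow> 'a::linordered_field list"
  assumes f: "continuous_map X (box_topology n) f" and g: "continuous_map X (box_topology n') g"
  shows "continuous_map X (box_topology (n + n')) (\<lambda>x. f x @ g x)"
proof -
  have len: "length (f x) = n" "length (g x) = n'" if "x \<in> topspace X" for x
    using f g that by (auto simp: continuous_map_def)
  have "topcontinuous_at X (box_topology (n + n')) (\<lambda>x. f x @ g x) x" if x: "x \<in> topspace X" for x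
    unfolding topcontinuous_at_def
  proof (intro conjI allI impI)
    show "x \<in> topspace X" by (rule x)
    show "(\<lambda>x. f x @ g x) \<in> topspace X \<rightarrow> topspace (box_topology (n + n'))" using len by auto
    fix V :: "'a list set" assume V: "openin (box_topology (n + n')) V \<and> f x @ g x \<in> V"
    then obtain d where d: "d > 0" "cube (n + n') (f x @ g x) d \<subseteq> V" unfolding openin_box_topology by blast
    define W where "W = {y \<in> topspace X. f y \<in> cube n (f x) d} \<inter> {y \<in> topspace X. g y \<in> cube n' (g x) d}"
    have "openin X W" unfolding W_def
      by (intro openin_Int openin_continuous_map_preimage[OF f] openin_continuous_map_preimage[OF g] openin_cube d)
    moreover have "x \<in> W" unfolding W_def using x len[OF x] d(1) by (simp add: cube_center)
    moreover have "f y @ g y \<in> V" if y: "y \<in> W" for y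
    proof -
      have fy: "f y \<in> cube n (f x) d" "g y \<in> cube n' (g x) d" using y unfolding W_def by auto
      then have "f y @ g y \<in> cube (n + n') (f x @ g x) d"
        using len[OF x] by (auto simp: cube_def nth_append)
      then show ?thesis using d(2) by blast
    qed
    ultimately show "\<exists>U. openin X U \<and> x \<in> U \<and> (\<forall>y\<in>U. f y @ g y \<in> V)" by blast
  qed
  then show ?thesis unfolding continuous_map_eq_topcontinuous_at by blast
qed

locale definable_pair = tame_structure +
  fixes G G' :: "'a dgroup" and m m' :: nat
  assumes G: "definable_group M G" and G': "definable_group M G'"
    and m: "definable M m (carrier G)" and m': "definable M m' (carrier G')"
begin

abbreviation H :: "'a dgroup" where "H \<equiv> dprod m G G'"

sublocale G: group G using G by (simp add: definable_group_def)
sublocale G': group G' using G' by (simp add: definable_group_def)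

lemma len: "x \<in> carrier G \<Longrightarrow> length x = m" and len': "y \<in> carrier G' \<Longrightarrow> length y = m'"
  using definable_length m m' by blast+

lemma mem_H: "w \<in> lprod (carrier G) (carrier G') \<longleftrightarrow> take m w \<in> carrier G \<and> drop m w \<in> carrier G'"
  by (rule lprod_mem[OF len])

lemma append_mem_H: "x \<in> carrier G \<Longrightarrow> y \<in> carrier G' \<Longrightarrow> x @ y \<in> lprod (carrier G) (carrier G')"
  by (auto simp: lprod_def)

lemma take_drop_append [simp]:
  "x \<in> carrier G \<Longrightarrow> take m (x @ y) = x" "x \<in> carrier G \<Longrightarrow> drop m (x @ y) = y"
  by (simp_all add: len)

text \<open>With the general rules active, the simplifier would distribute \<open>take m\<close> and
  \<open>drop m\<close> over the append; the rules just declared return the two coordinates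
  directly.\<close>

declare take_append [simp del] drop_append [simp del]

section \<open>The product as a definable topological group\<close>

lemma group_H: "group H"
proof (rule groupI)
  fix u v assume "u \<in> carrier H" "v \<in> carrier H"
  then show "u \<otimes>\<^bsub>H\<^esub> v \<in> carrier H" by (simp add: mem_H)
next
  show "\<one>\<^bsub>H\<^esub> \<in> carrier H" by (simp add: mem_H)
next
  fix u v w assume "u \<in> carrier H" "v \<in> carrier H" "w \<in> carrier H"
  then show "u \<otimes>\<^bsub>H\<^esub> v \<otimes>\<^bsub>H\<^esub> w = u \<otimes>\<^bsub>H\<^esub> (v \<otimes>\<^bsub>H\<^esub> w)" by (simp add: mem_H G.m_assoc G'.m_assoc)
next
  fix u assume u: "u \<in> carrier H"
  then show "\<one>\<^bsub>H\<^esub> \<otimes>\<^bsub>H\<^esub> u = u" by (simp add: mem_H)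
  show "\<exists>v\<in>carrier H. v \<otimes>\<^bsub>H\<^esub> u = \<one>\<^bsub>H\<^esub>"
    using u by (intro bexI[of _ "inv\<^bsub>G\<^esub> (take m u) @ inv\<^bsub>G'\<^esub> (drop m u)"]) (simp_all add: mem_H)
qed

lemma inv_H: "u \<in> carrier H \<Longrightarrow> inv\<^bsub>H\<^esub> u = inv\<^bsub>G\<^esub> (take m u) @ inv\<^bsub>G'\<^esub> (drop m u)"
  by (rule group.inv_equality[OF group_H]) (simp_all add: mem_H)

lemma definable_H: "definable M (m + m') (carrier H)"
  using definable_Times[OF m m'] by (simp add: lprod_def)

lemma tops: "topspace (gtop G) = carrier G" "topspace (gtop G') = carrier G'"
  using G G' by (auto simp: definable_group_def topological_group_on_def)

lemma topspace_H: "topspace (gtop H) = carrier H"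
  unfolding gtop_dprod topspace_pullback_topology by (auto simp: tops mem_H)

lemma continuous_take: "continuous_map (gtop H) (gtop G) (take m)"
  and continuous_drop: "continuous_map (gtop H) (gtop G') (drop m)"
proof -
  have "continuous_map (gtop H) (gtop G) (fst \<circ> (\<lambda>u. (take m u, drop m u)))"
    "continuous_map (gtop H) (gtop G') (snd \<circ> (\<lambda>u. (take m u, drop m u)))"
    unfolding gtop_dprod
    by (rule continuous_map_pullback[OF continuous_map_fst]) (rule continuous_map_pullback[OF continuous_map_snd])
  then show "continuous_map (gtop H) (gtop G) (take m)" "continuous_map (gtop H) (gtop G') (drop m)"
    by (simp_all add: o_def)
qed

lemma continuous_into_H:
  assumes "continuous_map X (gtop G) (\<lambda>x. take m (g x))" "continuous_map X (gtop G') (\<lambda>x. drop m (g x))"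
  shows "continuous_map X (gtop H) g"
  unfolding gtop_dprod
proof (rule continuous_map_pullback')
  show "continuous_map X (prod_topology (gtop G) (gtop G')) ((\<lambda>u. (take m u, drop m u)) \<circ> g)"
    using assms by (auto simp: o_def intro: continuous_map_pairedI)
  show "topspace X \<subseteq> g -` lprod (carrier G) (carrier G')"
    using assms by (auto simp: mem_H continuous_map_def tops)
qed

lemma continuous_append:
  assumes "continuous_map X (gtop G) f" "continuous_map X (gtop G') g"
  shows "continuous_map X (gtop H) (\<lambda>x. f x @ g x)"
proof (rule continuous_into_H)
  have f: "f x \<in> carrier G" if "x \<in> topspace X" for x using assms(1) that tops by (auto simp: continuous_map_def)
  show "continuous_map X (gtop G) (\<lambda>x. take m (f x @ g x))"
    by (rule continuous_map_eq[OF assms(1)]) (simp add: f)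
  show "continuous_map X (gtop G') (\<lambda>x. drop m (f x @ g x))"
    by (rule continuous_map_eq[OF assms(2)]) (simp add: f)
qed

lemma continuous_mult: "continuous_map (prod_topology (gtop G) (gtop G)) (gtop G) (\<lambda>(x, y). x \<otimes>\<^bsub>G\<^esub> y)"
  and continuous_mult': "continuous_map (prod_topology (gtop G') (gtop G')) (gtop G') (\<lambda>(x, y). x \<otimes>\<^bsub>G'\<^esub> y)"
  and continuous_inv: "continuous_map (gtop G) (gtop G) (\<lambda>x. inv\<^bsub>G\<^esub> x)"
  and continuous_inv': "continuous_map (gtop G') (gtop G') (\<lambda>x. inv\<^bsub>G'\<^esub> x)"
  using G G' by (auto simp: definable_group_def topological_group_on_def)

lemma continuous_multI:
  "continuous_map X (gtop G) f \<Longrightarrow> continuous_map X (gtop G) g \<Longrightarrow> continuous_map X (gtop G) (\<lambda>x. f x \<otimes>\<^bsub>G\<^esub> g x)"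
  using continuous_map_compose[OF continuous_map_pairedI continuous_mult] by (simp add: o_def)

lemma continuous_multI':
  "continuous_map X (gtop G') f \<Longrightarrow> continuous_map X (gtop G') g \<Longrightarrow> continuous_map X (gtop G') (\<lambda>x. f x \<otimes>\<^bsub>G'\<^esub> g x)"
  using continuous_map_compose[OF continuous_map_pairedI continuous_mult'] by (simp add: o_def)

lemma continuous_compose: "continuous_map X Y f \<Longrightarrow> continuous_map Y Z g \<Longrightarrow> continuous_map X Z (\<lambda>x. g (f x))"
  using continuous_map_compose by (fastforce simp: o_def)

lemma topological_group_H: "topological_group_on H"
  unfolding topological_group_on_def
proof (intro conjI)
  show "topspace (gtop H) = carrier H" by (rule topspace_H)
  have "continuous_map (prod_topology (gtop H) (gtop H)) (gtop H)
      (\<lambda>z. (take m (fst z) \<otimes>\<^bsub>G\<^esub> take m (snd z)) @ (drop m (fst z) \<otimes>\<^bsub>G'\<^esub> drop m (snd z)))"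
    by (intro continuous_append continuous_multI continuous_multI'
        continuous_compose[OF continuous_map_fst continuous_take] continuous_compose[OF continuous_map_snd continuous_take]
        continuous_compose[OF continuous_map_fst continuous_drop] continuous_compose[OF continuous_map_snd continuous_drop])
  then show "continuous_map (prod_topology (gtop H) (gtop H)) (gtop H) (\<lambda>(x, y). x \<otimes>\<^bsub>H\<^esub> y)"
    by (simp add: case_prod_beta')
  have "continuous_map (gtop H) (gtop H) (\<lambda>u. inv\<^bsub>G\<^esub> (take m u) @ inv\<^bsub>G'\<^esub> (drop m u))"
    by (intro continuous_append continuous_compose[OF continuous_take continuous_inv] continuous_compose[OF continuous_drop continuous_inv'])
  then show "continuous_map (gtop H) (gtop H) (\<lambda>x. inv\<^bsub>H\<^esub> x)"
    by (rule continuous_map_eq) (simp add: topspace_H inv_H del: dprod_simps)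
qed

lemma dmap_take: "dmap M (m + m') m (carrier H) (take m)" and dmap_drop: "dmap M (m + m') m' (carrier H) (drop m)"
  by (rule dmap_vt[OF vt_takeI definable_H], simp) (rule dmap_vt[OF vt_dropI definable_H], simp)

lemma definable_mult_H: "definable_set M {x @ y @ (x \<otimes>\<^bsub>H\<^esub> y) | x y. x \<in> carrier H \<and> y \<in> carrier H}"
proof -
  let ?n = "m + m'"
  let ?HH = "{x @ y | x y. x \<in> carrier H \<and> y \<in> carrier H}"
  have HH: "definable M (?n + ?n) ?HH" by (rule definable_Times[OF definable_H definable_H])
  have lenH: "length u = ?n" if "u \<in> carrier H" for u using definable_length[OF definable_H that] .
  have t1: "dmap M (?n + ?n) ?n ?HH (take ?n)" by (rule dmap_vt[OF vt_takeI HH]) simp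
  have t2: "dmap M (?n + ?n) ?n ?HH (drop ?n)" by (rule dmap_vt[OF vt_dropI HH]) simp
  have r: "take ?n w \<in> carrier H" "drop ?n w \<in> carrier H" if "w \<in> ?HH" for w using that lenH by (auto simp: take_append drop_append simp del: dprod_simps)
  have r': "take m (take ?n w) \<in> carrier G" "drop m (take ?n w) \<in> carrier G'" "take m (drop ?n w) \<in> carrier G" "drop m (drop ?n w) \<in> carrier G'"
    if "w \<in> ?HH" for w using r[OF that] by (simp_all only: dprod_simps mem_H)
  have "dmap M (?n + ?n) (m + m') ?HH (\<lambda>w. (take m (take ?n w) \<otimes>\<^bsub>G\<^esub> take m (drop ?n w)) @ (drop m (take ?n w) \<otimes>\<^bsub>G'\<^esub> drop m (drop ?n w)))"
    by (intro dmap_append dmap_mult[OF G m] dmap_mult[OF G' m'] dmap_comp[OF t1 dmap_take r(1)] dmap_comp[OF t2 dmap_take r(2)]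
        dmap_comp[OF t1 dmap_drop r(1)] dmap_comp[OF t2 dmap_drop r(2)] Pi_I r')
  from dmap_graph[OF this]
  have "definable M (?n + ?n + (m + m')) {w @ ((take m (take ?n w) \<otimes>\<^bsub>G\<^esub> take m (drop ?n w)) @ (drop m (take ?n w) \<otimes>\<^bsub>G'\<^esub> drop m (drop ?n w))) | w. w \<in> ?HH}" .
  also have "{w @ ((take m (take ?n w) \<otimes>\<^bsub>G\<^esub> take m (drop ?n w)) @ (drop m (take ?n w) \<otimes>\<^bsub>G'\<^esub> drop m (drop ?n w))) | w. w \<in> ?HH} =
      {x @ y @ (x \<otimes>\<^bsub>H\<^esub> y) | x y. x \<in> carrier H \<and> y \<in> carrier H}" (is "?L = ?R")
  proof (intro equalityI subsetI)
    fix z assume "z \<in> ?L"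
    then obtain x y where xy: "x \<in> carrier H" "y \<in> carrier H" and z: "z = (x @ y) @ ((take m (take ?n (x @ y)) \<otimes>\<^bsub>G\<^esub> take m (drop ?n (x @ y))) @ (drop m (take ?n (x @ y)) \<otimes>\<^bsub>G'\<^esub> drop m (drop ?n (x @ y))))"
      by blast
    have "take ?n (x @ y) = x" "drop ?n (x @ y) = y" using lenH[OF xy(1)] by (simp_all add: take_append drop_append)
    then have "z = x @ y @ (x \<otimes>\<^bsub>H\<^esub> y)" using z by simp
    then show "z \<in> ?R" using xy by blast
  next
    fix z assume "z \<in> ?R"
    then obtain x y where xy: "x \<in> carrier H" "y \<in> carrier H" and z: "z = x @ y @ (x \<otimes>\<^bsub>H\<^esub> y)" by blast
    have "take ?n (x @ y) = x" "drop ?n (x @ y) = y" using lenH[OF xy(1)] by (simp_all add: take_append drop_append)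
    then have "z = (x @ y) @ ((take m (take ?n (x @ y)) \<otimes>\<^bsub>G\<^esub> take m (drop ?n (x @ y))) @ (drop m (take ?n (x @ y)) \<otimes>\<^bsub>G'\<^esub> drop m (drop ?n (x @ y))))"
      using z by simp
    then show "z \<in> ?L" using xy by blast
  qed
  finally show ?thesis unfolding definable_set_def by blast
qed

section \<open>The product atlas\<close>

lemma chart_product:
  assumes U: "openin (gtop G) U" "openin (box_topology n) (\<phi> ` U)" "definable_map M U (\<phi> ` U) \<phi>"
      "homeomorphic_map (subtopology (gtop G) U) (subtopology (box_topology n) (\<phi> ` U)) \<phi>"
    and U': "openin (gtop G') U'" "openin (box_topology n') (\<phi>' ` U')" "definable_map M U' (\<phi>' ` U') \<phi>'"
      "homeomorphic_map (subtopology (gtop G') U') (subtopology (box_topology n') (\<phi>' ` U')) \<phi>'"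
  defines "\<xi> \<equiv> \<lambda>w. \<phi> (take m w) @ \<phi>' (drop m w)"
  shows "openin (gtop H) (lprod U U')" "openin (box_topology (n + n')) (\<xi> ` lprod U U')"
    "definable_map M (lprod U U') (\<xi> ` lprod U U') \<xi>"
    "homeomorphic_map (subtopology (gtop H) (lprod U U')) (subtopology (box_topology (n + n')) (\<xi> ` lprod U U')) \<xi>"
proof -
  have UG: "U \<subseteq> carrier G" "U' \<subseteq> carrier G'" using U(1) U'(1) tops openin_subset by blast+
  have memU: "w \<in> lprod U U' \<longleftrightarrow> take m w \<in> U \<and> drop m w \<in> U'" for w
    by (rule lprod_mem) (use UG len in blast)
  have dU: "dmap M m n U \<phi>" by (rule chart_dmap[OF U(1) tops(1) m U(2,3)])
  have dU': "dmap M m' n' U' \<phi>'" by (rule chart_dmap[OF U'(1) tops(2) m' U'(2,3)])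
  have lphi: "length (\<phi> x) = n" if "x \<in> U" for x using dmap_length[OF dU that] .
  have memV: "w \<in> lprod (\<phi> ` U) (\<phi>' ` U') \<longleftrightarrow> take n w \<in> \<phi> ` U \<and> drop n w \<in> \<phi>' ` U'" for w
    by (rule lprod_mem) (use lphi in auto)
  have img: "\<xi> ` lprod U U' = lprod (\<phi> ` U) (\<phi>' ` U')"
  proof (intro equalityI subsetI)
    fix z assume "z \<in> \<xi> ` lprod U U'" then show "z \<in> lprod (\<phi> ` U) (\<phi>' ` U')"
      unfolding \<xi>_def using memU by (auto simp: lprod_def)
  next
    fix z assume "z \<in> lprod (\<phi> ` U) (\<phi>' ` U')"
    then obtain x y where xy: "x \<in> U" "y \<in> U'" "z = \<phi> x @ \<phi>' y" by (auto simp: lprod_def)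
    have "x \<in> carrier G" using xy UG by blast
    then have "z = \<xi> (x @ y)" using xy by (simp add: \<xi>_def)
    moreover have "x @ y \<in> lprod U U'" using xy by (auto simp: lprod_def)
    ultimately show "z \<in> \<xi> ` lprod U U'" by blast
  qed
  show oU: "openin (gtop H) (lprod U U')"
    unfolding gtop_dprod openin_pullback_topology
  proof (intro exI conjI)
    show "openin (prod_topology (gtop G) (gtop G')) (U \<times> U')" using U(1) U'(1) by (simp add: openin_prod_Times_iff)
    show "lprod U U' = (\<lambda>u. (take m u, drop m u)) -` (U \<times> U') \<inter> lprod (carrier G) (carrier G')"
      using memU mem_H UG by blast
  qed
  show oV: "openin (box_topology (n + n')) (\<xi> ` lprod U U')"
  proof -
    have "openin (box_topology (n + n')) ({w \<in> topspace (box_topology (n + n')). take n w \<in> \<phi> ` U} \<inter>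
        {w \<in> topspace (box_topology (n + n')). drop n w \<in> \<phi>' ` U'})"
      by (intro openin_Int openin_continuous_map_preimage[OF continuous_map_box_take U(2)]
          openin_continuous_map_preimage[OF continuous_map_box_drop U'(2)])
    moreover have "{w \<in> topspace (box_topology (n + n')). take n w \<in> \<phi> ` U} \<inter>
        {w \<in> topspace (box_topology (n + n')). drop n w \<in> \<phi>' ` U'} = lprod (\<phi> ` U) (\<phi>' ` U')"
    proof -
      have l: "length w = n + n'" if "w \<in> lprod (\<phi> ` U) (\<phi>' ` U')" for w
        using that lphi dmap_length[OF dU'] by (auto simp: lprod_def)
      show ?thesis
      proof (rule Set.set_eqI)
        fix w
        show "w \<in> {w \<in> topspace (box_topology (n + n')). take n w \<in> \<phi> ` U} \<inter>
          {w \<in> topspace (box_topology (n + n')). drop n w \<in> \<phi>' ` U'} \<longleftrightarrow> w \<in> lprod (\<phi> ` U) (\<phi>' ` U')"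
          unfolding Int_iff mem_Collect_eq topspace_box_topology using l[of w] memV[of w] by blast
      qed
    qed
    ultimately show ?thesis unfolding img by simp
  qed
  have dUU: "definable M (m + m') (lprod U U')"
    using definable_Times[of M m U m' U'] dU dU' by (simp add: dmap_def lprod_def)
  have d\<xi>: "dmap M (m + m') (n + n') (lprod U U') \<xi>"
    unfolding \<xi>_def
  proof (rule dmap_append)
    show "dmap M (m + m') n (lprod U U') (\<lambda>w. \<phi> (take m w))"
      by (rule dmap_comp[OF dmap_vt[OF vt_takeI dUU] dU]) (auto simp: memU)
    show "dmap M (m + m') n' (lprod U U') (\<lambda>w. \<phi>' (drop m w))"
      by (rule dmap_comp[OF dmap_vt[OF vt_dropI dUU] dU']) (auto simp: memU)
  qed
  show "definable_map M (lprod U U') (\<xi> ` lprod U U') \<xi>"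
    unfolding definable_map_iff[OF dUU dmap_image[OF d\<xi> subset_refl dUU]] using d\<xi> by blast
  obtain \<psi> where \<psi>: "homeomorphic_maps (subtopology (gtop G) U) (subtopology (box_topology n) (\<phi> ` U)) \<phi> \<psi>"
    using U(4) homeomorphic_map_maps by blast
  obtain \<psi>' where \<psi>': "homeomorphic_maps (subtopology (gtop G') U') (subtopology (box_topology n') (\<phi>' ` U')) \<phi>' \<psi>'"
    using U'(4) homeomorphic_map_maps by blast
  have tsU: "topspace (subtopology (gtop G) U) = U" "topspace (subtopology (gtop G') U') = U'"
    using UG tops by auto
  have inv: "\<psi> (\<phi> x) = x" if "x \<in> U" for x using \<psi> that unfolding homeomorphic_maps_def tsU by blast
  have inv': "\<psi>' (\<phi>' x) = x" if "x \<in> U'" for x using \<psi>' that unfolding homeomorphic_maps_def tsU by blast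
  define \<omega> where "\<omega> = (\<lambda>w. \<psi> (take n w) @ \<psi>' (drop n w))"
  let ?S = "subtopology (gtop H) (lprod U U')"
  let ?B = "subtopology (box_topology (n + n')) (\<xi> ` lprod U U')"
  have "homeomorphic_maps ?S ?B \<xi> \<omega>"
    unfolding homeomorphic_maps_def
  proof (intro conjI ballI)
    note c\<phi> = \<psi>[unfolded homeomorphic_maps_def, THEN conjunct1, THEN continuous_map_into_fulltopology]
      and c\<phi>' = \<psi>'[unfolded homeomorphic_maps_def, THEN conjunct1, THEN continuous_map_into_fulltopology]
      and c\<psi> = \<psi>[unfolded homeomorphic_maps_def, THEN conjunct2, THEN conjunct1, THEN continuous_map_into_fulltopology]
      and c\<psi>' = \<psi>'[unfolded homeomorphic_maps_def, THEN conjunct2, THEN conjunct1, THEN continuous_map_into_fulltopology]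
    have 1: "continuous_map ?S (subtopology (gtop G) U) (take m)"
      by (rule continuous_map_into_subtopology[OF continuous_map_from_subtopology[OF continuous_take]]) (simp add: memU Pi_iff)
    have 2: "continuous_map ?S (subtopology (gtop G') U') (drop m)"
      by (rule continuous_map_into_subtopology[OF continuous_map_from_subtopology[OF continuous_drop]]) (simp add: memU Pi_iff)
    have "continuous_map ?S (box_topology n) (\<lambda>w. \<phi> (take m w))" "continuous_map ?S (box_topology n') (\<lambda>w. \<phi>' (drop m w))"
      by (rule continuous_compose[OF 1 c\<phi>]) (rule continuous_compose[OF 2 c\<phi>'])
    then have "continuous_map ?S (box_topology (n + n')) \<xi>" unfolding \<xi>_def by (rule continuous_map_box_append)
    then show "continuous_map ?S ?B \<xi>" by (rule continuous_map_into_subtopology) (simp add: Pi_iff)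
    have 3: "continuous_map ?B (subtopology (box_topology n) (\<phi> ` U)) (take n)"
      unfolding img
      by (rule continuous_map_into_subtopology[OF continuous_map_from_subtopology[OF continuous_map_box_take]]) (simp add: memV Pi_iff)
    have 4: "continuous_map ?B (subtopology (box_topology n') (\<phi>' ` U')) (drop n)"
      unfolding img
      by (rule continuous_map_into_subtopology[OF continuous_map_from_subtopology[OF continuous_map_box_drop]]) (simp add: memV Pi_iff)
    have "continuous_map ?B (gtop G) (\<lambda>w. \<psi> (take n w))" "continuous_map ?B (gtop G') (\<lambda>w. \<psi>' (drop n w))"
      by (rule continuous_compose[OF 3 c\<psi>]) (rule continuous_compose[OF 4 c\<psi>'])
    then have "continuous_map ?B (gtop H) \<omega>" unfolding \<omega>_def by (rule continuous_append)
    moreover have *: "\<omega> (\<xi> w) = w" if "w \<in> lprod U U'" for w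
      using that lphi inv inv' unfolding \<omega>_def \<xi>_def memU by (simp add: take_append drop_append)
    moreover have "\<omega> \<in> topspace ?B \<rightarrow> lprod U U'"
    proof
      fix w assume "w \<in> topspace ?B"
      then obtain v where "v \<in> lprod U U'" "w = \<xi> v" by auto
      then show "\<omega> w \<in> lprod U U'" using * by simp
    qed
    ultimately show "continuous_map ?B ?S \<omega>" by (intro continuous_map_into_subtopology)
    show "\<omega> (\<xi> w) = w" if "w \<in> topspace ?S" for w using *[of w] that by simp
    show "\<xi> (\<omega> w) = w" if w: "w \<in> topspace ?B" for w
    proof -
      obtain v where "v \<in> lprod U U'" "w = \<xi> v" using w by auto
      then show ?thesis using * by simp
    qed
  qed
  then show "homeomorphic_map ?S ?B \<xi>" using homeomorphic_map_maps by blast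
qed

lemma definable_manifold_H: "definable_manifold M (gtop H)"
proof -
  obtain n \<A> where A: "finite \<A>" "topspace (gtop G) = \<Union>(fst ` \<A>)" "\<forall>(U, \<phi>)\<in>\<A>. openin (gtop G) U \<and>
      openin (box_topology n) (\<phi> ` U) \<and> definable_map M U (\<phi> ` U) \<phi> \<and>
      homeomorphic_map (subtopology (gtop G) U) (subtopology (box_topology n) (\<phi> ` U)) \<phi>"
    using G unfolding definable_group_def definable_manifold_def by blast
  obtain n' \<A>' where A': "finite \<A>'" "topspace (gtop G') = \<Union>(fst ` \<A>')" "\<forall>(U, \<phi>)\<in>\<A>'. openin (gtop G') U \<and>
      openin (box_topology n') (\<phi> ` U) \<and> definable_map M U (\<phi> ` U) \<phi> \<and>
      homeomorphic_map (subtopology (gtop G') U) (subtopology (box_topology n') (\<phi> ` U)) \<phi>"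
    using G' unfolding definable_group_def definable_manifold_def by blast
  define c where "c = (\<lambda>(j, j'). (lprod (fst j) (fst j'), \<lambda>w. (snd j) (take m w) @ (snd j') (drop m w)) ::
    'a list set \<times> ('a list \<Rightarrow> 'a list))"
  show ?thesis unfolding definable_manifold_def
  proof (intro exI conjI)
    show "finite (c ` (\<A> \<times> \<A>'))" using A(1) A'(1) by simp
    show "topspace (gtop H) = \<Union>(fst ` c ` (\<A> \<times> \<A>'))"
    proof -
      have "w \<in> lprod (carrier G) (carrier G') \<longleftrightarrow> (\<exists>j\<in>\<A>. \<exists>j'\<in>\<A>'. w \<in> lprod (fst j) (fst j'))" for w
        using A(2) A'(2) tops unfolding lprod_def by blast
      moreover have "w \<in> \<Union>(fst ` c ` (\<A> \<times> \<A>')) \<longleftrightarrow> (\<exists>j\<in>\<A>. \<exists>j'\<in>\<A>'. w \<in> fst (c (j, j')))" for w by blast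
      moreover have "fst (c (j, j')) = lprod (fst j) (fst j')" for j j' by (simp add: c_def)
      ultimately show ?thesis unfolding topspace_H dprod_simps by (intro Set.set_eqI) simp
    qed
    show "\<forall>(U, \<phi>)\<in>c ` (\<A> \<times> \<A>'). openin (gtop H) U \<and> openin (box_topology (n + n')) (\<phi> ` U) \<and>
        definable_map M U (\<phi> ` U) \<phi> \<and>
        homeomorphic_map (subtopology (gtop H) U) (subtopology (box_topology (n + n')) (\<phi> ` U)) \<phi>"
    proof (rule ballI, clarify)
      fix W \<xi> U \<phi> U' \<phi>' assume j: "(U, \<phi>) \<in> \<A>" "(U', \<phi>') \<in> \<A>'" and "(W, \<xi>) = c ((U, \<phi>), (U', \<phi>'))"
      then have W: "W = lprod U U'" "\<xi> = (\<lambda>w. \<phi> (take m w) @ \<phi>' (drop m w))" by (simp_all add: c_def)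
      have a: "openin (gtop G) U" "openin (box_topology n) (\<phi> ` U)" "definable_map M U (\<phi> ` U) \<phi>"
        "homeomorphic_map (subtopology (gtop G) U) (subtopology (box_topology n) (\<phi> ` U)) \<phi>"
        using A(3)[THEN bspec, OF j(1), unfolded prod.case] by simp_all
      have a': "openin (gtop G') U'" "openin (box_topology n') (\<phi>' ` U')" "definable_map M U' (\<phi>' ` U') \<phi>'"
        "homeomorphic_map (subtopology (gtop G') U') (subtopology (box_topology n') (\<phi>' ` U')) \<phi>'"
        using A'(3)[THEN bspec, OF j(2), unfolded prod.case] by simp_all
      show "openin (gtop H) W \<and> openin (box_topology (n + n')) (\<xi> ` W) \<and>
        definable_map M W (\<xi> ` W) \<xi> \<and>
        homeomorphic_map (subtopology (gtop H) W) (subtopology (box_topology (n + n')) (\<xi> ` W)) \<xi>"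
        unfolding W by (intro conjI chart_product[OF a a'])
    qed
  qed
qed

lemma definable_group_H: "definable_group M H"
  unfolding definable_group_def
  using group_H definable_H definable_mult_H topological_group_H definable_manifold_H
  unfolding definable_set_def by blast

lemma definable_map_take: "definable_map M (carrier H) (carrier G) (take m)"
  and definable_map_drop: "definable_map M (carrier H) (carrier G') (drop m)"
  unfolding definable_map_iff[OF definable_H m] definable_map_iff[OF definable_H m']
  using dmap_take dmap_drop by (auto simp: mem_H)

text \<open>Limits are found coordinatewise. This makes the hypotheses on definably compact groups
  available for H.\<close>

lemma definably_compact_H:
  assumes c: "definably_compact M (gtop G)" and c': "definably_compact M (gtop G')"
  shows "definably_compact M (gtop H)"
  unfolding definably_compact_def
proof (intro allI impI)
  fix a b :: 'a and \<sigma> :: "'a list \<Rightarrow> 'a list"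
  let ?I = "{[s] | s. a < s \<and> s < b}"
  assume \<sigma>: "a < b \<and> definable_map M ?I (topspace (gtop H)) \<sigma> \<and>
        continuous_map (subtopology (box_topology 1) ?I) (gtop H) \<sigma>"
  have I: "definable M 1 ?I"
    by (rule definable_set_subset) (use \<sigma> in \<open>auto simp: definable_map_def\<close>)
  have d\<sigma>: "dmap M 1 (m + m') ?I \<sigma>" "\<sigma> \<in> ?I \<rightarrow> carrier H"
    using \<sigma> definable_map_iff[OF I definable_H] unfolding topspace_H by auto
  have 1: "definable_map M ?I (topspace (gtop G)) (\<lambda>x. take m (\<sigma> x))" "definable_map M ?I (topspace (gtop G')) (\<lambda>x. drop m (\<sigma> x))"
    unfolding tops definable_map_iff[OF I m] definable_map_iff[OF I m']
    using dmap_comp[OF d\<sigma>(1) dmap_take] dmap_comp[OF d\<sigma>(1) dmap_drop] d\<sigma>(2) mem_H by (simp_all add: Pi_iff)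
  have 2: "continuous_map (subtopology (box_topology 1) ?I) (gtop G) (\<lambda>x. take m (\<sigma> x))"
    "continuous_map (subtopology (box_topology 1) ?I) (gtop G') (\<lambda>x. drop m (\<sigma> x))"
    using \<sigma> continuous_compose continuous_take continuous_drop by blast+
  note C = c[unfolded definably_compact_def, THEN spec[of _ a], THEN spec[of _ b], THEN spec[of _ "\<lambda>x. take m (\<sigma> x)"],
        THEN mp, OF conjI[OF conjunct1[OF \<sigma>] conjI[OF 1(1) 2(1)]], unfolded tops]
    and C' = c'[unfolded definably_compact_def, THEN spec[of _ a], THEN spec[of _ b], THEN spec[of _ "\<lambda>x. drop m (\<sigma> x)"],
        THEN mp, OF conjI[OF conjunct1[OF \<sigma>] conjI[OF 1(2) 2(2)]], unfolded tops]
  \<comment> \<open>Neighbourhoods in the pulled-back topology contain boxes, so the two coordinate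
    limits can be controlled separately.\<close>
  have box: "\<exists>U1 U2. openin (gtop G) U1 \<and> openin (gtop G') U2 \<and> x \<in> U1 \<and> y \<in> U2 \<and> (\<forall>w\<in>carrier H. take m w \<in> U1 \<longrightarrow> drop m w \<in> U2 \<longrightarrow> w \<in> U)"
    if x: "x \<in> carrier G" "y \<in> carrier G'" and U: "openin (gtop H) U" "x @ y \<in> U" for x y U
  proof -
    obtain V where V: "openin (prod_topology (gtop G) (gtop G')) V" "U = (\<lambda>u. (take m u, drop m u)) -` V \<inter> lprod (carrier G) (carrier G')"
      using U(1) unfolding gtop_dprod openin_pullback_topology by blast
    have xy: "(x, y) \<in> V" using U(2) x V(2) by simp
    obtain U1 U2 where U12: "openin (gtop G) U1 \<and> openin (gtop G') U2 \<and> x \<in> U1 \<and> y \<in> U2 \<and> U1 \<times> U2 \<subseteq> V"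
      using openin_prod_topology_alt[THEN iffD1, OF V(1), THEN spec[of _ x], THEN spec[of _ y], THEN mp, OF xy]
      by (elim exE) blast
    have "w \<in> U" if "w \<in> carrier H" "take m w \<in> U1" "drop m w \<in> U2" for w
    proof -
      have "(take m w, drop m w) \<in> V" using U12 that(2,3) by blast
      then show ?thesis using V(2) that(1) by simp
    qed
    then show ?thesis using U12 by blast
  qed
  have mem: "\<sigma> [s] \<in> carrier H" if "a < s" "s < b" for s using d\<sigma>(2) that by blast
  show "(\<exists>x\<in>topspace (gtop H). \<forall>U. openin (gtop H) U \<and> x \<in> U \<longrightarrow>
           (\<exists>c. a < c \<and> c < b \<and> (\<forall>s. a < s \<and> s < c \<longrightarrow> \<sigma> [s] \<in> U))) \<and>
        (\<exists>x\<in>topspace (gtop H). \<forall>U. openin (gtop H) U \<and> x \<in> U \<longrightarrow>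
           (\<exists>c. a < c \<and> c < b \<and> (\<forall>s. c < s \<and> s < b \<longrightarrow> \<sigma> [s] \<in> U)))"
  proof (intro conjI)
    obtain x where x: "x \<in> carrier G" "\<forall>U. openin (gtop G) U \<and> x \<in> U \<longrightarrow> (\<exists>c. a < c \<and> c < b \<and> (\<forall>s. a < s \<and> s < c \<longrightarrow> take m (\<sigma> [s]) \<in> U))"
      using C[THEN conjunct1] by (elim bexE)
    obtain y where y: "y \<in> carrier G'" "\<forall>U. openin (gtop G') U \<and> y \<in> U \<longrightarrow> (\<exists>c. a < c \<and> c < b \<and> (\<forall>s. a < s \<and> s < c \<longrightarrow> drop m (\<sigma> [s]) \<in> U))"
      using C'[THEN conjunct1] by (elim bexE)
    have "\<exists>c. a < c \<and> c < b \<and> (\<forall>s. a < s \<and> s < c \<longrightarrow> \<sigma> [s] \<in> U)" if U: "openin (gtop H) U" "x @ y \<in> U" for U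
    proof -
      obtain U1 U2 where U12: "openin (gtop G) U1" "openin (gtop G') U2" "x \<in> U1" "y \<in> U2"
        "\<forall>w\<in>carrier H. take m w \<in> U1 \<longrightarrow> drop m w \<in> U2 \<longrightarrow> w \<in> U" using box[OF x(1) y(1) U] by blast
      obtain c1 where c1: "a < c1" "c1 < b" "\<forall>s. a < s \<and> s < c1 \<longrightarrow> take m (\<sigma> [s]) \<in> U1" using x(2) U12 by blast
      obtain c2 where c2: "a < c2" "c2 < b" "\<forall>s. a < s \<and> s < c2 \<longrightarrow> drop m (\<sigma> [s]) \<in> U2" using y(2) U12 by blast
      show ?thesis
      proof (intro exI conjI allI impI)
        show "a < min c1 c2" "min c1 c2 < b" using c1 c2 by auto
        fix s assume s: "a < s \<and> s < min c1 c2"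
        then have "take m (\<sigma> [s]) \<in> U1" "drop m (\<sigma> [s]) \<in> U2" "\<sigma> [s] \<in> carrier H" using c1 c2 mem by auto
        then show "\<sigma> [s] \<in> U" using U12(5) by blast
      qed
    qed
    moreover have "x @ y \<in> topspace (gtop H)" using x(1) y(1) unfolding topspace_H by (simp add: append_mem_H)
    ultimately show "\<exists>x\<in>topspace (gtop H). \<forall>U. openin (gtop H) U \<and> x \<in> U \<longrightarrow>
           (\<exists>c. a < c \<and> c < b \<and> (\<forall>s. a < s \<and> s < c \<longrightarrow> \<sigma> [s] \<in> U))" by blast
  next
    obtain x where x: "x \<in> carrier G" "\<forall>U. openin (gtop G) U \<and> x \<in> U \<longrightarrow> (\<exists>c. a < c \<and> c < b \<and> (\<forall>s. c < s \<and> s < b \<longrightarrow> take m (\<sigma> [s]) \<in> U))"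
      using C[THEN conjunct2] by (elim bexE)
    obtain y where y: "y \<in> carrier G'" "\<forall>U. openin (gtop G') U \<and> y \<in> U \<longrightarrow> (\<exists>c. a < c \<and> c < b \<and> (\<forall>s. c < s \<and> s < b \<longrightarrow> drop m (\<sigma> [s]) \<in> U))"
      using C'[THEN conjunct2] by (elim bexE)
    have "\<exists>c. a < c \<and> c < b \<and> (\<forall>s. c < s \<and> s < b \<longrightarrow> \<sigma> [s] \<in> U)" if U: "openin (gtop H) U" "x @ y \<in> U" for U
    proof -
      obtain U1 U2 where U12: "openin (gtop G) U1" "openin (gtop G') U2" "x \<in> U1" "y \<in> U2"
        "\<forall>w\<in>carrier H. take m w \<in> U1 \<longrightarrow> drop m w \<in> U2 \<longrightarrow> w \<in> U" using box[OF x(1) y(1) U] by blast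
      obtain c1 where c1: "a < c1" "c1 < b" "\<forall>s. c1 < s \<and> s < b \<longrightarrow> take m (\<sigma> [s]) \<in> U1" using x(2) U12 by blast
      obtain c2 where c2: "a < c2" "c2 < b" "\<forall>s. c2 < s \<and> s < b \<longrightarrow> drop m (\<sigma> [s]) \<in> U2" using y(2) U12 by blast
      show ?thesis
      proof (intro exI conjI allI impI)
        show "a < max c1 c2" "max c1 c2 < b" using c1 c2 by auto
        fix s assume s: "max c1 c2 < s \<and> s < b"
        moreover from s c1 have "a < s" by auto
        ultimately have "take m (\<sigma> [s]) \<in> U1" "drop m (\<sigma> [s]) \<in> U2" "\<sigma> [s] \<in> carrier H" using c1 c2 mem by auto
        then show "\<sigma> [s] \<in> U" using U12(5) by blast
      qed
    qed
    moreover have "x @ y \<in> topspace (gtop H)" using x(1) y(1) unfolding topspace_H by (simp add: append_mem_H)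
    ultimately show "\<exists>x\<in>topspace (gtop H). \<forall>U. openin (gtop H) U \<and> x \<in> U \<longrightarrow>
           (\<exists>c. a < c \<and> c < b \<and> (\<forall>s. c < s \<and> s < b \<longrightarrow> \<sigma> [s] \<in> U))" by blast
  qed
qed

end

context tame_structure begin

text \<open>Membership of quotients in the subgroups replaces equality of cosets; in the product it
  splits into coordinates by \<open>H_diff_mem\<close>.\<close>

lemma coset_mapI:
  assumes L: "lgroup G N" "lgroup G2 N2" and k: "cdmap M G G2 k"
    and eq: "\<And>x y. x \<in> carrier G \<Longrightarrow> y \<in> carrier G \<Longrightarrow> y \<otimes>\<^bsub>G\<^esub> inv\<^bsub>G\<^esub> x \<in> N \<Longrightarrow> k y \<otimes>\<^bsub>G2\<^esub> inv\<^bsub>G2\<^esub> (k x) \<in> N2"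
  shows "coset_map G N G2 N2 k"
  unfolding coset_map_def
proof (intro conjI L k ballI)
  fix x y assume x: "x \<in> carrier G" and "y \<in> \<tau>_map G N x"
  then have y: "y \<in> carrier G" "y \<otimes>\<^bsub>G\<^esub> inv\<^bsub>G\<^esub> x \<in> N" using tau_subset[OF L(1) x] tau_mem[OF L(1) x] by auto
  have "k y \<in> \<tau>_map G2 N2 (k x)"
    using tau_mem[OF L(2) cdmap_mem[OF k x] cdmap_mem[OF k y(1)]] eq[OF x y] by simp
  then show "\<tau>_map G2 N2 (k y) = \<tau>_map G2 N2 (k x)" by (rule tau_eq[OF L(2) cdmap_mem[OF k x]])
qed

lemma coset_mapD:
  assumes k: "coset_map G N G2 N2 k" and x: "x \<in> carrier G" and y: "y \<in> carrier G" "y \<otimes>\<^bsub>G\<^esub> inv\<^bsub>G\<^esub> x \<in> N"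
  shows "k y \<otimes>\<^bsub>G2\<^esub> inv\<^bsub>G2\<^esub> (k x) \<in> N2"
proof -
  have L: "lgroup G N" "lgroup G2 N2" and kd: "cdmap M G G2 k" using k by (auto simp: coset_map_def)
  have "y \<in> \<tau>_map G N x" using tau_mem[OF L(1) x y(1)] y(2) by simp
  then have "\<tau>_map G2 N2 (k y) = \<tau>_map G2 N2 (k x)" using k x unfolding coset_map_def by blast
  then have "k y \<in> \<tau>_map G2 N2 (k x)" using tau_self[OF L(2) cdmap_mem[OF kd y(1)]] by simp
  then show ?thesis using tau_mem[OF L(2) cdmap_mem[OF kd x] cdmap_mem[OF kd y(1)]] by simp
qed

text \<open>The graph of inversion is the part of the carrier square on which multiplication takes
  the value one.\<close>

lemma inv_dmap:
  assumes G: "definable_group M G" and m: "definable M m (carrier G)"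
  shows "dmap M m m (carrier G) (\<lambda>x. inv\<^bsub>G\<^esub> x)"
proof -
  interpret group G using G by (simp add: definable_group_def)
  let ?GG = "{x @ y | x y. x \<in> carrier G \<and> y \<in> carrier G}"
  have len: "length x = m" if "x \<in> carrier G" for x using definable_length[OF m that] .
  have "definable M m ((\<lambda>_. \<one>\<^bsub>G\<^esub>) ` carrier G)"
    by (rule dmap_image[OF dmap_const[OF m len] _ m]) auto
  then have "definable M m {\<one>\<^bsub>G\<^esub>}" by (simp add: image_constant[OF one_closed])
  from dmap_preimage[OF mult_dmap[OF G m] this]
  have "definable M (m + m) {w \<in> ?GG. take m w \<otimes>\<^bsub>G\<^esub> drop m w \<in> {\<one>\<^bsub>G\<^esub>}}" .
  also have "{w \<in> ?GG. take m w \<otimes>\<^bsub>G\<^esub> drop m w \<in> {\<one>\<^bsub>G\<^esub>}} = {x @ inv\<^bsub>G\<^esub> x | x. x \<in> carrier G}" (is "?L = ?R")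
  proof (intro equalityI subsetI)
    fix w assume "w \<in> ?L"
    then obtain x y where xy: "x \<in> carrier G" "y \<in> carrier G" "w = x @ y" "x \<otimes>\<^bsub>G\<^esub> y = \<one>\<^bsub>G\<^esub>" using len by auto
    then have "y = inv\<^bsub>G\<^esub> x" by (metis inv_equality inv_inv inv_comm)
    then show "w \<in> ?R" using xy by blast
  qed (use len in auto)
  finally have "definable_map M (carrier G) (carrier G) (\<lambda>x. inv\<^bsub>G\<^esub> x)"
    using m by (auto simp: definable_map_def definable_set_def)
  then show ?thesis unfolding definable_map_iff[OF m m] by blast
qed

text \<open>Continuity is automatic by \<open>definable_hom_continuous\<close>, and compatibility
  with cosets follows from \<open>G00_hom\<close>.\<close>

lemma coset_map_hom:
  assumes G: "definable_group M G" "definable_group M G2" and N: "is_G00 M \<kappa> G N" "is_G00 M \<kappa> G2 N2"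
    and h: "definable_hom M G G2 h"
  shows "coset_map G N G2 N2 h"
proof (rule coset_mapI)
  show L: "lgroup G N" "lgroup G2 N2" using G N by (auto intro: is_G00_lgroup)
  have hh: "h \<in> hom G G2" "definable_map M (carrier G) (carrier G2) h" using h by (auto simp: definable_hom_def)
  show "cdmap M G G2 h"
    using hh(2) G definable_hom_continuous[OF G h] by (auto simp: cdmap_def intro: definable_group_dspace)
  interpret group_hom G G2 h
    using lgroupD(2)[OF L(1)] lgroupD(2)[OF L(2)] hh(1) by (simp add: group_hom_def group_hom_axioms_def)
  fix x y assume x: "x \<in> carrier G" and y: "y \<in> carrier G" and n: "y \<otimes>\<^bsub>G\<^esub> inv\<^bsub>G\<^esub> x \<in> N"
  have "h (y \<otimes>\<^bsub>G\<^esub> inv\<^bsub>G\<^esub> x) \<in> N2"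
    by (rule G00_hom[OF G h N(1) _ n]) (use N(2) in \<open>simp add: is_G00_def\<close>)
  then show "h y \<otimes>\<^bsub>G2\<^esub> inv\<^bsub>G2\<^esub> (h x) \<in> N2" using x y by simp
qed

end

section \<open>The logic topology of a product\<close>

locale definable_pair_G00 = definable_pair +
  fixes N N' NH :: "'a list set"
  assumes N: "is_G00 M \<kappa> G N" and N': "is_G00 M \<kappa> G' N'" and NH: "is_G00 M \<kappa> H NH"
begin

abbreviation "\<Lambda> \<equiv> logic_topology M \<kappa> G N"
abbreviation "\<Lambda>' \<equiv> logic_topology M \<kappa> G' N'"
abbreviation "\<Lambda>H \<equiv> logic_topology M \<kappa> H NH"
abbreviation "\<tau> \<equiv> \<tau>_map G N"
abbreviation "\<tau>' \<equiv> \<tau>_map G' N'"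
abbreviation "\<tau>H \<equiv> \<tau>_map H NH"

lemma L: "lgroup G N" and L': "lgroup G' N'" and LH: "lgroup H NH"
  using is_G00_lgroup G G' definable_group_H N N' NH by blast+

lemma ds: "dspace M G" and ds': "dspace M G'" and dsH: "dspace M H"
  using lgroupD(5) L L' LH by blast+

lemma take_hom: "definable_hom M H G (take m)" and drop_hom: "definable_hom M H G' (drop m)"
  unfolding definable_hom_def
  by (auto intro!: homI definable_map_take[simplified] definable_map_drop[simplified] simp: mem_H)

lemma dmap_append_const: "y \<in> carrier G' \<Longrightarrow> dmap M m (m + m') (carrier G) (\<lambda>x. x @ y)"
  by (intro dmap_append dmap_id dmap_const m len')

lemma dmap_const_append: "x \<in> carrier G \<Longrightarrow> dmap M m' (m + m') (carrier G') (\<lambda>y. x @ y)"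
  by (intro dmap_append dmap_id dmap_const m' len)

lemma append_hom: "definable_hom M G H (\<lambda>x. x @ \<one>\<^bsub>G'\<^esub>)" "definable_hom M G' H (\<lambda>y. \<one>\<^bsub>G\<^esub> @ y)"
  unfolding definable_hom_def definable_map_iff[OF m definable_H] definable_map_iff[OF m' definable_H]
  using dmap_append_const[OF G'.one_closed] dmap_const_append[OF G.one_closed]
  by (auto intro!: homI simp: append_mem_H)

text \<open>One inclusion applies \<open>G00_hom\<close> to the two projections, the other to the
  two embeddings of the factors, whose values at the coordinates of w multiply to w.\<close>

lemma NH_mem: "w \<in> carrier H \<Longrightarrow> w \<in> NH \<longleftrightarrow> take m w \<in> N \<and> drop m w \<in> N'"
proof -
  assume w: "w \<in> carrier H"
  have b: "bounded_index_subgroup M \<kappa> G N" "bounded_index_subgroup M \<kappa> G' N'" "bounded_index_subgroup M \<kappa> H NH"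
    using N N' NH by (auto simp: is_G00_def)
  show ?thesis
  proof
    assume "w \<in> NH"
    then show "take m w \<in> N \<and> drop m w \<in> N'"
      using G00_hom[OF definable_group_H G take_hom NH b(1)] G00_hom[OF definable_group_H G' drop_hom NH b(2)] by blast
  next
    assume n: "take m w \<in> N \<and> drop m w \<in> N'"
    have c: "take m w \<in> carrier G" "drop m w \<in> carrier G'" using w by (auto simp: mem_H)
    have "take m w @ \<one>\<^bsub>G'\<^esub> \<in> NH" "\<one>\<^bsub>G\<^esub> @ drop m w \<in> NH"
      using G00_hom[OF G definable_group_H append_hom(1) N b(3)] G00_hom[OF G' definable_group_H append_hom(2) N' b(3)] n by blast+
    then have "(take m w @ \<one>\<^bsub>G'\<^esub>) \<otimes>\<^bsub>H\<^esub> (\<one>\<^bsub>G\<^esub> @ drop m w) \<in> NH"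
      by (rule subgroup.m_closed[OF lgroupD(3)[OF LH]])
    then show "w \<in> NH" using c by simp
  qed
qed

lemma H_diff_mem:
  assumes w: "w \<in> carrier H" and z: "z \<in> carrier H"
  shows "z \<otimes>\<^bsub>H\<^esub> inv\<^bsub>H\<^esub> w \<in> NH \<longleftrightarrow>
    take m z \<otimes>\<^bsub>G\<^esub> inv\<^bsub>G\<^esub> take m w \<in> N \<and> drop m z \<otimes>\<^bsub>G'\<^esub> inv\<^bsub>G'\<^esub> drop m w \<in> N'"
proof -
  have c: "take m w \<in> carrier G" "drop m w \<in> carrier G'" "take m z \<in> carrier G" "drop m z \<in> carrier G'"
    using w z by (auto simp: mem_H)
  have "z \<otimes>\<^bsub>H\<^esub> inv\<^bsub>H\<^esub> w = (take m z \<otimes>\<^bsub>G\<^esub> inv\<^bsub>G\<^esub> take m w) @ (drop m z \<otimes>\<^bsub>G'\<^esub> inv\<^bsub>G'\<^esub> drop m w)"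
    unfolding inv_H[OF w] using c by simp
  then show ?thesis using c NH_mem[of "z \<otimes>\<^bsub>H\<^esub> inv\<^bsub>H\<^esub> w"] by (simp add: append_mem_H)
qed

lemma tau_H:
  assumes w: "w \<in> carrier H"
  shows "\<tau>H w = lprod (\<tau> (take m w)) (\<tau>' (drop m w))"
proof (rule Set.set_eqI)
  fix z
  have c: "take m w \<in> carrier G" "drop m w \<in> carrier G'" using w by (auto simp: mem_H)
  note sub = tau_subset[OF L c(1)] tau_subset[OF L' c(2)]
  have z: "z \<in> lprod (\<tau> (take m w)) (\<tau>' (drop m w)) \<longleftrightarrow> take m z \<in> \<tau> (take m w) \<and> drop m z \<in> \<tau>' (drop m w)"
    by (rule lprod_mem) (use sub len in blast)
  show "z \<in> \<tau>H w \<longleftrightarrow> z \<in> lprod (\<tau> (take m w)) (\<tau>' (drop m w))"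
  proof (cases "z \<in> carrier H")
    case True
    then have zc: "take m z \<in> carrier G" "drop m z \<in> carrier G'" by (auto simp: mem_H)
    show ?thesis unfolding z tau_mem[OF LH w True] tau_mem[OF L c(1) zc(1)] tau_mem[OF L' c(2) zc(2)]
      by (rule H_diff_mem[OF w True])
  next
    case False
    then have "\<not> (take m z \<in> carrier G \<and> drop m z \<in> carrier G')" by (simp add: mem_H)
    then show ?thesis unfolding z using False tau_subset[OF LH w] sub by blast
  qed
qed

lemma tau_append: "x \<in> carrier G \<Longrightarrow> y \<in> carrier G' \<Longrightarrow> \<tau>H (x @ y) = lprod (\<tau> x) (\<tau>' y)"
  using tau_H[of "x @ y"] by (simp add: append_mem_H)

text \<open>Around a pair of cosets whose product lies in U, the tube lemma
  \<open>tdef_Times_meet\<close> gives definable sets D and D' whose product avoids the complement;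
  the cosets contained in D and those contained in D' form the required open box.\<close>

lemma continuous_lprod: "continuous_map (prod_topology \<Lambda> \<Lambda>') \<Lambda>H (\<lambda>(K, K'). lprod K K')"
  unfolding continuous_map_def
proof (intro conjI allI impI)
  show "(\<lambda>(K, K'). lprod K K') \<in> topspace (prod_topology \<Lambda> \<Lambda>') \<rightarrow> topspace \<Lambda>H"
  proof
    fix z assume "z \<in> topspace (prod_topology \<Lambda> \<Lambda>')"
    then obtain x y where xy: "x \<in> carrier G" "y \<in> carrier G'" "z = (\<tau> x, \<tau>' y)"
      by (auto simp: topspace_logic[OF L] topspace_logic[OF L'])
    then show "(case z of (K, K') \<Rightarrow> lprod K K') \<in> topspace \<Lambda>H"
      unfolding topspace_logic[OF LH] using tau_append[OF xy(1,2)] append_mem_H[OF xy(1,2)] by force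
  qed
  fix U assume U: "openin \<Lambda>H U"
  let ?X = "{w \<in> carrier H. \<tau>H w \<notin> U}"
  let ?P = "{z \<in> topspace (prod_topology \<Lambda> \<Lambda>'). (case z of (K, K') \<Rightarrow> lprod K K') \<in> U}"
  have X: "tdef (m + m') ?X" using U openin_logic[OF LH definable_H] by blast
  have "\<exists>W W'. openin \<Lambda> W \<and> openin \<Lambda>' W' \<and> K \<in> W \<and> K' \<in> W' \<and> W \<times> W' \<subseteq> ?P" if P: "(K, K') \<in> ?P" for K K'
  proof -
    obtain x y where xy: "x \<in> carrier G" "y \<in> carrier G'" "K = \<tau> x" "K' = \<tau>' y"
      using P by (auto simp: topspace_logic[OF L] topspace_logic[OF L'])
    have KU: "lprod K K' \<in> U" using P by simp
    have "a @ b \<notin> ?X" if ab: "a \<in> K" "b \<in> K'" for a b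
    proof -
      have c: "a \<in> carrier G" "b \<in> carrier G'" using ab xy tau_subset[OF L xy(1)] tau_subset[OF L' xy(2)] by auto
      have "\<tau> a = K" "\<tau>' b = K'" using ab xy tau_eq[OF L xy(1)] tau_eq[OF L' xy(2)] by auto
      then show ?thesis using tau_append[OF c] KU by simp
    qed
    from tdef_Times_meet[OF tdef_coset[OF L m xy(1), folded xy(3)] tdef_coset[OF L' m' xy(2), folded xy(4)] X this] obtain D D' where D: "definable M m D" "definable M m' D'" "K \<subseteq> D" "K' \<subseteq> D'"
        "\<forall>a\<in>D. \<forall>b\<in>D'. a @ b \<notin> ?X"
      by blast
    let ?W = "{K \<in> \<tau> ` carrier G. K \<subseteq> D}" and ?W' = "{K \<in> \<tau>' ` carrier G'. K \<subseteq> D'}"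
    have "?W \<times> ?W' \<subseteq> ?P"
    proof
      fix z assume "z \<in> ?W \<times> ?W'"
      then obtain a b where ab: "a \<in> carrier G" "b \<in> carrier G'" "z = (\<tau> a, \<tau>' b)" "\<tau> a \<subseteq> D" "\<tau>' b \<subseteq> D'" by auto
      have "a \<in> D" "b \<in> D'" using ab tau_self[OF L ab(1)] tau_self[OF L' ab(2)] by auto
      then have "\<tau>H (a @ b) \<in> U" using D(5) append_mem_H[OF ab(1,2)] by auto
      then show "z \<in> ?P" using ab by (auto simp: tau_append topspace_logic[OF L] topspace_logic[OF L'])
    qed
    then show ?thesis
      using openin_logic_inside[OF L m D(1)] openin_logic_inside[OF L' m' D(2)] xy D(3,4)
      by (intro exI[of _ ?W] exI[of _ ?W']) auto
  qed
  then show "openin (prod_topology \<Lambda> \<Lambda>') ?P" unfolding openin_prod_topology_alt by blast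
qed

lemma coset_map_take: "coset_map H NH G N (take m)" and coset_map_drop: "coset_map H NH G' N' (drop m)"
  by (rule coset_map_hom[OF definable_group_H G NH N take_hom]) (rule coset_map_hom[OF definable_group_H G' NH N' drop_hom])

lemma cdmap_append_const: "y \<in> carrier G' \<Longrightarrow> cdmap M G H (\<lambda>x. x @ y)"
  and cdmap_const_append: "x \<in> carrier G \<Longrightarrow> cdmap M G' H (\<lambda>y. x @ y)"
  unfolding cdmap_def definable_map_iff[OF m definable_H] definable_map_iff[OF m' definable_H]
  using ds ds' dsH tops
  by (auto intro!: dmap_append_const[simplified] dmap_const_append[simplified] continuous_append simp: append_mem_H)

text \<open>Slices at arbitrary y are needed, since they will pass through the endpoints of a given
  path. For y other than the identity they are not homomorphisms, so cosets are compared
  directly.\<close>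

lemma coset_map_append_const: "y \<in> carrier G' \<Longrightarrow> coset_map G N H NH (\<lambda>x. x @ y)"
  by (rule coset_mapI[OF L LH cdmap_append_const], assumption, subst H_diff_mem)
    (simp_all add: append_mem_H subgroup.one_closed[OF lgroupD(3)[OF L']])

lemma coset_map_const_append: "x \<in> carrier G \<Longrightarrow> coset_map G' N' H NH (\<lambda>y. x @ y)"
  by (rule coset_mapI[OF L' LH cdmap_const_append], assumption, subst H_diff_mem)
    (simp_all add: append_mem_H subgroup.one_closed[OF lgroupD(3)[OF L]])

lemma def_cont_append:
  assumes p: "def_continuous_on_cube M G n p" and q: "def_continuous_on_cube M G' n q"
  shows "def_continuous_on_cube M H n (\<lambda>x. p x @ q x)"
proof -
  have u: "definable M n (unit_cube n)" by (rule definable_unit_cube)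
  show ?thesis using p q unfolding def_continuous_on_cube_def definable_map_iff[OF u m] definable_map_iff[OF u m'] definable_map_iff[OF u definable_H]
    by (auto intro!: dmap_append continuous_append append_mem_H)
qed

text \<open>Writing c as (a, b), the path is the diagonal of the square (s, t) |-> (a s, b t), to
  which \<open>def_homotopic_diagonal\<close> applies.\<close>

lemma def_homotopic_sides:
  assumes c: "def_path M H c"
  shows "def_homotopic M H c (def_path_concat (\<lambda>x. take m (c [hd x]) @ drop m (c [0])) (\<lambda>x. take m (c [1]) @ drop m (c [hd x])))"
proof -
  have ct: "cdmap M H G (take m)" "cdmap M H G' (drop m)" using coset_map_take coset_map_drop by (auto simp: coset_map_def)
  have c2: "def_continuous_on_cube M H 2 (\<lambda>x. c [x ! i])" if i: "i < 2" for i
  proof (rule def_cont_comp1[OF c[unfolded def_path_def] dsH])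
    show "st M 2 (\<lambda>x. x ! i)" by (rule st_nth[OF vt_id i])
    show "cont_at 2 (\<lambda>x. x ! i) x" for x :: "'a list" by (rule cont_at_nth[OF i])
  qed (use i in \<open>auto simp: unit_cube_nth\<close>)
  define F where "F = (\<lambda>x. take m (c [x ! 0]) @ drop m (c [x ! 1]))"
  have "def_continuous_on_cube M H 2 F" unfolding F_def
    using def_cont_append[OF cdmap_def_cont[OF ct(1) c2[of 0]] cdmap_def_cont[OF ct(2) c2[of 1]]] by (simp add: o_def)
  from def_homotopic_diagonal[OF this dsH]
  have d: "def_homotopic M H (\<lambda>x. c [hd x]) (def_path_concat (\<lambda>x. take m (c [hd x]) @ drop m (c [0])) (\<lambda>x. take m (c [1]) @ drop m (c [hd x])))"
    by (simp add: F_def)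
  show ?thesis by (rule def_homotopic_trans[OF def_homotopic_cong[OF c dsH] d dsH]) simp
qed

text \<open>For points (a, b) and (a2, b2) in one coset, the quotient of the new second coordinates
  is the quotient of k a2 by k a times the conjugate by k a of the quotient of b2 by b. The first
  factor lies in N' because k respects cosets, the second by normality. Generality in k covers x |->
  inv (f x) as well, which gives the inverse shear.\<close>

lemma coset_map_shear:
  assumes k: "coset_map G N G' N' k"
  shows "coset_map H NH H NH (\<lambda>w. take m w @ (k (take m w) \<otimes>\<^bsub>G'\<^esub> drop m w))"
proof (rule coset_mapI[OF LH LH])
  have kd: "cdmap M G G' k" using k by (simp add: coset_map_def)
  have ct: "cdmap M H G (take m)" using coset_map_take by (simp add: coset_map_def)
  have kdm: "dmap M m m' (carrier G) k" using kd definable_map_iff[OF m m'] by (simp add: cdmap_def)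
  have kc: "continuous_map (gtop G) (gtop G') k" using kd by (simp add: cdmap_def)
  have c: "take m w \<in> carrier G" "drop m w \<in> carrier G'" "k (take m w) \<in> carrier G'" if "w \<in> carrier H" for w
    using that cdmap_mem[OF kd] by (auto simp: mem_H)
  have "dmap M (m + m') (m + m') (carrier H) (\<lambda>w. take m w @ (k (take m w) \<otimes>\<^bsub>G'\<^esub> drop m w))"
    by (intro dmap_append dmap_take dmap_drop dmap_mult[OF G' m'] dmap_comp[OF dmap_take kdm] Pi_I c)
  moreover have "continuous_map (gtop H) (gtop H) (\<lambda>w. take m w @ (k (take m w) \<otimes>\<^bsub>G'\<^esub> drop m w))"
    by (intro continuous_append continuous_multI' continuous_take continuous_drop continuous_compose[OF continuous_take kc])
  ultimately show "cdmap M H H (\<lambda>w. take m w @ (k (take m w) \<otimes>\<^bsub>G'\<^esub> drop m w))"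
    unfolding cdmap_def definable_map_iff[OF definable_H definable_H] using dsH c by (auto intro!: append_mem_H)
  fix w z assume w: "w \<in> carrier H" and z: "z \<in> carrier H" and n: "z \<otimes>\<^bsub>H\<^esub> inv\<^bsub>H\<^esub> w \<in> NH"
  let ?a = "take m w" and ?b = "drop m w" and ?a2 = "take m z" and ?b2 = "drop m z"
  note cw = c[OF w] and cz = c[OF z]
  have n1: "?a2 \<otimes>\<^bsub>G\<^esub> inv\<^bsub>G\<^esub> ?a \<in> N" "?b2 \<otimes>\<^bsub>G'\<^esub> inv\<^bsub>G'\<^esub> ?b \<in> N'" using n H_diff_mem[OF w z] by auto
  have "(k ?a2 \<otimes>\<^bsub>G'\<^esub> inv\<^bsub>G'\<^esub> (k ?a)) \<otimes>\<^bsub>G'\<^esub> (k ?a \<otimes>\<^bsub>G'\<^esub> (?b2 \<otimes>\<^bsub>G'\<^esub> inv\<^bsub>G'\<^esub> ?b) \<otimes>\<^bsub>G'\<^esub> inv\<^bsub>G'\<^esub> (k ?a)) \<in> N'"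
    by (rule subgroup.m_closed[OF lgroupD(3)[OF L'] coset_mapD[OF k cw(1) cz(1) n1(1)] G00_conjugate[OF G' N' cw(3) n1(2)]])
  also have "(k ?a2 \<otimes>\<^bsub>G'\<^esub> inv\<^bsub>G'\<^esub> (k ?a)) \<otimes>\<^bsub>G'\<^esub> (k ?a \<otimes>\<^bsub>G'\<^esub> (?b2 \<otimes>\<^bsub>G'\<^esub> inv\<^bsub>G'\<^esub> ?b) \<otimes>\<^bsub>G'\<^esub> inv\<^bsub>G'\<^esub> (k ?a)) =
      k ?a2 \<otimes>\<^bsub>G'\<^esub> (inv\<^bsub>G'\<^esub> (k ?a) \<otimes>\<^bsub>G'\<^esub> k ?a) \<otimes>\<^bsub>G'\<^esub> ?b2 \<otimes>\<^bsub>G'\<^esub> inv\<^bsub>G'\<^esub> ?b \<otimes>\<^bsub>G'\<^esub> inv\<^bsub>G'\<^esub> (k ?a)"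
    using cw cz by (simp only: G'.m_assoc G'.m_closed G'.inv_closed)
  also have "\<dots> = (k ?a2 \<otimes>\<^bsub>G'\<^esub> ?b2) \<otimes>\<^bsub>G'\<^esub> inv\<^bsub>G'\<^esub> (k ?a \<otimes>\<^bsub>G'\<^esub> ?b)"
    using cw cz by (simp add: G'.inv_mult_group G'.m_assoc)
  finally show "(?a2 @ (k ?a2 \<otimes>\<^bsub>G'\<^esub> ?b2)) \<otimes>\<^bsub>H\<^esub> inv\<^bsub>H\<^esub> (?a @ (k ?a \<otimes>\<^bsub>G'\<^esub> ?b)) \<in> NH"
    using n1(1) cw cz by (subst H_diff_mem) (simp_all add: append_mem_H)
qed

text \<open>The shear by the pointwise inverse of k undoes the shear by k; this is what qualifies it
  as a shear.\<close>

lemma coset_map_inverse: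
  assumes k: "coset_map G N G' N' k"
  shows "coset_map G N G' N' (\<lambda>x. inv\<^bsub>G'\<^esub> (k x))"
proof (rule coset_mapI[OF L L'])
  have kd: "cdmap M G G' k" using k by (simp add: coset_map_def)
  have kc: "continuous_map (gtop G) (gtop G') k" using kd by (simp add: cdmap_def)
  have kdm: "dmap M m m' (carrier G) k" using kd definable_map_iff[OF m m'] by (simp add: cdmap_def)
  have "dmap M m m' (carrier G) (\<lambda>x. inv\<^bsub>G'\<^esub> (k x))"
    by (rule dmap_comp[OF kdm inv_dmap[OF G' m'] cdmap_mem[OF kd]])
  then show "cdmap M G G' (\<lambda>x. inv\<^bsub>G'\<^esub> (k x))"
    unfolding cdmap_def definable_map_iff[OF m m']
    using ds ds' continuous_compose[OF kc continuous_inv'] cdmap_mem[OF kd] by auto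
  fix x y assume x: "x \<in> carrier G" and y: "y \<in> carrier G" and n: "y \<otimes>\<^bsub>G\<^esub> inv\<^bsub>G\<^esub> x \<in> N"
  note c = cdmap_mem[OF kd x] cdmap_mem[OF kd y]
  have "inv\<^bsub>G'\<^esub> (k y \<otimes>\<^bsub>G'\<^esub> inv\<^bsub>G'\<^esub> (k x)) \<in> N'"
    by (rule subgroup.m_inv_closed[OF lgroupD(3)[OF L'] coset_mapD[OF k x y n]])
  \<comment> \<open>Conjugating k x inv (k y) by inv (k y) gives inv (k y) k x.\<close>
  from G00_conjugate[OF G' N' G'.inv_closed[OF c(2)] this]
  show "inv\<^bsub>G'\<^esub> (k y) \<otimes>\<^bsub>G'\<^esub> inv\<^bsub>G'\<^esub> (inv\<^bsub>G'\<^esub> (k x)) \<in> N'"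
    using c by (simp add: G'.inv_mult_group G'.m_assoc)
qed

end

section \<open>Comparison morphisms and products\<close>

context tame_structure begin

lemma tau_star_unique:
  assumes T: "is_tau_star M \<kappa> G N T" and S: "is_comparison M \<kappa> G N S" and a: "def_path M G a"
  shows "snd S (def_path_class M G a) = snd T (def_path_class M G a)"
proof -
  have eq: "gpd_morphism_eq (def_fund_gpd M G) (fund_gpd (logic_topology M \<kappa> G N)) S T"
    using T S unfolding is_tau_star_def by blast
  have a01: "a [0] \<in> carrier G" "a [1] \<in> carrier G" using def_path_mem[OF a] by auto
  have "def_path_class M G a \<in> Hom (def_fund_gpd M G) (a [0]) (a [1])"
    unfolding def_fund_gpd_simps using a by blast
  then show ?thesis using eq a01 unfolding gpd_morphism_eq_def def_fund_gpd_simps(1) by blast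
qed

text \<open>Representatives of a class share their endpoints, and \<open>comparison_path\<close>
  exhibits one with the right ones.\<close>

lemma comparison_ends:
  assumes T: "is_comparison M \<kappa> G N T" and G: "definable_group M G" and a: "def_path M G a"
    and p: "pathin (logic_topology M \<kappa> G N) p" "snd T (def_path_class M G a) = path_class (logic_topology M \<kappa> G N) p"
  shows "p 0 = \<tau>_map G N (a [0])" "p 1 = \<tau>_map G N (a [1])"
proof -
  obtain b where b: "pathin (logic_topology M \<kappa> G N) b" "b 0 = \<tau>_map G N (a [0])" "b 1 = \<tau>_map G N (a [1])"
    "snd T (def_path_class M G a) = path_class (logic_topology M \<kappa> G N) b"
    using comparison_path[OF T G a] by blast
  have "path_homotopic (logic_topology M \<kappa> G N) b p" by (rule path_class_eqD) (use b p in auto)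
  from path_homotopic_endpoints[OF this] show "p 0 = \<tau>_map G N (a [0])" "p 1 = \<tau>_map G N (a [1])" using b by auto
qed

lemma comparison_concat:
  assumes T: "is_comparison M \<kappa> G N T" and G: "definable_group M G"
    and a: "def_path M G a" and b: "def_path M G b" and ab: "a [1] = b [0]"
    and p: "pathin (logic_topology M \<kappa> G N) p" "snd T (def_path_class M G a) = path_class (logic_topology M \<kappa> G N) p"
    and q: "pathin (logic_topology M \<kappa> G N) q" "snd T (def_path_class M G b) = path_class (logic_topology M \<kappa> G N) q"
  shows "snd T (def_path_class M G (def_path_concat a b)) = path_class (logic_topology M \<kappa> G N) (path_concat p q)"
proof -
  have c: "a [0] \<in> carrier G" "a [1] \<in> carrier G" "b [1] \<in> carrier G" using def_path_mem[OF a] def_path_mem[OF b] by auto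
  have h: "def_path_class M G a \<in> Hom (def_fund_gpd M G) (a [0]) (a [1])" "def_path_class M G b \<in> Hom (def_fund_gpd M G) (a [1]) (b [1])"
    unfolding def_fund_gpd_simps using a b ab by auto
  have "p 1 = q 0" using comparison_ends(2)[OF T G a p] comparison_ends(1)[OF T G b q] ab by simp
  then show ?thesis
    using gpd_morphismD(4)[OF is_comparisonD(1)[OF T] _ _ _ h] c
    by (simp add: def_fund_gpd_simps(1) Comp_def_path_class[OF a b definable_group_dspace[OF G] ab] p(2) q(2) Comp_path_class[OF p(1) q(1)])
qed

lemma comparison_const:
  assumes T: "is_comparison M \<kappa> G N T" and x: "x \<in> carrier G"
  shows "snd T (def_path_class M G (\<lambda>_. x)) = path_class (logic_topology M \<kappa> G N) (\<lambda>_. \<tau>_map G N x)"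
  using gpd_morphismD(2)[OF is_comparisonD(1)[OF T]] is_comparisonD(2)[OF T x] x by (simp add: def_fund_gpd_simps fund_gpd_simps)

end

locale tau_star_pair = definable_pair_G00 +
  fixes T T' TH :: "'a comparison"
  assumes T: "is_tau_star M \<kappa> G N T" and T': "is_tau_star M \<kappa> G' N' T'" and TH: "is_tau_star M \<kappa> H NH TH"
begin

abbreviation "pr \<equiv> induced_map G N (take m)"
abbreviation "pr' \<equiv> induced_map G' N' (drop m)"

lemma comparison_G: "is_comparison M \<kappa> G N T" and comparison_G': "is_comparison M \<kappa> G' N' T'" and comparison_H: "is_comparison M \<kappa> H NH TH"
  using T T' TH by (auto simp: is_tau_star_def)

lemma cdmap_take: "cdmap M H G (take m)" and cdmap_drop: "cdmap M H G' (drop m)"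
  using coset_map_take coset_map_drop by (auto simp: coset_map_def)

lemma continuous_pr: "continuous_map \<Lambda>H \<Lambda> pr" and continuous_pr': "continuous_map \<Lambda>H \<Lambda>' pr'"
  using coset_map_continuous coset_map_take coset_map_drop by blast+

lemma pr_lprod:
  assumes "K \<in> topspace \<Lambda>" "K' \<in> topspace \<Lambda>'"
  shows "lprod K K' \<in> topspace \<Lambda>H" "pr (lprod K K') = K" "pr' (lprod K K') = K'"
proof -
  obtain x y where xy: "x \<in> carrier G" "y \<in> carrier G'" "K = \<tau> x" "K' = \<tau>' y"
    using assms by (auto simp: topspace_logic[OF L] topspace_logic[OF L'])
  have w: "x @ y \<in> carrier H" using append_mem_H[OF xy(1,2)] by simp
  have eq: "lprod K K' = \<tau>H (x @ y)" using tau_append[OF xy(1,2)] xy(3,4) by simp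
  show "lprod K K' \<in> topspace \<Lambda>H" unfolding eq topspace_logic[OF LH] using w by blast
  show "pr (lprod K K') = K" "pr' (lprod K K') = K'"
    unfolding eq using induced_map_tau[OF coset_map_take w] induced_map_tau[OF coset_map_drop w] xy by simp_all
qed

lemma lprod_pr:
  assumes "K \<in> topspace \<Lambda>H"
  shows "lprod (pr K) (pr' K) = K"
proof -
  obtain w where w: "w \<in> carrier H" "K = \<tau>H w" using assms by (auto simp: topspace_logic[OF LH])
  have "pr K = \<tau> (take m w)" "pr' K = \<tau>' (drop m w)"
    unfolding w(2) by (rule induced_map_tau[OF coset_map_take w(1)]) (rule induced_map_tau[OF coset_map_drop w(1)])
  then show ?thesis using tau_H[OF w(1)] w(2) by simp
qed

lemma pathin_mem: "pathin X p \<Longrightarrow> 0 \<le> t \<Longrightarrow> t \<le> 1 \<Longrightarrow> p t \<in> topspace X"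
  by (auto simp: pathin_def continuous_map_def)

text \<open>Passing to the slice at y and projecting back is a comparison morphism of G by
  \<open>comparison_retract\<close>; uniqueness identifies it with T.\<close>

lemma T_via_H:
  assumes a: "def_path M G a" and y: "y \<in> carrier G'" and b: "pathin \<Lambda>H \<beta>"
    "snd TH (def_path_class M H (\<lambda>x. a x @ y)) = path_class \<Lambda>H \<beta>"
  shows "snd T (def_path_class M G a) = path_class \<Lambda> (pr \<circ> \<beta>)"
proof -
  have "snd (fund_map \<Lambda> pr \<circ>\<^sub>g (TH \<circ>\<^sub>g def_fund_map M H (\<lambda>x. x @ y))) (def_path_class M G a) = snd T (def_path_class M G a)"
    by (rule tau_star_unique[OF T comparison_retract[OF comparison_H coset_map_append_const[OF y] coset_map_take] a]) simp
  then show ?thesis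
    using def_fund_map_class[OF cdmap_append_const[OF y] a] fund_map_class[OF continuous_pr b(1)] b(2)
    by (simp add: gpd_comp_def o_def)
qed

lemma T'_via_H:
  assumes a: "def_path M G' a" and x: "x \<in> carrier G" and b: "pathin \<Lambda>H \<beta>"
    "snd TH (def_path_class M H (\<lambda>y. x @ a y)) = path_class \<Lambda>H \<beta>"
  shows "snd T' (def_path_class M G' a) = path_class \<Lambda>' (pr' \<circ> \<beta>)"
proof -
  have "snd (fund_map \<Lambda>' pr' \<circ>\<^sub>g (TH \<circ>\<^sub>g def_fund_map M H (\<lambda>y. x @ y))) (def_path_class M G' a) = snd T' (def_path_class M G' a)"
    by (rule tau_star_unique[OF T' comparison_retract[OF comparison_H coset_map_const_append[OF x] coset_map_drop] a]) (simp add: x)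
  then show ?thesis
    using def_fund_map_class[OF cdmap_const_append[OF x] a] fund_map_class[OF continuous_pr' b(1)] b(2)
    by (simp add: gpd_comp_def o_def)
qed

text \<open>The union runs over all choices of representatives; \<open>TP_class\<close> shows that
  they give a single class, the convention already used in \<open>Comp\<close> and
  \<open>fund_map\<close>.\<close>

definition TP :: "'a comparison" where
  "TP = (\<tau>H, \<lambda>P. \<Union>c\<in>P. \<Union>p\<in>snd T (def_path_class M G (take m \<circ> c)). \<Union>q\<in>snd T' (def_path_class M G' (drop m \<circ> c)).
     path_class \<Lambda>H (\<lambda>t. lprod (p t) (q t)))"

lemma fst_TP: "fst TP = \<tau>H"
  by (simp add: TP_def)

lemma path_homotopic_lprod: "path_homotopic \<Lambda> p p' \<Longrightarrow> path_homotopic \<Lambda>' q q' \<Longrightarrow> path_homotopic \<Lambda>H (\<lambda>t. lprod (p t) (q t)) (\<lambda>t. lprod (p' t) (q' t))"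
  using path_homotopic_pair[OF _ _ continuous_lprod] by fastforce

lemma pathin_lprod: "pathin \<Lambda> p \<Longrightarrow> pathin \<Lambda>' q \<Longrightarrow> pathin \<Lambda>H (\<lambda>t. lprod (p t) (q t))"
  using pathin_pair[OF _ _ continuous_lprod] by fastforce

text \<open>Homotopic paths in H have homotopic projections, and homotopic factors have homotopic
  products, so every term of the union is the same class.\<close>

lemma TP_class:
  assumes c: "def_path M H c"
    and p: "pathin \<Lambda> p" "snd T (def_path_class M G (take m \<circ> c)) = path_class \<Lambda> p"
    and q: "pathin \<Lambda>' q" "snd T' (def_path_class M G' (drop m \<circ> c)) = path_class \<Lambda>' q"
  shows "snd TP (def_path_class M H c) = path_class \<Lambda>H (\<lambda>t. lprod (p t) (q t))" (is "_ = ?R")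
proof -
  have cls: "def_path_class M G (take m \<circ> d) = def_path_class M G (take m \<circ> c)"
      "def_path_class M G' (drop m \<circ> d) = def_path_class M G' (drop m \<circ> c)" if d: "d \<in> def_path_class M H c" for d
  proof -
    have h: "def_homotopic M H c d" using d by (simp add: def_path_class_def)
    show "def_path_class M G (take m \<circ> d) = def_path_class M G (take m \<circ> c)"
      using def_path_class_eq[OF cdmap_def_homotopic[OF cdmap_take h] ds] by simp
    show "def_path_class M G' (drop m \<circ> d) = def_path_class M G' (drop m \<circ> c)"
      using def_path_class_eq[OF cdmap_def_homotopic[OF cdmap_drop h] ds'] by simp
  qed
  have inner: "(\<Union>p'\<in>path_class \<Lambda> p. \<Union>q'\<in>path_class \<Lambda>' q. path_class \<Lambda>H (\<lambda>t. lprod (p' t) (q' t))) = ?R"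
  proof -
    have "path_class \<Lambda>H (\<lambda>t. lprod (p' t) (q' t)) = ?R" if pq: "p' \<in> path_class \<Lambda> p" "q' \<in> path_class \<Lambda>' q" for p' q'
    proof -
      have "path_homotopic \<Lambda>H (\<lambda>t. lprod (p t) (q t)) (\<lambda>t. lprod (p' t) (q' t))"
        using pq unfolding path_class_path_homotopic by (intro path_homotopic_lprod) auto
      from path_class_eq[OF this] show ?thesis by simp
    qed
    then have "(\<Union>p'\<in>path_class \<Lambda> p. \<Union>q'\<in>path_class \<Lambda>' q. path_class \<Lambda>H (\<lambda>t. lprod (p' t) (q' t))) =
        (\<Union>p'\<in>path_class \<Lambda> p. \<Union>q'\<in>path_class \<Lambda>' q. ?R)" by (intro SUP_cong refl)
    moreover have "path_class \<Lambda> p \<noteq> {}" "path_class \<Lambda>' q \<noteq> {}"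
      using path_class_self[OF p(1)] path_class_self[OF q(1)] by blast+
    ultimately show ?thesis by simp
  qed
  have "snd TP (def_path_class M H c) = (\<Union>d\<in>def_path_class M H c. ?R)"
    unfolding TP_def snd_conv by (intro SUP_cong refl) (simp only: cls p(2) q(2) inner)
  also have "\<dots> = ?R" using def_path_class_self[OF c dsH] by (subst UN_constant) auto
  finally show ?thesis .
qed

lemma TP_class_ex:
  assumes c: "def_path M H c"
  obtains p q where "pathin \<Lambda> p" "snd T (def_path_class M G (take m \<circ> c)) = path_class \<Lambda> p"
    "p 0 = \<tau> (take m (c [0]))" "p 1 = \<tau> (take m (c [1]))"
    "pathin \<Lambda>' q" "snd T' (def_path_class M G' (drop m \<circ> c)) = path_class \<Lambda>' q"
    "q 0 = \<tau>' (drop m (c [0]))" "q 1 = \<tau>' (drop m (c [1]))"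
  using comparison_path[OF comparison_G G cdmap_def_path[OF cdmap_take c]] comparison_path[OF comparison_G' G' cdmap_def_path[OF cdmap_drop c]]
  by (auto simp: o_def)

lemma TP_morphism: "gpd_morphism (def_fund_gpd M H) (fund_gpd \<Lambda>H) TP"
  unfolding gpd_morphism_def def_fund_gpd_simps(1,2) fund_gpd_simps(1,2) fst_TP
proof (intro conjI ballI)
  fix w assume w: "w \<in> carrier H"
  have c: "take m w \<in> carrier G" "drop m w \<in> carrier G'" using w by (auto simp: mem_H)
  show "\<tau>H w \<in> topspace \<Lambda>H" unfolding topspace_logic[OF LH] using w by blast
  have "def_path M H (\<lambda>_. w)" unfolding def_path_def
    using w dsH unfolding dspace_def by (intro def_cont_const) auto
  moreover have "\<tau> (take m w) \<in> topspace \<Lambda>" "\<tau>' (drop m w) \<in> topspace \<Lambda>'"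
    unfolding topspace_logic[OF L] topspace_logic[OF L'] using c by blast+
  ultimately have "snd TP (def_path_class M H (\<lambda>_. w)) = path_class \<Lambda>H (\<lambda>t. lprod (\<tau> (take m w)) (\<tau>' (drop m w)))"
    using comparison_const[OF comparison_G c(1)] comparison_const[OF comparison_G' c(2)]
    by (intro TP_class pathin_const') (simp_all add: o_def)
  then show "snd TP (def_path_class M H (\<lambda>_. w)) = path_class \<Lambda>H (\<lambda>_. \<tau>H w)" unfolding tau_H[OF w] .
next
  fix w z P assume P: "P \<in> Hom (def_fund_gpd M H) w z"
  obtain c where c: "P = def_path_class M H c" "def_path M H c" "c [0] = w" "c [1] = z"
    using P unfolding def_fund_gpd_simps by blast
  obtain p q where pq: "pathin \<Lambda> p" "snd T (def_path_class M G (take m \<circ> c)) = path_class \<Lambda> p"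
    "p 0 = \<tau> (take m (c [0]))" "p 1 = \<tau> (take m (c [1]))"
    "pathin \<Lambda>' q" "snd T' (def_path_class M G' (drop m \<circ> c)) = path_class \<Lambda>' q"
    "q 0 = \<tau>' (drop m (c [0]))" "q 1 = \<tau>' (drop m (c [1]))" using TP_class_ex[OF c(2)] .
  have "w \<in> carrier H" "z \<in> carrier H" using def_path_mem[OF c(2), of 0] def_path_mem[OF c(2), of 1] c(3,4) by auto
  then show "snd TP P \<in> Hom (fund_gpd \<Lambda>H) (\<tau>H w) (\<tau>H z)"
    unfolding fund_gpd_simps c(1) TP_class[OF c(2) pq(1,2,5,6)]
    using pathin_lprod[OF pq(1,5)] pq(3,4,7,8) c(3,4) tau_H by (intro exI[of _ "\<lambda>t. lprod (p t) (q t)"]) auto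
next
  fix w z v P Q assume P: "P \<in> Hom (def_fund_gpd M H) w z" and Q: "Q \<in> Hom (def_fund_gpd M H) z v"
  obtain c where c: "P = def_path_class M H c" "def_path M H c" "c [0] = w" "c [1] = z"
    using P unfolding def_fund_gpd_simps by blast
  obtain d where d: "Q = def_path_class M H d" "def_path M H d" "d [0] = z" "d [1] = v"
    using Q unfolding def_fund_gpd_simps by blast
  obtain p q where pq: "pathin \<Lambda> p" "snd T (def_path_class M G (take m \<circ> c)) = path_class \<Lambda> p"
    "p 0 = \<tau> (take m (c [0]))" "p 1 = \<tau> (take m (c [1]))"
    "pathin \<Lambda>' q" "snd T' (def_path_class M G' (drop m \<circ> c)) = path_class \<Lambda>' q"
    "q 0 = \<tau>' (drop m (c [0]))" "q 1 = \<tau>' (drop m (c [1]))" using TP_class_ex[OF c(2)] .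
  obtain r s where rs: "pathin \<Lambda> r" "snd T (def_path_class M G (take m \<circ> d)) = path_class \<Lambda> r"
    "r 0 = \<tau> (take m (d [0]))" "r 1 = \<tau> (take m (d [1]))"
    "pathin \<Lambda>' s" "snd T' (def_path_class M G' (drop m \<circ> d)) = path_class \<Lambda>' s"
    "s 0 = \<tau>' (drop m (d [0]))" "s 1 = \<tau>' (drop m (d [1]))" using TP_class_ex[OF d(2)] .
  have cd1: "c [1] = d [0]" using c d by simp
  have pr: "p 1 = r 0" "q 1 = s 0" using pq rs cd1 by auto
  have "snd TP (def_path_class M H (def_path_concat c d)) = path_class \<Lambda>H (\<lambda>t. lprod (path_concat p r t) (path_concat q s t))"
  proof (rule TP_class)
    show "def_path M H (def_path_concat c d)" by (rule def_path_concat[OF c(2) d(2) dsH cd1])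
    show "pathin \<Lambda> (path_concat p r)" "pathin \<Lambda>' (path_concat q s)" using pathin_concat pq rs pr by blast+
    show "snd T (def_path_class M G (take m \<circ> def_path_concat c d)) = path_class \<Lambda> (path_concat p r)"
      unfolding comp_def_path_concat
      by (rule comparison_concat[OF comparison_G G cdmap_def_path[OF cdmap_take c(2)] cdmap_def_path[OF cdmap_take d(2)] _ pq(1,2) rs(1,2)]) (simp add: cd1)
    show "snd T' (def_path_class M G' (drop m \<circ> def_path_concat c d)) = path_class \<Lambda>' (path_concat q s)"
      unfolding comp_def_path_concat
      by (rule comparison_concat[OF comparison_G' G' cdmap_def_path[OF cdmap_drop c(2)] cdmap_def_path[OF cdmap_drop d(2)] _ pq(5,6) rs(5,6)]) (simp add: cd1)
  qed
  also have "(\<lambda>t. lprod (path_concat p r t) (path_concat q s t)) = path_concat (\<lambda>t. lprod (p t) (q t)) (\<lambda>t. lprod (r t) (s t))"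
    by (rule ext) (simp add: path_concat_def)
  finally show "snd TP (Comp (def_fund_gpd M H) P Q) = Comp (fund_gpd \<Lambda>H) (snd TP P) (snd TP Q)"
    unfolding c(1) d(1) Comp_def_path_class[OF c(2) d(2) dsH cd1] TP_class[OF c(2) pq(1,2,5,6)] TP_class[OF d(2) rs(1,2,5,6)]
    using Comp_path_class[OF pathin_lprod[OF pq(1,5)] pathin_lprod[OF rs(1,5)]] pr by simp
qed

text \<open>\<open>\<beta>\<close> stays in a given open set but is not a pair of representatives of the two comparison classes, while
  the pair \<open>(pr \<circ> \<gamma>, pr' \<circ> \<eta>)\<close> need not stay in that set. Adding to \<open>\<beta>\<close> a loop in each factor repairs this.\<close>

lemma path_homotopic_correction:
  assumes \<gamma>: "pathin \<Lambda>H \<gamma>" and \<eta>: "pathin \<Lambda>H \<eta>" and \<beta>: "path_homotopic \<Lambda>H \<beta> (path_concat \<gamma> \<eta>)" and \<gamma>\<eta>: "\<gamma> 1 = \<eta> 0"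
    and loops: "pr' (\<gamma> 1) = pr' (\<gamma> 0)" "pr (\<eta> 1) = pr (\<eta> 0)"
  defines "\<zeta> \<equiv> path_concat (\<lambda>t. lprod (pr (\<gamma> 0)) (pr' (\<gamma> (1 - t)))) (path_concat \<beta> (\<lambda>t. lprod (pr (\<eta> (1 - t))) (pr' (\<eta> 1))))"
  shows "path_homotopic \<Lambda>H \<zeta> (\<lambda>t. lprod (pr (\<gamma> t)) (pr' (\<eta> t)))"
proof -
  let ?g = "pr \<circ> \<gamma>" and ?g' = "pr' \<circ> \<gamma>" and ?e = "pr \<circ> \<eta>" and ?e' = "pr' \<circ> \<eta>"
  let ?l = "\<lambda>t. lprod (pr (\<gamma> 0)) (pr' (\<gamma> (1 - t)))" and ?r = "\<lambda>t. lprod (pr (\<eta> (1 - t))) (pr' (\<eta> 1))"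
  have g: "pathin \<Lambda> ?g" "pathin \<Lambda>' ?g'" and e: "pathin \<Lambda> ?e" "pathin \<Lambda>' ?e'"
    using pathin_compose' \<gamma> \<eta> continuous_pr continuous_pr' by blast+
  have ends: "\<beta> 0 = \<gamma> 0" "\<beta> 1 = \<eta> 1" using path_homotopic_endpoints[OF path_homotopic_sym[OF \<beta>]] by simp_all
  have p01: "pr (\<gamma> t) \<in> topspace \<Lambda>" "pr' (\<gamma> t) \<in> topspace \<Lambda>'" "pr (\<eta> t) \<in> topspace \<Lambda>" "pr' (\<eta> t) \<in> topspace \<Lambda>'"
      "lprod (pr (\<gamma> t)) (pr' (\<gamma> t)) = \<gamma> t" "lprod (pr (\<eta> t)) (pr' (\<eta> t)) = \<eta> t"
    if "0 \<le> t" "t \<le> 1" for t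
    using pathin_mem[OF g(1) that] pathin_mem[OF g(2) that] pathin_mem[OF e(1) that] pathin_mem[OF e(2) that]
      lprod_pr[OF pathin_mem[OF \<gamma> that]] lprod_pr[OF pathin_mem[OF \<eta> that]] unfolding o_apply by blast+
  have l: "pathin \<Lambda>H ?l" and r: "pathin \<Lambda>H ?r"
    using pathin_lprod[OF pathin_const' pathin_reverse[OF g(2)]] pathin_lprod[OF pathin_reverse[OF e(1)] pathin_const'] p01
    by (simp_all add: o_def)
  have l1: "?l 1 = \<beta> 0" unfolding ends using p01(5)[of 0] by simp
  have r0: "\<beta> 1 = ?r 0" unfolding ends using p01(6)[of 1] by simp
  note \<beta>p = path_homotopic_imp_pathin(1)[OF \<beta>]
  have \<zeta>: "pathin \<Lambda>H \<zeta>" unfolding \<zeta>_def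
    by (intro pathin_concat l r \<beta>p) (use l1 r0 in simp_all)
  have el: "path_homotopic \<Lambda> (pr \<circ> ?l) (\<lambda>_. ?g 0)" "path_homotopic \<Lambda>' (pr' \<circ> ?l) (\<lambda>t. ?g' (1 - t))"
    using pr_lprod[OF p01(1)[of 0] p01(2)]
    by (intro path_homotopic_cong pathin_compose'[OF l continuous_pr] pathin_compose'[OF l continuous_pr'], simp)+
  have er: "path_homotopic \<Lambda> (pr \<circ> ?r) (\<lambda>t. ?e (1 - t))" "path_homotopic \<Lambda>' (pr' \<circ> ?r) (\<lambda>_. ?e' 1)"
    using pr_lprod[OF p01(3) p01(4)[of 1]]
    by (intro path_homotopic_cong pathin_compose'[OF r continuous_pr] pathin_compose'[OF r continuous_pr'], simp)+
  \<comment> \<open>Up to homotopy, the first coordinate of \<zeta> is a constant, then ?g, ?e and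
    ?e reversed, which leaves ?g; the second is ?g' reversed, then ?g', ?e' and a constant, which
    leaves ?e'.\<close>
  have eq: "path_homotopic \<Lambda> (pr \<circ> \<zeta>) (path_concat (\<lambda>_. ?g 0) (path_concat (pr \<circ> \<beta>) (\<lambda>t. ?e (1 - t))))"
      "path_homotopic \<Lambda>' (pr' \<circ> \<zeta>) (path_concat (\<lambda>t. ?g' (1 - t)) (path_concat (pr' \<circ> \<beta>) (\<lambda>_. ?e' 1)))"
    unfolding \<zeta>_def comp_path_concat
    by (intro path_homotopic_concat el er path_homotopic_refl[OF pathin_compose'[OF \<beta>p continuous_pr]] path_homotopic_refl[OF pathin_compose'[OF \<beta>p continuous_pr']];
        use l1 r0 in \<open>simp only: o_apply path_concat_ends\<close>)+
  have \<beta>1: "path_homotopic \<Lambda> (pr \<circ> \<beta>) (path_concat ?g ?e)" and \<beta>2: "path_homotopic \<Lambda>' (pr' \<circ> \<beta>) (path_concat ?g' ?e')"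
    using path_homotopic_compose[OF \<beta> continuous_pr] path_homotopic_compose[OF \<beta> continuous_pr'] by (simp_all only: comp_path_concat)
  have "path_homotopic \<Lambda> (path_concat (pr \<circ> \<beta>) (\<lambda>t. ?e (1 - t))) ?g"
    by (rule path_homotopic_trans[OF path_homotopic_concat[OF \<beta>1 path_homotopic_refl[OF pathin_reverse[OF e(1)]]] path_homotopic_cancel_right[OF g(1) e(1)]])
      (simp_all add: ends \<gamma>\<eta>)
  from path_homotopic_concat[OF path_homotopic_refl[OF pathin_const'] this, of "?g 0"] p01(1)[of 0] ends
  have "path_homotopic \<Lambda> (path_concat (\<lambda>_. ?g 0) (path_concat (pr \<circ> \<beta>) (\<lambda>t. ?e (1 - t)))) (path_concat (\<lambda>_. ?g 0) ?g)" by simp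
  from path_homotopic_trans[OF path_homotopic_trans[OF eq(1) this] path_homotopic_const_left[OF g(1)]]
  have 1: "path_homotopic \<Lambda> (pr \<circ> \<zeta>) ?g" .
  have "path_homotopic \<Lambda>' (path_concat (pr' \<circ> \<beta>) (\<lambda>_. ?e' 1)) (path_concat (path_concat ?g' ?e') (\<lambda>_. ?e' 1))"
    by (rule path_homotopic_concat[OF \<beta>2 path_homotopic_refl[OF pathin_const']]) (use p01(4)[of 1] ends in simp_all)
  moreover have "path_homotopic \<Lambda>' (path_concat (path_concat ?g' ?e') (\<lambda>_. ?e' 1)) (path_concat ?g' ?e')"
    using path_homotopic_const_right[OF pathin_concat[OF g(2) e(2)]] \<gamma>\<eta> by simp
  ultimately have "path_homotopic \<Lambda>' (path_concat (pr' \<circ> \<beta>) (\<lambda>_. ?e' 1)) (path_concat ?g' ?e')" by (rule path_homotopic_trans)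
  from path_homotopic_concat[OF path_homotopic_refl[OF pathin_reverse[OF g(2)]] this] ends
  have "path_homotopic \<Lambda>' (path_concat (\<lambda>t. ?g' (1 - t)) (path_concat (pr' \<circ> \<beta>) (\<lambda>_. ?e' 1))) (path_concat (\<lambda>t. ?g' (1 - t)) (path_concat ?g' ?e'))" by simp
  moreover have "path_homotopic \<Lambda>' (path_concat (\<lambda>t. ?g' (1 - t)) (path_concat ?g' ?e')) ?e'"
    by (rule path_homotopic_cancel_left[OF g(2) e(2)]) (simp add: \<gamma>\<eta>)
  ultimately have 2: "path_homotopic \<Lambda>' (pr' \<circ> \<zeta>) ?e'" using path_homotopic_trans[OF eq(2)] path_homotopic_trans by blast
  have "path_homotopic \<Lambda>H \<zeta> (\<lambda>t. lprod ((pr \<circ> \<zeta>) t) ((pr' \<circ> \<zeta>) t))"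
    by (rule path_homotopic_cong[OF \<zeta>]) (simp add: lprod_pr pathin_mem[OF \<zeta>])
  from path_homotopic_trans[OF this path_homotopic_lprod[OF 1 2]] show ?thesis by simp
qed

text \<open>A path c = (a, b) is deformed to the slice of a at b [0] followed by the slice of b at a
  [1]. On these slices the comparison of H provides representatives of the two factor classes, which
  \<open>path_homotopic_correction\<close> reassembles inside U.\<close>

lemma TP_comparison: "is_comparison M \<kappa> H NH TP"
proof (rule is_comparisonI[OF TP_morphism])
  show "fst TP w = \<tau>H w" for w by (simp add: fst_TP)
  fix U c assume U: "openin \<Lambda>H U" and c: "def_path M H c" and cU: "\<And>s. 0 \<le> s \<Longrightarrow> s \<le> 1 \<Longrightarrow> \<tau>H (c [s]) \<in> U"
  define a b where "a = take m \<circ> c" and "b = drop m \<circ> c"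
  have a: "def_path M G a" and b: "def_path M G' b" using cdmap_def_path c cdmap_take cdmap_drop unfolding a_def b_def by blast+
  have ab: "a [0] \<in> carrier G" "a [1] \<in> carrier G" "b [0] \<in> carrier G'" "b [1] \<in> carrier G'"
    using def_path_mem[OF a, of 0] def_path_mem[OF a, of 1] def_path_mem[OF b, of 0] def_path_mem[OF b, of 1] by auto
  have mem: "c [s] \<in> carrier H" "c [s] = a [s] @ b [s]" if "0 \<le> s" "s \<le> 1" for s
    using def_path_mem[OF c that] by (simp_all add: a_def b_def)
  let ?x = "\<lambda>x. a x @ b [0]" and ?y = "\<lambda>x. a [1] @ b x"
  have x: "def_path M H ?x" and y: "def_path M H ?y"
    using cdmap_def_path[OF cdmap_append_const[OF ab(3)] a] cdmap_def_path[OF cdmap_const_append[OF ab(2)] b]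
    by (simp_all add: o_def)
  obtain \<beta> where \<beta>: "pathin \<Lambda>H \<beta>" "\<beta> ` {0..1} \<subseteq> U" "snd TH (def_path_class M H c) = path_class \<Lambda>H \<beta>"
    using is_comparisonD(3)[OF comparison_H U c cU] by blast
  have t: "\<tau> (a [0]) \<in> topspace \<Lambda>" "\<tau>' (b [1]) \<in> topspace \<Lambda>'"
    unfolding topspace_logic[OF L] topspace_logic[OF L'] using ab by blast+
  \<comment> \<open>The first slice lies over V, because its second coordinate is constantly b [0]
    and c [0] lies over U. For a path in V, combining its second coordinate with the constant coset
    of a [0] gives a path in U; W plays the symmetric role at the end of c.\<close>
  define V where "V = {K \<in> topspace \<Lambda>H. lprod (\<tau> (a [0])) (pr' K) \<in> U}"
  define W where "W = {K \<in> topspace \<Lambda>H. lprod (pr K) (\<tau>' (b [1])) \<in> U}"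
  have "continuous_map \<Lambda>H \<Lambda>H (\<lambda>K. lprod (\<tau> (a [0])) (pr' K))" "continuous_map \<Lambda>H \<Lambda>H (\<lambda>K. lprod (pr K) (\<tau>' (b [1])))"
    using continuous_map_compose[OF continuous_map_pairedI[OF continuous_map_const[THEN iffD2] continuous_pr'] continuous_lprod]
      continuous_map_compose[OF continuous_map_pairedI[OF continuous_pr continuous_map_const[THEN iffD2]] continuous_lprod] t
    by (auto simp: o_def)
  then have V: "openin \<Lambda>H V" and W: "openin \<Lambda>H W" unfolding V_def W_def using U by (auto intro: openin_continuous_map_preimage)
  have tx: "\<tau>H (x @ y) \<in> topspace \<Lambda>H" "pr (\<tau>H (x @ y)) = \<tau> x" "pr' (\<tau>H (x @ y)) = \<tau>' y" "lprod (\<tau> x) (\<tau>' y) = \<tau>H (x @ y)"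
    if "x \<in> carrier G" "y \<in> carrier G'" for x y
    using that pr_lprod[of "\<tau> x" "\<tau>' y"] tau_append[OF that] by (simp_all add: topspace_logic[OF L] topspace_logic[OF L'])
  have xV: "\<tau>H (?x [s]) \<in> V" if s: "0 \<le> s" "s \<le> 1" for s
    using tx(1,3)[OF def_path_mem[OF a s] ab(3)] tx(4)[OF ab(1,3)] cU[of 0] mem(2)[of 0] unfolding V_def by simp
  have yW: "\<tau>H (?y [s]) \<in> W" if s: "0 \<le> s" "s \<le> 1" for s
    using tx(1,2)[OF ab(2) def_path_mem[OF b s]] tx(4)[OF ab(2,4)] cU[of 1] mem(2)[of 1] unfolding W_def by simp
  obtain \<gamma> where \<gamma>: "pathin \<Lambda>H \<gamma>" "\<gamma> ` {0..1} \<subseteq> V" "snd TH (def_path_class M H ?x) = path_class \<Lambda>H \<gamma>"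
    using is_comparisonD(3)[OF comparison_H V x xV] by blast
  obtain \<eta> where \<eta>: "pathin \<Lambda>H \<eta>" "\<eta> ` {0..1} \<subseteq> W" "snd TH (def_path_class M H ?y) = path_class \<Lambda>H \<eta>"
    using is_comparisonD(3)[OF comparison_H W y yW] by blast
  note \<gamma>e = comparison_ends[OF comparison_H definable_group_H x \<gamma>(1,3)]
  note \<eta>e = comparison_ends[OF comparison_H definable_group_H y \<eta>(1,3)]
  \<comment> \<open>Multiplicativity of TH on the two slices then relates \<beta> to \<gamma>
    followed by \<eta>.\<close>
  have "def_path_class M H c = def_path_class M H (def_path_concat ?x ?y)"
  proof (rule def_path_class_eq[OF def_homotopic_trans[OF def_homotopic_sides[OF c] def_homotopic_cong dsH] dsH])
    show "def_path M H (def_path_concat (\<lambda>x. take m (c [hd x]) @ drop m (c [0])) (\<lambda>x. take m (c [1]) @ drop m (c [hd x])))"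
      using def_homotopic_sides[OF c] def_homotopic_paths by blast
  qed (auto simp: def_path_concat_def dsH a_def b_def)
  then have cc: "path_class \<Lambda>H \<beta> = path_class \<Lambda>H (path_concat \<gamma> \<eta>)"
    using comparison_concat[OF comparison_H definable_group_H x y _ \<gamma>(1,3) \<eta>(1,3)] \<beta>(3) by simp
  have ge: "\<gamma> 1 = \<eta> 0" unfolding \<gamma>e \<eta>e ..
  have \<beta>path_homotopic: "path_homotopic \<Lambda>H \<beta> (path_concat \<gamma> \<eta>)" by (rule path_class_eqD[OF cc pathin_concat[OF \<gamma>(1) \<eta>(1) ge]])
  define \<zeta> where "\<zeta> = path_concat (\<lambda>t. lprod (pr (\<gamma> 0)) (pr' (\<gamma> (1 - t)))) (path_concat \<beta> (\<lambda>t. lprod (pr (\<eta> (1 - t))) (pr' (\<eta> 1))))"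
  have pe: "pr (\<gamma> 0) = \<tau> (a [0])" "pr' (\<gamma> 0) = \<tau>' (b [0])" "pr' (\<gamma> 1) = \<tau>' (b [0])"
      "pr (\<eta> 0) = \<tau> (a [1])" "pr (\<eta> 1) = \<tau> (a [1])" "pr' (\<eta> 1) = \<tau>' (b [1])"
    unfolding \<gamma>e \<eta>e using tx ab by simp_all
  have path_homotopic\<zeta>: "path_homotopic \<Lambda>H \<zeta> (\<lambda>t. lprod (pr (\<gamma> t)) (pr' (\<eta> t)))" unfolding \<zeta>_def
    by (rule path_homotopic_correction[OF \<gamma>(1) \<eta>(1) \<beta>path_homotopic ge]) (simp_all only: pe)
  have "\<zeta> t \<in> U" if t: "t \<in> {0..1}" for t
  proof -
    have gt: "\<gamma> (1 - t) \<in> V" "\<eta> (1 - t) \<in> W" if "t \<in> {0..1}" for t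
      using \<gamma>(2) \<eta>(2) that by (auto simp: image_subset_iff)
    have lU: "lprod (pr (\<gamma> 0)) (pr' (\<gamma> (1 - t))) \<in> U" "lprod (pr (\<eta> (1 - t))) (pr' (\<eta> 1)) \<in> U" if "t \<in> {0..1}" for t
      using gt[OF that] unfolding pe V_def W_def by auto
    show ?thesis unfolding \<zeta>_def
      by (intro path_concat_in lU t) (use \<beta>(2) in auto)
  qed
  then have "\<zeta> ` {0..1} \<subseteq> U" by blast
  moreover have "snd TP (def_path_class M H c) = path_class \<Lambda>H \<zeta>"
  proof -
    have "snd T (def_path_class M G a) = path_class \<Lambda> (pr \<circ> \<gamma>)" "snd T' (def_path_class M G' b) = path_class \<Lambda>' (pr' \<circ> \<eta>)"
      using T_via_H[OF a ab(3) \<gamma>(1,3)] T'_via_H[OF b ab(2) \<eta>(1,3)] by simp_all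
    from TP_class[OF c pathin_compose'[OF \<gamma>(1) continuous_pr] this(1)[unfolded a_def]
        pathin_compose'[OF \<eta>(1) continuous_pr'] this(2)[unfolded b_def]]
    show ?thesis using path_class_eq[OF path_homotopic\<zeta>] by simp
  qed
  ultimately show "\<exists>b. pathin \<Lambda>H b \<and> b ` {0..1} \<subseteq> U \<and> snd TP (def_path_class M H c) = path_class \<Lambda>H b"
    using path_homotopic_imp_pathin(1)[OF path_homotopic\<zeta>] by blast
qed

text \<open>TP and TH are both comparison morphisms of H, so uniqueness carries the componentwise
  formula for TP over to TH.\<close>

lemma TH_class:
  assumes a: "def_path M G a" and b: "def_path M G' b"
    and p: "pathin \<Lambda> p" "snd T (def_path_class M G a) = path_class \<Lambda> p"
    and q: "pathin \<Lambda>' q" "snd T' (def_path_class M G' b) = path_class \<Lambda>' q"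
  shows "snd TH (def_path_class M H (\<lambda>x. a x @ b x)) = path_class \<Lambda>H (\<lambda>t. lprod (p t) (q t))"
proof -
  let ?c = "\<lambda>x. a x @ b x"
  have c: "def_path M H ?c" using def_cont_append a b unfolding def_path_def by blast
  have "def_homotopic M G a (take m \<circ> ?c)" "def_homotopic M G' b (drop m \<circ> ?c)"
    by (rule def_homotopic_cong[OF a ds], simp add: def_path_mem[OF a])
      (rule def_homotopic_cong[OF b ds'], simp add: def_path_mem[OF a])
  then have "def_path_class M G (take m \<circ> ?c) = def_path_class M G a" "def_path_class M G' (drop m \<circ> ?c) = def_path_class M G' b"
    using def_path_class_eq ds ds' by blast+
  then have "snd TP (def_path_class M H ?c) = path_class \<Lambda>H (\<lambda>t. lprod (p t) (q t))"
    using TP_class[OF c p(1) _ q(1)] p(2) q(2) by simp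
  then show ?thesis using tau_star_unique[OF TH TP_comparison c] by simp
qed

text \<open>By uniqueness the comparison morphism of \<open>H\<close> commutes with the shear \<open>(x, y) \<mapsto> (x, f x \<otimes> y)\<close>,
  which takes the path \<open>(a, \<one>)\<close> to \<open>(a, f \<circ> a)\<close>.\<close>

lemma naturality_on_paths:
  assumes f: "coset_map G N G' N' f" and a: "def_path M G a"
    and p: "pathin \<Lambda> p" "snd T (def_path_class M G a) = path_class \<Lambda> p"
  shows "snd T' (def_path_class M G' (f \<circ> a)) = path_class \<Lambda>' (induced_map G' N' f \<circ> p)"
proof -
  have fc: "cdmap M G G' f" using f by (simp add: coset_map_def)
  have fa: "def_path M G' (f \<circ> a)" by (rule cdmap_def_path[OF fc a])
  let ?s = "\<lambda>w. take m w @ (f (take m w) \<otimes>\<^bsub>G'\<^esub> drop m w)"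
  let ?s' = "\<lambda>w. take m w @ (inv\<^bsub>G'\<^esub> (f (take m w)) \<otimes>\<^bsub>G'\<^esub> drop m w)"
  have s: "coset_map H NH H NH ?s" by (rule coset_map_shear[OF f])
  have s': "coset_map H NH H NH ?s'" by (rule coset_map_shear[OF coset_map_inverse[OF f]])
  have sc': "cdmap M H H ?s'" using s' by (simp add: coset_map_def)
  have ss: "?s (?s' w) = w" if w: "w \<in> carrier H" for w
  proof -
    have "take m w \<in> carrier G" "drop m w \<in> carrier G'" "f (take m w) \<in> carrier G'"
      using w cdmap_mem[OF fc] by (auto simp: mem_H)
    then show ?thesis by (simp add: G'.m_assoc[symmetric])
  qed
  obtain q where q: "pathin \<Lambda>' q" "snd T' (def_path_class M G' (f \<circ> a)) = path_class \<Lambda>' q"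
    using comparison_path[OF comparison_G' G' fa] by blast
  let ?c = "\<lambda>x. a x @ (f \<circ> a) x"
  have c: "def_path M H ?c" using def_cont_append a fa unfolding def_path_def by blast
  let ?e = "\<lambda>_ :: 'a list. \<one>\<^bsub>G'\<^esub>"
  have e: "def_path M G' ?e" unfolding def_path_def
    using ds' unfolding dspace_def by (intro def_cont_const) auto
  have e1: "\<tau>' \<one>\<^bsub>G'\<^esub> \<in> topspace \<Lambda>'" unfolding topspace_logic[OF L'] by blast
  let ?r = "\<lambda>t. lprod (p t) (\<tau>' \<one>\<^bsub>G'\<^esub>)"
  have r: "pathin \<Lambda>H ?r" by (rule pathin_lprod[OF p(1) pathin_const'[OF e1]])
  \<comment> \<open>The inverse shear takes ?c, the graph of f along a, to (a, 1), because inv (f x)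
    cancels f x.\<close>
  have "def_homotopic M H (?s' \<circ> ?c) (\<lambda>x. a x @ ?e x)"
    by (rule def_homotopic_cong[OF cdmap_def_path[OF sc' c] dsH])
      (use def_path_mem[OF a] cdmap_mem[OF fc] in simp)
  then have sce: "def_path_class M H (?s' \<circ> ?c) = def_path_class M H (\<lambda>x. a x @ ?e x)" by (rule def_path_class_eq[OF _ dsH])
  have "snd (fund_map \<Lambda>H (induced_map H NH ?s) \<circ>\<^sub>g (TH \<circ>\<^sub>g def_fund_map M H ?s')) (def_path_class M H ?c) = snd TH (def_path_class M H ?c)"
    by (rule tau_star_unique[OF TH comparison_retract[OF comparison_H s' s ss] c])
  moreover have "snd (fund_map \<Lambda>H (induced_map H NH ?s) \<circ>\<^sub>g (TH \<circ>\<^sub>g def_fund_map M H ?s')) (def_path_class M H ?c) =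
      path_class \<Lambda>H (induced_map H NH ?s \<circ> ?r)"
  proof -
    have "snd TH (snd (def_fund_map M H ?s') (def_path_class M H ?c)) = path_class \<Lambda>H ?r"
      using def_fund_map_class[OF sc' c] sce TH_class[OF a e p pathin_const'[OF e1] comparison_const[OF comparison_G' G'.one_closed]]
      by (simp only:)
    then show ?thesis
      using fund_map_class[OF coset_map_continuous[OF s] r] by (simp only: gpd_comp_def snd_conv o_apply[of "snd _"])
  qed
  \<comment> \<open>Two expressions for the value of TH at the class of ?c: componentwise, and by
    conjugation with the shear.\<close>
  ultimately have "path_class \<Lambda>H (\<lambda>t. lprod (p t) (q t)) = path_class \<Lambda>H (induced_map H NH ?s \<circ> ?r)"
    using TH_class[OF a fa p q] by simp
  then have h: "path_homotopic \<Lambda>H (\<lambda>t. lprod (p t) (q t)) (induced_map H NH ?s \<circ> ?r)"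
    using path_class_eqD pathin_compose'[OF r coset_map_continuous[OF s]] by blast
  have h1: "path_homotopic \<Lambda>' q (pr' \<circ> (\<lambda>t. lprod (p t) (q t)))"
    by (rule path_homotopic_cong[OF q(1)]) (simp add: pr_lprod pathin_mem[OF p(1)] pathin_mem[OF q(1)])
  \<comment> \<open>At the coset of (x, 1) the shear gives the coset of (x, f x), whose second
    coordinate is the coset of f x.\<close>
  have h2: "path_homotopic \<Lambda>' (pr' \<circ> (induced_map H NH ?s \<circ> ?r)) (induced_map G' N' f \<circ> p)"
  proof (rule path_homotopic_cong)
    show "pathin \<Lambda>' (pr' \<circ> (induced_map H NH ?s \<circ> ?r))"
      by (rule pathin_compose'[OF pathin_compose'[OF r coset_map_continuous[OF s]] continuous_pr'])
    fix t :: real assume t: "0 \<le> t" "t \<le> 1"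
    obtain x where x: "x \<in> carrier G" "p t = \<tau> x" using pathin_mem[OF p(1) t] unfolding topspace_logic[OF L] by blast
    have fx: "f x \<in> carrier G'" by (rule cdmap_mem[OF fc x(1)])
    have w: "x @ \<one>\<^bsub>G'\<^esub> \<in> carrier H" "x @ f x \<in> carrier H" using append_mem_H[OF x(1)] fx by simp_all
    have "induced_map H NH ?s (lprod (\<tau> x) (\<tau>' \<one>\<^bsub>G'\<^esub>)) = \<tau>H (x @ f x)"
      using induced_map_tau[OF s w(1)] tau_append[OF x(1) G'.one_closed] x(1) fx by simp
    then show "(pr' \<circ> (induced_map H NH ?s \<circ> ?r)) t = (induced_map G' N' f \<circ> p) t"
      using induced_map_tau[OF coset_map_drop w(2)] induced_map_tau[OF f x(1)] x by simp
  qed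
  have "path_homotopic \<Lambda>' q (induced_map G' N' f \<circ> p)"
    by (rule path_homotopic_trans[OF path_homotopic_trans[OF h1 path_homotopic_compose[OF h continuous_pr']] h2])
  then show ?thesis using q(2) path_class_eq by simp
qed

end

theorem theorem6p1:
  fixes M :: "('a::linordered_field, 'f, 'r) expansion"
    and \<kappa> :: "'k rel"
    and G00 :: "'a dgroup \<Rightarrow> 'a list set"
    and tau_star :: "'a dgroup \<Rightarrow> 'a comparison"
    and G G' :: "'a dgroup"
    and f :: "'a list \<Rightarrow> 'a list"
  assumes "real_closed_field TYPE('a)"
    and "o_minimal M"
    and "sufficiently_saturated M \<kappa>"
    and "\<And>H. definably_compact_group M H \<Longrightarrow> is_G00 M \<kappa> H (G00 H)"
    and "\<And>H. definably_compact_group M H \<Longrightarrow> is_tau_star M \<kappa> H (G00 H) (tau_star H)"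
    and "definably_compact_group M G"
    and "definably_compact_group M G'"
    and "definable_hom M G G' f"
  shows "gpd_morphism_eq (def_fund_gpd M G) (fund_gpd (logic_topology M \<kappa> G' (G00 G')))
           (tau_star G' \<circ>\<^sub>g def_fund_map M G' f)
           (fund_map (logic_topology M \<kappa> G' (G00 G')) (induced_map G' (G00 G') f) \<circ>\<^sub>g tau_star G)"
proof -
  have dG: "definable_group M G" and dG': "definable_group M G'"
    using assms(6,7) by (auto simp: definably_compact_group_def)
  interpret tame_structure M \<kappa> using assms(2,3) by unfold_locales
  obtain m where m: "definable M m (carrier G)" using definable_carrier[OF dG] .
  obtain m' where m': "definable M m' (carrier G')" using definable_carrier[OF dG'] .
  interpret definable_pair M \<kappa> G G' m m' using dG dG' m m' by unfold_locales
  \<comment> \<open>The assumptions on \<open>G00\<close> and \<open>tau_star\<close> range over all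
    definably compact groups, so they can be applied to the product.\<close>
  have cH: "definably_compact_group M (dprod m G G')"
    using definable_group_H definably_compact_H assms(6,7) by (simp add: definably_compact_group_def)
  interpret tau_star_pair M \<kappa> G G' m m' "G00 G" "G00 G'" "G00 (dprod m G G')"
    "tau_star G" "tau_star G'" "tau_star (dprod m G G')"
    using assms(4,5)[OF assms(6)] assms(4,5)[OF assms(7)] assms(4,5)[OF cH] by unfold_locales
  have f: "coset_map G (G00 G) G' (G00 G') f" by (rule coset_map_hom[OF dG dG' N N' assms(8)])
  have fc: "cdmap M G G' f" using f by (simp add: coset_map_def)
  note fl = coset_map_continuous[OF f]
  show ?thesis unfolding gpd_morphism_eq_def def_fund_gpd_simps(1)
  proof (intro conjI ballI)
    show "gpd_morphism (def_fund_gpd M G) (fund_gpd \<Lambda>') (tau_star G' \<circ>\<^sub>g def_fund_map M G' f)"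
      by (rule gpd_morphism_comp[OF def_fund_map_morphism[OF fc] is_comparisonD(1)[OF comparison_G']])
    show "gpd_morphism (def_fund_gpd M G) (fund_gpd \<Lambda>') (fund_map \<Lambda>' (induced_map G' (G00 G') f) \<circ>\<^sub>g tau_star G)"
      by (rule gpd_morphism_comp[OF is_comparisonD(1)[OF comparison_G] fund_map_morphism[OF fl]])
    show "fst (tau_star G' \<circ>\<^sub>g def_fund_map M G' f) x = fst (fund_map \<Lambda>' (induced_map G' (G00 G') f) \<circ>\<^sub>g tau_star G) x"
      if x: "x \<in> carrier G" for x
      using is_comparisonD(2)[OF comparison_G x] is_comparisonD(2)[OF comparison_G' cdmap_mem[OF fc x]] induced_map_tau[OF f x]
      by (simp add: gpd_comp_def def_fund_map_def fund_map_def)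
    fix x y P assume "P \<in> Hom (def_fund_gpd M G) x y"
    then obtain a where a: "P = def_path_class M G a" "def_path M G a" unfolding def_fund_gpd_simps by blast
    obtain p where p: "pathin \<Lambda> p" "snd (tau_star G) (def_path_class M G a) = path_class \<Lambda> p"
      using comparison_path[OF comparison_G dG a(2)] by blast
    show "snd (tau_star G' \<circ>\<^sub>g def_fund_map M G' f) P = snd (fund_map \<Lambda>' (induced_map G' (G00 G') f) \<circ>\<^sub>g tau_star G) P"
      using naturality_on_paths[OF f a(2) p] def_fund_map_class[OF fc a(2)] fund_map_class[OF fl p(1)] p(2)
      by (simp add: gpd_comp_def a(1))
  qed
qed

end
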